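(* Let $(\mathcal T_\ell)_{\ell\in\mathbb N}$ and $(U_\ell)_{\ell\in\mathbb N}$ be the meshes and discrete solutions generated by the adaptive algorithm (described in the context) with arbitrary adaptivity parameter $0<\theta\le 1$. Then the algorithm is convergent in $H^1_0(\Omega)$, i.e. $$U_\ell\to u\quad\text{in }H^1_0(\Omega)\text{ as }\ell\to\infty.$$ In particular, $u=u_\infty\in\mathcal S^p_0(\mathcal T_\infty)$, where $u_\infty\in \mathcal S^p_0(\mathcal T_\infty)$ denotes the $H^1_0(\Omega)$-limit of the sequence $(U_\ell)$, i.e. the unique Galerkin solution of $b(u_\infty,v)=\int_\Omega fv\,dx$ for all $v\in\mathcal S^p_0(\mathcal T_\infty)$.
   Context: Problem. $\Omega\subset\mathbb R^d$, $d\ge2$, is a bounded polyhedral Lipschitz domain with boundary $\Gamma$; $f\in L^2(\Omega)$; $\boldsymbol A\in (W^{1,\infty}(\Omega))^{d\times d}$ is symmetric, $\boldsymbol b\in (L^\infty(\Omega))^d$, $c\in L^\infty(\Omega)$; $\mathcal L v:=-\mathrm{div}(\boldsymbol A\nabla v)+\boldsymbol b\cdot\nabla v+cv$. The bilinear form $b(v,w):=\int_\Omega \boldsymbol A\nabla v\cdot\nabla w+\boldsymbol b\cdot\nabla v\,w+cvw\,dx$ on $H^1_0(\Omega)$ (in general non-symmetric) is bounded, $|b(v,w)|\le C_{\rm cont}\|\nabla v\|_{L^2(\Omega)}\|\nabla w\|_{L^2(\Omega)}$, and is assumed elliptic, $b(v,v)\ge C_{\rm ell}\|\nabla v\|_{L^2(\Omega)}^2$,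 with $C_{\rm ell}>0$. $u\in H^1_0(\Omega)$ is the unique solution of $b(u,v)=\int_\Omega fv\,dx$ for all $v\in H^1_0(\Omega)$. Meshes and discretization. $\mathcal T_0$ is a conforming simplicial triangulation of $\Omega$ (regular in the sense of Ciarlet); refinement is by newest vertex bisection (NVB); all meshes obtained are conforming and uniformly $\gamma$-shape regular ($\gamma^{-1}|T|^{1/d}\le\mathrm{diam}(T)\le\gamma|T|^{1/d}$), and sons $T'$ of a refined element $T$ satisfy $|T'|\le|T|/2$. For fixed $p\ge1$, $\mathcal S^p_0(\mathcal T_\ell)$ is the space of functions in $H^1_0(\Omega)$ that are polynomials of degree at most $p$ on each $T\in\mathcal T_\ell$. $U_\ell\in\mathcal S^p_0(\mathcal T_\ell)$ is the unique solution of $b(U_\ell,V_\ell)=\int_\Omega fV_\ell\,dx$ for all $V_\ell\in\mathcal S^p_0(\mathcal T_\ell)$. $\mathcal S^p_0(\mathcal T_\infty):=\overline{\bigcup_{\ell\in\mathbb N}\mathcal S^p_0(\mathcal T_\ell)}$ (closure in $H^1(\Omega)$). Estimator. $\eta_\ell(T)^2:=|T|^{2/d}\|\mathcal L|_TU_\ell-f\|_{L^2(T)}^2+|T|^{1/d}\|[\boldsymbol A\nabla U_\ell\cdot n]\|_{L^2(\partial T\cap\Omega)}^2$ for $T\in\mathcal T_\ell$, where $\mathcal L|_T U_\ell$ is the elementwise application of $\mathcal L$ and $[\cdot]$ is the conormal jump over interior facets, and $\eta_\ell^2:=\sum_{T\in\mathcal T_\ell}\eta_\ell(T)^2$. The estimator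 is known to be reliable: $\|\nabla(u-U_\ell)\|_{L^2(\Omega)}\le C_{\rm rel}\eta_\ell$ with $C_{\rm rel}>0$ independent of $\ell$. Adaptive algorithm. Input: $\mathcal T_0$ and $0<\theta\le1$. For $\ell=0,1,2,\dots$: (i) compute $U_\ell$; (ii) compute $\eta_\ell(T)$ for all $T\in\mathcal T_\ell$; (iii) determine a set $\mathcal M_\ell\subseteq\mathcal T_\ell$ of minimal cardinality with $\theta\,\eta_\ell^2\le\sum_{T\in\mathcal M_\ell}\eta_\ell(T)^2$ (Dörfler marking); (iv) refine (at least) the elements of $\mathcal M_\ell$ by NVB to obtain $\mathcal T_{\ell+1}$. *)

theory Defs
  imports "HOL-Analysis.Analysis"
begin

text \<open>
  Functions on \<open>\<Omega>\<close> are total functions on \<^typ>\<open>real ^ 'n\<close> whose values outside \<open>\<Omega>\<close> are irrelevant.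
  Lebesgue and Sobolev spaces are sets of such functions, not quotients, so that equality in these
  spaces is equality almost everywhere on \<open>\<Omega>\<close>. The space dimension \<open>d\<close> is \<^term>\<open>CARD('n)\<close>.
\<close>


section \<open>Lebesgue spaces and weak derivatives\<close>

definition L2_space :: "(real ^ 'n) set \<Rightarrow> (real ^ 'n \<Rightarrow> real) set" where
  "L2_space S = {g. g \<in> borel_measurable (lebesgue_on S) \<and>
                    integrable (lebesgue_on S) (\<lambda>x. (g x)\<^sup>2)}"

definition Linf_space :: "(real ^ 'n) set \<Rightarrow> (real ^ 'n \<Rightarrow> real) set" where
  "Linf_space S = {g. g \<in> borel_measurable (lebesgue_on S) \<and>
                      (\<exists>M. AE x in lebesgue_on S. \<bar>g x\<bar> \<le> M)}"

definition L2_norm :: "(real ^ 'n) set \<Rightarrow> (real ^ 'n \<Rightarrow> 'b :: real_normed_vector) \<Rightarrow> real" where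
  "L2_norm S g = sqrt (LINT x | lebesgue_on S. (norm (g x))\<^sup>2)"

definition partial :: "'n \<Rightarrow> (real ^ 'n \<Rightarrow> real) \<Rightarrow> real ^ 'n \<Rightarrow> real" where
  "partial i g x = frechet_derivative g (at x) (axis i 1)"

definition grad :: "(real ^ 'n \<Rightarrow> real) \<Rightarrow> real ^ 'n \<Rightarrow> real ^ 'n" where
  "grad g x = (\<chi> i. partial i g x)"

primrec C_k :: "nat \<Rightarrow> (real ^ 'n \<Rightarrow> real) \<Rightarrow> bool" where
  "C_k 0 g \<longleftrightarrow> continuous_on UNIV g"
| "C_k (Suc k) g \<longleftrightarrow> (\<forall>x. g differentiable (at x)) \<and> (\<forall>i. C_k k (partial i g))"

definition test_functions :: "(real ^ 'n) set \<Rightarrow> (real ^ 'n \<Rightarrow> real) set" where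
  "test_functions \<Omega> = {\<phi>. (\<forall>k. C_k k \<phi>) \<and> compact (closure {x. \<phi> x \<noteq> 0}) \<and>
                           closure {x. \<phi> x \<noteq> 0} \<subseteq> \<Omega>}"

definition L1_loc :: "(real ^ 'n) set \<Rightarrow> (real ^ 'n \<Rightarrow> real) set" where
  "L1_loc \<Omega> = {g. \<forall>K. compact K \<and> K \<subseteq> \<Omega> \<longrightarrow> integrable (lebesgue_on K) g}"

definition has_weak_partial ::
    "(real ^ 'n) set \<Rightarrow> 'n \<Rightarrow> (real ^ 'n \<Rightarrow> real) \<Rightarrow> (real ^ 'n \<Rightarrow> real) \<Rightarrow> bool" where
  "has_weak_partial \<Omega> i v g \<longleftrightarrow> v \<in> L1_loc \<Omega> \<and> g \<in> L1_loc \<Omega> \<and>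
     (\<forall>\<phi> \<in> test_functions \<Omega>.
        (LINT x | lebesgue_on \<Omega>. v x * partial i \<phi> x) = - (LINT x | lebesgue_on \<Omega>. g x * \<phi> x))"

text \<open>
  Weak derivatives are unique only almost everywhere; the operators below select a representative
  and are meaningful only for functions that possess the weak derivatives in question.
\<close>

definition weak_partial :: "(real ^ 'n) set \<Rightarrow> 'n \<Rightarrow> (real ^ 'n \<Rightarrow> real) \<Rightarrow> real ^ 'n \<Rightarrow> real" where
  "weak_partial \<Omega> i v = (SOME g. has_weak_partial \<Omega> i v g)"

definition weak_grad :: "(real ^ 'n) set \<Rightarrow> (real ^ 'n \<Rightarrow> real) \<Rightarrow> real ^ 'n \<Rightarrow> real ^ 'n" where
  "weak_grad \<Omega> v x = (\<chi> i. weak_partial \<Omega> i v x)"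

definition weak_div :: "(real ^ 'n) set \<Rightarrow> (real ^ 'n \<Rightarrow> real ^ 'n) \<Rightarrow> real ^ 'n \<Rightarrow> real" where
  "weak_div \<Omega> F x = (\<Sum>i\<in>UNIV. weak_partial \<Omega> i (\<lambda>y. F y $ i) x)"


section \<open>Sobolev spaces\<close>

definition W1inf_space :: "(real ^ 'n) set \<Rightarrow> (real ^ 'n \<Rightarrow> real) set" where
  "W1inf_space \<Omega> = {v \<in> Linf_space \<Omega>. \<forall>i. \<exists>g \<in> Linf_space \<Omega>. has_weak_partial \<Omega> i v g}"

definition H1_space :: "(real ^ 'n) set \<Rightarrow> (real ^ 'n \<Rightarrow> real) set" where
  "H1_space \<Omega> = {v \<in> L2_space \<Omega>. \<forall>i. \<exists>g \<in> L2_space \<Omega>. has_weak_partial \<Omega> i v g}"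

definition H1_norm :: "(real ^ 'n) set \<Rightarrow> (real ^ 'n \<Rightarrow> real) \<Rightarrow> real" where
  "H1_norm \<Omega> v = sqrt ((L2_norm \<Omega> v)\<^sup>2 + (L2_norm \<Omega> (weak_grad \<Omega> v))\<^sup>2)"

definition H1_closure ::
    "(real ^ 'n) set \<Rightarrow> (real ^ 'n \<Rightarrow> real) set \<Rightarrow> (real ^ 'n \<Rightarrow> real) set" where
  "H1_closure \<Omega> W = {v \<in> H1_space \<Omega>. \<forall>\<epsilon>>0. \<exists>w\<in>W. H1_norm \<Omega> (\<lambda>x. v x - w x) < \<epsilon>}"

definition H10_space :: "(real ^ 'n) set \<Rightarrow> (real ^ 'n \<Rightarrow> real) set" where
  "H10_space \<Omega> = H1_closure \<Omega> (test_functions \<Omega>)"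


section \<open>The domain and the differential operator\<close>

text \<open>
  Near each boundary point, \<open>\<Omega>\<close> is the strict epigraph, in direction \<open>e\<close>, of a Lipschitz function
  defined on the hyperplane orthogonal to \<open>e\<close>.
\<close>

definition lipschitz_domain :: "(real ^ 'n) set \<Rightarrow> bool" where
  "lipschitz_domain \<Omega> \<longleftrightarrow> open \<Omega> \<and> connected \<Omega> \<and> \<Omega> \<noteq> {} \<and>
     (\<forall>x \<in> frontier \<Omega>. \<exists>r>0. \<exists>e. norm e = 1 \<and>
        (\<exists>L (\<psi> :: real ^ 'n \<Rightarrow> real). L-lipschitz_on {z. e \<bullet> z = 0} \<psi> \<and>
           (\<forall>y \<in> ball x r. y \<in> \<Omega> \<longleftrightarrow> \<psi> (y - (e \<bullet> y) *\<^sub>R e) < e \<bullet> y)))"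

definition polyhedral :: "(real ^ 'n) set \<Rightarrow> bool" where
  "polyhedral \<Omega> \<longleftrightarrow> (\<exists>P. finite P \<and> (\<forall>K\<in>P. polytope K) \<and> closure \<Omega> = \<Union>P)"

definition bilinear_form ::
    "(real ^ 'n) set \<Rightarrow> (real ^ 'n \<Rightarrow> real ^ 'n ^ 'n) \<Rightarrow> (real ^ 'n \<Rightarrow> real ^ 'n) \<Rightarrow>
     (real ^ 'n \<Rightarrow> real) \<Rightarrow> (real ^ 'n \<Rightarrow> real) \<Rightarrow> (real ^ 'n \<Rightarrow> real) \<Rightarrow> real" where
  "bilinear_form \<Omega> A b c v w =
     (LINT x | lebesgue_on \<Omega>.
        (A x *v weak_grad \<Omega> v x) \<bullet> weak_grad \<Omega> w x + (b x \<bullet> weak_grad \<Omega> v x) * w x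
        + c x * v x * w x)"

definition diff_op ::
    "(real ^ 'n) set \<Rightarrow> (real ^ 'n \<Rightarrow> real ^ 'n ^ 'n) \<Rightarrow> (real ^ 'n \<Rightarrow> real ^ 'n) \<Rightarrow>
     (real ^ 'n \<Rightarrow> real) \<Rightarrow> (real ^ 'n \<Rightarrow> real) \<Rightarrow> real ^ 'n \<Rightarrow> real" where
  "diff_op G A b c v x =
     - weak_div G (\<lambda>y. A y *v weak_grad G v y) x + b x \<bullet> weak_grad G v x + c x * v x"

definition galerkin_solution ::
    "(real ^ 'n) set \<Rightarrow> (real ^ 'n \<Rightarrow> real ^ 'n ^ 'n) \<Rightarrow> (real ^ 'n \<Rightarrow> real ^ 'n) \<Rightarrow>
     (real ^ 'n \<Rightarrow> real) \<Rightarrow> (real ^ 'n \<Rightarrow> real) \<Rightarrow>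
     (real ^ 'n \<Rightarrow> real) set \<Rightarrow> (real ^ 'n \<Rightarrow> real) \<Rightarrow> bool" where
  "galerkin_solution \<Omega> A b c f V w \<longleftrightarrow>
     w \<in> V \<and> (\<forall>v\<in>V. bilinear_form \<Omega> A b c w v = (LINT x | lebesgue_on \<Omega>. f x * v x))"


section \<open>Tagged simplices and newest vertex bisection\<close>

text \<open>
  A tagged simplex is a list of vertices \<open>[z\<^sub>0, \<dots>, z\<^sub>d]\<close> with a type \<open>t < d\<close>; its refinement edge joins
  \<open>z\<^sub>0\<close> and \<open>z\<^sub>d\<close>. The bisection rule is that of Maubach and Traxler, i.e. newest vertex bisection in
  arbitrary dimension: with \<open>m = (z\<^sub>0 + z\<^sub>d) / 2\<close>, the two sons are
  \<open>[z\<^sub>0, m, z\<^sub>1, \<dots>, z\<^sub>t, z\<^bsub>t+1\<^esub>, \<dots>, z\<^bsub>d-1\<^esub>]\<close> and \<open>[z\<^sub>d, m, z\<^sub>1, \<dots>, z\<^sub>t, z\<^bsub>d-1\<^esub>, \<dots>, z\<^bsub>t+1\<^esub>]\<close>,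
  both of type \<open>(t + 1) mod d\<close>.
\<close>

type_synonym 'n tagged_simplex = "(real ^ 'n) list \<times> nat"

definition elem :: "('n::finite) tagged_simplex \<Rightarrow> (real ^ 'n) set" where
  "elem T = convex hull (set (fst T))"

definition vol :: "('n::finite) tagged_simplex \<Rightarrow> real" where
  "vol T = measure lebesgue (elem T)"

definition is_tagged_simplex :: "('n::finite) tagged_simplex \<Rightarrow> bool" where
  "is_tagged_simplex T \<longleftrightarrow> length (fst T) = CARD('n) + 1 \<and> distinct (fst T) \<and>
     \<not> affine_dependent (set (fst T)) \<and> snd T < CARD('n)"

definition sons :: "('n::finite) tagged_simplex \<Rightarrow> 'n tagged_simplex set" where
  "sons T =
     (let z = fst T; t = snd T; m = midpoint (hd z) (last z); mid = butlast (tl z);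
          t' = (t + 1) mod CARD('n)
      in {(hd z # m # take t mid @ drop t mid, t'),
          (last z # m # take t mid @ rev (drop t mid), t')})"

text \<open>
  Replacing a single simplex by its sons in general creates hanging nodes. Conformity is required
  separately, of the meshes that are actually used.
\<close>

inductive bisection :: "('n::finite) tagged_simplex set \<Rightarrow> 'n tagged_simplex set \<Rightarrow> bool" where
  "T \<in> \<T> \<Longrightarrow> bisection \<T> (\<T> - {T} \<union> sons T)"

definition nvb_refinement :: "('n::finite) tagged_simplex set \<Rightarrow> 'n tagged_simplex set \<Rightarrow> bool" where
  "nvb_refinement = bisection\<^sup>*\<^sup>*"

definition conforming_mesh :: "(real ^ 'n) set \<Rightarrow> ('n::finite) tagged_simplex set \<Rightarrow> bool" where
  "conforming_mesh \<Omega> \<T> \<longleftrightarrow> (\<forall>T\<in>\<T>. is_tagged_simplex T) \<and> inj_on elem \<T> \<and>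
     triangulation (elem ` \<T>) \<and> \<Union> (elem ` \<T>) = closure \<Omega>"

definition shape_regular :: "real \<Rightarrow> ('n::finite) tagged_simplex set \<Rightarrow> bool" where
  "shape_regular \<gamma> \<T> \<longleftrightarrow>
     (\<forall>T\<in>\<T>. inverse \<gamma> * vol T powr (1 / CARD('n)) \<le> diameter (elem T) \<and>
             diameter (elem T) \<le> \<gamma> * vol T powr (1 / CARD('n)))"


section \<open>Discrete spaces\<close>

definition poly_space :: "nat \<Rightarrow> (real ^ 'n \<Rightarrow> real) set" where
  "poly_space p = {q. \<exists>a :: ('n \<Rightarrow> nat) \<Rightarrow> real.
     q = (\<lambda>x. \<Sum>\<alpha> | (\<Sum>i\<in>UNIV. \<alpha> i) \<le> p. a \<alpha> * (\<Prod>i\<in>UNIV. (x $ i) ^ \<alpha> i))}"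

definition Sp0_space ::
    "(real ^ 'n) set \<Rightarrow> nat \<Rightarrow> ('n::finite) tagged_simplex set \<Rightarrow> (real ^ 'n \<Rightarrow> real) set" where
  "Sp0_space \<Omega> p \<T> = {v \<in> H10_space \<Omega>.
     \<forall>T\<in>\<T>. \<exists>q \<in> poly_space p. AE x in lebesgue_on (elem T). v x = q x}"

definition Sp0_limit_space ::
    "(real ^ 'n) set \<Rightarrow> nat \<Rightarrow> (nat \<Rightarrow> ('n::finite) tagged_simplex set) \<Rightarrow> (real ^ 'n \<Rightarrow> real) set" where
  "Sp0_limit_space \<Omega> p \<T> = H1_closure \<Omega> (\<Union>l. Sp0_space \<Omega> p (\<T> l))"


section \<open>The residual error estimator\<close>

text \<open>
  The polynomial that represents a discrete function on an element. It is uniquely determined and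
  provides the trace of the gradient on the facets, which are null sets.
\<close>

definition elem_poly ::
    "nat \<Rightarrow> ('n::finite) tagged_simplex \<Rightarrow> (real ^ 'n \<Rightarrow> real) \<Rightarrow> real ^ 'n \<Rightarrow> real" where
  "elem_poly p T v = (SOME q. q \<in> poly_space p \<and> (AE x in lebesgue_on (elem T). v x = q x))"

definition unit_normal :: "(real ^ 'n) set \<Rightarrow> real ^ 'n" where
  "unit_normal F = (SOME n. norm n = 1 \<and> (\<forall>x\<in>F. \<forall>y\<in>F. n \<bullet> (x - y) = 0))"

text \<open>
  Integral over a facet \<open>F\<close> with respect to the \<open>(d-1)\<close>-dimensional surface measure. By Fubini's
  theorem, it equals the volume integral over the right prism of height 1 with base \<open>F\<close> of the
  function extended constantly in the normal direction; on this prism, the closest point in the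
  affine hull of \<open>F\<close> is the foot point in \<open>F\<close>.
\<close>

definition facet_integral :: "(real ^ 'n) set \<Rightarrow> (real ^ 'n \<Rightarrow> real) \<Rightarrow> real" where
  "facet_integral F g =
     (LINT x | lebesgue_on {y + s *\<^sub>R unit_normal F | y s. y \<in> F \<and> s \<in> {0..1}}.
        g (closest_point (affine hull F) x))"

text \<open>
  The squared \<open>L\<^sup>2\<close> norm of the conormal jump on the part of the boundary of \<open>T\<close> inside the domain.
  In a conforming mesh, this part consists (up to a null set) of the facets that \<open>T\<close> shares with
  another element, and each such facet is shared with exactly one element. The square does not
  depend on the sign of the normal.
\<close>

definition jump_sq ::
    "(real ^ 'n \<Rightarrow> real ^ 'n ^ 'n) \<Rightarrow> nat \<Rightarrow> ('n::finite) tagged_simplex set \<Rightarrow>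
     (real ^ 'n \<Rightarrow> real) \<Rightarrow> 'n tagged_simplex \<Rightarrow> real" where
  "jump_sq A p \<T> v T =
     (\<Sum>T' \<in> \<T> - {T}. \<Sum>F | F facet_of elem T \<and> F facet_of elem T'.
        facet_integral F (\<lambda>x.
          ((A x *v grad (elem_poly p T v) x - A x *v grad (elem_poly p T' v) x)
             \<bullet> unit_normal F)\<^sup>2))"

text \<open>
  The volume residual is taken over the interior of the element, on which the differential
  operator is applied weakly; the boundary of the element is a null set.
\<close>

definition indicator_sq ::
    "(real ^ 'n \<Rightarrow> real ^ 'n ^ 'n) \<Rightarrow> (real ^ 'n \<Rightarrow> real ^ 'n) \<Rightarrow> (real ^ 'n \<Rightarrow> real) \<Rightarrow>
     (real ^ 'n \<Rightarrow> real) \<Rightarrow> nat \<Rightarrow> ('n::finite) tagged_simplex set \<Rightarrow>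
     (real ^ 'n \<Rightarrow> real) \<Rightarrow> 'n tagged_simplex \<Rightarrow> real" where
  "indicator_sq A b c f p \<T> v T =
     vol T powr (2 / CARD('n)) *
       (L2_norm (interior (elem T)) (\<lambda>x. diff_op (interior (elem T)) A b c v x - f x))\<^sup>2
     + vol T powr (1 / CARD('n)) * jump_sq A p \<T> v T"

definition estimator ::
    "(real ^ 'n \<Rightarrow> real ^ 'n ^ 'n) \<Rightarrow> (real ^ 'n \<Rightarrow> real ^ 'n) \<Rightarrow> (real ^ 'n \<Rightarrow> real) \<Rightarrow>
     (real ^ 'n \<Rightarrow> real) \<Rightarrow> nat \<Rightarrow> ('n::finite) tagged_simplex set \<Rightarrow>
     (real ^ 'n \<Rightarrow> real) \<Rightarrow> real" where
  "estimator A b c f p \<T> v = sqrt (\<Sum>T\<in>\<T>. indicator_sq A b c f p \<T> v T)"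


section \<open>The adaptive algorithm\<close>

definition doerfler_marking :: "real \<Rightarrow> ('t \<Rightarrow> real) \<Rightarrow> 't set \<Rightarrow> 't set \<Rightarrow> bool" where
  "doerfler_marking \<theta> \<eta>2 \<T> \<M> \<longleftrightarrow>
     \<M> \<subseteq> \<T> \<and> \<theta> * sum \<eta>2 \<T> \<le> sum \<eta>2 \<M> \<and>
     (\<forall>\<M>'. \<M>' \<subseteq> \<T> \<and> \<theta> * sum \<eta>2 \<T> \<le> sum \<eta>2 \<M>' \<longrightarrow> card \<M> \<le> card \<M>')"

text \<open>
  An element that has been bisected never reappears in a later mesh, so the marked elements are
  refined precisely if none of them belongs to the next mesh. Any conforming refinement with this
  property is allowed, in particular the coarsest one.
\<close>

definition adaptive_run ::
    "(real ^ 'n) set \<Rightarrow> (real ^ 'n \<Rightarrow> real ^ 'n ^ 'n) \<Rightarrow> (real ^ 'n \<Rightarrow> real ^ 'n) \<Rightarrow>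
     (real ^ 'n \<Rightarrow> real) \<Rightarrow> (real ^ 'n \<Rightarrow> real) \<Rightarrow> nat \<Rightarrow> real \<Rightarrow>
     (nat \<Rightarrow> ('n::finite) tagged_simplex set) \<Rightarrow> (nat \<Rightarrow> real ^ 'n \<Rightarrow> real) \<Rightarrow> bool" where
  "adaptive_run \<Omega> A b c f p \<theta> \<T> U \<longleftrightarrow>
     conforming_mesh \<Omega> (\<T> 0) \<and>
     (\<forall>l. galerkin_solution \<Omega> A b c f (Sp0_space \<Omega> p (\<T> l)) (U l) \<and>
          (\<exists>\<M>. doerfler_marking \<theta> (indicator_sq A b c f p (\<T> l) (U l)) (\<T> l) \<M> \<and>
               nvb_refinement (\<T> l) (\<T> (Suc l)) \<and> \<M> \<inter> \<T> (Suc l) = {} \<and>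
               conforming_mesh \<Omega> (\<T> (Suc l))))"

end

theory Submission
  imports Defs
begin

text \<open>
  The Galerkin solutions form a Cauchy sequence, so it remains to make the estimator small. Every
  refinement lowers the sum of the squared element volumes by a fixed fraction of the squared
  volumes of the refined elements; hence the volumes of the refined elements tend to zero, and so
  do their diameters by shape regularity. On refined elements compare \<open>U l\<close> with \<open>U k\<close> for a fixed
  large \<open>k\<close>: inverse estimates bound the part of the indicators that stems from \<open>U l - U k\<close> by its
  energy, which is small. The volume residual of \<open>U k\<close> carries a factor \<open>h\<^sup>2\<close>. Its jumps vanish away
  from the skeleton of the \<open>k\<close>-th mesh, and the refined elements that meet the skeleton lie in a
  neighbourhood whose measure tends to zero. Doerfler marking and reliability transfer the
  convergence of the refined indicators to the error.
\<close>

section \<open>Smooth functions\<close>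

text \<open>The comparison runs against a discrete \<open>U k\<close> rather than against the limit
  because jumps and second derivatives make sense only for piecewise polynomials. Those of
  \<open>U k\<close> are bounded by a constant that depends on \<open>k\<close> alone, so
  \<open>k\<close> is fixed first and the refined elements become small afterwards. Volumes are
  squared in the potential because their plain sum is always the volume of the closure of \<Omega>
  and registers no refinement. Elements that are never refined are covered by Doerfler marking,
  which bounds the whole estimator by its marked part. Function spaces are sets and weak gradients
  are chosen representatives; hence identities are stated almost everywhere, and squared norms with
  factors 2 stand in for triangle inequalities. Facet integrals are bounded through point values of
  gradients. These come from inverse estimates that hold on every set filling a fixed fraction of a
  ball, by compactness of the normalized polynomials. Reliability identifies the limit with
  \<open>u\<close> directly, and \<open>u\<close> itself serves as the Galerkin solution in the
  limit space.\<close>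

lemma partial_has_derivative: "(g has_derivative g') (at x) \<Longrightarrow> partial i g x = g' (axis i 1)"
  unfolding partial_def using frechet_derivative_at by metis

lemma has_derivative_partial:
  fixes g :: "real ^ 'n \<Rightarrow> real"
  assumes "g differentiable (at x)"
  shows "(g has_derivative (\<lambda>h. \<Sum>i\<in>UNIV. h $ i * partial i g x)) (at x)"
proof -
  obtain g' where g': "(g has_derivative g') (at x)"
    using assms unfolding differentiable_def by blast
  then interpret bounded_linear g' by (rule has_derivative_bounded_linear)
  have "g' h = (\<Sum>i\<in>UNIV. h $ i * partial i g x)" for h
  proof -
    have "g' h = g' (\<Sum>i\<in>UNIV. h $ i *\<^sub>R axis i 1)"
      by (metis basis_expansion scalar_mult_eq_scaleR)
    also have "\<dots> = (\<Sum>i\<in>UNIV. h $ i * g' (axis i 1))"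
      by (simp add: sum scaleR)
    finally show ?thesis using partial_has_derivative[OF g'] by simp
  qed
  then have "g' = (\<lambda>h. \<Sum>i\<in>UNIV. h $ i * partial i g x)" by auto
  then show ?thesis using g' by simp
qed

lemma partial_const [simp]: "partial i (\<lambda>x. c) = (\<lambda>x. 0)"
  using partial_has_derivative[OF has_derivative_const] by blast

lemma partial_coord [simp]: "partial i (\<lambda>x. x $ j) = (\<lambda>x. if i = j then 1 else 0)"
proof
  fix x :: "real ^ 'a"
  have "((\<lambda>x. x $ j) has_derivative (\<lambda>h. h $ j)) (at x)"
    by (simp add: bounded_linear_imp_has_derivative bounded_linear_vec_nth)
  from partial_has_derivative[OF this] show "partial i (\<lambda>x. x $ j) x = (if i = j then 1 else 0)"
    by (auto simp: axis_def)
qed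

lemma partial_add:
  "f differentiable (at x) \<Longrightarrow> g differentiable (at x) \<Longrightarrow>
    partial i (\<lambda>x. f x + g x) x = partial i f x + partial i g x"
proof -
  assume "f differentiable (at x)" "g differentiable (at x)"
  then obtain f' g' where d: "(f has_derivative f') (at x)" "(g has_derivative g') (at x)"
    unfolding differentiable_def by blast
  show ?thesis
    using partial_has_derivative[OF has_derivative_add[OF d], of i]
      partial_has_derivative[OF d(1), of i] partial_has_derivative[OF d(2), of i]
    by simp
qed

lemma partial_mult:
  "f differentiable (at x) \<Longrightarrow> g differentiable (at x) \<Longrightarrow>
    partial i (\<lambda>x. f x * g x) x = f x * partial i g x + g x * partial i f x"
proof -
  assume "f differentiable (at x)" "g differentiable (at x)"
  then obtain f' g' where d: "(f has_derivative f') (at x)" "(g has_derivative g') (at x)"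
    unfolding differentiable_def by blast
  show ?thesis
    using partial_has_derivative[OF has_derivative_mult[OF d], of i]
      partial_has_derivative[OF d(1), of i] partial_has_derivative[OF d(2), of i]
    by (simp add: mult.commute)
qed

lemma C_k_Suc_imp: "C_k (Suc k) g \<Longrightarrow> C_k k g"
proof (induction k arbitrary: g)
  case 0
  then show ?case
    by (auto intro!: continuous_at_imp_continuous_on differentiable_imp_continuous_within)
next
  case (Suc k)
  then show ?case by (metis C_k.simps(2))
qed

lemma C_k_const: "C_k k (\<lambda>x. c)"
  by (induction k arbitrary: c) auto

lemma C_k_coord: "C_k k (\<lambda>x. x $ i)"
proof (induction k)
  case (Suc k)
  have "(\<lambda>x::real^'a. x $ i) differentiable at x" for x
    by (simp add: bounded_linear_imp_differentiable bounded_linear_vec_nth)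
  then show ?case by (auto simp: C_k_const)
qed (auto intro: continuous_intros)

lemma C_k_add: "C_k k f \<Longrightarrow> C_k k g \<Longrightarrow> C_k k (\<lambda>x. f x + g x)"
proof (induction k arbitrary: f g)
  case (Suc k)
  then have "partial i (\<lambda>x. f x + g x) = (\<lambda>x. partial i f x + partial i g x)" for i
    by (auto simp: partial_add)
  then show ?case using Suc by auto
qed (auto intro: continuous_intros)

lemma C_k_mult: "C_k k f \<Longrightarrow> C_k k g \<Longrightarrow> C_k k (\<lambda>x. f x * g x)"
proof (induction k arbitrary: f g)
  case (Suc k)
  then have "partial i (\<lambda>x. f x * g x) = (\<lambda>x. f x * partial i g x + g x * partial i f x)" for i
    by (auto simp: partial_mult)
  \<comment> \<open>The product rule keeps one factor undifferentiated, so the induction needs the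
    factors themselves in class \<open>k\<close> as well.\<close>
  moreover have "C_k k f" "C_k k g" using Suc.prems C_k_Suc_imp by blast+
  ultimately show ?case using Suc by (auto intro!: C_k_add)
qed (auto intro: continuous_intros)

definition smooth :: "(real ^ 'n \<Rightarrow> real) \<Rightarrow> bool" where
  "smooth g \<longleftrightarrow> (\<forall>k. C_k k g)"

lemma smooth_const: "smooth (\<lambda>x. c)" by (simp add: smooth_def C_k_const)

lemma smooth_coord: "smooth (\<lambda>x. x $ i)" by (simp add: smooth_def C_k_coord)

lemma smooth_add: "smooth f \<Longrightarrow> smooth g \<Longrightarrow> smooth (\<lambda>x. f x + g x)"
  by (simp add: smooth_def C_k_add)

lemma smooth_mult: "smooth f \<Longrightarrow> smooth g \<Longrightarrow> smooth (\<lambda>x. f x * g x)"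
  by (simp add: smooth_def C_k_mult)

lemma smooth_power: "smooth f \<Longrightarrow> smooth (\<lambda>x. f x ^ k)"
  by (induction k) (auto simp: smooth_const smooth_mult)

lemma smooth_sum: "(\<And>i. i \<in> I \<Longrightarrow> smooth (f i)) \<Longrightarrow> smooth (\<lambda>x. \<Sum>i\<in>I. f i x)"
  by (induction I rule: infinite_finite_induct) (auto simp: smooth_const smooth_add)

lemma smooth_prod: "(\<And>i. i \<in> I \<Longrightarrow> smooth (f i)) \<Longrightarrow> smooth (\<lambda>x. \<Prod>i\<in>I. f i x)"
  by (induction I rule: infinite_finite_induct) (auto simp: smooth_const smooth_mult)

lemma smooth_partial: "smooth g \<Longrightarrow> smooth (partial i g)"
  unfolding smooth_def by (metis C_k.simps(2))

lemma smooth_differentiable: "smooth g \<Longrightarrow> g differentiable (at x)"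
  unfolding smooth_def by (metis C_k.simps(2))

lemma smooth_continuous_on: "smooth g \<Longrightarrow> continuous_on S g"
  unfolding smooth_def by (metis C_k.simps(1) continuous_on_subset subset_UNIV)

text \<open>A derivative sees only a neighbourhood, and off a closed set the function agrees locally
  with zero.\<close>

lemma partial_zero_outside_closed:
  assumes "closed K" "\<And>x. x \<notin> K \<Longrightarrow> g x = 0" "x \<notin> K"
  shows "partial i g x = 0"
proof -
  have "((\<lambda>x. 0) has_derivative (\<lambda>x. 0)) (at x)" by simp
  moreover have "open (- K)" "x \<in> - K" using assms by auto
  ultimately have "(g has_derivative (\<lambda>x. 0)) (at x)"
    using has_derivative_transform_within_open[of "\<lambda>x. 0" "\<lambda>x. 0" x UNIV "- K" g] assms(2) by fastforce
  then show ?thesis by (rule partial_has_derivative)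
qed

lemma test_functionsD:
  assumes "\<phi> \<in> test_functions \<Omega>"
  shows "smooth \<phi>" "compact (closure {x. \<phi> x \<noteq> 0})" "closure {x. \<phi> x \<noteq> 0} \<subseteq> \<Omega>"
    "\<And>x. x \<notin> closure {x. \<phi> x \<noteq> 0} \<Longrightarrow> \<phi> x = 0"
    "\<And>x. x \<notin> closure {x. \<phi> x \<noteq> 0} \<Longrightarrow> partial i \<phi> x = 0"
proof -
  show "smooth \<phi>" "compact (closure {x. \<phi> x \<noteq> 0})" "closure {x. \<phi> x \<noteq> 0} \<subseteq> \<Omega>"
    using assms unfolding test_functions_def smooth_def by auto
  show *: "x \<notin> closure {x. \<phi> x \<noteq> 0} \<Longrightarrow> \<phi> x = 0" for x
    using closure_subset[of "{x. \<phi> x \<noteq> 0}"] by auto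
  show "x \<notin> closure {x. \<phi> x \<noteq> 0} \<Longrightarrow> partial i \<phi> x = 0" for x
    by (rule partial_zero_outside_closed[OF closed_closure *]) assumption+
qed

lemma compact_if_closed_subset_compact: "compact S \<Longrightarrow> closed T \<Longrightarrow> T \<subseteq> S \<Longrightarrow> compact T"
  using compact_Int_closed[of S T] by (simp add: inf.absorb2)

lemma test_functions_mono: "G \<subseteq> \<Omega> \<Longrightarrow> test_functions G \<subseteq> test_functions \<Omega>"
  unfolding test_functions_def by auto

lemma test_functions_mult_smooth:
  assumes "\<phi> \<in> test_functions \<Omega>" "smooth q"
  shows "(\<lambda>x. q x * \<phi> x) \<in> test_functions \<Omega>"
proof -
  have sub: "closure {x. q x * \<phi> x \<noteq> 0} \<subseteq> closure {x. \<phi> x \<noteq> 0}"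
    by (intro closure_mono) auto
  then have "compact (closure {x. q x * \<phi> x \<noteq> 0})"
    by (rule compact_if_closed_subset_compact[OF test_functionsD(2)[OF assms(1)] closed_closure])
  moreover have "smooth (\<lambda>x. q x * \<phi> x)"
    by (rule smooth_mult[OF assms(2) test_functionsD(1)[OF assms(1)]])
  ultimately show ?thesis
    using sub test_functionsD(3)[OF assms(1)] unfolding test_functions_def smooth_def by auto
qed

section \<open>Bump functions\<close>

text \<open>The classical flat function \<open>exp (- 1 / t)\<close> multiplied by a power of
  \<open>1 / t\<close>. The powers are carried along because the family is then closed under
  differentiation, which makes smoothness a plain induction.\<close>

definition flat_exp :: "nat \<Rightarrow> real \<Rightarrow> real" where
  "flat_exp n t = (if t > 0 then inverse t ^ n * exp (- inverse t) else 0)"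

lemma flat_exp_tendsto_0: "(flat_exp n \<longlongrightarrow> 0) (at 0)"
proof -
  have "((\<lambda>t. inverse t ^ n / exp (inverse t)) \<longlongrightarrow> 0) (at_right (0::real))"
    by (rule filterlim_compose[OF tendsto_power_div_exp_0 filterlim_inverse_at_top_right])
  moreover have "eventually (\<lambda>t::real. inverse t ^ n / exp (inverse t) = flat_exp n t) (at_right 0)"
    unfolding eventually_at_right_field
    by (intro exI[of _ 1]) (auto simp: flat_exp_def exp_minus divide_inverse)
  ultimately have r: "(flat_exp n \<longlongrightarrow> 0) (at_right 0)"
    by (rule Lim_transform_eventually)
  have "eventually (\<lambda>t::real. 0 = flat_exp n t) (at_left 0)"
    unfolding eventually_at_left_field
    by (intro exI[of _ "-1"]) (auto simp: flat_exp_def)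
  then have l: "(flat_exp n \<longlongrightarrow> 0) (at_left 0)"
    by (rule Lim_transform_eventually[OF tendsto_const])
  show ?thesis using l r by (simp add: filterlim_split_at)
qed

lemma flat_exp_DERIV:
  "(flat_exp n has_real_derivative flat_exp (n + 2) t - n * flat_exp (n + 1) t) (at t)"
proof -
  consider "t > 0" | "t < 0" | "t = 0" by linarith
  then show ?thesis
  proof cases
    case 1
    have "((\<lambda>t. inverse t ^ n * exp (- inverse t)) has_real_derivative
        flat_exp (n + 2) t - n * flat_exp (n + 1) t) (at t)"
    proof (cases n)
      case 0
      then show ?thesis
        using 1 by (auto intro!: derivative_eq_intros simp: flat_exp_def field_simps power2_eq_square)
    next
      case (Suc m)
      have "((\<lambda>t. inverse t ^ n * exp (- inverse t)) has_real_derivative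
         inverse t ^ n * (exp (- inverse t) * inverse t ^ 2) + (n * inverse t ^ m * (- (inverse t ^ 2))) * exp (- inverse t)) (at t)"
      proof -
        have "(inverse has_real_derivative - (inverse t ^ 2)) (at t)"
          using DERIV_inverse[of t] 1 by (simp add: numeral_2_eq_2)
        from DERIV_power_Suc[OF this, of m]
        have d1: "((\<lambda>t. inverse t ^ n) has_real_derivative n * inverse t ^ m * - (inverse t ^ 2)) (at t)"
          using Suc by (simp add: algebra_simps)
        have d2: "((\<lambda>t. exp (- inverse t)) has_real_derivative exp (- inverse t) * inverse t ^ 2) (at t)"
          using 1 by (auto intro!: derivative_eq_intros simp: power2_eq_square)
        show ?thesis using DERIV_mult[OF d1 d2] by (simp add: algebra_simps)
      qed
      moreover have "inverse t ^ n * (exp (- inverse t) * inverse t ^ 2) + (n * inverse t ^ m * (- (inverse t ^ 2))) * exp (- inverse t)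
         = flat_exp (n + 2) t - n * flat_exp (n + 1) t"
        using 1 Suc by (simp add: flat_exp_def power2_eq_square algebra_simps)
      ultimately show ?thesis by simp
    qed
    then show ?thesis
      by (rule has_field_derivative_transform_within_open[of _ _ _ "{0<..}"])
        (use 1 in \<open>auto simp: flat_exp_def\<close>)
  next
    case 2
    have "((\<lambda>t. 0) has_real_derivative flat_exp (n + 2) t - n * flat_exp (n + 1) t) (at t)"
      using 2 by (auto simp: flat_exp_def)
    then show ?thesis
      by (rule has_field_derivative_transform_within_open[of _ _ _ "{..<0}"])
        (use 2 in \<open>auto simp: flat_exp_def\<close>)
  next
    case 3
    \<comment> \<open>At the origin the difference quotient is again a member of the family, so the
      derivative there is the limit of \<open>flat_exp (Suc n)\<close>, namely 0.\<close>
    have "(\<lambda>h. (flat_exp n h - flat_exp n 0) / h) = flat_exp (Suc n)"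
      by (auto simp: flat_exp_def divide_inverse)
    then have "(flat_exp n has_real_derivative 0) (at 0)"
      unfolding DERIV_def using flat_exp_tendsto_0[of "Suc n"] by simp
    then show ?thesis using 3 by (simp add: flat_exp_def)
  qed
qed

lemma has_derivative_flat_exp_coord:
  "((\<lambda>x. flat_exp n (c * x $ i + b)) has_derivative
     (\<lambda>h. (flat_exp (n + 2) (c * x $ i + b) - n * flat_exp (n + 1) (c * x $ i + b)) * (c * h $ i))) (at x)"
proof -
  have "((\<lambda>x. c * x $ i + b) has_derivative (\<lambda>h. c * h $ i)) (at x)"
    by (auto intro!: derivative_eq_intros bounded_linear_imp_has_derivative bounded_linear_vec_nth)
  from has_derivative_compose[OF this flat_exp_DERIV[unfolded has_field_derivative_def]]
  show ?thesis by (simp add: mult.commute)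
qed

lemma C_k_flat_exp: "C_k k (\<lambda>x. flat_exp n (c * x $ i + b))"
proof (induction k arbitrary: n)
  case 0
  show ?case
    by (simp, intro continuous_at_imp_continuous_on ballI has_derivative_continuous)
      (rule has_derivative_flat_exp_coord)
next
  case (Suc k)
  have "partial j (\<lambda>x. flat_exp n (c * x $ i + b)) = (\<lambda>x. (if i = j then c else 0) *
      (flat_exp (n + 2) (c * x $ i + b) + (- real n) * flat_exp (n + 1) (c * x $ i + b)))" for j
    by (rule ext, subst partial_has_derivative[OF has_derivative_flat_exp_coord]) (auto simp: axis_def)
  moreover have "C_k k (\<lambda>x. (if i = j then c else 0) *
      (flat_exp (n + 2) (c * x $ i + b) + (- real n) * flat_exp (n + 1) (c * x $ i + b)))" for j
    by (intro C_k_mult C_k_add C_k_const Suc)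
  moreover have "(\<lambda>x. flat_exp n (c * x $ i + b)) differentiable (at x)" for x
    using has_derivative_flat_exp_coord differentiable_def by blast
  ultimately show ?case by simp
qed

text \<open>A smooth approximation of the indicator of the open box: the scaling by
  \<open>Suc n\<close> drives each factor \<open>exp (- 1 / (Suc n * s))\<close> to 1 wherever the
  distance \<open>s\<close> to the face is positive. The arguments are written as
  \<open>c * x $ i + b\<close> to match \<open>C_k_flat_exp\<close>.\<close>

definition box_bump :: "nat \<Rightarrow> real ^ 'n \<Rightarrow> real ^ 'n \<Rightarrow> real ^ 'n \<Rightarrow> real" where
  "box_bump n a b x = (\<Prod>i\<in>UNIV. flat_exp 0 (real (Suc n) * x $ i + - real (Suc n) * a $ i) *
     flat_exp 0 (- real (Suc n) * x $ i + real (Suc n) * b $ i))"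

lemma mem_box_vec: "(x :: real ^ 'n) \<in> box a b \<longleftrightarrow> (\<forall>i. a $ i < x $ i \<and> x $ i < b $ i)"
  by (simp add: mem_box_cart)

lemma box_bump_outside:
  fixes x :: "real ^ 'n"
  shows "x \<notin> box a b \<Longrightarrow> box_bump n a b x = 0"
proof -
  assume "x \<notin> box a b"
  then obtain i where i: "x $ i \<le> a $ i \<or> b $ i \<le> x $ i" unfolding mem_box_vec by (auto simp: not_less)
  have "real (Suc n) * x $ i + - real (Suc n) * a $ i = real (Suc n) * (x $ i - a $ i)"
    "- real (Suc n) * x $ i + real (Suc n) * b $ i = real (Suc n) * (b $ i - x $ i)"
    by (auto simp: algebra_simps)
  then have "flat_exp 0 (real (Suc n) * x $ i + - real (Suc n) * a $ i) *
     flat_exp 0 (- real (Suc n) * x $ i + real (Suc n) * b $ i) = 0"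
    using i by (auto simp: flat_exp_def zero_less_mult_iff)
  then show ?thesis unfolding box_bump_def by (metis (no_types, lifting) UNIV_I finite prod_zero_iff)
qed

lemma flat_exp_0_bounds: "0 \<le> flat_exp 0 t" "flat_exp 0 t \<le> 1"
  by (auto simp: flat_exp_def)

lemma box_bump_bounds: "0 \<le> box_bump n a b x" "box_bump n a b x \<le> 1"
  unfolding box_bump_def
  by (intro prod_nonneg prod_le_1 ballI conjI mult_nonneg_nonneg mult_le_one flat_exp_0_bounds)+

lemma box_bump_test:
  assumes "cbox a b \<subseteq> \<Omega>"
  shows "box_bump n a b \<in> test_functions \<Omega>"
proof -
  have sub: "closure {x. box_bump n a b x \<noteq> 0} \<subseteq> cbox a b"
    by (rule closure_minimal) (use box_bump_outside[of _ a b n] box_subset_cbox[of a b] in auto)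
  then have "compact (closure {x. box_bump n a b x \<noteq> 0})"
    by (rule compact_if_closed_subset_compact[OF compact_cbox closed_closure])
  moreover have "smooth (box_bump n a b)"
    unfolding box_bump_def[abs_def] by (intro smooth_prod smooth_mult) (auto simp: smooth_def C_k_flat_exp)
  ultimately show ?thesis
    using assms sub unfolding test_functions_def smooth_def by auto
qed

lemma flat_exp_0_tendsto: "s > 0 \<Longrightarrow> (\<lambda>n. flat_exp 0 (real (Suc n) * s)) \<longlonglongrightarrow> 1"
proof -
  assume s: "s > 0"
  have "(\<lambda>n. inverse (real (Suc n)) * inverse s) \<longlonglongrightarrow> 0"
    using LIMSEQ_inverse_real_of_nat tendsto_mult_left_zero by blast
  then have "(\<lambda>n. exp (- (inverse (real (Suc n)) * inverse s))) \<longlonglongrightarrow> exp (- 0)"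
    by (intro tendsto_intros)
  moreover have "flat_exp 0 (real (Suc n) * s) = exp (- (inverse (real (Suc n)) * inverse s))" for n
    using s by (simp add: flat_exp_def zero_less_mult_iff del: of_nat_Suc)
  ultimately show ?thesis by simp
qed

lemma box_bump_tendsto:
  fixes a b x :: "real ^ 'n"
  shows "(\<lambda>n. box_bump n a b x) \<longlonglongrightarrow> indicator (box a b) x"
proof (cases "x \<in> box a b")
  case True
  have "(\<lambda>n. box_bump n a b x) \<longlonglongrightarrow> (\<Prod>i\<in>(UNIV::'n set). 1 * 1)"
    unfolding box_bump_def
  proof (intro tendsto_prod tendsto_mult)
    fix i
    have "real (Suc n) * x $ i + - real (Suc n) * a $ i = real (Suc n) * (x $ i - a $ i)"
      "- real (Suc n) * x $ i + real (Suc n) * b $ i = real (Suc n) * (b $ i - x $ i)" for n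
      by (auto simp: algebra_simps)
    then show "(\<lambda>n. flat_exp 0 (real (Suc n) * x $ i + - real (Suc n) * a $ i)) \<longlonglongrightarrow> 1"
      "(\<lambda>n. flat_exp 0 (- real (Suc n) * x $ i + real (Suc n) * b $ i)) \<longlonglongrightarrow> 1"
      using flat_exp_0_tendsto[of "x $ i - a $ i"] flat_exp_0_tendsto[of "b $ i - x $ i"] True
      unfolding mem_box_vec by auto
  qed
  then show ?thesis using True by simp
next
  case False
  then show ?thesis by (simp add: box_bump_outside)
qed

section \<open>Integrals of partial derivatives\<close>

lemma lborel_integral_translation:
  fixes f :: "'a::euclidean_space \<Rightarrow> real"
  assumes "f \<in> borel_measurable borel"
  shows "(LINT x|lborel. f (c + x)) = (LINT x|lborel. f x)"
proof -
  have "(LINT x|lborel. f x) = (LINT x|distr lborel borel ((+) c). f x)" by (simp add: lborel_distr_plus)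
  also have "\<dots> = (LINT x|lborel. f (c + x))"
    using assms by (subst integral_distr) auto
  finally show ?thesis by simp
qed

lemma continuous_zero_outside_bounded:
  fixes f :: "'a::euclidean_space \<Rightarrow> real"
  assumes "continuous_on UNIV f" "\<And>x. x \<notin> cball 0 R \<Longrightarrow> f x = 0"
  obtains M where "\<And>x. \<bar>f x\<bar> \<le> M" "M \<ge> 0"
proof -
  have "compact (f ` cball 0 R)"
    using assms by (intro compact_continuous_image) (auto intro: continuous_on_subset)
  then obtain M where "\<forall>y\<in>f ` cball 0 R. norm y \<le> M"
    using compact_imp_bounded[of "f ` cball 0 R"] unfolding bounded_iff by blast
  then have M: "\<And>x. x \<in> cball 0 R \<Longrightarrow> \<bar>f x\<bar> \<le> M" by simp
  have "\<bar>f x\<bar> \<le> max M 0" for x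
    using M[of x] assms(2)[of x] by (cases "x \<in> cball 0 R") auto
  then show ?thesis using that[of "max M 0"] by simp
qed

lemma integrable_continuous_zero_outside:
  fixes f :: "'a::euclidean_space \<Rightarrow> real"
  assumes "continuous_on UNIV f" "\<And>x. x \<notin> cball 0 R \<Longrightarrow> f x = 0"
  shows "integrable lborel f"
proof -
  obtain M where M: "\<And>x. \<bar>f x\<bar> \<le> M" "M \<ge> 0"
    using continuous_zero_outside_bounded[OF assms] by blast
  show ?thesis
  proof (rule Bochner_Integration.integrable_bound)
    show "integrable lborel (\<lambda>x. M * indicator (cball 0 R) x)"
      by (intro integrable_mult_right integrable_real_indicator)
        (use emeasure_bounded_finite[OF bounded_cball] in auto)
    show "f \<in> borel_measurable lborel"
      using assms(1) borel_measurable_continuous_onI by auto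
    show "AE x in lborel. norm (f x) \<le> norm (M * indicator (cball 0 R) x)"
      using M assms(2) by (intro AE_I2) (auto simp: indicator_def)
  qed
qed

text \<open>The difference quotients of \<open>\<psi>\<close> integrate to zero because Lebesgue measure is translation invariant.\<close>

lemma integral_partial_zero:
  fixes \<psi> :: "real ^ 'n \<Rightarrow> real"
  assumes diff: "\<And>x. \<psi> differentiable (at x)" and cont: "continuous_on UNIV (partial i \<psi>)"
    and zero: "\<And>x. x \<notin> cball 0 R \<Longrightarrow> \<psi> x = 0"
  shows "integrable lborel (partial i \<psi>)" "(LINT x|lborel. partial i \<psi> x) = 0"
proof -
  have pzero: "partial i \<psi> x = 0" if "x \<notin> cball 0 R" for x
    using partial_zero_outside_closed[OF closed_cball zero that] .
  show "integrable lborel (partial i \<psi>)"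
    using integrable_continuous_zero_outside[OF cont pzero] .
  have c\<psi>: "continuous_on UNIV \<psi>"
    using diff by (auto intro!: continuous_at_imp_continuous_on differentiable_imp_continuous_within)
  then have int\<psi>: "integrable lborel \<psi>" using zero by (rule integrable_continuous_zero_outside)
  have [measurable]: "\<psi> \<in> borel_measurable borel" "partial i \<psi> \<in> borel_measurable borel"
    using c\<psi> cont borel_measurable_continuous_onI by auto
  obtain M where M: "\<And>x. \<bar>partial i \<psi> x\<bar> \<le> M" "M \<ge> 0"
    using continuous_zero_outside_bounded[OF cont pzero] by blast
  define e :: "real ^ 'n" where "e = axis i 1"
  have ne: "norm e = 1" by (simp add: e_def)
  define t where "t n = inverse (real (Suc n))" for n
  have t: "0 < t n" "t n \<le> 1" for n by (auto simp: t_def field_simps)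
  define D where "D n x = (\<psi> (t n *\<^sub>R e + x) - \<psi> x) / t n" for n x
  have line: "((\<lambda>s. \<psi> (s *\<^sub>R e + x)) has_real_derivative partial i \<psi> (s *\<^sub>R e + x)) (at s)" for s x
  proof -
    obtain \<psi>' where \<psi>': "(\<psi> has_derivative \<psi>') (at (s *\<^sub>R e + x))"
      using diff unfolding differentiable_def by blast
    have "((\<lambda>s. s *\<^sub>R e + x) has_derivative (\<lambda>h. h *\<^sub>R e)) (at s)"
      by (auto intro!: derivative_eq_intros)
    from has_derivative_compose[OF this \<psi>']
    have "((\<lambda>s. \<psi> (s *\<^sub>R e + x)) has_derivative (\<lambda>h. \<psi>' (h *\<^sub>R e))) (at s)" .
    moreover have "\<psi>' (h *\<^sub>R e) = partial i \<psi> (s *\<^sub>R e + x) * h" for h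
      using partial_has_derivative[OF \<psi>', of i] has_derivative_bounded_linear[OF \<psi>']
      by (simp add: e_def linear_simps(5) mult.commute)
    ultimately show ?thesis by (simp add: has_field_derivative_def)
  qed
  have "(\<lambda>n. LINT x|lborel. D n x) \<longlonglongrightarrow> (LINT x|lborel. partial i \<psi> x)"
  proof (rule integral_dominated_convergence)
    \<comment> \<open>The increments \<open>t n\<close> are at most 1 and \<open>e\<close> is a unit
      vector, so all quotients vanish outside the ball enlarged by 1; inside it the mean value
      theorem bounds them by \<open>M\<close>.\<close>
    show "integrable lborel (\<lambda>x. M * indicator (cball 0 (R + 1)) x)"
      by (intro integrable_mult_right integrable_real_indicator)
        (use emeasure_bounded_finite[OF bounded_cball] in auto)
    show "AE x in lborel. norm (D n x) \<le> M * indicator (cball 0 (R + 1)) x" for n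
    proof (intro AE_I2)
      fix x
      show "norm (D n x) \<le> M * indicator (cball 0 (R + 1)) x"
      proof (cases "x \<in> cball 0 (R + 1)")
        case True
        obtain z where "\<psi> (t n *\<^sub>R e + x) - \<psi> (0 *\<^sub>R e + x) = (t n - 0) * partial i \<psi> (z *\<^sub>R e + x)"
          using MVT2[OF t(1)[of n], of "\<lambda>s. \<psi> (s *\<^sub>R e + x)" "\<lambda>s. partial i \<psi> (s *\<^sub>R e + x)"] line by blast
        then have "D n x = partial i \<psi> (z *\<^sub>R e + x)"
          using t(1)[of n] by (simp add: D_def)
        then show ?thesis using M True by simp
      next
        case False
        then have nx: "norm x > R + 1" by simp
        have "norm x \<le> norm (t n *\<^sub>R e + x) + norm (t n *\<^sub>R e)"
          using norm_triangle_ineq4[of "t n *\<^sub>R e + x" "t n *\<^sub>R e"] by simp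
        then have "norm (t n *\<^sub>R e + x) > R" using nx ne t[of n] by simp
        then show ?thesis using False nx zero[of x] zero[of "t n *\<^sub>R e + x"] by (simp add: D_def)
      qed
    qed
    show "AE x in lborel. (\<lambda>n. D n x) \<longlonglongrightarrow> partial i \<psi> x"
    proof (intro AE_I2)
      fix x
      have "((\<lambda>h. (\<psi> (h *\<^sub>R e + x) - \<psi> x) / h) \<longlongrightarrow> partial i \<psi> x) (at 0)"
        using line[of x 0] unfolding DERIV_def by simp
      moreover have "filterlim t (at 0) sequentially"
        unfolding filterlim_at t_def using LIMSEQ_inverse_real_of_nat by auto
      ultimately have "((\<lambda>n. (\<psi> (t n *\<^sub>R e + x) - \<psi> x) / t n) \<longlongrightarrow> partial i \<psi> x) sequentially"
        by (rule filterlim_compose)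
      then show "(\<lambda>n. D n x) \<longlonglongrightarrow> partial i \<psi> x" by (simp add: D_def)
    qed
  qed (auto simp: D_def[abs_def])
  moreover have "(LINT x|lborel. D n x) = 0" for n
  proof -
    have "integrable lborel (\<lambda>x. \<psi> (t n *\<^sub>R e + x))"
    proof -
      have "integrable (distr lborel borel ((+) (t n *\<^sub>R e))) \<psi>" using int\<psi> by (simp add: lborel_distr_plus)
      then show ?thesis by (subst (asm) integrable_distr_eq) auto
    qed
    then show ?thesis unfolding D_def
      using int\<psi> lborel_integral_translation[of \<psi> "t n *\<^sub>R e"] by simp
  qed
  ultimately have "(\<lambda>n. 0) \<longlonglongrightarrow> (LINT x|lborel. partial i \<psi> x)" by simp
  then show "(LINT x|lborel. partial i \<psi> x) = 0" by (simp add: LIMSEQ_const_iff)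
qed

section \<open>The fundamental lemma of the calculus of variations\<close>

text \<open>A Dynkin argument: open boxes are stable under intersection and generate the Borel sets,
  so the integral of \<open>g\<close> vanishes over every Borel set, which determines
  \<open>g\<close> almost everywhere.\<close>

lemma AE_zero_if_box_integrals_zero:
  fixes g :: "'a::euclidean_space \<Rightarrow> real"
  assumes g: "integrable lborel g"
    and box: "\<And>a b. (LINT x:box a b|lborel. g x) = 0"
  shows "AE x in lborel. g x = 0"
proof (rule density_unique_real[OF g])
  let ?E = "range (\<lambda>(a, b). box a b::'a set)"
  have si: "set_integrable lborel X g" if "X \<in> sets borel" for X
    using integrable_mult_indicator[OF _ g, of X] that by (simp add: set_integrable_def)
  \<comment> \<open>The complement step of the induction subtracts from the integral over the whole
    space, which is not a box but an increasing union of boxes.\<close>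
  have full: "(LINT x|lborel. g x) = 0"
  proof -
    let ?A = "\<lambda>n::nat. box (- (real n *\<^sub>R One)) (real n *\<^sub>R One) :: 'a set"
    have U: "(\<Union>i. ?A i) = UNIV" unfolding UN_box_eq_UNIV by auto
    have "(\<lambda>i. LINT x:?A i|lborel. g x) \<longlonglongrightarrow> (LINT x:(\<Union>i. ?A i)|lborel. g x)"
    proof (rule set_integral_cont_up)
      show "incseq ?A"
        by (intro monoI subset_box_imp) auto
    qed (use si in auto)
    then have "(LINT x:UNIV|lborel. g x) = 0" using box U by (simp add: LIMSEQ_const_iff)
    then show ?thesis by (simp add: set_lebesgue_integral_def)
  qed
  fix X :: "'a set" assume "X \<in> sets lborel"
  then have X: "X \<in> sigma_sets UNIV ?E" by (simp add: borel_eq_box)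
  have "Int_stable ?E" "?E \<subseteq> Pow UNIV" by (auto simp: Int_stable_def box_Int_box)
  from this X have "(LINT x:X|lborel. g x) = 0"
  proof (induction rule: sigma_sets_induct_disjoint)
    case (basic X) then show ?case using box by auto
  next
    case empty then show ?case by (simp add: set_lebesgue_integral_def)
  next
    case (compl X)
    have X: "X \<in> sets borel" using compl(1) by (simp add: borel_eq_box)
    have "(LINT x|lborel. g x) = (LINT x:X|lborel. g x) + (LINT x:UNIV - X|lborel. g x)"
      using set_integral_Un[of X "UNIV - X" lborel g] si X by (simp add: set_lebesgue_integral_def)
    then show ?case using compl(2) full by simp
  next
    case (union X)
    have X: "X i \<in> sets borel" for i using union(2) by (auto simp: borel_eq_box)
    have "(LINT x:(\<Union>i. X i)|lborel. g x) = (\<Sum>i. (LINT x:(X i)|lborel. g x))"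
      using X union(1) by (intro lebesgue_integral_countable_add si) (auto simp: disjoint_family_on_def)
    then show ?case using union(3) by simp
  qed
  then show "(LINT x:X|lborel. g x) = (LINT x:X|lborel. 0)"
    by (simp add: set_lebesgue_integral_def)
qed auto

section \<open>Lebesgue integrals on subsets\<close>

lemma open_in_lebesgue: "open S \<Longrightarrow> S \<in> sets lebesgue" for S :: "'a::euclidean_space set"
  using borel_open[of S] sets_completionI_sets[of S lborel] by simp

lemma closed_in_lebesgue: "closed S \<Longrightarrow> S \<in> sets lebesgue" for S :: "'a::euclidean_space set"
  using borel_closed[of S] sets_completionI_sets[of S lborel] by simp

lemma compact_in_lebesgue: "compact S \<Longrightarrow> S \<in> sets lebesgue" for S :: "'a::euclidean_space set"
  by (simp add: closed_in_lebesgue compact_imp_closed)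

lemma AE_lebesgue_on_iff:
  fixes S :: "'a::euclidean_space set"
  shows "S \<in> sets lebesgue \<Longrightarrow> (AE x in lebesgue_on S. P x) \<longleftrightarrow> (AE x in lebesgue. x \<in> S \<longrightarrow> P x)"
  by (simp add: AE_restrict_space_iff)

lemma AE_lebesgue_on_subset:
  fixes S :: "'a::euclidean_space set"
  assumes "AE x in lebesgue_on T. P x" "S \<subseteq> T" "S \<in> sets lebesgue" "T \<in> sets lebesgue"
  shows "AE x in lebesgue_on S. P x"
  using assms(1) unfolding AE_lebesgue_on_iff[OF assms(3)] AE_lebesgue_on_iff[OF assms(4)]
  by eventually_elim (use assms(2) in auto)

text \<open>Lebesgue measure is complete, so a change on a null set preserves measurability.\<close>

lemma measurable_cong_AE_on:
  fixes f g :: "'a::euclidean_space \<Rightarrow> real"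
  assumes S: "S \<in> sets lebesgue" and ae: "AE x in lebesgue_on S. f x = g x"
    and f: "f \<in> borel_measurable (lebesgue_on S)"
  shows "g \<in> borel_measurable (lebesgue_on S)"
proof -
  have "(\<lambda>x. if x \<in> S then f x else 0) \<in> borel_measurable lebesgue"
    using f S by (simp add: borel_measurable_if)
  moreover have "AE x in lebesgue. (if x \<in> S then f x else 0) = (if x \<in> S then g x else 0)"
    using ae unfolding AE_lebesgue_on_iff[OF S] by eventually_elim auto
  ultimately have "(\<lambda>x. if x \<in> S then g x else 0) \<in> borel_measurable lebesgue"
    by (rule borel_measurable_AE)
  then show ?thesis using S by (simp add: borel_measurable_if)
qed

lemma integrable_cong_AE_on:
  fixes f g :: "'a::euclidean_space \<Rightarrow> real"
  assumes S: "S \<in> sets lebesgue" and ae: "AE x in lebesgue_on S. f x = g x"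
    and f: "integrable (lebesgue_on S) f"
  shows "integrable (lebesgue_on S) g"
  using integrable_cong_AE_imp[OF f measurable_cong_AE_on[OF S ae borel_measurable_integrable[OF f]]] ae
  by (simp add: eq_commute)

text \<open>Holds for arbitrary functions: by completeness both are measurable or neither is, and in
  the latter case both integrals take the default value 0. This form allows representatives chosen
  by \<open>SOME\<close> to be exchanged inside integrals.\<close>

lemma integral_cong_AE_on:
  fixes f g :: "'a::euclidean_space \<Rightarrow> real"
  assumes S: "S \<in> sets lebesgue" and ae: "AE x in lebesgue_on S. f x = g x"
  shows "integral\<^sup>L (lebesgue_on S) f = integral\<^sup>L (lebesgue_on S) g"
proof (cases "f \<in> borel_measurable (lebesgue_on S)")
  case True
  then show ?thesis
    using integral_cong_AE[OF True measurable_cong_AE_on[OF S ae True] ae] by simp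
next
  case False
  have ae': "AE x in lebesgue_on S. g x = f x" using ae by eventually_elim auto
  then have "g \<notin> borel_measurable (lebesgue_on S)"
    using False measurable_cong_AE_on[OF S ae'] by blast
  then show ?thesis
    using False by (metis borel_measurable_integrable not_integrable_integral_eq)
qed

text \<open>Both integrals are those of the same function extended by zero. This moves integrals
  between a domain, a subdomain and the support of a test function.\<close>

lemma lebesgue_on_zero_outside:
  fixes f :: "'a::euclidean_space \<Rightarrow> real"
  assumes "K \<in> sets lebesgue" "S \<in> sets lebesgue" "K \<subseteq> S" "\<And>x. x \<in> S \<Longrightarrow> x \<notin> K \<Longrightarrow> f x = 0"
  shows "integrable (lebesgue_on S) f \<longleftrightarrow> integrable (lebesgue_on K) f"
    and "integral\<^sup>L (lebesgue_on S) f = integral\<^sup>L (lebesgue_on K) f"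
proof -
  have eq: "(\<lambda>x. if x \<in> S then f x else 0) = (\<lambda>x. if x \<in> K then f x else 0)"
    by (rule ext) (use assms(3,4) in auto)
  show "integrable (lebesgue_on S) f \<longleftrightarrow> integrable (lebesgue_on K) f"
    using Lebesgue_Measure.integrable_restrict_UNIV[OF assms(1), of f] Lebesgue_Measure.integrable_restrict_UNIV[OF assms(2), of f]
    by (simp add: eq)
  show "integral\<^sup>L (lebesgue_on S) f = integral\<^sup>L (lebesgue_on K) f"
    using Lebesgue_Measure.integral_restrict_UNIV[OF assms(1), of f]
      Lebesgue_Measure.integral_restrict_UNIV[OF assms(2), of f]
    by (simp add: eq)
qed

lemma integrable_lebesgue_on_subset:
  fixes f :: "'a::euclidean_space \<Rightarrow> real"
  assumes f: "integrable (lebesgue_on T) f" and "S \<subseteq> T" "S \<in> sets lebesgue" "T \<in> sets lebesgue"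
  shows "integrable (lebesgue_on S) f"
proof -
  have "(\<lambda>x. if x \<in> T then f x else 0) \<in> borel_measurable lebesgue"
    using borel_measurable_integrable[OF f] assms by (simp add: borel_measurable_if)
  then have "f \<in> borel_measurable (lebesgue_on S)"
    using borel_measurable_integrable[OF f] assms(2) measurable_restrict_mono by blast
  then have m: "(\<lambda>x. if x \<in> S then f x else 0) \<in> borel_measurable lebesgue"
    using assms by (simp add: borel_measurable_if)
  have "integrable lebesgue (\<lambda>x. if x \<in> T then f x else 0)"
    using f Lebesgue_Measure.integrable_restrict_UNIV[OF assms(4), of f] by simp
  then have "integrable lebesgue (\<lambda>x. if x \<in> S then f x else 0)"
    by (rule Bochner_Integration.integrable_bound[OF _ m]) (use assms(2) in auto)
  then show ?thesis using Lebesgue_Measure.integrable_restrict_UNIV[OF assms(3), of f] by simp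
qed

lemma continuous_on_measurable_lebesgue_on:
  fixes f :: "'a::euclidean_space \<Rightarrow> real"
  shows "continuous_on S f \<Longrightarrow> S \<in> sets lebesgue \<Longrightarrow> f \<in> borel_measurable (lebesgue_on S)"
  by (rule continuous_imp_measurable_on_sets_lebesgue)

lemma continuous_on_compact_bound:
  fixes f :: "'a::euclidean_space \<Rightarrow> real"
  assumes "continuous_on K f" "compact K"
  obtains M where "M \<ge> 0" "\<And>x. x \<in> K \<Longrightarrow> \<bar>f x\<bar> \<le> M"
proof -
  have "compact (f ` K)" using assms compact_continuous_image by blast
  then obtain M where "\<forall>y\<in>f ` K. norm y \<le> M"
    using compact_imp_bounded[of "f ` K"] unfolding bounded_iff by blast
  then have "\<And>x. x \<in> K \<Longrightarrow> \<bar>f x\<bar> \<le> max M 0" by force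
  then show ?thesis using that[of "max M 0"] by simp
qed

lemma integrable_mult_continuous:
  fixes v \<phi> :: "'a::euclidean_space \<Rightarrow> real"
  assumes v: "integrable (lebesgue_on K) v" and \<phi>: "continuous_on K \<phi>" and K: "compact K"
  shows "integrable (lebesgue_on K) (\<lambda>x. v x * \<phi> x)"
proof -
  obtain M where M: "M \<ge> 0" "\<And>x. x \<in> K \<Longrightarrow> \<bar>\<phi> x\<bar> \<le> M"
    using continuous_on_compact_bound[OF \<phi> K] by blast
  have [measurable]: "\<phi> \<in> borel_measurable (lebesgue_on K)"
    using \<phi> K continuous_on_measurable_lebesgue_on compact_in_lebesgue by blast
  show ?thesis
  proof (rule Bochner_Integration.integrable_bound)
    show "integrable (lebesgue_on K) (\<lambda>x. M * v x)" using v by simp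
    show "AE x in lebesgue_on K. norm (v x * \<phi> x) \<le> norm (M * v x)"
      using M by (intro AE_I2) (auto simp: abs_mult mult.commute intro!: mult_right_mono)
  qed (use v in measurable)
qed

lemma integrable_continuous_compact:
  fixes \<phi> :: "'a::euclidean_space \<Rightarrow> real"
  assumes \<phi>: "continuous_on K \<phi>" and K: "compact K"
  shows "integrable (lebesgue_on K) \<phi>"
proof -
  have "K \<in> lmeasurable" using K by (simp add: lmeasurable_compact)
  then have "integrable (lebesgue_on K) (\<lambda>x. 1)"
    by (simp add: finite_measure.integrable_const finite_measure_lebesgue_on)
  from integrable_mult_continuous[OF this \<phi> K] show ?thesis by simp
qed

section \<open>Weak derivatives\<close>

lemma L1_loc_mult:
  fixes v \<phi> :: "real ^ 'n \<Rightarrow> real"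
  assumes v: "v \<in> L1_loc \<Omega>" and \<phi>: "continuous_on UNIV \<phi>" and \<Omega>: "open \<Omega>"
    and K: "compact K" "K \<subseteq> \<Omega>" "\<And>x. x \<notin> K \<Longrightarrow> \<phi> x = 0"
  shows "integrable (lebesgue_on \<Omega>) (\<lambda>x. v x * \<phi> x)"
proof (subst lebesgue_on_zero_outside(1)[of K])
  show "integrable (lebesgue_on K) (\<lambda>x. v x * \<phi> x)"
    using v K \<phi> unfolding L1_loc_def
    by (intro integrable_mult_continuous) (auto intro: continuous_on_subset)
qed (use K \<Omega> in \<open>auto simp: open_in_lebesgue compact_in_lebesgue\<close>)

lemma L1_loc_test:
  fixes v :: "real ^ 'n \<Rightarrow> real"
  assumes "v \<in> L1_loc \<Omega>" "\<phi> \<in> test_functions \<Omega>" "open \<Omega>"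
  shows "integrable (lebesgue_on \<Omega>) (\<lambda>x. v x * \<phi> x)"
    and "integrable (lebesgue_on \<Omega>) (\<lambda>x. v x * partial i \<phi> x)"
  by (rule L1_loc_mult[OF assms(1) _ assms(3) test_functionsD(2,3)[OF assms(2)]];
      use test_functionsD[OF assms(2)] in \<open>blast intro: smooth_continuous_on smooth_partial\<close>)+

lemma L1_loc_lincomb:
  "v \<in> L1_loc \<Omega> \<Longrightarrow> w \<in> L1_loc \<Omega> \<Longrightarrow> (\<lambda>x. \<alpha> * v x + \<beta> * w x) \<in> L1_loc \<Omega>"
  unfolding L1_loc_def by auto

lemma L1_loc_continuous_mult:
  assumes "v \<in> L1_loc \<Omega>" "continuous_on UNIV q"
  shows "(\<lambda>x. v x * q x) \<in> L1_loc \<Omega>"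
  using assms unfolding L1_loc_def
  by (auto intro!: integrable_mult_continuous intro: continuous_on_subset)

lemma L1_loc_subset: "v \<in> L1_loc \<Omega> \<Longrightarrow> G \<subseteq> \<Omega> \<Longrightarrow> v \<in> L1_loc G"
  unfolding L1_loc_def by auto

lemma L1_loc_AE:
  assumes "v \<in> L1_loc \<Omega>" "AE x in lebesgue_on \<Omega>. v x = w x" "\<Omega> \<in> sets lebesgue"
  shows "w \<in> L1_loc \<Omega>"
  unfolding L1_loc_def
proof (clarify)
  fix K assume "compact K" "K \<subseteq> \<Omega>"
  then show "integrable (lebesgue_on K) w"
    using integrable_cong_AE_on[OF _ AE_lebesgue_on_subset[OF assms(2)], of K] assms
    unfolding L1_loc_def by (simp add: compact_in_lebesgue)
qed

text \<open>Testing with box bumps and passing to the limit by dominated convergence shows that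
  \<open>g\<close> integrates to zero over each open box whose closed box lies in \<Omega>; the
  Dynkin argument then applies locally.\<close>

lemma fundamental_lemma:
  fixes g :: "real ^ 'n \<Rightarrow> real"
  assumes \<Omega>: "open \<Omega>" and g: "g \<in> L1_loc \<Omega>"
    and test: "\<And>\<phi>. \<phi> \<in> test_functions \<Omega> \<Longrightarrow> (LINT x|lebesgue_on \<Omega>. g x * \<phi> x) = 0"
  shows "AE x in lebesgue_on \<Omega>. g x = 0"
proof -
  have box0: "(LINT x|lebesgue_on (box c d). g x) = 0" if cd: "cbox c d \<subseteq> \<Omega>" for c d
  proof -
    have ig: "integrable (lebesgue_on (cbox c d)) g" using g cd unfolding L1_loc_def by auto
    have sm: "box_bump n c d \<in> borel_measurable (lebesgue_on (cbox c d))" for n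
      by (intro continuous_on_measurable_lebesgue_on smooth_continuous_on)
        (use test_functionsD(1)[OF box_bump_test[OF order_refl]] in auto)
    have "(\<lambda>n. LINT x|lebesgue_on (cbox c d). g x * box_bump n c d x)
       \<longlonglongrightarrow> (LINT x|lebesgue_on (cbox c d). g x * indicator (box c d) x)"
    proof (rule integral_dominated_convergence)
      show "integrable (lebesgue_on (cbox c d)) (\<lambda>x. norm (g x))" using ig by simp
      show "AE x in lebesgue_on (cbox c d). norm (g x * box_bump n c d x) \<le> norm (g x)" for n
        by (intro AE_I2) (auto simp: abs_mult box_bump_bounds intro: mult_left_le)
      show "AE x in lebesgue_on (cbox c d). (\<lambda>n. g x * box_bump n c d x) \<longlonglongrightarrow> g x * indicator (box c d) x"
        by (intro AE_I2 tendsto_mult tendsto_const box_bump_tendsto)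
      have "indicator (box c d) \<in> borel_measurable (lebesgue_on (cbox c d))"
        by (intro borel_measurable_indicator sets_restrict_space_iff[THEN iffD2])
          (auto simp: box_subset_cbox open_in_lebesgue)
      then show "(\<lambda>x. g x * indicator (box c d) x) \<in> borel_measurable (lebesgue_on (cbox c d))"
        using borel_measurable_times[OF borel_measurable_integrable[OF ig]] by blast
    qed (use sm ig in auto)
    moreover have "(LINT x|lebesgue_on (cbox c d). g x * box_bump n c d x) = 0" for n
    proof -
      have "(LINT x|lebesgue_on \<Omega>. g x * box_bump n c d x) = (LINT x|lebesgue_on (cbox c d). g x * box_bump n c d x)"
        by (rule lebesgue_on_zero_outside(2))
          (use cd \<Omega> box_bump_outside[of _ c d n] box_subset_cbox[of c d] in \<open>auto simp: open_in_lebesgue\<close>)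
      then show ?thesis using test[OF box_bump_test[OF cd]] by simp
    qed
    ultimately have "(LINT x|lebesgue_on (cbox c d). g x * indicator (box c d) x) = 0"
      by (simp add: LIMSEQ_const_iff)
    moreover have "(LINT x|lebesgue_on (cbox c d). g x * indicator (box c d) x) =
        (LINT x|lebesgue_on (box c d). g x * indicator (box c d) x)"
      by (rule lebesgue_on_zero_outside(2)) (auto simp: open_in_lebesgue box_subset_cbox)
    moreover have "\<dots> = (LINT x|lebesgue_on (box c d). g x)"
      by (intro Bochner_Integration.integral_cong) auto
    ultimately show ?thesis by simp
  qed
  \<comment> \<open>Only local integrability is available, so \<open>g\<close> is cut off to one
    box. Intersections of boxes are boxes whose closures stay inside \<open>cbox a b\<close>, hence
    \<open>box0\<close> still applies to them.\<close>
  have cb: "AE x in lebesgue. x \<in> cbox a b \<longrightarrow> g x = 0" if ab: "cbox a b \<subseteq> \<Omega>" for a b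
  proof -
    let ?g = "\<lambda>x. if x \<in> box a b then g x else 0"
    have "integrable (lebesgue_on (cbox a b)) g" using g ab unfolding L1_loc_def by auto
    then have "integrable (lebesgue_on (box a b)) g"
      by (rule integrable_lebesgue_on_subset) (auto simp: open_in_lebesgue box_subset_cbox)
    then have ig: "integrable lebesgue ?g"
      by (simp add: Lebesgue_Measure.integrable_restrict_UNIV open_in_lebesgue)
    \<comment> \<open>The Dynkin argument lives on \<open>lborel\<close>, so the Lebesgue measurable
      cut-off is exchanged for a Borel representative.\<close>
    then obtain h where h: "h \<in> borel_measurable lborel" "AE x in lborel. ?g x = h x"
      using completion_ex_borel_measurable_real[of ?g lborel] by auto
    have h': "AE x in lebesgue. ?g x = h x" using h(2) by (rule AE_completion)
    have "integrable lebesgue h"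
      by (rule integrable_cong_AE_imp[OF ig measurable_completion[OF h(1)] h'])
    then have ih: "integrable lborel h" using h(1) integrable_completion by blast
    have "AE x in lborel. h x = 0"
    proof (rule AE_zero_if_box_integrals_zero[OF ih])
      fix c d
      obtain c' d' where cd: "box a b \<inter> box c d = box c' d'" using box_Int_box by blast
      have ind: "(indicator (box c d) :: _ \<Rightarrow> real) \<in> borel_measurable lebesgue"
        by (intro borel_measurable_indicator open_in_lebesgue open_box)
      have "(LINT x:box c d|lborel. h x) = (LINT x|lebesgue. indicator (box c d) x * h x)"
        using h(1) by (subst integral_completion) (auto simp: set_lebesgue_integral_def)
      also have "\<dots> = (LINT x|lebesgue. (if x \<in> box c' d' then g x else 0))"
      proof (rule integral_cong_AE)
        show "(\<lambda>x. if x \<in> box c' d' then g x else 0) \<in> borel_measurable lebesgue"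
        proof -
          have "(\<lambda>x. if x \<in> box c' d' then g x else 0) = (\<lambda>x. indicator (box c d) x * ?g x)"
            using cd by (auto simp: fun_eq_iff indicator_def)
          then show ?thesis
            by (rule ssubst) (rule borel_measurable_times[OF ind borel_measurable_integrable[OF ig]])
        qed
        show "AE x in lebesgue. indicator (box c d) x * h x = (if x \<in> box c' d' then g x else 0)"
          using h'
        proof eventually_elim
          case (elim x)
          have "x \<in> box c' d' \<longleftrightarrow> x \<in> box a b \<and> x \<in> box c d" using cd by blast
          then show ?case using elim by (simp add: indicator_def split: if_splits)
        qed
        show "(\<lambda>x. indicator (box c d) x * h x) \<in> borel_measurable lebesgue"
          by (rule borel_measurable_times[OF ind measurable_completion[OF h(1)]])
      qed
      also have "\<dots> = (LINT x|lebesgue_on (box c' d'). g x)"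
        by (rule Lebesgue_Measure.integral_restrict_UNIV) (simp add: open_in_lebesgue)
      also have "\<dots> = 0"
      \<comment> \<open>Only for a nonempty open box is \<open>cbox c' d'\<close> its closure; an
        empty one may come with arbitrary corners.\<close>
      proof (cases "box c' d' = {}")
        case False
        then have "cbox c' d' = closure (box c' d')" by simp
        also have "\<dots> \<subseteq> closure (box a b)" using cd by (intro closure_mono) auto
        also have "\<dots> \<subseteq> cbox a b" by (intro closure_minimal box_subset_cbox closed_cbox)
        finally show ?thesis using box0 ab by blast
      qed simp
      finally show "(LINT x:box c d|lborel. h x) = 0" .
    qed
    then have "AE x in lebesgue. h x = 0" by (rule AE_completion)
    moreover have "AE x in lebesgue. x \<notin> cbox a b - box a b"
    proof -
      have "cbox a b - box a b \<in> null_sets lebesgue"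
        using negligible_frontier_interval[of a b] by (simp add: negligible_iff_null_sets)
      then show ?thesis by (rule AE_not_in)
    qed
    ultimately show ?thesis using h' by eventually_elim (auto split: if_splits)
  qed
  obtain D where D: "countable D" "D \<subseteq> Pow \<Omega>" "\<And>X. X \<in> D \<Longrightarrow> \<exists>a b. X = cbox a b" "\<Union>D = \<Omega>"
    using open_countable_Union_open_cbox[OF \<Omega>] by metis
  have "\<forall>X\<in>D. AE x in lebesgue. x \<in> X \<longrightarrow> g x = 0"
    using cb D(2,3) by (metis PowD subsetD)
  then have "AE x in lebesgue. \<forall>X\<in>D. x \<in> X \<longrightarrow> g x = 0"
    by (intro AE_ball_countable' D(1)) blast
  then have "AE x in lebesgue. x \<in> \<Omega> \<longrightarrow> g x = 0"
    by eventually_elim (use D(4) in blast)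
  then show ?thesis using \<Omega> by (simp add: AE_lebesgue_on_iff open_in_lebesgue)
qed

lemma has_weak_partial_lincomb:
  fixes v w :: "real ^ 'n \<Rightarrow> real"
  assumes "has_weak_partial \<Omega> i v g" "has_weak_partial \<Omega> i w h" "open \<Omega>"
  shows "has_weak_partial \<Omega> i (\<lambda>x. \<alpha> * v x + \<beta> * w x) (\<lambda>x. \<alpha> * g x + \<beta> * h x)"
  unfolding has_weak_partial_def
proof (intro conjI ballI)
  have m: "v \<in> L1_loc \<Omega>" "w \<in> L1_loc \<Omega>" "g \<in> L1_loc \<Omega>" "h \<in> L1_loc \<Omega>"
    using assms unfolding has_weak_partial_def by auto
  show "(\<lambda>x. \<alpha> * v x + \<beta> * w x) \<in> L1_loc \<Omega>" "(\<lambda>x. \<alpha> * g x + \<beta> * h x) \<in> L1_loc \<Omega>"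
    using m by (auto intro: L1_loc_lincomb)
  fix \<phi> assume \<phi>: "\<phi> \<in> test_functions \<Omega>"
  note i = m[THEN L1_loc_test(1)[OF _ \<phi> assms(3)]] m[THEN L1_loc_test(2)[OF _ \<phi> assms(3), of _ i]]
  have "(LINT x|lebesgue_on \<Omega>. (\<alpha> * v x + \<beta> * w x) * partial i \<phi> x) =
      \<alpha> * (LINT x|lebesgue_on \<Omega>. v x * partial i \<phi> x) + \<beta> * (LINT x|lebesgue_on \<Omega>. w x * partial i \<phi> x)"
    using i by (simp add: distrib_right mult.assoc)
  moreover have "(LINT x|lebesgue_on \<Omega>. (\<alpha> * g x + \<beta> * h x) * \<phi> x) =
      \<alpha> * (LINT x|lebesgue_on \<Omega>. g x * \<phi> x) + \<beta> * (LINT x|lebesgue_on \<Omega>. h x * \<phi> x)"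
    using i by (simp add: distrib_right mult.assoc)
  ultimately show "(LINT x|lebesgue_on \<Omega>. (\<alpha> * v x + \<beta> * w x) * partial i \<phi> x) =
      - (LINT x|lebesgue_on \<Omega>. (\<alpha> * g x + \<beta> * h x) * \<phi> x)"
    using assms \<phi> unfolding has_weak_partial_def by (simp add: algebra_simps)
qed

lemma has_weak_partial_AE:
  fixes v w :: "real ^ 'n \<Rightarrow> real"
  assumes "has_weak_partial \<Omega> i v g" "AE x in lebesgue_on \<Omega>. v x = w x"
    "AE x in lebesgue_on \<Omega>. g x = h x" "open \<Omega>"
  shows "has_weak_partial \<Omega> i w h"
  unfolding has_weak_partial_def
proof (intro conjI ballI)
  note o = open_in_lebesgue[OF assms(4)]
  show "w \<in> L1_loc \<Omega>" "h \<in> L1_loc \<Omega>"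
    using assms o L1_loc_AE unfolding has_weak_partial_def by blast+
  fix \<phi> assume \<phi>: "\<phi> \<in> test_functions \<Omega>"
  have "(LINT x|lebesgue_on \<Omega>. v x * partial i \<phi> x) = (LINT x|lebesgue_on \<Omega>. w x * partial i \<phi> x)"
    by (rule integral_cong_AE_on[OF o]) (use assms(2) in eventually_elim, simp)
  moreover have "(LINT x|lebesgue_on \<Omega>. g x * \<phi> x) = (LINT x|lebesgue_on \<Omega>. h x * \<phi> x)"
    by (rule integral_cong_AE_on[OF o]) (use assms(3) in eventually_elim, simp)
  ultimately show "(LINT x|lebesgue_on \<Omega>. w x * partial i \<phi> x) = - (LINT x|lebesgue_on \<Omega>. h x * \<phi> x)"
    using assms(1) \<phi> unfolding has_weak_partial_def by simp
qed

text \<open>The difference of the two derivatives is orthogonal to all test functions. The functions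
  \<open>v\<close> and \<open>w\<close> need only agree almost everywhere, which suits discrete
  functions and their polynomials.\<close>

lemma has_weak_partial_unique:
  fixes v w :: "real ^ 'n \<Rightarrow> real"
  assumes v: "has_weak_partial \<Omega> i v g" and w: "has_weak_partial \<Omega> i w h"
    and ae: "AE x in lebesgue_on \<Omega>. v x = w x" and \<Omega>: "open \<Omega>"
  shows "AE x in lebesgue_on \<Omega>. g x = h x"
proof -
  have d: "has_weak_partial \<Omega> i (\<lambda>x. 1 * v x + (-1) * w x) (\<lambda>x. 1 * g x + (-1) * h x)"
    by (rule has_weak_partial_lincomb[OF v w \<Omega>])
  have "AE x in lebesgue_on \<Omega>. 1 * g x + (-1) * h x = 0"
  proof (rule fundamental_lemma[OF \<Omega>])
    show "(\<lambda>x. 1 * g x + (-1) * h x) \<in> L1_loc \<Omega>" using d unfolding has_weak_partial_def by blast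
    fix \<phi> assume \<phi>: "\<phi> \<in> test_functions \<Omega>"
    have "(LINT x|lebesgue_on \<Omega>. (1 * v x + (-1) * w x) * partial i \<phi> x) = (LINT x|lebesgue_on \<Omega>. 0)"
      by (rule integral_cong_AE_on[OF open_in_lebesgue[OF \<Omega>]]) (use ae in eventually_elim, simp)
    then show "(LINT x|lebesgue_on \<Omega>. (1 * g x + (-1) * h x) * \<phi> x) = 0"
      using d \<phi> unfolding has_weak_partial_def by simp
  qed
  then show ?thesis by eventually_elim auto
qed

lemma has_weak_partial_subset:
  fixes v :: "real ^ 'n \<Rightarrow> real"
  assumes v: "has_weak_partial \<Omega> i v g" and "G \<subseteq> \<Omega>" "open \<Omega>" "open G"
  shows "has_weak_partial G i v g"
  unfolding has_weak_partial_def
proof (intro conjI ballI)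
  show "v \<in> L1_loc G" "g \<in> L1_loc G"
    using v assms(2) L1_loc_subset unfolding has_weak_partial_def by blast+
  fix \<phi> assume \<phi>: "\<phi> \<in> test_functions G"
  then have \<phi>': "\<phi> \<in> test_functions \<Omega>" using test_functions_mono assms(2) by blast
  have z: "x \<notin> G \<Longrightarrow> \<phi> x = 0" "x \<notin> G \<Longrightarrow> partial i \<phi> x = 0" for x
    using test_functionsD(3,4,5)[OF \<phi>] by blast+
  have "(LINT x|lebesgue_on \<Omega>. v x * partial i \<phi> x) = (LINT x|lebesgue_on G. v x * partial i \<phi> x)"
    "(LINT x|lebesgue_on \<Omega>. g x * \<phi> x) = (LINT x|lebesgue_on G. g x * \<phi> x)"
    by (rule lebesgue_on_zero_outside(2); use assms z in \<open>auto simp: open_in_lebesgue\<close>)+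
  then show "(LINT x|lebesgue_on G. v x * partial i \<phi> x) = - (LINT x|lebesgue_on G. g x * \<phi> x)"
    using v \<phi>' unfolding has_weak_partial_def by simp
qed

text \<open>This is the vanishing integral of a partial derivative of a test function. It is the one
  integration by parts from which the product rule below produces the weak derivatives of all smooth
  functions.\<close>

lemma has_weak_partial_const:
  fixes \<Omega> :: "(real ^ 'n) set"
  assumes "open \<Omega>"
  shows "has_weak_partial \<Omega> i (\<lambda>x. 1) (\<lambda>x. 0)"
  unfolding has_weak_partial_def
proof (intro conjI ballI)
  show "(\<lambda>x. 1) \<in> L1_loc \<Omega>" "(\<lambda>x. 0) \<in> L1_loc \<Omega>"
    unfolding L1_loc_def by (auto intro: integrable_continuous_compact)
  fix \<phi> assume \<phi>: "\<phi> \<in> test_functions \<Omega>"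
  let ?K = "closure {x. \<phi> x \<noteq> 0}"
  note K = test_functionsD[OF \<phi>]
  obtain R where R: "?K \<subseteq> cball 0 R"
    using compact_imp_bounded[OF K(2)] by (auto simp: bounded_iff subset_iff)
  have c: "continuous_on UNIV (partial i \<phi>)" using K(1) smooth_partial smooth_continuous_on by blast
  have "(LINT x|lebesgue_on \<Omega>. partial i \<phi> x) = (LINT x|lebesgue_on UNIV. partial i \<phi> x)"
  proof (rule lebesgue_on_zero_outside(2)[symmetric])
    fix x :: "real ^ 'n" assume "x \<notin> \<Omega>"
    then show "partial i \<phi> x = 0" using K(3,5) by blast
  qed (use assms open_in_lebesgue in auto)
  also have "\<dots> = (LINT x|lborel. partial i \<phi> x)"
    using integral_completion[of "partial i \<phi>" lborel] borel_measurable_continuous_onI[OF c]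
    by (simp add: lebesgue_on_UNIV_eq)
  also have "\<dots> = 0"
  proof (rule integral_partial_zero(2)[where R = R])
    fix x :: "real ^ 'n" assume "x \<notin> cball 0 R"
    then show "\<phi> x = 0" using K(4) R by blast
  qed (use K(1) smooth_differentiable c in auto)
  finally show "(LINT x|lebesgue_on \<Omega>. 1 * partial i \<phi> x) = - (LINT x|lebesgue_on \<Omega>. 0 * \<phi> x)" by simp
qed

text \<open>The smooth factor is moved onto the test function: \<open>q * \<phi>\<close> is again a
  test function, and the classical product rule for it yields the extra term.\<close>

lemma has_weak_partial_mult_smooth:
  fixes v :: "real ^ 'n \<Rightarrow> real"
  assumes v: "has_weak_partial \<Omega> i v g" and q: "smooth q" and \<Omega>: "open \<Omega>"
  shows "has_weak_partial \<Omega> i (\<lambda>x. v x * q x) (\<lambda>x. g x * q x + v x * partial i q x)"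
  unfolding has_weak_partial_def
proof (intro conjI ballI)
  have m: "v \<in> L1_loc \<Omega>" "g \<in> L1_loc \<Omega>" using v unfolding has_weak_partial_def by auto
  have cq: "continuous_on UNIV q" "continuous_on UNIV (partial i q)"
    using q smooth_partial smooth_continuous_on by blast+
  show "(\<lambda>x. v x * q x) \<in> L1_loc \<Omega>" using L1_loc_continuous_mult[OF m(1) cq(1)] .
  show "(\<lambda>x. g x * q x + v x * partial i q x) \<in> L1_loc \<Omega>"
    using L1_loc_lincomb[OF L1_loc_continuous_mult[OF m(2) cq(1)] L1_loc_continuous_mult[OF m(1) cq(2)], of 1 1]
    by simp
  fix \<phi> assume \<phi>: "\<phi> \<in> test_functions \<Omega>"
  have \<phi>q: "(\<lambda>x. q x * \<phi> x) \<in> test_functions \<Omega>" "(\<lambda>x. partial i q x * \<phi> x) \<in> test_functions \<Omega>"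
    using test_functions_mult_smooth[OF \<phi>] q smooth_partial by blast+
  have pq: "partial i (\<lambda>x. q x * \<phi> x) x = q x * partial i \<phi> x + \<phi> x * partial i q x" for x
    using partial_mult smooth_differentiable q test_functionsD(1)[OF \<phi>] by blast
  note i = L1_loc_test(1)[OF m(2) \<phi>q(1) \<Omega>] L1_loc_test(1)[OF m(1) \<phi>q(2) \<Omega>]
    L1_loc_test(2)[OF m(1) \<phi>q(1) \<Omega>, of i]
  have "(LINT x|lebesgue_on \<Omega>. v x * q x * partial i \<phi> x) =
      (LINT x|lebesgue_on \<Omega>. v x * partial i (\<lambda>x. q x * \<phi> x) x - v x * (partial i q x * \<phi> x))"
    by (rule Bochner_Integration.integral_cong) (simp_all add: pq, simp add: algebra_simps)
  also have "\<dots> = (LINT x|lebesgue_on \<Omega>. v x * partial i (\<lambda>x. q x * \<phi> x) x) - (LINT x|lebesgue_on \<Omega>. v x * (partial i q x * \<phi> x))"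
    using i by simp
  also have "\<dots> = - (LINT x|lebesgue_on \<Omega>. g x * (q x * \<phi> x)) - (LINT x|lebesgue_on \<Omega>. v x * (partial i q x * \<phi> x))"
    using v \<phi>q(1) unfolding has_weak_partial_def by simp
  also have "\<dots> = - (LINT x|lebesgue_on \<Omega>. g x * (q x * \<phi> x) + v x * (partial i q x * \<phi> x))"
    using i by simp
  also have "\<dots> = - (LINT x|lebesgue_on \<Omega>. (g x * q x + v x * partial i q x) * \<phi> x)"
    by (simp add: algebra_simps)
  finally show "(LINT x|lebesgue_on \<Omega>. v x * q x * partial i \<phi> x) =
      - (LINT x|lebesgue_on \<Omega>. (g x * q x + v x * partial i q x) * \<phi> x)" .
qed

lemma has_weak_partial_smooth:
  fixes q :: "real ^ 'n \<Rightarrow> real"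
  assumes "smooth q" "open \<Omega>"
  shows "has_weak_partial \<Omega> i q (partial i q)"
  using has_weak_partial_mult_smooth[OF has_weak_partial_const[OF assms(2)] assms(1,2)] by simp

lemma has_weak_partial_sum:
  fixes v :: "'j \<Rightarrow> real ^ 'n \<Rightarrow> real"
  assumes "finite J" "\<And>j. j \<in> J \<Longrightarrow> has_weak_partial \<Omega> i (v j) (g j)" "open \<Omega>"
  shows "has_weak_partial \<Omega> i (\<lambda>x. \<Sum>j\<in>J. v j x) (\<lambda>x. \<Sum>j\<in>J. g j x)"
  using assms(1,2)
proof (induction J rule: finite_induct)
  case empty
  show ?case
    using has_weak_partial_lincomb[OF has_weak_partial_const has_weak_partial_const, of \<Omega> i 0 0] assms(3)
    by simp
next
  case (insert j J)
  have "has_weak_partial \<Omega> i (\<lambda>x. 1 * v j x + 1 * (\<Sum>j\<in>J. v j x)) (\<lambda>x. 1 * g j x + 1 * (\<Sum>j\<in>J. g j x))"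
    by (rule has_weak_partial_lincomb) (use insert assms(3) in auto)
  then show ?case using insert by simp
qed

lemma weak_partial_works: "has_weak_partial \<Omega> i v g \<Longrightarrow> has_weak_partial \<Omega> i v (weak_partial \<Omega> i v)"
  unfolding weak_partial_def by (rule someI[of "has_weak_partial \<Omega> i v"])

text \<open>The selected representative can be computed from any known weak derivative, even that of
  an almost everywhere equal function.\<close>

lemma weak_partial_AE:
  fixes v :: "real ^ 'n \<Rightarrow> real"
  assumes "has_weak_partial \<Omega> i w g" "AE x in lebesgue_on \<Omega>. v x = w x" "open \<Omega>"
  shows "AE x in lebesgue_on \<Omega>. weak_partial \<Omega> i v x = g x"
proof -
  have "AE x in lebesgue_on \<Omega>. w x = v x" using assms(2) by eventually_elim simp
  then have "has_weak_partial \<Omega> i v g" using has_weak_partial_AE[OF assms(1) _ _ assms(3)] by simp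
  then show ?thesis
    using has_weak_partial_unique[OF weak_partial_works] assms(3) by blast
qed

section \<open>Square integrable functions\<close>

lemma L2_space_mult_integrable:
  assumes "f \<in> L2_space S" "g \<in> L2_space S"
  shows "integrable (lebesgue_on S) (\<lambda>x. f x * g x)"
proof (rule Bochner_Integration.integrable_bound)
  show "integrable (lebesgue_on S) (\<lambda>x. (f x)\<^sup>2 + (g x)\<^sup>2)"
    using assms unfolding L2_space_def by auto
  have "\<bar>a * b\<bar> \<le> a\<^sup>2 + b\<^sup>2" for a b :: real
    using zero_le_power2[of "a + b"] zero_le_power2[of "a - b"] zero_le_power2[of a] zero_le_power2[of b]
    unfolding power2_sum power2_diff abs_le_iff by (simp add: algebra_simps)
  then show "AE x in lebesgue_on S. norm (f x * g x) \<le> norm ((f x)\<^sup>2 + (g x)\<^sup>2)"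
    by (intro AE_I2) simp
qed (use assms in \<open>auto simp: L2_space_def\<close>)

lemma L2_space_lincomb:
  assumes "f \<in> L2_space S" "g \<in> L2_space S"
  shows "(\<lambda>x. \<alpha> * f x + \<beta> * g x) \<in> L2_space S"
proof -
  have "integrable (lebesgue_on S) (\<lambda>x. \<alpha>\<^sup>2 * (f x)\<^sup>2 + (2 * \<alpha> * \<beta>) * (f x * g x) + \<beta>\<^sup>2 * (g x)\<^sup>2)"
    using assms L2_space_mult_integrable[OF assms] unfolding L2_space_def by auto
  moreover have "(\<lambda>x. \<alpha>\<^sup>2 * (f x)\<^sup>2 + (2 * \<alpha> * \<beta>) * (f x * g x) + \<beta>\<^sup>2 * (g x)\<^sup>2) = (\<lambda>x. (\<alpha> * f x + \<beta> * g x)\<^sup>2)"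
    by (auto simp: power2_eq_square algebra_simps)
  ultimately show ?thesis using assms unfolding L2_space_def by auto
qed

lemma L2_space_AE:
  fixes f g :: "real ^ 'n \<Rightarrow> real"
  assumes "f \<in> L2_space S" "AE x in lebesgue_on S. f x = g x" "S \<in> sets lebesgue"
  shows "g \<in> L2_space S"
proof -
  have "AE x in lebesgue_on S. (f x)\<^sup>2 = (g x)\<^sup>2" using assms(2) by eventually_elim simp
  then have "integrable (lebesgue_on S) (\<lambda>x. (g x)\<^sup>2)"
    by (rule integrable_cong_AE_on[OF assms(3)]) (use assms(1) in \<open>simp add: L2_space_def\<close>)
  moreover have "g \<in> borel_measurable (lebesgue_on S)"
    by (rule measurable_cong_AE_on[OF assms(3,2)]) (use assms(1) in \<open>simp add: L2_space_def\<close>)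
  ultimately show ?thesis by (simp add: L2_space_def)
qed

lemma Linf_L2_mult:
  assumes "a \<in> Linf_space S" "f \<in> L2_space S"
  shows "(\<lambda>x. a x * f x) \<in> L2_space S"
proof -
  obtain M where M: "AE x in lebesgue_on S. \<bar>a x\<bar> \<le> M" using assms unfolding Linf_space_def by auto
  have "integrable (lebesgue_on S) (\<lambda>x. (a x * f x)\<^sup>2)"
  proof (rule Bochner_Integration.integrable_bound)
    show "integrable (lebesgue_on S) (\<lambda>x. M\<^sup>2 * (f x)\<^sup>2)" using assms unfolding L2_space_def by auto
    show "AE x in lebesgue_on S. norm ((a x * f x)\<^sup>2) \<le> norm (M\<^sup>2 * (f x)\<^sup>2)"
      using M
    proof eventually_elim
      case (elim x)
      then have "(a x)\<^sup>2 \<le> M\<^sup>2" using power_mono[of "\<bar>a x\<bar>" M 2] by simp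
      then show ?case by (simp add: power_mult_distrib mult_right_mono)
    qed
  qed (use assms in \<open>auto simp: L2_space_def Linf_space_def\<close>)
  then show ?thesis using assms by (auto simp: L2_space_def Linf_space_def)
qed

lemma L2_space_subset:
  fixes f :: "real ^ 'n \<Rightarrow> real"
  assumes "f \<in> L2_space T" "S \<subseteq> T" "S \<in> sets lebesgue" "T \<in> sets lebesgue"
  shows "f \<in> L2_space S"
proof -
  have f: "f \<in> borel_measurable (lebesgue_on T)" "integrable (lebesgue_on T) (\<lambda>x. (f x)\<^sup>2)"
    using assms(1) by (simp_all add: L2_space_def)
  show ?thesis
    using measurable_restrict_mono[OF f(1) assms(2)] integrable_lebesgue_on_subset[OF f(2) assms(2-4)]
    by (simp add: L2_space_def)
qed

lemma L2_space_zero: "(\<lambda>x. 0) \<in> L2_space S"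
  unfolding L2_space_def by auto

lemma L2_norm_power2: "(L2_norm S g)\<^sup>2 = (LINT x|lebesgue_on S. (norm (g x))\<^sup>2)"
  unfolding L2_norm_def by (simp add: integral_nonneg)

section \<open>The spaces H1 and H10\<close>

lemma H1_spaceD:
  fixes v :: "real ^ 'n \<Rightarrow> real"
  assumes "v \<in> H1_space \<Omega>" "open \<Omega>"
  shows "v \<in> L2_space \<Omega>" "has_weak_partial \<Omega> i v (weak_partial \<Omega> i v)" "weak_partial \<Omega> i v \<in> L2_space \<Omega>"
proof -
  show "v \<in> L2_space \<Omega>" using assms unfolding H1_space_def by auto
  obtain g where g: "g \<in> L2_space \<Omega>" "has_weak_partial \<Omega> i v g"
    using assms unfolding H1_space_def by auto
  show "has_weak_partial \<Omega> i v (weak_partial \<Omega> i v)" using weak_partial_works[OF g(2)] .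
  from has_weak_partial_unique[OF g(2) this _ assms(2)] show "weak_partial \<Omega> i v \<in> L2_space \<Omega>"
    using L2_space_AE[OF g(1)] assms(2) open_in_lebesgue by auto
qed

text \<open>Gradients of the three functions are selected independently, so linearity of
  \<open>weak_grad\<close> is an almost everywhere statement.\<close>

lemma H1_lincomb:
  fixes v w :: "real ^ 'n \<Rightarrow> real"
  assumes "v \<in> H1_space \<Omega>" "w \<in> H1_space \<Omega>" "open \<Omega>"
  shows "(\<lambda>x. \<alpha> * v x + \<beta> * w x) \<in> H1_space \<Omega>"
    and "AE x in lebesgue_on \<Omega>. weak_grad \<Omega> (\<lambda>x. \<alpha> * v x + \<beta> * w x) x =
      \<alpha> *\<^sub>R weak_grad \<Omega> v x + \<beta> *\<^sub>R weak_grad \<Omega> w x"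
proof -
  note D = H1_spaceD[OF assms(1,3)] H1_spaceD[OF assms(2,3)]
  have h: "has_weak_partial \<Omega> i (\<lambda>x. \<alpha> * v x + \<beta> * w x)
      (\<lambda>x. \<alpha> * weak_partial \<Omega> i v x + \<beta> * weak_partial \<Omega> i w x)" for i
    by (rule has_weak_partial_lincomb[OF D(2) D(5) assms(3)])
  show "(\<lambda>x. \<alpha> * v x + \<beta> * w x) \<in> H1_space \<Omega>"
    unfolding H1_space_def using h D L2_space_lincomb by blast
  have "AE x in lebesgue_on \<Omega>. weak_partial \<Omega> i (\<lambda>x. \<alpha> * v x + \<beta> * w x) x =
      \<alpha> * weak_partial \<Omega> i v x + \<beta> * weak_partial \<Omega> i w x" for i
    using weak_partial_AE[OF h _ assms(3)] by simp
  then have "AE x in lebesgue_on \<Omega>. \<forall>i\<in>UNIV. weak_partial \<Omega> i (\<lambda>x. \<alpha> * v x + \<beta> * w x) x =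
      \<alpha> * weak_partial \<Omega> i v x + \<beta> * weak_partial \<Omega> i w x"
    by (intro AE_finite_allI) auto
  then show "AE x in lebesgue_on \<Omega>. weak_grad \<Omega> (\<lambda>x. \<alpha> * v x + \<beta> * w x) x =
      \<alpha> *\<^sub>R weak_grad \<Omega> v x + \<beta> *\<^sub>R weak_grad \<Omega> w x"
    by eventually_elim (auto simp: weak_grad_def vec_eq_iff)
qed

lemma H1_diff:
  fixes v w :: "real ^ 'n \<Rightarrow> real"
  assumes "v \<in> H1_space \<Omega>" "w \<in> H1_space \<Omega>" "open \<Omega>"
  shows "(\<lambda>x. v x - w x) \<in> H1_space \<Omega>"
  using H1_lincomb(1)[OF assms, of 1 "-1"] by simp

text \<open>The square of the gradient seminorm. Being a quadratic form it expands exactly under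
  linear combinations, see \<open>energy_lincomb\<close>, and obeys the parallelogram law.\<close>

definition energy :: "(real ^ 'n) set \<Rightarrow> (real ^ 'n \<Rightarrow> real) \<Rightarrow> real" where
  "energy \<Omega> v = (LINT x|lebesgue_on \<Omega>. (norm (weak_grad \<Omega> v x))\<^sup>2)"

definition l2sq :: "(real ^ 'n) set \<Rightarrow> (real ^ 'n \<Rightarrow> real) \<Rightarrow> real" where
  "l2sq \<Omega> v = (LINT x|lebesgue_on \<Omega>. (v x)\<^sup>2)"

lemma energy_eq: "(L2_norm \<Omega> (weak_grad \<Omega> v))\<^sup>2 = energy \<Omega> v"
  by (simp add: L2_norm_power2 energy_def)

lemma L2_norm_energy: "L2_norm \<Omega> (weak_grad \<Omega> v) = sqrt (energy \<Omega> v)"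
  by (simp add: L2_norm_def energy_def)

lemma energy_nonneg: "0 \<le> energy \<Omega> v" by (simp add: energy_def integral_nonneg)

lemma l2sq_nonneg: "0 \<le> l2sq \<Omega> v" by (simp add: l2sq_def integral_nonneg)

lemma H1_norm_power2: "(H1_norm \<Omega> v)\<^sup>2 = l2sq \<Omega> v + energy \<Omega> v"
  unfolding H1_norm_def using l2sq_nonneg[of \<Omega> v] energy_nonneg[of \<Omega> v]
  by (simp add: L2_norm_power2 energy_def l2sq_def)

lemma norm_vec_power2: "(norm (x :: real ^ 'n))\<^sup>2 = (\<Sum>i\<in>UNIV. (x $ i)\<^sup>2)"
  unfolding power2_norm_eq_inner inner_vec_def by (simp add: power2_eq_square)

lemma weak_grad_sq_integrable:
  fixes v :: "real ^ 'n \<Rightarrow> real"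
  assumes "v \<in> H1_space \<Omega>" "open \<Omega>"
  shows "integrable (lebesgue_on \<Omega>) (\<lambda>x. (norm (weak_grad \<Omega> v x))\<^sup>2)"
  using H1_spaceD(3)[OF assms] unfolding norm_vec_power2 weak_grad_def L2_space_def by auto

lemma weak_grad_inner_integrable:
  fixes v w :: "real ^ 'n \<Rightarrow> real"
  assumes "v \<in> H1_space \<Omega>" "w \<in> H1_space \<Omega>" "open \<Omega>"
  shows "integrable (lebesgue_on \<Omega>) (\<lambda>x. weak_grad \<Omega> v x \<bullet> weak_grad \<Omega> w x)"
  using L2_space_mult_integrable[OF H1_spaceD(3)[OF assms(1,3)] H1_spaceD(3)[OF assms(2,3)]]
  unfolding inner_vec_def weak_grad_def by auto

lemma energy_lincomb:
  fixes v w :: "real ^ 'n \<Rightarrow> real"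
  assumes "v \<in> H1_space \<Omega>" "w \<in> H1_space \<Omega>" "open \<Omega>"
  shows "energy \<Omega> (\<lambda>x. \<alpha> * v x + \<beta> * w x) = \<alpha>\<^sup>2 * energy \<Omega> v +
    2 * \<alpha> * \<beta> * (LINT x|lebesgue_on \<Omega>. weak_grad \<Omega> v x \<bullet> weak_grad \<Omega> w x) + \<beta>\<^sup>2 * energy \<Omega> w"
proof -
  note i = weak_grad_sq_integrable[OF assms(1,3)] weak_grad_sq_integrable[OF assms(2,3)]
    weak_grad_inner_integrable[OF assms]
  have "energy \<Omega> (\<lambda>x. \<alpha> * v x + \<beta> * w x) = (LINT x|lebesgue_on \<Omega>. \<alpha>\<^sup>2 * (norm (weak_grad \<Omega> v x))\<^sup>2 +
    2 * \<alpha> * \<beta> * (weak_grad \<Omega> v x \<bullet> weak_grad \<Omega> w x) + \<beta>\<^sup>2 * (norm (weak_grad \<Omega> w x))\<^sup>2)"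
    unfolding energy_def
  proof (rule integral_cong_AE_on[OF open_in_lebesgue[OF assms(3)]])
    show "AE x in lebesgue_on \<Omega>. (norm (weak_grad \<Omega> (\<lambda>x. \<alpha> * v x + \<beta> * w x) x))\<^sup>2 =
      \<alpha>\<^sup>2 * (norm (weak_grad \<Omega> v x))\<^sup>2 +
      2 * \<alpha> * \<beta> * (weak_grad \<Omega> v x \<bullet> weak_grad \<Omega> w x) + \<beta>\<^sup>2 * (norm (weak_grad \<Omega> w x))\<^sup>2"
      using H1_lincomb(2)[OF assms, of \<alpha> \<beta>]
    proof eventually_elim
      case (elim x)
      show ?case unfolding elim power2_norm_eq_inner
        by (simp add: inner_add_left inner_add_right inner_commute[of "weak_grad \<Omega> w x" "weak_grad \<Omega> v x"] power2_eq_square algebra_simps)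
    qed
  qed
  then show ?thesis using i unfolding energy_def by simp
qed

lemma energy_parallelogram:
  fixes v w :: "real ^ 'n \<Rightarrow> real"
  assumes "v \<in> H1_space \<Omega>" "w \<in> H1_space \<Omega>" "open \<Omega>"
  shows "4 * energy \<Omega> (\<lambda>x. 1/2 * v x + 1/2 * w x) + energy \<Omega> (\<lambda>x. v x - w x) =
    2 * energy \<Omega> v + 2 * energy \<Omega> w"
  using energy_lincomb[OF assms, of "1/2" "1/2"] energy_lincomb[OF assms, of 1 "-1"]
  by (simp add: power2_eq_square algebra_simps)

lemma energy_diff_le:
  fixes v w :: "real ^ 'n \<Rightarrow> real"
  assumes "v \<in> H1_space \<Omega>" "w \<in> H1_space \<Omega>" "open \<Omega>"
  shows "energy \<Omega> (\<lambda>x. v x - w x) \<le> 2 * energy \<Omega> v + 2 * energy \<Omega> w"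
  using energy_parallelogram[OF assms] energy_nonneg[of \<Omega> "\<lambda>x. 1/2 * v x + 1/2 * w x"] by simp

lemma energy_diff_commute:
  fixes v w :: "real ^ 'n \<Rightarrow> real"
  assumes "v \<in> H1_space \<Omega>" "w \<in> H1_space \<Omega>" "open \<Omega>"
  shows "energy \<Omega> (\<lambda>x. v x - w x) = energy \<Omega> (\<lambda>x. w x - v x)"
  using energy_lincomb[OF assms, of 1 "-1"] energy_lincomb[OF assms, of "-1" 1] by (simp add: algebra_simps)

lemma l2sq_diff_le:
  assumes "v \<in> L2_space \<Omega>" "w \<in> L2_space \<Omega>"
  shows "l2sq \<Omega> (\<lambda>x. v x - w x) \<le> 2 * l2sq \<Omega> v + 2 * l2sq \<Omega> w"
proof -
  have i: "integrable (lebesgue_on \<Omega>) (\<lambda>x. (v x)\<^sup>2)" "integrable (lebesgue_on \<Omega>) (\<lambda>x. (w x)\<^sup>2)"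
    using assms unfolding L2_space_def by auto
  have "l2sq \<Omega> (\<lambda>x. v x - w x) \<le> (LINT x|lebesgue_on \<Omega>. 2 * (v x)\<^sup>2 + 2 * (w x)\<^sup>2)"
    unfolding l2sq_def
  proof (rule integral_mono')
    show "(v x - w x)\<^sup>2 \<le> 2 * (v x)\<^sup>2 + 2 * (w x)\<^sup>2" for x
      using zero_le_power2[of "v x + w x"] by (simp add: power2_eq_square algebra_simps)
  qed (use i in auto)
  then show ?thesis using i unfolding l2sq_def by simp
qed

lemma l2sq_lincomb_le:
  assumes "v \<in> L2_space \<Omega>" "w \<in> L2_space \<Omega>"
  shows "l2sq \<Omega> (\<lambda>x. \<alpha> * v x + \<beta> * w x) \<le> 2 * \<alpha>\<^sup>2 * l2sq \<Omega> v + 2 * \<beta>\<^sup>2 * l2sq \<Omega> w"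
proof -
  have z: "(\<lambda>x. 0) \<in> L2_space \<Omega>" by (rule L2_space_zero)
  have m: "(\<lambda>x. \<alpha> * v x) \<in> L2_space \<Omega>" "(\<lambda>x. - \<beta> * w x) \<in> L2_space \<Omega>"
    using L2_space_lincomb[OF assms(1) z, of \<alpha> 0] L2_space_lincomb[OF assms(2) z, of "-\<beta>" 0] by simp_all
  show ?thesis using l2sq_diff_le[OF m] by (simp add: l2sq_def power_mult_distrib)
qed

text \<open>Used as a triangle inequality; the factor 2 from
  \<open>(a + b)^2 \<le> 2 a^2 + 2 b^2\<close> is harmless in all approximation arguments.\<close>

lemma H1_norm_lincomb_le:
  fixes v w :: "real ^ 'n \<Rightarrow> real"
  assumes "v \<in> H1_space \<Omega>" "w \<in> H1_space \<Omega>" "open \<Omega>"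
  shows "(H1_norm \<Omega> (\<lambda>x. \<alpha> * v x + \<beta> * w x))\<^sup>2 \<le>
    2 * \<alpha>\<^sup>2 * (H1_norm \<Omega> v)\<^sup>2 + 2 * \<beta>\<^sup>2 * (H1_norm \<Omega> w)\<^sup>2"
proof -
  have "energy \<Omega> (\<lambda>x. \<alpha> * v x + \<beta> * w x) \<le> 2 * (\<alpha>\<^sup>2 * energy \<Omega> v) + 2 * (\<beta>\<^sup>2 * energy \<Omega> w)"
  proof -
    define I where "I = (LINT x|lebesgue_on \<Omega>. weak_grad \<Omega> v x \<bullet> weak_grad \<Omega> w x)"
    \<comment> \<open>Nonnegativity of the energy with the opposite sign of \<beta> bounds the mixed
      term by the two pure ones.\<close>
    have "energy \<Omega> (\<lambda>x. \<alpha> * v x + (- \<beta>) * w x) = \<alpha>\<^sup>2 * energy \<Omega> v + 2 * \<alpha> * (- \<beta>) * I + (- \<beta>)\<^sup>2 * energy \<Omega> w"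
      unfolding I_def by (rule energy_lincomb[OF assms])
    then have "0 \<le> \<alpha>\<^sup>2 * energy \<Omega> v - 2 * \<alpha> * \<beta> * I + \<beta>\<^sup>2 * energy \<Omega> w"
      using energy_nonneg[of \<Omega> "\<lambda>x. \<alpha> * v x + (- \<beta>) * w x"] by simp
    moreover have "energy \<Omega> (\<lambda>x. \<alpha> * v x + \<beta> * w x) = \<alpha>\<^sup>2 * energy \<Omega> v + 2 * \<alpha> * \<beta> * I + \<beta>\<^sup>2 * energy \<Omega> w"
      unfolding I_def by (rule energy_lincomb[OF assms])
    ultimately show ?thesis by linarith
  qed
  then show ?thesis
    using l2sq_lincomb_le[OF H1_spaceD(1)[OF assms(1,3)] H1_spaceD(1)[OF assms(2,3)], of \<alpha> \<beta>]
    unfolding H1_norm_power2 by (simp add: algebra_simps)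
qed

lemma test_function_H1:
  fixes \<phi> :: "real ^ 'n \<Rightarrow> real"
  assumes \<phi>: "\<phi> \<in> test_functions \<Omega>" and \<Omega>: "open \<Omega>"
  shows "\<phi> \<in> H1_space \<Omega>" "AE x in lebesgue_on \<Omega>. weak_partial \<Omega> i \<phi> x = partial i \<phi> x"
proof -
  note D = test_functionsD[OF \<phi>]
  have L2: "g \<in> L2_space \<Omega>" if g: "continuous_on UNIV g" "\<And>x. x \<notin> closure {x. \<phi> x \<noteq> 0} \<Longrightarrow> g x = 0" for g
  proof -
    have "continuous_on UNIV (\<lambda>x. (g x)\<^sup>2)" using g(1) by (intro continuous_intros)
    then have "integrable (lebesgue_on (closure {x. \<phi> x \<noteq> 0})) (\<lambda>x. (g x)\<^sup>2)"
      by (intro integrable_continuous_compact D(2)) (rule continuous_on_subset, auto)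
    then have "integrable (lebesgue_on \<Omega>) (\<lambda>x. (g x)\<^sup>2)"
      using lebesgue_on_zero_outside(1)[of "closure {x. \<phi> x \<noteq> 0}" \<Omega> "\<lambda>x. (g x)\<^sup>2"] D(2,3) g(2) \<Omega>
      by (simp add: compact_in_lebesgue open_in_lebesgue)
    moreover have "g \<in> borel_measurable (lebesgue_on \<Omega>)"
      using g(1) \<Omega> by (intro continuous_on_measurable_lebesgue_on) (auto simp: open_in_lebesgue intro: continuous_on_subset)
    ultimately show ?thesis unfolding L2_space_def by auto
  qed
  have w: "has_weak_partial \<Omega> i \<phi> (partial i \<phi>)" for i
    by (rule has_weak_partial_smooth[OF D(1) \<Omega>])
  have "partial i \<phi> \<in> L2_space \<Omega>" for i
    by (rule L2[OF smooth_continuous_on[OF smooth_partial[OF D(1)]] D(5)])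
  moreover have "\<phi> \<in> L2_space \<Omega>" by (rule L2[OF smooth_continuous_on[OF D(1)] D(4)])
  ultimately show "\<phi> \<in> H1_space \<Omega>" using w unfolding H1_space_def by blast
  show "AE x in lebesgue_on \<Omega>. weak_partial \<Omega> i \<phi> x = partial i \<phi> x"
    by (rule weak_partial_AE[OF w _ \<Omega>]) simp
qed

lemma smooth_lincomb_test:
  assumes "\<phi> \<in> test_functions \<Omega>" "\<psi> \<in> test_functions \<Omega>"
  shows "(\<lambda>x. \<alpha> * \<phi> x + \<beta> * \<psi> x) \<in> test_functions \<Omega>"
proof -
  have "closure {x. \<alpha> * \<phi> x + \<beta> * \<psi> x \<noteq> 0} \<subseteq> closure ({x. \<phi> x \<noteq> 0} \<union> {x. \<psi> x \<noteq> 0})"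
    by (intro closure_mono) auto
  then have sub: "closure {x. \<alpha> * \<phi> x + \<beta> * \<psi> x \<noteq> 0} \<subseteq> closure {x. \<phi> x \<noteq> 0} \<union> closure {x. \<psi> x \<noteq> 0}" by simp
  have "compact (closure {x. \<alpha> * \<phi> x + \<beta> * \<psi> x \<noteq> 0})"
    by (rule compact_if_closed_subset_compact[OF compact_Un[OF test_functionsD(2)[OF assms(1)] test_functionsD(2)[OF assms(2)]] closed_closure sub])
  moreover have "smooth (\<lambda>x. \<alpha> * \<phi> x + \<beta> * \<psi> x)"
    by (intro smooth_add smooth_mult smooth_const test_functionsD(1)[OF assms(1)] test_functionsD(1)[OF assms(2)])
  moreover have "closure {x. \<alpha> * \<phi> x + \<beta> * \<psi> x \<noteq> 0} \<subseteq> \<Omega>"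
    using sub test_functionsD(3)[OF assms(1)] test_functionsD(3)[OF assms(2)] by blast
  ultimately show ?thesis unfolding test_functions_def smooth_def by blast
qed

lemma H1_closure_lincomb:
  fixes v w :: "real ^ 'n \<Rightarrow> real"
  assumes v: "v \<in> H1_closure \<Omega> W" and w: "w \<in> H1_closure \<Omega> W" and \<Omega>: "open \<Omega>"
    and W: "W \<subseteq> H1_space \<Omega>" "\<And>v w \<alpha> \<beta>. v \<in> W \<Longrightarrow> w \<in> W \<Longrightarrow> (\<lambda>x. \<alpha> * v x + \<beta> * w x) \<in> W"
  shows "(\<lambda>x. \<alpha> * v x + \<beta> * w x) \<in> H1_closure \<Omega> W"
  unfolding H1_closure_def
proof (intro CollectI conjI allI impI)
  have H: "v \<in> H1_space \<Omega>" "w \<in> H1_space \<Omega>" using v w unfolding H1_closure_def by auto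
  show "(\<lambda>x. \<alpha> * v x + \<beta> * w x) \<in> H1_space \<Omega>" by (rule H1_lincomb(1)[OF H \<Omega>])
  fix \<epsilon> :: real assume \<epsilon>: "\<epsilon> > 0"
  \<comment> \<open>The summand 1 keeps \<open>K\<close> positive when both coefficients vanish, and
    makes the final bound \<open>(K - 1) * (\<epsilon>\<^sup>2 / K)\<close> strictly smaller than
    the square of \<epsilon>.\<close>
  define K where "K = 2 * \<alpha>\<^sup>2 + 2 * \<beta>\<^sup>2 + 1"
  have K: "K > 0" unfolding K_def by (intro add_nonneg_pos add_nonneg_nonneg) auto
  define \<delta> where "\<delta> = sqrt (\<epsilon>\<^sup>2 / K)"
  have \<delta>: "\<delta> > 0" using \<epsilon> K by (simp add: \<delta>_def)
  obtain v' w' where v': "v' \<in> W" "H1_norm \<Omega> (\<lambda>x. v x - v' x) < \<delta>"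
    and w': "w' \<in> W" "H1_norm \<Omega> (\<lambda>x. w x - w' x) < \<delta>"
    using v w \<delta> unfolding H1_closure_def by blast
  have nn: "0 \<le> H1_norm \<Omega> g" for g :: "real ^ 'n \<Rightarrow> real" by (simp add: H1_norm_def)
  have sq: "(H1_norm \<Omega> (\<lambda>x. v x - v' x))\<^sup>2 \<le> \<epsilon>\<^sup>2 / K" "(H1_norm \<Omega> (\<lambda>x. w x - w' x))\<^sup>2 \<le> \<epsilon>\<^sup>2 / K"
    using power_mono[OF less_imp_le[OF v'(2)] nn, of 2] power_mono[OF less_imp_le[OF w'(2)] nn, of 2] K
    by (simp_all add: \<delta>_def)
  have m: "(\<lambda>x. v x - v' x) \<in> H1_space \<Omega>" "(\<lambda>x. w x - w' x) \<in> H1_space \<Omega>"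
    using H1_diff[OF H(1) _ \<Omega>] H1_diff[OF H(2) _ \<Omega>] v'(1) w'(1) W(1) by auto
  have eq: "(\<lambda>x. \<alpha> * v x + \<beta> * w x - (\<alpha> * v' x + \<beta> * w' x)) =
     (\<lambda>x. \<alpha> * (v x - v' x) + \<beta> * (w x - w' x))" by (auto simp: algebra_simps)
  have "(H1_norm \<Omega> (\<lambda>x. \<alpha> * v x + \<beta> * w x - (\<alpha> * v' x + \<beta> * w' x)))\<^sup>2 \<le>
     2 * \<alpha>\<^sup>2 * (\<epsilon>\<^sup>2 / K) + 2 * \<beta>\<^sup>2 * (\<epsilon>\<^sup>2 / K)"
    unfolding eq by (rule order_trans[OF H1_norm_lincomb_le[OF m \<Omega>]]) (intro add_mono mult_left_mono sq, auto)
  also have "\<dots> = (2 * \<alpha>\<^sup>2 + 2 * \<beta>\<^sup>2) * (\<epsilon>\<^sup>2 / K)" by (rule distrib_right[symmetric])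
  also have "2 * \<alpha>\<^sup>2 + 2 * \<beta>\<^sup>2 = K - 1" by (simp add: K_def)
  also have "(K - 1) * (\<epsilon>\<^sup>2 / K) < K * (\<epsilon>\<^sup>2 / K)" using K \<epsilon> by (intro mult_strict_right_mono) auto
  also have "\<dots> = \<epsilon>\<^sup>2" using K by simp
  finally have "H1_norm \<Omega> (\<lambda>x. \<alpha> * v x + \<beta> * w x - (\<alpha> * v' x + \<beta> * w' x)) < \<epsilon>"
    using \<epsilon> power_less_imp_less_base by fastforce
  then show "\<exists>z\<in>W. H1_norm \<Omega> (\<lambda>x. \<alpha> * v x + \<beta> * w x - z x) < \<epsilon>"
    by (intro bexI[OF _ W(2)[OF v'(1) w'(1)]])
qed

lemma H10_lincomb:
  fixes v w :: "real ^ 'n \<Rightarrow> real"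
  assumes "v \<in> H10_space \<Omega>" "w \<in> H10_space \<Omega>" "open \<Omega>"
  shows "(\<lambda>x. \<alpha> * v x + \<beta> * w x) \<in> H10_space \<Omega>"
  using assms unfolding H10_space_def
  by (intro H1_closure_lincomb smooth_lincomb_test) (auto intro: test_function_H1)

lemma H10_subset_H1: "H10_space \<Omega> \<subseteq> H1_space \<Omega>"
  unfolding H10_space_def H1_closure_def by auto

section \<open>The Poincare inequality\<close>

text \<open>Integrate \<open>\<partial>\<^sub>i (x\<^sub>i \<phi>\<^sup>2)\<close> to zero.\<close>

lemma poincare_test:
  fixes \<phi> :: "real ^ 'n \<Rightarrow> real"
  assumes \<phi>: "\<phi> \<in> test_functions \<Omega>" and \<Omega>: "open \<Omega>" "\<Omega> \<subseteq> cball 0 R" and R: "R > 0"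
  shows "l2sq \<Omega> \<phi> \<le> 4 * R\<^sup>2 * energy \<Omega> \<phi>"
proof -
  \<comment> \<open>Any one coordinate direction will do.\<close>
  define i :: 'n where "i = undefined"
  note D = test_functionsD[OF \<phi>]
  note S = open_in_lebesgue[OF \<Omega>(1)]
  note H = test_function_H1[OF \<phi> \<Omega>(1)]
  have v: "has_weak_partial \<Omega> i (\<lambda>x. 1 * (x $ i)) (\<lambda>x. 0 * (x $ i) + 1 * partial i (\<lambda>x. x $ i) x)"
    by (rule has_weak_partial_mult_smooth[OF has_weak_partial_const smooth_coord]) (rule \<Omega>)+
  have \<phi>2: "(\<lambda>x. \<phi> x * \<phi> x) \<in> test_functions \<Omega>" using test_functions_mult_smooth[OF \<phi> D(1)] .
  have p2: "partial i (\<lambda>x. \<phi> x * \<phi> x) x = 2 * \<phi> x * partial i \<phi> x" for x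
    using partial_mult[of \<phi> x \<phi> i] smooth_differentiable[OF D(1)] by simp
  have L2: "\<phi> \<in> L2_space \<Omega>" using H1_spaceD(1)[OF H(1) \<Omega>(1)] .
  have L2p: "partial i \<phi> \<in> L2_space \<Omega>" using L2_space_AE[OF H1_spaceD(3)[OF H(1) \<Omega>(1)] H(2) S] .
  have int: "integrable (lebesgue_on \<Omega>) (\<lambda>x. (\<phi> x)\<^sup>2)" "integrable (lebesgue_on \<Omega>) (\<lambda>x. (partial i \<phi> x)\<^sup>2)"
    using L2 L2p unfolding L2_space_def by auto
  have "(LINT x|lebesgue_on \<Omega>. (\<phi> x)\<^sup>2) = - (LINT x|lebesgue_on \<Omega>. x $ i * (2 * \<phi> x * partial i \<phi> x))"
    using v \<phi>2 unfolding has_weak_partial_def by (auto simp: p2 power2_eq_square)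
  also have "\<dots> = (LINT x|lebesgue_on \<Omega>. - (x $ i * (2 * \<phi> x * partial i \<phi> x)))" by simp
  also have "\<dots> \<le> (LINT x|lebesgue_on \<Omega>. (\<phi> x)\<^sup>2 / 2 + 2 * R\<^sup>2 * (partial i \<phi> x)\<^sup>2)"
  proof (rule integral_mono')
    fix x assume "x \<in> space (lebesgue_on \<Omega>)"
    then have "\<bar>x $ i\<bar> \<le> R" using \<Omega>(2) component_le_norm_cart[of x i] by (auto simp: subset_iff)
    then have x2: "(x $ i)\<^sup>2 \<le> R\<^sup>2" using power_mono[of "\<bar>x $ i\<bar>" R 2] by simp
    \<comment> \<open>This is Young's inequality, weighted so that half of the integral of
      \<open>\<phi>\<^sup>2\<close> can be absorbed on the left.\<close>
    have "0 \<le> (\<phi> x + 2 * (x $ i) * partial i \<phi> x)\<^sup>2" by simp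
    then have "- (x $ i * (2 * \<phi> x * partial i \<phi> x)) \<le> (\<phi> x)\<^sup>2 / 2 + 2 * ((x $ i)\<^sup>2 * (partial i \<phi> x)\<^sup>2)"
      by (simp add: power2_eq_square algebra_simps)
    also have "\<dots> \<le> (\<phi> x)\<^sup>2 / 2 + 2 * (R\<^sup>2 * (partial i \<phi> x)\<^sup>2)"
      using mult_right_mono[OF x2, of "(partial i \<phi> x)\<^sup>2"] by simp
    finally show "- (x $ i * (2 * \<phi> x * partial i \<phi> x)) \<le> (\<phi> x)\<^sup>2 / 2 + 2 * R\<^sup>2 * (partial i \<phi> x)\<^sup>2" by simp
  qed (use int in auto)
  also have "\<dots> = (LINT x|lebesgue_on \<Omega>. (\<phi> x)\<^sup>2) / 2 + 2 * R\<^sup>2 * (LINT x|lebesgue_on \<Omega>. (partial i \<phi> x)\<^sup>2)"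
    using int by simp
  finally have 1: "l2sq \<Omega> \<phi> \<le> 4 * R\<^sup>2 * (LINT x|lebesgue_on \<Omega>. (partial i \<phi> x)\<^sup>2)"
    unfolding l2sq_def by simp
  have "(LINT x|lebesgue_on \<Omega>. (partial i \<phi> x)\<^sup>2) = (LINT x|lebesgue_on \<Omega>. (weak_partial \<Omega> i \<phi> x)\<^sup>2)"
    by (rule integral_cong_AE_on[OF S]) (use H(2)[of i] in eventually_elim, simp)
  also have "\<dots> \<le> energy \<Omega> \<phi>"
    unfolding energy_def
  proof (rule integral_mono'[OF weak_grad_sq_integrable[OF H(1) \<Omega>(1)]])
    show "(weak_partial \<Omega> i \<phi> x)\<^sup>2 \<le> (norm (weak_grad \<Omega> \<phi> x))\<^sup>2" for x
      using component_le_norm_cart[of "weak_grad \<Omega> \<phi> x" i] power_mono[of "\<bar>weak_partial \<Omega> i \<phi> x\<bar>" "norm (weak_grad \<Omega> \<phi> x)" 2]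
      by (simp add: weak_grad_def)
  qed auto
  finally show ?thesis using 1 R by (meson mult_left_mono order_trans zero_le_mult_iff zero_le_numeral zero_le_power2)
qed

text \<open>By density of the test functions. Passing to and from the approximant through squared
  norms costs a factor 2 each time, which turns 4 into 16.\<close>

lemma poincare:
  fixes \<Omega> :: "(real ^ 'n) set"
  assumes \<Omega>: "open \<Omega>" "bounded \<Omega>"
  obtains C where "C > 0" "\<And>v. v \<in> H10_space \<Omega> \<Longrightarrow> l2sq \<Omega> v \<le> C * energy \<Omega> v"
proof -
  obtain R where R: "R > 0" "\<Omega> \<subseteq> cball 0 R"
    using \<Omega>(2) unfolding bounded_pos by (auto simp: subset_iff)
  have "l2sq \<Omega> v \<le> (16 * R\<^sup>2) * energy \<Omega> v" if v: "v \<in> H10_space \<Omega>" for v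
  proof (rule field_le_epsilon)
    fix e :: real assume e: "e > 0"
    \<comment> \<open>\<open>K\<close> collects the coefficients of the two approximation errors: 2
      for the function and \<open>16 * R\<^sup>2\<close> for the gradient.\<close>
    define K where "K = 16 * R\<^sup>2 + 2"
    have K: "K > 0" unfolding K_def by (intro add_nonneg_pos) auto
    have "sqrt (e / K) > 0" using e K by simp
    then obtain \<phi> where \<phi>: "\<phi> \<in> test_functions \<Omega>" "H1_norm \<Omega> (\<lambda>x. v x - \<phi> x) < sqrt (e / K)"
      using v unfolding H10_space_def H1_closure_def by blast
    have vH: "v \<in> H1_space \<Omega>" using v H10_subset_H1 by blast
    have \<phi>H: "\<phi> \<in> H1_space \<Omega>" using test_function_H1(1)[OF \<phi>(1) \<Omega>(1)] .
    have dH: "(\<lambda>x. v x - \<phi> x) \<in> H1_space \<Omega>" using H1_diff[OF vH \<phi>H \<Omega>(1)] .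
    have "(H1_norm \<Omega> (\<lambda>x. v x - \<phi> x))\<^sup>2 \<le> (sqrt (e / K))\<^sup>2"
      using \<phi>(2) by (intro power_mono) (auto simp: H1_norm_def)
    then have d: "l2sq \<Omega> (\<lambda>x. v x - \<phi> x) + energy \<Omega> (\<lambda>x. v x - \<phi> x) \<le> e / K"
      using e K by (simp add: H1_norm_power2)
    have p: "l2sq \<Omega> \<phi> \<le> 4 * R\<^sup>2 * energy \<Omega> \<phi>" by (rule poincare_test[OF \<phi>(1) \<Omega>(1) R(2,1)])
    have l: "l2sq \<Omega> v \<le> 2 * l2sq \<Omega> (\<lambda>x. v x - \<phi> x) + 2 * l2sq \<Omega> \<phi>"
      using l2sq_lincomb_le[OF H1_spaceD(1)[OF dH \<Omega>(1)] H1_spaceD(1)[OF \<phi>H \<Omega>(1)], of 1 1] by simp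
    have en: "energy \<Omega> \<phi> \<le> 2 * energy \<Omega> v + 2 * energy \<Omega> (\<lambda>x. v x - \<phi> x)"
      using energy_diff_le[OF vH dH \<Omega>(1)] by simp
    have "4 * R\<^sup>2 * energy \<Omega> \<phi> \<le> 4 * R\<^sup>2 * (2 * energy \<Omega> v + 2 * energy \<Omega> (\<lambda>x. v x - \<phi> x))"
      using en by (intro mult_left_mono) auto
    then have "l2sq \<Omega> v \<le> 16 * R\<^sup>2 * energy \<Omega> v + (2 * l2sq \<Omega> (\<lambda>x. v x - \<phi> x) + 16 * R\<^sup>2 * energy \<Omega> (\<lambda>x. v x - \<phi> x))"
      using l p by (simp add: algebra_simps)
    also have "2 * l2sq \<Omega> (\<lambda>x. v x - \<phi> x) + 16 * R\<^sup>2 * energy \<Omega> (\<lambda>x. v x - \<phi> x) \<le>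
        K * (l2sq \<Omega> (\<lambda>x. v x - \<phi> x) + energy \<Omega> (\<lambda>x. v x - \<phi> x))"
      using l2sq_nonneg[of \<Omega> "\<lambda>x. v x - \<phi> x"] energy_nonneg[of \<Omega> "\<lambda>x. v x - \<phi> x"]
      by (simp add: K_def algebra_simps)
    also have "\<dots> \<le> K * (e / K)" using d K by (intro mult_left_mono) auto
    also have "\<dots> = e" using K by simp
    finally show "l2sq \<Omega> v \<le> 16 * R\<^sup>2 * energy \<Omega> v + e" by simp
  qed
  then show ?thesis using that[of "16 * R\<^sup>2"] R(1) by simp
qed

section \<open>The bilinear form\<close>

lemma bilinear_integrable:
  fixes A :: "real ^ 'n \<Rightarrow> real ^ 'n ^ 'n" and b :: "real ^ 'n \<Rightarrow> real ^ 'n"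
  assumes \<Omega>: "open \<Omega>"
    and A: "\<And>i j. (\<lambda>x. A x $ i $ j) \<in> Linf_space \<Omega>"
    and b: "\<And>i. (\<lambda>x. b x $ i) \<in> Linf_space \<Omega>" and c: "c \<in> Linf_space \<Omega>"
    and v: "v \<in> H1_space \<Omega>" and w: "w \<in> H1_space \<Omega>"
  shows "integrable (lebesgue_on \<Omega>) (\<lambda>x. (A x *v weak_grad \<Omega> v x) \<bullet> weak_grad \<Omega> w x
    + (b x \<bullet> weak_grad \<Omega> v x) * w x + c x * v x * w x)"
proof -
  note V = H1_spaceD[OF v \<Omega>] and W = H1_spaceD[OF w \<Omega>]
  have 1: "(\<lambda>x. (A x *v weak_grad \<Omega> v x) \<bullet> weak_grad \<Omega> w x) =
     (\<lambda>x. \<Sum>i\<in>UNIV. \<Sum>j\<in>UNIV. A x $ i $ j * weak_partial \<Omega> j v x * weak_partial \<Omega> i w x)"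
    by (rule ext) (simp add: inner_vec_def matrix_vector_mult_def weak_grad_def sum_distrib_right)
  have "integrable (lebesgue_on \<Omega>) (\<lambda>x. (A x *v weak_grad \<Omega> v x) \<bullet> weak_grad \<Omega> w x)"
    unfolding 1 by (intro Bochner_Integration.integrable_sum L2_space_mult_integrable Linf_L2_mult A V W)
  moreover have "(\<lambda>x. (b x \<bullet> weak_grad \<Omega> v x) * w x) = (\<lambda>x. \<Sum>i\<in>UNIV. b x $ i * weak_partial \<Omega> i v x * w x)"
    by (rule ext) (simp add: inner_vec_def weak_grad_def sum_distrib_right)
  then have "integrable (lebesgue_on \<Omega>) (\<lambda>x. (b x \<bullet> weak_grad \<Omega> v x) * w x)"
    by (simp only:) (intro Bochner_Integration.integrable_sum L2_space_mult_integrable Linf_L2_mult b V W)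
  moreover have "integrable (lebesgue_on \<Omega>) (\<lambda>x. c x * v x * w x)"
    by (intro L2_space_mult_integrable Linf_L2_mult c V W)
  ultimately show ?thesis by (intro Bochner_Integration.integrable_add)
qed

lemma bilinear_form_lincomb:
  fixes A :: "real ^ 'n \<Rightarrow> real ^ 'n ^ 'n" and b :: "real ^ 'n \<Rightarrow> real ^ 'n"
  assumes \<Omega>: "open \<Omega>"
    and A: "\<And>i j. (\<lambda>x. A x $ i $ j) \<in> Linf_space \<Omega>"
    and b: "\<And>i. (\<lambda>x. b x $ i) \<in> Linf_space \<Omega>" and c: "c \<in> Linf_space \<Omega>"
    and v: "v \<in> H1_space \<Omega>" and w: "w \<in> H1_space \<Omega>" and z: "z \<in> H1_space \<Omega>"
  shows "bilinear_form \<Omega> A b c (\<lambda>x. \<alpha> * v x + \<beta> * w x) z =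
      \<alpha> * bilinear_form \<Omega> A b c v z + \<beta> * bilinear_form \<Omega> A b c w z"
    and "bilinear_form \<Omega> A b c z (\<lambda>x. \<alpha> * v x + \<beta> * w x) =
      \<alpha> * bilinear_form \<Omega> A b c z v + \<beta> * bilinear_form \<Omega> A b c z w"
proof -
  note I = bilinear_integrable[OF \<Omega> A b c]
  note lc = H1_lincomb(2)[OF v w \<Omega>, of \<alpha> \<beta>]
  note S = open_in_lebesgue[OF \<Omega>]
  have "bilinear_form \<Omega> A b c (\<lambda>x. \<alpha> * v x + \<beta> * w x) z =
    (LINT x|lebesgue_on \<Omega>. \<alpha> * ((A x *v weak_grad \<Omega> v x) \<bullet> weak_grad \<Omega> z x
    + (b x \<bullet> weak_grad \<Omega> v x) * z x + c x * v x * z x) + \<beta> * ((A x *v weak_grad \<Omega> w x) \<bullet> weak_grad \<Omega> z x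
    + (b x \<bullet> weak_grad \<Omega> w x) * z x + c x * w x * z x))"
    unfolding bilinear_form_def
  proof (rule integral_cong_AE_on[OF S])
    show "AE x in lebesgue_on \<Omega>. (A x *v weak_grad \<Omega> (\<lambda>x. \<alpha> * v x + \<beta> * w x) x) \<bullet> weak_grad \<Omega> z x
       + (b x \<bullet> weak_grad \<Omega> (\<lambda>x. \<alpha> * v x + \<beta> * w x) x) * z x + c x * (\<alpha> * v x + \<beta> * w x) * z x =
       \<alpha> * ((A x *v weak_grad \<Omega> v x) \<bullet> weak_grad \<Omega> z x
    + (b x \<bullet> weak_grad \<Omega> v x) * z x + c x * v x * z x) + \<beta> * ((A x *v weak_grad \<Omega> w x) \<bullet> weak_grad \<Omega> z x
    + (b x \<bullet> weak_grad \<Omega> w x) * z x + c x * w x * z x)"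
      using lc
    proof eventually_elim
      case (elim x)
      show ?case unfolding elim
        by (simp add: matrix_vector_right_distrib matrix_vector_mult_scaleR inner_add_left inner_add_right algebra_simps)
    qed
  qed
  then show "bilinear_form \<Omega> A b c (\<lambda>x. \<alpha> * v x + \<beta> * w x) z =
      \<alpha> * bilinear_form \<Omega> A b c v z + \<beta> * bilinear_form \<Omega> A b c w z"
    using I[OF v z] I[OF w z] unfolding bilinear_form_def by simp
  have "bilinear_form \<Omega> A b c z (\<lambda>x. \<alpha> * v x + \<beta> * w x) =
    (LINT x|lebesgue_on \<Omega>. \<alpha> * ((A x *v weak_grad \<Omega> z x) \<bullet> weak_grad \<Omega> v x
    + (b x \<bullet> weak_grad \<Omega> z x) * v x + c x * z x * v x) + \<beta> * ((A x *v weak_grad \<Omega> z x) \<bullet> weak_grad \<Omega> w x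
    + (b x \<bullet> weak_grad \<Omega> z x) * w x + c x * z x * w x))"
    unfolding bilinear_form_def
  proof (rule integral_cong_AE_on[OF S])
    show "AE x in lebesgue_on \<Omega>. (A x *v weak_grad \<Omega> z x) \<bullet> weak_grad \<Omega> (\<lambda>x. \<alpha> * v x + \<beta> * w x) x
       + (b x \<bullet> weak_grad \<Omega> z x) * (\<alpha> * v x + \<beta> * w x) + c x * z x * (\<alpha> * v x + \<beta> * w x) =
       \<alpha> * ((A x *v weak_grad \<Omega> z x) \<bullet> weak_grad \<Omega> v x
    + (b x \<bullet> weak_grad \<Omega> z x) * v x + c x * z x * v x) + \<beta> * ((A x *v weak_grad \<Omega> z x) \<bullet> weak_grad \<Omega> w x
    + (b x \<bullet> weak_grad \<Omega> z x) * w x + c x * z x * w x)"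
      using lc
    proof eventually_elim
      case (elim x)
      show ?case unfolding elim by (simp add: inner_add_right algebra_simps)
    qed
  qed
  then show "bilinear_form \<Omega> A b c z (\<lambda>x. \<alpha> * v x + \<beta> * w x) =
      \<alpha> * bilinear_form \<Omega> A b c z v + \<beta> * bilinear_form \<Omega> A b c z w"
    using I[OF z v] I[OF z w] unfolding bilinear_form_def by simp
qed

section \<open>Convergence of the Galerkin solutions\<close>

text \<open>
  The sequence of Galerkin solutions is Cauchy in the energy seminorm. Among all elements of
  \<open>\<Union>l. V l\<close> that satisfy the \<open>l\<close>-th Galerkin equations choose an almost minimal one \<open>w l\<close>. The
  parallelogram law shows that \<open>w\<close> is Cauchy, and by ellipticity \<open>U j - w l\<close> is controlled by
  \<open>w j - w l\<close> once \<open>w l\<close> lies in \<open>V j\<close>. This needs neither completeness nor symmetry.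
\<close>

lemma galerkin_cauchy:
  fixes V :: "nat \<Rightarrow> (real ^ 'n \<Rightarrow> real) set" and B :: "(real ^ 'n \<Rightarrow> real) \<Rightarrow> (real ^ 'n \<Rightarrow> real) \<Rightarrow> real"
  assumes \<Omega>: "open \<Omega>"
    and VH: "\<And>l. V l \<subseteq> H10_space \<Omega>"
    and Vlin: "\<And>l v w \<alpha> \<beta>. v \<in> V l \<Longrightarrow> w \<in> V l \<Longrightarrow> (\<lambda>x. \<alpha> * v x + \<beta> * w x) \<in> V l"
    and Vmono: "\<And>l. V l \<subseteq> V (Suc l)"
    and Bl: "\<And>v w z \<alpha> \<beta>. v \<in> H10_space \<Omega> \<Longrightarrow> w \<in> H10_space \<Omega> \<Longrightarrow> z \<in> H10_space \<Omega> \<Longrightarrow>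
       B (\<lambda>x. \<alpha> * v x + \<beta> * w x) z = \<alpha> * B v z + \<beta> * B w z"
    and Bb: "\<And>v w. v \<in> H10_space \<Omega> \<Longrightarrow> w \<in> H10_space \<Omega> \<Longrightarrow> \<bar>B v w\<bar> \<le> C * sqrt (energy \<Omega> v) * sqrt (energy \<Omega> w)"
    and Be: "c > 0" "\<And>v. v \<in> H10_space \<Omega> \<Longrightarrow> c * energy \<Omega> v \<le> B v v"
    and U: "\<And>l. U l \<in> V l" "\<And>l v. v \<in> V l \<Longrightarrow> B (U l) v = B u v" and u: "u \<in> H10_space \<Omega>"
  shows "\<exists>M. \<forall>l. energy \<Omega> (U l) \<le> M"
    and "\<And>e. e > 0 \<Longrightarrow> \<exists>k. \<forall>l\<ge>k. energy \<Omega> (\<lambda>x. U l x - U k x) < e"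
proof -
  have H1: "v \<in> H10_space \<Omega> \<Longrightarrow> v \<in> H1_space \<Omega>" for v using H10_subset_H1 by blast
  have mono: "V l \<subseteq> V j" if "l \<le> j" for l j using lift_Suc_mono_le[of V, OF Vmono that] .
  have diff: "v \<in> H10_space \<Omega> \<Longrightarrow> w \<in> H10_space \<Omega> \<Longrightarrow> (\<lambda>x. v x - w x) \<in> H10_space \<Omega>" for v w
    using H10_lincomb[OF _ _ \<Omega>, of v w 1 "-1"] by simp
  have Vdiff: "v \<in> V l \<Longrightarrow> w \<in> V l \<Longrightarrow> (\<lambda>x. v x - w x) \<in> V l" for v w l
    using Vlin[of v l w 1 "-1"] by simp
  have Bdiff: "B (\<lambda>x. v x - w x) z = B v z - B w z"
    if "v \<in> H10_space \<Omega>" "w \<in> H10_space \<Omega>" "z \<in> H10_space \<Omega>" for v w z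
    using Bl[OF that, of 1 "-1"] by simp
  \<comment> \<open>This is the computation of Cea's lemma: ellipticity below, boundedness above,
    and one factor of the seminorm of \<open>z\<close> cancels.\<close>
  have key: "energy \<Omega> z \<le> (C / c)\<^sup>2 * energy \<Omega> y"
    if z: "z \<in> H10_space \<Omega>" and y: "y \<in> H10_space \<Omega>" and eq: "B z z = B y z" for y z
  proof (cases "energy \<Omega> z = 0")
    case True
    then show ?thesis using energy_nonneg[of \<Omega> y] by simp
  next
    case False
    define s t where "s = sqrt (energy \<Omega> z)" and "t = sqrt (energy \<Omega> y)"
    have s: "s > 0" "s\<^sup>2 = energy \<Omega> z" "t\<^sup>2 = energy \<Omega> y"
      using False energy_nonneg[of \<Omega> z] energy_nonneg[of \<Omega> y] by (auto simp: s_def t_def)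
    have "c * energy \<Omega> z \<le> \<bar>B y z\<bar>" using order_trans[OF Be(2)[OF z], of "\<bar>B y z\<bar>"] eq by simp
    also have "\<dots> \<le> C * t * s" using Bb[OF y z] by (simp add: s_def t_def)
    finally have "c * (s * s) \<le> C * t * s" using s(2) by (simp add: power2_eq_square)
    then have "c * s \<le> C * t" using s(1) by (simp add: mult.assoc[symmetric])
    then have "s \<le> C / c * t" using Be(1) by (simp add: field_simps)
    then have "s\<^sup>2 \<le> (C / c * t)\<^sup>2" using s(1) by (intro power_mono) auto
    also have "\<dots> = (C / c)\<^sup>2 * t\<^sup>2" by (rule power_mult_distrib)
    finally show ?thesis using s by simp
  qed
  have UH: "U l \<in> H10_space \<Omega>" for l using U(1) VH by blast
  define M where "M = (C / c)\<^sup>2 * energy \<Omega> u"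
  have bd: "energy \<Omega> (U l) \<le> M" for l
    unfolding M_def by (rule key[OF UH u]) (rule U(2)[OF U(1)])
  then show "\<exists>M. \<forall>l. energy \<Omega> (U l) \<le> M" by blast
  \<comment> \<open>\<open>K l\<close> is stable under midpoints, contains all \<open>U j\<close>
    with \<open>l \<le> j\<close>, and shrinks as \<open>l\<close> grows. Hence the infima
    \<open>m l\<close> increase and stay below \<open>M\<close>, so they converge to their
    supremum.\<close>
  define K where "K l = {w. (\<exists>i. w \<in> V i) \<and> (\<forall>v\<in>V l. B w v = B u v)}" for l
  have KH: "w \<in> K l \<Longrightarrow> w \<in> H10_space \<Omega>" for w l using VH unfolding K_def by blast
  have UK: "U j \<in> K l" if "l \<le> j" for l j
    using U mono[OF that] unfolding K_def by blast
  have Kanti: "K j \<subseteq> K l" if "l \<le> j" for l j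
    using mono[OF that] unfolding K_def by blast
  define m where "m l = Inf (energy \<Omega> ` K l)" for l
  have bb: "bdd_below (energy \<Omega> ` K l)" for l
    by (rule bdd_belowI2[of _ 0]) (rule energy_nonneg)
  have m_le: "m l \<le> energy \<Omega> w" if "w \<in> K l" for l w
    unfolding m_def by (rule cINF_lower[OF bb that])
  have m_mono: "m l \<le> m j" if "l \<le> j" for l j
    unfolding m_def by (rule cInf_superset_mono) (use UK[of j j] bb Kanti[OF that] in auto)
  have mM: "m l \<le> M" for l using m_le[OF UK[of l l]] bd[of l] by simp
  \<comment> \<open>The infimum need not be attained within the union of the discrete spaces, whence
    the slack \<open>1 / Suc l\<close>.\<close>
  have "\<exists>w. w \<in> K l \<and> energy \<Omega> w < m l + 1 / real (Suc l)" for l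
  proof -
    have "\<exists>y\<in>energy \<Omega> ` K l. y < m l + 1 / real (Suc l)"
      using cInf_lessD[of "energy \<Omega> ` K l" "m l + 1 / real (Suc l)"] UK[of l l] by (auto simp: m_def[symmetric])
    then show ?thesis by blast
  qed
  then obtain w where w: "\<And>l. w l \<in> K l" "\<And>l. energy \<Omega> (w l) < m l + 1 / real (Suc l)" by metis
  \<comment> \<open>The midpoint of \<open>w j\<close> and \<open>w l\<close> competes in
    \<open>K l\<close>, so its energy is at least \<open>m l\<close>; the parallelogram law turns
    this into closeness of the two.\<close>
  have wc: "energy \<Omega> (\<lambda>x. w j x - w l x) \<le> 2 * (m j - m l) + 4 / real (Suc l)" if lj: "l \<le> j" for l j
  proof -
    have wj: "w j \<in> K l" using w(1)[of j] Kanti[OF lj] by blast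
    have "(\<lambda>x. 1/2 * w j x + 1/2 * w l x) \<in> K l"
    proof -
      obtain i i' where i: "w j \<in> V i" "w l \<in> V i'" using w(1) unfolding K_def by blast
      then have "w j \<in> V (max i i')" "w l \<in> V (max i i')" using mono by (meson max.cobounded1 max.cobounded2 subsetD)+
      then have "(\<lambda>x. 1/2 * w j x + 1/2 * w l x) \<in> V (max i i')" by (rule Vlin)
      moreover have "B (\<lambda>x. 1/2 * w j x + 1/2 * w l x) v = B u v" if v: "v \<in> V l" for v
        using Bl[OF KH[OF wj] KH[OF w(1)[of l]], of v "1/2" "1/2"] v VH wj w(1)[of l] unfolding K_def by auto
      ultimately show ?thesis unfolding K_def by blast
    qed
    then have "m l \<le> energy \<Omega> (\<lambda>x. 1/2 * w j x + 1/2 * w l x)" by (rule m_le)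
    moreover have "1 / real (Suc j) \<le> 1 / real (Suc l)" using lj by (simp add: field_simps)
    moreover note energy_parallelogram[OF H1[OF KH[OF wj]] H1[OF KH[OF w(1)[of l]]] \<Omega>] w(2)[of j] w(2)[of l]
    ultimately show ?thesis by simp
  qed
  \<comment> \<open>\<open>U j\<close> and \<open>w j\<close> satisfy the same equations on
    \<open>V j\<close>. If \<open>w l\<close> also lies in \<open>V j\<close>, then
    \<open>U j - w l\<close> is an admissible test function and \<open>key\<close> applies with
    \<open>y = w j - w l\<close>.\<close>
  have Uw: "energy \<Omega> (\<lambda>x. U j x - w l x) \<le> (C / c)\<^sup>2 * energy \<Omega> (\<lambda>x. w j x - w l x)" if "w l \<in> V j" for l j
  proof (rule key)
    have H: "w l \<in> H10_space \<Omega>" "w j \<in> H10_space \<Omega>" using KH w(1) by blast+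
    show Z: "(\<lambda>x. U j x - w l x) \<in> H10_space \<Omega>" "(\<lambda>x. w j x - w l x) \<in> H10_space \<Omega>"
      using diff UH H by blast+
    have v: "(\<lambda>x. U j x - w l x) \<in> V j" using Vdiff U(1) that by blast
    have "B (w j) (\<lambda>x. U j x - w l x) = B u (\<lambda>x. U j x - w l x)"
      using w(1)[of j] v unfolding K_def by blast
    then show "B (\<lambda>x. U j x - w l x) (\<lambda>x. U j x - w l x) = B (\<lambda>x. w j x - w l x) (\<lambda>x. U j x - w l x)"
      using U(2)[OF v] Bdiff[OF UH H(1) Z(1)] Bdiff[OF H(2,1) Z(1)] by simp
  qed
  fix e :: real assume e: "e > 0"
  \<comment> \<open>\<open>D\<close> dominates the factor 4 from the last quasi-triangle inequality
    times the Cea constant. With three contributions of size \<open>e / (8 * D)\<close> the total is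
    at most \<open>3 * e / 8\<close>.\<close>
  define D where "D = 4 * (C / c)\<^sup>2 + 1"
  have D: "D > 0" by (auto simp: D_def intro: add_nonneg_pos)
  define S where "S = Sup (range m)"
  have ba: "bdd_above (range m)" using mM by (intro bdd_aboveI2[of _ _ M]) auto
  have mS: "m l \<le> S" for l unfolding S_def by (rule cSUP_upper[OF _ ba]) simp
  have "S - e / (8 * D) < S" using e D by simp
  then obtain l0 where l0: "S - e / (8 * D) < m l0" unfolding S_def using less_cSUP_iff[OF _ ba] by auto
  obtain l1 where l1: "8 * 4 * D / e < real l1" using reals_Archimedean2 by blast
  define l where "l = max l0 l1"
  have ml: "S - e / (8 * D) < m l" using l0 m_mono[of l0 l] by (simp add: l_def)
  have "32 * D < real l1 * e" using l1 e by (simp add: field_simps)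
  also have "\<dots> \<le> real (Suc l) * e" using e by (intro mult_right_mono) (auto simp: l_def)
  finally have l4: "4 / real (Suc l) \<le> e / (8 * D)" using e D by (simp add: field_simps)
  have small: "energy \<Omega> (\<lambda>x. w j x - w l x) \<le> 3 * (e / (8 * D))" if "l \<le> j" for j
    using wc[OF that] ml mS[of j] l4 by simp
  obtain i where i: "w l \<in> V i" using w(1)[of l] unfolding K_def by blast
  define k where "k = max i l"
  have Usmall: "energy \<Omega> (\<lambda>x. U j x - w l x) \<le> (C / c)\<^sup>2 * (3 * (e / (8 * D)))" if j: "k \<le> j" for j
  proof -
    have "w l \<in> V j" using i mono[of i j] j by (auto simp: k_def)
    from order_trans[OF Uw[OF this] mult_left_mono[OF small]] show ?thesis using j by (auto simp: k_def)
  qed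
  have "energy \<Omega> (\<lambda>x. U j x - U k x) < e" if j: "k \<le> j" for j
  proof -
    have H: "(\<lambda>x. U j x - w l x) \<in> H1_space \<Omega>" "(\<lambda>x. U k x - w l x) \<in> H1_space \<Omega>"
      using H1 diff UH KH w(1) by blast+
    have "energy \<Omega> (\<lambda>x. U j x - U k x) \<le> 2 * energy \<Omega> (\<lambda>x. U j x - w l x) + 2 * energy \<Omega> (\<lambda>x. U k x - w l x)"
      using energy_diff_le[OF H \<Omega>] by simp
    also have "\<dots> \<le> 4 * ((C / c)\<^sup>2 * (3 * (e / (8 * D))))" using Usmall[OF j] Usmall[of k, OF order_refl] by linarith
    also have "\<dots> = (4 * (C / c)\<^sup>2) * (3 * (e / (8 * D)))" by (simp only: mult.assoc)
    also have "\<dots> \<le> D * (3 * (e / (8 * D)))"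
    proof (rule mult_right_mono)
      show "4 * (C / c)\<^sup>2 \<le> D" by (simp add: D_def)
      show "0 \<le> 3 * (e / (8 * D))" using e D by simp
    qed
    also have "\<dots> < e" using e D by simp
    finally show ?thesis .
  qed
  then show "\<exists>k. \<forall>l\<ge>k. energy \<Omega> (\<lambda>x. U l x - U k x) < e" by blast
qed

section \<open>Polynomials\<close>

definition multi_idx :: "nat \<Rightarrow> ('n::finite \<Rightarrow> nat) set" where
  "multi_idx p = {\<alpha>. (\<Sum>i\<in>UNIV. \<alpha> i) \<le> p}"

definition monomial :: "('n::finite \<Rightarrow> nat) \<Rightarrow> real ^ 'n \<Rightarrow> real" where
  "monomial \<alpha> x = (\<Prod>i\<in>UNIV. (x $ i) ^ \<alpha> i)"

text \<open>The members of \<open>poly_space\<close> with explicit coefficients, as required for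
  induction on the degree and for compactness of coefficient vectors.\<close>

definition polyn :: "nat \<Rightarrow> (('n::finite \<Rightarrow> nat) \<Rightarrow> real) \<Rightarrow> real ^ 'n \<Rightarrow> real" where
  "polyn p a x = (\<Sum>\<alpha>\<in>multi_idx p. a \<alpha> * monomial \<alpha> x)"

lemma poly_space_iff: "q \<in> poly_space p \<longleftrightarrow> (\<exists>a. q = polyn p a)"
  unfolding poly_space_def polyn_def[abs_def] multi_idx_def monomial_def[abs_def] by simp

lemma finite_multi_idx: "finite (multi_idx p :: ('n::finite \<Rightarrow> nat) set)"
proof (rule finite_subset)
  show "(multi_idx p :: ('n \<Rightarrow> nat) set) \<subseteq> PiE UNIV (\<lambda>_. {..p})"
  proof
    fix \<alpha> :: "'n \<Rightarrow> nat" assume "\<alpha> \<in> multi_idx p"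
    then have "\<alpha> i \<le> p" for i
      using member_le_sum[of i UNIV \<alpha>] by (auto simp: multi_idx_def intro: order_trans)
    then show "\<alpha> \<in> PiE UNIV (\<lambda>_. {..p})" by auto
  qed
qed (auto intro: finite_PiE)

lemma poly_space_lincomb:
  assumes "q \<in> poly_space p" "r \<in> poly_space p"
  shows "(\<lambda>x. \<alpha> * q x + \<beta> * r x) \<in> poly_space p"
proof -
  obtain a b where ab: "q = polyn p a" "r = polyn p b" using assms unfolding poly_space_iff by blast
  have "(\<lambda>x. \<alpha> * q x + \<beta> * r x) = polyn p (\<lambda>i. \<alpha> * a i + \<beta> * b i)"
    unfolding ab polyn_def by (auto simp: sum_distrib_left sum.distrib algebra_simps)
  then show ?thesis unfolding poly_space_iff by blast
qed

lemma poly_space_mono: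
  assumes "p \<le> p'"
  shows "poly_space p \<subseteq> (poly_space p' :: (real ^ 'n::finite \<Rightarrow> real) set)"
proof
  fix q :: "real ^ 'n \<Rightarrow> real" assume "q \<in> poly_space p"
  then obtain a where a: "q = polyn p a" unfolding poly_space_iff by blast
  have "polyn p a x = polyn p' (\<lambda>\<alpha>. if \<alpha> \<in> multi_idx p then a \<alpha> else 0) x" for x
    unfolding polyn_def
    by (rule sum.mono_neutral_cong_left[OF finite_multi_idx]) (use assms in \<open>auto simp: multi_idx_def\<close>)
  then have "q = polyn p' (\<lambda>\<alpha>. if \<alpha> \<in> multi_idx p then a \<alpha> else 0)" using a by auto
  then show "q \<in> poly_space p'" unfolding poly_space_iff by blast
qed

lemma poly_space_const: "(\<lambda>x::real^'a::finite. c) \<in> poly_space p"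
proof -
  have "(\<lambda>x::real^'a. c) = polyn 0 (\<lambda>_. c)"
  proof
    fix x :: "real ^ 'a"
    have "multi_idx 0 = {\<lambda>_::'a. 0 :: nat}" by (auto simp: multi_idx_def)
    then show "c = polyn 0 (\<lambda>_. c) x" by (simp add: polyn_def monomial_def)
  qed
  then have "(\<lambda>x::real^'a. c) \<in> poly_space 0" unfolding poly_space_iff by blast
  then show ?thesis using poly_space_mono[of 0 p] by blast
qed

lemma poly_space_sum:
  "(\<And>i. i \<in> I \<Longrightarrow> f i \<in> poly_space p) \<Longrightarrow> (\<lambda>x. \<Sum>i\<in>I. f i x) \<in> poly_space p"
proof (induction I rule: infinite_finite_induct)
  case (insert i I)
  then show ?case using poly_space_lincomb[of "f i" p "\<lambda>x. \<Sum>i\<in>I. f i x" 1 1] by simp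
qed (auto simp: poly_space_const)

lemma poly_space_scale: "q \<in> poly_space p \<Longrightarrow> (\<lambda>x. c * q x) \<in> poly_space p"
  using poly_space_lincomb[of q p q c 0] by simp

lemma monomial_in_poly_space: "(\<Sum>i\<in>UNIV. \<alpha> i) \<le> p \<Longrightarrow> monomial \<alpha> \<in> poly_space p"
proof -
  assume \<alpha>: "(\<Sum>i\<in>UNIV. \<alpha> i) \<le> p"
  have "monomial \<alpha> x = polyn p (\<lambda>\<beta>. if \<beta> = \<alpha> then 1 else 0) x" for x
  proof -
    have "polyn p (\<lambda>\<beta>. if \<beta> = \<alpha> then 1 else 0) x = (\<Sum>\<beta>\<in>multi_idx p. if \<beta> = \<alpha> then monomial \<beta> x else 0)"
      unfolding polyn_def by (intro sum.cong) auto
    moreover have "\<alpha> \<in> multi_idx p" using \<alpha> by (simp add: multi_idx_def)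
    ultimately show ?thesis by (simp add: finite_multi_idx sum.delta)
  qed
  then show ?thesis unfolding poly_space_iff by blast
qed

lemma poly_space_mult:
  assumes "q \<in> poly_space p" "r \<in> poly_space p'"
  shows "(\<lambda>x. q x * r x) \<in> poly_space (p + p')"
proof -
  obtain a b where ab: "q = polyn p a" "r = polyn p' b" using assms unfolding poly_space_iff by blast
  have eq: "(\<lambda>x. q x * r x) = (\<lambda>x. \<Sum>\<alpha>\<in>multi_idx p. \<Sum>\<beta>\<in>multi_idx p'. (a \<alpha> * b \<beta>) * monomial (\<lambda>i. \<alpha> i + \<beta> i) x)"
    unfolding ab polyn_def
    by (auto simp: sum_product monomial_def power_add prod.distrib mult_ac intro!: sum.cong)
  show ?thesis
    unfolding eq
    by (intro poly_space_sum poly_space_scale monomial_in_poly_space) (auto simp: multi_idx_def sum.distrib intro: add_mono)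
qed

lemma poly_space_power: "q \<in> poly_space 1 \<Longrightarrow> (\<lambda>x. q x ^ k) \<in> poly_space k"
proof (induction k)
  case (Suc k)
  then show ?case using poly_space_mult[of q 1 "\<lambda>x. q x ^ k" k] by simp
qed (simp add: poly_space_const)

lemma poly_space_prod:
  "(\<And>i. i \<in> I \<Longrightarrow> f i \<in> poly_space (d i)) \<Longrightarrow> (\<lambda>x. \<Prod>i\<in>I. f i x) \<in> poly_space (\<Sum>i\<in>I. d i)"
proof (induction I rule: infinite_finite_induct)
  case (insert i I)
  then show ?case using poly_space_mult[of "f i" "d i" "\<lambda>x. \<Prod>i\<in>I. f i x" "\<Sum>i\<in>I. d i"] by simp
qed (auto simp: poly_space_const)

lemma poly_space_coord: "(\<lambda>x. x $ i) \<in> poly_space 1"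
proof -
  have "monomial (\<lambda>j. if j = i then 1 else 0) \<in> poly_space 1"
    by (rule monomial_in_poly_space) simp
  moreover have "monomial (\<lambda>j. if j = i then 1 else 0) x = x $ i" for x
  proof -
    have "monomial (\<lambda>j. if j = i then 1 else 0) x = (\<Prod>j\<in>UNIV. if j = i then x $ j else 1)"
      unfolding monomial_def by (intro prod.cong) auto
    then show ?thesis by simp
  qed
  then have "monomial (\<lambda>j. if j = i then 1 else 0) = (\<lambda>x. x $ i)" by auto
  ultimately show ?thesis by simp
qed

lemma poly_space_affine:
  assumes "q \<in> poly_space p"
  shows "(\<lambda>y. q (x0 + R *\<^sub>R y)) \<in> poly_space p"
proof -
  obtain a where a: "q = polyn p a" using assms unfolding poly_space_iff by blast
  have "(\<lambda>y. monomial \<alpha> (x0 + R *\<^sub>R y)) \<in> poly_space p" if "\<alpha> \<in> multi_idx p" for \<alpha>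
  proof -
    have "(\<lambda>y. (x0 + R *\<^sub>R y) $ i) \<in> poly_space 1" for i
      using poly_space_lincomb[OF poly_space_const[of "x0 $ i" 1] poly_space_coord[of i], of 1 R] by simp
    then have "(\<lambda>y. monomial \<alpha> (x0 + R *\<^sub>R y)) \<in> poly_space (\<Sum>i\<in>UNIV. \<alpha> i)"
      unfolding monomial_def by (intro poly_space_prod poly_space_power)
    then show ?thesis using that poly_space_mono unfolding multi_idx_def by blast
  qed
  then show ?thesis unfolding a polyn_def by (intro poly_space_sum poly_space_scale)
qed

lemma smooth_monomial: "smooth (monomial \<alpha>)"
  unfolding monomial_def[abs_def] by (intro smooth_prod smooth_power smooth_coord)

lemma smooth_polyn: "smooth (polyn p a)"
  unfolding polyn_def[abs_def] by (intro smooth_sum smooth_mult smooth_const smooth_monomial)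

lemma smooth_poly_space: "q \<in> poly_space p \<Longrightarrow> smooth q"
  using smooth_polyn unfolding poly_space_iff by blast

lemma partial_line:
  fixes g :: "real ^ 'n \<Rightarrow> real"
  assumes "g differentiable (at (x + t *\<^sub>R axis i 1))"
  shows "((\<lambda>s. g (x + s *\<^sub>R axis i 1)) has_real_derivative partial i g (x + t *\<^sub>R axis i 1)) (at t)"
proof -
  obtain g' where g': "(g has_derivative g') (at (x + t *\<^sub>R axis i 1))"
    using assms unfolding differentiable_def by blast
  have "((\<lambda>s. x + s *\<^sub>R axis i (1::real)) has_derivative (\<lambda>h. h *\<^sub>R axis i 1)) (at t)"
    by (auto intro!: derivative_eq_intros)
  from has_derivative_compose[OF this g']
  have "((\<lambda>s. g (x + s *\<^sub>R axis i 1)) has_derivative (\<lambda>h. g' (h *\<^sub>R axis i 1))) (at t)" .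
  moreover have "g' (h *\<^sub>R axis i 1) = partial i g (x + t *\<^sub>R axis i 1) * h" for h
    using partial_has_derivative[OF g', of i] has_derivative_bounded_linear[OF g']
    by (simp add: linear_simps(5) mult.commute)
  ultimately show ?thesis by (simp add: has_field_derivative_def)
qed

text \<open>Restriction to a coordinate line reduces this to a power of one variable. If
  \<open>\<alpha> i = 0\<close>, the truncated exponent is multiplied by zero.\<close>

lemma partial_monomial: "partial i (monomial \<alpha>) x = real (\<alpha> i) * monomial (\<alpha>(i := \<alpha> i - 1)) x"
proof -
  define C where "C = (\<Prod>j\<in>UNIV - {i}. (x $ j) ^ \<alpha> j)"
  have split: "monomial \<beta> y = (y $ i) ^ \<beta> i * (\<Prod>j\<in>UNIV - {i}. (y $ j) ^ \<beta> j)" for \<beta> y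
    unfolding monomial_def by (simp add: prod.remove[of UNIV i])
  have "((\<lambda>s. monomial \<alpha> (x + s *\<^sub>R axis i 1)) has_real_derivative partial i (monomial \<alpha>) (x + 0 *\<^sub>R axis i 1)) (at 0)"
    by (rule partial_line) (rule smooth_differentiable[OF smooth_monomial])
  moreover have "(\<lambda>s. monomial \<alpha> (x + s *\<^sub>R axis i 1)) = (\<lambda>s. (x $ i + s) ^ \<alpha> i * C)"
  proof
    fix s
    have "(\<Prod>j\<in>UNIV - {i}. ((x + s *\<^sub>R axis i 1) $ j) ^ \<alpha> j) = C"
      unfolding C_def by (intro prod.cong) (auto simp: axis_def)
    then show "monomial \<alpha> (x + s *\<^sub>R axis i 1) = (x $ i + s) ^ \<alpha> i * C"
      unfolding split by (simp add: axis_def)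
  qed
  moreover have "((\<lambda>s. (x $ i + s) ^ \<alpha> i * C) has_real_derivative real (\<alpha> i) * (x $ i + 0) ^ (\<alpha> i - 1) * C) (at 0)"
    by (auto intro!: derivative_eq_intros)
  ultimately have "partial i (monomial \<alpha>) x = real (\<alpha> i) * (x $ i) ^ (\<alpha> i - 1) * C"
    using DERIV_unique by fastforce
  moreover have "(\<Prod>j\<in>UNIV - {i}. (x $ j) ^ (\<alpha>(i := \<alpha> i - 1)) j) = C"
    unfolding C_def by (intro prod.cong) auto
  ultimately show ?thesis unfolding split by simp
qed

lemma partial_polyn: "partial i (polyn p a) x = (\<Sum>\<alpha>\<in>multi_idx p. a \<alpha> * (real (\<alpha> i) * monomial (\<alpha>(i := \<alpha> i - 1)) x))"
proof -
  have d: "(polyn p a has_derivative (\<lambda>h. \<Sum>\<alpha>\<in>multi_idx p. a \<alpha> * (\<Sum>j\<in>UNIV. h $ j * partial j (monomial \<alpha>) x))) (at x)"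
    unfolding polyn_def[abs_def]
    by (intro has_derivative_sum has_derivative_mult_right has_derivative_partial smooth_differentiable smooth_monomial)
  have "(\<Sum>j\<in>UNIV. axis i 1 $ j * partial j (monomial \<alpha>) x) = partial i (monomial \<alpha>) x" for \<alpha>
  proof -
    have "(\<Sum>j\<in>UNIV. axis i 1 $ j * partial j (monomial \<alpha>) x) = (\<Sum>j\<in>UNIV. if j = i then partial j (monomial \<alpha>) x else 0)"
      by (intro sum.cong) (auto simp: axis_def)
    then show ?thesis by simp
  qed
  then show ?thesis using partial_has_derivative[OF d, of i] by (simp add: partial_monomial)
qed

lemma poly_space_partial: "q \<in> poly_space p \<Longrightarrow> partial i q \<in> poly_space p"
proof -
  assume "q \<in> poly_space p"
  then obtain a where a: "q = polyn p a" unfolding poly_space_iff by blast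
  have "monomial (\<alpha>(i := \<alpha> i - 1)) \<in> poly_space p" if "\<alpha> \<in> multi_idx p" for \<alpha>
  proof (rule monomial_in_poly_space)
    have "(\<Sum>j\<in>UNIV. (\<alpha>(i := \<alpha> i - 1)) j) \<le> (\<Sum>j\<in>UNIV. \<alpha> j)" by (intro sum_mono) auto
    then show "(\<Sum>j\<in>UNIV. (\<alpha>(i := \<alpha> i - 1)) j) \<le> p" using that by (auto simp: multi_idx_def)
  qed
  then have "(\<lambda>x. \<Sum>\<alpha>\<in>multi_idx p. a \<alpha> * (real (\<alpha> i) * monomial (\<alpha>(i := \<alpha> i - 1)) x)) \<in> poly_space p"
    by (intro poly_space_sum poly_space_scale)
  then show ?thesis unfolding a partial_polyn[abs_def] .
qed

text \<open>In contrast to \<open>partial_polyn\<close>, the degree drops and the new coefficients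
  are visible; a nonzero nonconstant coefficient survives in some partial derivative.\<close>

lemma partial_polyn_Suc:
  "partial i (polyn (Suc p) a) x = polyn p (\<lambda>\<beta>. real (Suc (\<beta> i)) * a (\<beta>(i := Suc (\<beta> i)))) x"
proof -
  have S: "(\<Sum>j\<in>UNIV. (\<beta>(i := k)) j) = k + (\<Sum>j\<in>UNIV - {i}. \<beta> j)" for \<beta> and k :: nat
    by (simp add: sum.remove[of UNIV i])
  have S': "(\<Sum>j\<in>UNIV. \<beta> j) = \<beta> i + (\<Sum>j\<in>UNIV - {i}. \<beta> j)" for \<beta> :: "'a \<Rightarrow> nat"
    by (simp add: sum.remove[of UNIV i])
  have "partial i (polyn (Suc p) a) x =
      (\<Sum>\<alpha>\<in>{\<alpha>\<in>multi_idx (Suc p). \<alpha> i > 0}. a \<alpha> * (real (\<alpha> i) * monomial (\<alpha>(i := \<alpha> i - 1)) x))"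
    unfolding partial_polyn by (rule sum.mono_neutral_right) (auto simp: finite_multi_idx)
  also have "\<dots> = (\<Sum>\<beta>\<in>multi_idx p. (real (Suc (\<beta> i)) * a (\<beta>(i := Suc (\<beta> i)))) * monomial \<beta> x)"
  proof (rule sum.reindex_bij_witness[of _ "\<lambda>\<beta>. \<beta>(i := Suc (\<beta> i))" "\<lambda>\<alpha>. \<alpha>(i := \<alpha> i - 1)"])
    fix \<alpha> assume "\<alpha> \<in> {\<alpha>\<in>multi_idx (Suc p). \<alpha> i > 0}"
    then show "\<alpha>(i := \<alpha> i - 1) \<in> multi_idx p" using S'[of \<alpha>] unfolding multi_idx_def S mem_Collect_eq by linarith
  next
    fix \<beta> :: "'a \<Rightarrow> nat" assume "\<beta> \<in> multi_idx p"
    then show "\<beta>(i := Suc (\<beta> i)) \<in> {\<alpha>\<in>multi_idx (Suc p). \<alpha> i > 0}"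
      using S'[of \<beta>] unfolding multi_idx_def S mem_Collect_eq by simp
  qed auto
  finally show ?thesis unfolding polyn_def .
qed

section \<open>Zero sets of polynomials\<close>

text \<open>Packing by translation invariance. Arbitrarily many translates in one ball force measure
  zero; a controlled number of translates of a simplex bounds its edges from below.\<close>

lemma measure_disjoint_translates:
  fixes E B :: "'a::euclidean_space set"
  assumes E: "E \<in> lmeasurable" and B: "B \<in> lmeasurable" and I: "finite I"
    and sub: "\<And>d. d \<in> I \<Longrightarrow> (+) d ` E \<subseteq> B"
    and dj: "\<And>d d'. d \<in> I \<Longrightarrow> d' \<in> I \<Longrightarrow> d \<noteq> d' \<Longrightarrow> negligible ((+) d ` E \<inter> (+) d' ` E)"
  shows "real (card I) * measure lebesgue E \<le> measure lebesgue B"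
proof -
  have m: "(+) d ` E \<in> lmeasurable" for d using E by (rule measurable_translation)
  have "measure lebesgue (\<Union>((\<lambda>d. (+) d ` E) ` I)) = (\<Sum>d\<in>I. measure lebesgue ((+) d ` E))"
    using dj by (intro measure_negligible_finite_Union_image I m) (auto simp: pairwise_def)
  also have "\<dots> = real (card I) * measure lebesgue E" by (simp add: measure_translation)
  finally have "real (card I) * measure lebesgue E = measure lebesgue (\<Union>((\<lambda>d. (+) d ` E) ` I))" by simp
  also have "\<dots> \<le> measure lebesgue B"
    by (rule measure_mono_fmeasurable[OF _ _ B])
      (use sub I m in \<open>auto intro!: fmeasurableD fmeasurable.finite_UN\<close>)
  finally show ?thesis .
qed

text \<open>The translates by \<open>v / (n + 1)\<close> are pairwise disjoint, since a common point
  would give two points of \<open>E\<close> on one line in direction \<open>v\<close>. All of them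
  fit into one ball, so no positive measure is possible.\<close>

lemma negligible_meets_lines_once:
  fixes E :: "'a::euclidean_space set"
  assumes E: "E \<in> sets lebesgue" "bounded E" and v: "v \<noteq> 0"
    and line: "\<And>y t. y \<in> E \<Longrightarrow> y + t *\<^sub>R v \<in> E \<Longrightarrow> t = 0"
  shows "negligible E"
proof -
  obtain R where R: "\<And>x. x \<in> E \<Longrightarrow> norm x \<le> R" using E(2) unfolding bounded_iff by blast
  have Em: "E \<in> lmeasurable" using E bounded_set_imp_lmeasurable by blast
  let ?B = "cball 0 (R + norm v) :: 'a set"
  have N: "real N * measure lebesgue E \<le> measure lebesgue ?B" for N
  proof -
    define I where "I = (\<lambda>n. (1 / real (Suc n)) *\<^sub>R v) ` {..<N}"
    have inj: "inj_on (\<lambda>n. (1 / real (Suc n)) *\<^sub>R v) {..<N}"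
      using v by (auto simp: inj_on_def)
    have "real (card I) * measure lebesgue E \<le> measure lebesgue ?B"
    proof (rule measure_disjoint_translates[OF Em])
      fix d assume "d \<in> I"
      then obtain n where d: "d = (1 / real (Suc n)) *\<^sub>R v" by (auto simp: I_def)
      have "norm d \<le> norm v" unfolding d by (simp add: divide_simps) (simp add: mult_le_cancel_right1 algebra_simps)
      then show "(+) d ` E \<subseteq> ?B" using R by (auto intro!: norm_triangle_le add_mono simp: add.commute)
    next
      fix d d' assume dd: "d \<in> I" "d' \<in> I" "d \<noteq> d'"
      obtain t t' where t: "d = t *\<^sub>R v" "d' = t' *\<^sub>R v" using dd unfolding I_def by auto
      have "(+) d ` E \<inter> (+) d' ` E = {}"
      proof (rule ccontr)
        assume "(+) d ` E \<inter> (+) d' ` E \<noteq> {}"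
        then obtain y z where yz: "y \<in> E" "z \<in> E" "d + y = d' + z" by auto
        then have "y + (t - t') *\<^sub>R v = z" unfolding t by (simp add: algebra_simps)
        then have "t - t' = 0" using line[OF yz(1), of "t - t'"] yz(2) by simp
        then show False using dd(3) t by simp
      qed
      then show "negligible ((+) d ` E \<inter> (+) d' ` E)" by simp
    qed (auto simp: I_def)
    then show ?thesis unfolding I_def using inj by (simp add: card_image)
  qed
  have "measure lebesgue E = 0"
  proof (rule ccontr)
    assume "measure lebesgue E \<noteq> 0"
    then have pos: "measure lebesgue E > 0" by (simp add: less_le)
    obtain N :: nat where "measure lebesgue ?B / measure lebesgue E < real N" using reals_Archimedean2 by blast
    then show False using N[of N] pos by (simp add: field_simps)
  qed
  then show ?thesis using Em by (simp add: negligible_iff_measure0)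
qed

text \<open>Near such a zero the \<open>i\<close>-th partial derivative has no zeros, so by the mean
  value theorem each line in direction \<open>i\<close> meets the zero set at most once within a
  small ball.\<close>

lemma negligible_transversal_zeros:
  fixes g :: "real ^ 'n \<Rightarrow> real"
  assumes g: "smooth g"
  shows "negligible {x. g x = 0 \<and> partial i g x \<noteq> 0}"
proof (subst locally_negligible_alt, rule ballI)
  let ?S = "{x. g x = 0 \<and> partial i g x \<noteq> 0}"
  fix x assume x: "x \<in> ?S"
  have c: "continuous_on UNIV g" "continuous_on UNIV (partial i g)"
    using g smooth_partial smooth_continuous_on by blast+
  have op: "open {x. partial i g x \<noteq> 0}" using c(2) by (intro open_Collect_neq continuous_intros)
  then obtain r where r: "r > 0" "ball x r \<subseteq> {x. partial i g x \<noteq> 0}"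
    using x unfolding open_contains_ball by blast
  let ?U = "?S \<inter> ball x r"
  have "negligible ?U"
  proof (rule negligible_meets_lines_once)
    have "closed {x. g x = 0}" using c(1) by (intro closed_Collect_eq continuous_intros)
    then have "{x. g x = 0} \<in> sets lebesgue" "{x. partial i g x \<noteq> 0} \<in> sets lebesgue" "ball x r \<in> sets lebesgue"
      using op by (auto intro: closed_in_lebesgue open_in_lebesgue)
    moreover have "?U = {x. g x = 0} \<inter> {x. partial i g x \<noteq> 0} \<inter> ball x r" by auto
    ultimately show "?U \<in> sets lebesgue" by (simp only:) (intro sets.Int)
    show "bounded ?U" by (rule bounded_subset[OF bounded_ball]) auto
    show "axis i (1::real) \<noteq> 0" by (simp add: axis_eq_0_iff)
    fix y t assume y: "y \<in> ?U" and yt: "y + t *\<^sub>R axis i 1 \<in> ?U"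
    have line: "((\<lambda>s. g (y + s *\<^sub>R axis i 1)) has_real_derivative partial i g (y + s *\<^sub>R axis i 1)) (at s)" for s
      by (rule partial_line) (rule smooth_differentiable[OF g])
    show "t = 0"
    proof (rule ccontr)
      assume "t \<noteq> 0"
      define l u where "l = min 0 t" and "u = max 0 t"
      have lu: "l < u" using \<open>t \<noteq> 0\<close> by (auto simp: l_def u_def)
      have ends: "g (y + l *\<^sub>R axis i 1) = g (y + u *\<^sub>R axis i 1)"
        using y yt by (auto simp: l_def u_def min_def max_def)
      obtain z where z: "l < z" "z < u" "g (y + u *\<^sub>R axis i 1) - g (y + l *\<^sub>R axis i 1) = (u - l) * partial i g (y + z *\<^sub>R axis i 1)"
        using MVT2[OF lu, of "\<lambda>s. g (y + s *\<^sub>R axis i 1)" "\<lambda>s. partial i g (y + s *\<^sub>R axis i 1)"] line by blast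
      then have p0: "partial i g (y + z *\<^sub>R axis i 1) = 0" using ends lu by simp
      \<comment> \<open>The intermediate point is a convex combination of two zeros in the ball,
        hence it lies in the ball, where the partial derivative cannot vanish.\<close>
      define s where "s = z / t"
      have s: "0 \<le> s" "s \<le> 1" using z \<open>t \<noteq> 0\<close> unfolding s_def l_def u_def
        by (auto simp: min_def max_def divide_simps split: if_splits)
      have "y + z *\<^sub>R axis i 1 = (1 - s) *\<^sub>R y + s *\<^sub>R (y + t *\<^sub>R axis i 1)"
        using \<open>t \<noteq> 0\<close> by (simp add: s_def algebra_simps)
      moreover have "(1 - s) *\<^sub>R y + s *\<^sub>R (y + t *\<^sub>R axis i 1) \<in> ball x r"
        using convexD_alt[OF convex_ball, of y x r "y + t *\<^sub>R axis i 1" s] s y yt by blast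
      ultimately have "y + z *\<^sub>R axis i 1 \<in> ball x r" by simp
      then show False using r(2) p0 by blast
    qed
  qed
  moreover have "openin (top_of_set ?S) ?U" by (simp add: openin_open_Int)
  ultimately show "\<exists>U. openin (top_of_set ?S) U \<and> x \<in> U \<and> negligible U"
    using x r(1) by (intro exI[of _ ?U]) simp
qed

text \<open>Induction on the degree: a zero is either transversal for a suitable coordinate or also
  a zero of a nontrivial partial derivative of lower degree.\<close>

lemma negligible_polyn_zeros:
  assumes "\<alpha> \<in> multi_idx p" "a \<alpha> \<noteq> 0"
  shows "negligible {x. polyn p a x = 0}"
  using assms
proof (induction p arbitrary: a \<alpha>)
  case 0
  have "multi_idx 0 = {\<lambda>_::'a. 0 :: nat}" by (auto simp: multi_idx_def)
  then show ?case using 0 by (simp add: polyn_def monomial_def)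
next
  case (Suc p)
  show ?case
  proof (cases "\<exists>\<beta> i. \<beta> \<in> multi_idx (Suc p) \<and> a \<beta> \<noteq> 0 \<and> \<beta> i > 0")
    case True
    then obtain \<beta> i where \<beta>: "\<beta> \<in> multi_idx (Suc p)" "a \<beta> \<noteq> 0" "\<beta> i > 0" by blast
    let ?a = "\<lambda>\<beta>. real (Suc (\<beta> i)) * a (\<beta>(i := Suc (\<beta> i)))"
    have m: "\<beta>(i := \<beta> i - 1) \<in> multi_idx p"
    proof -
      have "(\<Sum>j\<in>UNIV. (\<beta>(i := \<beta> i - 1)) j) = \<beta> i - 1 + (\<Sum>j\<in>UNIV - {i}. \<beta> j)"
        by (simp add: sum.remove[of UNIV i])
      moreover have "(\<Sum>j\<in>UNIV. \<beta> j) = \<beta> i + (\<Sum>j\<in>UNIV - {i}. \<beta> j)" by (simp add: sum.remove[of UNIV i])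
      ultimately show ?thesis using \<beta> unfolding multi_idx_def by simp
    qed
    have "?a (\<beta>(i := \<beta> i - 1)) \<noteq> 0" using \<beta> by simp
    then have "negligible {x. polyn p ?a x = 0}" by (rule Suc.IH[OF m])
    moreover have "{x. polyn (Suc p) a x = 0} \<subseteq> {x. polyn p ?a x = 0} \<union>
        {x. polyn (Suc p) a x = 0 \<and> partial i (polyn (Suc p) a) x \<noteq> 0}"
      by (auto simp: partial_polyn_Suc)
    ultimately show ?thesis
      using negligible_transversal_zeros[OF smooth_polyn, of "Suc p" a i] negligible_Un negligible_subset by blast
  next
    \<comment> \<open>Only the constant coefficient is nonzero, so there are no zeros at
      all.\<close>
    case False
    have "\<alpha> = (\<lambda>_. 0)" using False Suc.prems by fastforce
    then have a0: "a (\<lambda>_. 0) \<noteq> 0" using Suc.prems by simp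
    have "polyn (Suc p) a x = a (\<lambda>_. 0)" for x
    proof -
      have "polyn (Suc p) a x = (\<Sum>\<beta>\<in>{\<lambda>_. 0}. a \<beta> * monomial \<beta> x)"
        unfolding polyn_def
      proof (rule sum.mono_neutral_right[OF finite_multi_idx])
        show "\<forall>\<beta>\<in>multi_idx (Suc p) - {\<lambda>_. 0}. a \<beta> * monomial \<beta> x = 0"
          using False by fastforce
      qed (auto simp: multi_idx_def)
      then show ?thesis by (simp add: monomial_def)
    qed
    then show ?thesis using a0 by simp
  qed
qed

text \<open>The difference would otherwise have a null zero set. This makes the choice in
  \<open>elem_poly\<close> a determinate polynomial.\<close>

lemma poly_space_unique:
  assumes "q \<in> poly_space p" "r \<in> poly_space p" and T: "T \<in> sets lebesgue" "\<not> negligible T"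
    and ae: "AE x in lebesgue_on T. q x = r x"
  shows "q = r"
proof -
  have "(\<lambda>x. 1 * q x + (-1) * r x) \<in> poly_space p" by (rule poly_space_lincomb[OF assms(1,2)])
  then obtain a where a: "(\<lambda>x. 1 * q x + (-1) * r x) = polyn p a" unfolding poly_space_iff by blast
  have a': "polyn p a x = q x - r x" for x using fun_cong[OF a, of x] by simp
  have "\<forall>\<alpha>\<in>multi_idx p. a \<alpha> = 0"
  proof (rule ccontr)
    assume "\<not> (\<forall>\<alpha>\<in>multi_idx p. a \<alpha> = 0)"
    then have n: "negligible {x. polyn p a x = 0}" using negligible_polyn_zeros by blast
    have "AE x in lebesgue. x \<in> T \<longrightarrow> q x = r x" using ae T by (simp add: AE_lebesgue_on_iff)
    then obtain N where N: "N \<in> null_sets lebesgue" "{x. \<not> (x \<in> T \<longrightarrow> q x = r x)} \<subseteq> N"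
      by (auto simp: eventually_ae_filter)
    have "T \<subseteq> {x. polyn p a x = 0} \<union> N" using N(2) a' by auto
    moreover have "negligible N" using N(1) by (simp add: negligible_iff_null_sets)
    ultimately have "negligible T" using n negligible_Un negligible_subset by blast
    then show False using T(2) by blast
  qed
  then have "polyn p a x = 0" for x by (simp add: polyn_def)
  then show ?thesis using a' by (intro ext) simp
qed

section \<open>Inverse estimates\<close>

lemma monomial_le_1: "x \<in> cball 0 1 \<Longrightarrow> \<bar>monomial \<alpha> x\<bar> \<le> 1"
proof -
  assume "x \<in> cball 0 1"
  then have "\<bar>x $ i\<bar> \<le> 1" for i using component_le_norm_cart[of x i] by simp
  then show ?thesis unfolding monomial_def abs_prod
    by (intro prod_le_1) (auto simp: power_abs power_le_one)
qed

text \<open>The closed sublevel sets in the unit ball decrease to a part of the zero set, which is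
  null; measure is continuous along them.\<close>

lemma small_sublevel_single:
  assumes \<epsilon>: "\<epsilon> > 0" and l: "\<alpha> \<in> multi_idx p" "l \<alpha> \<noteq> 0"
  shows "\<exists>\<delta>>0. measure lebesgue {x \<in> cball 0 1. \<bar>polyn p l x\<bar> \<le> \<delta>} < \<epsilon>"
proof -
  define A where "A n = {x \<in> cball 0 1. \<bar>polyn p l x\<bar> \<le> 1 / real (Suc n)}" for n
  have c: "continuous_on UNIV (polyn p l)" by (rule smooth_continuous_on[OF smooth_polyn])
  have "closed {x. \<bar>polyn p l x\<bar> \<le> 1 / real (Suc n)}" for n
    using c by (intro closed_Collect_le continuous_intros)
  moreover have "A n = cball 0 1 \<inter> {x. \<bar>polyn p l x\<bar> \<le> 1 / real (Suc n)}" for n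
    unfolding A_def by blast
  ultimately have "compact (A n)" for n
    by (simp only:) (rule compact_Int_closed[OF compact_cball])
  then have Am: "A n \<in> lmeasurable" for n by (rule lmeasurable_compact)
  have lim: "(\<lambda>n. measure lebesgue (A n)) \<longlonglongrightarrow> measure lebesgue (\<Inter>n. A n)"
  proof (rule Lim_measure_decseq)
    show "decseq A"
    proof (rule decseq_SucI)
      fix n
      have "1 / real (Suc (Suc n)) \<le> 1 / real (Suc n)" by (simp add: field_simps)
      then show "A (Suc n) \<subseteq> A n" unfolding A_def by fastforce
    qed
    show "emeasure lebesgue (A i) \<noteq> \<infinity>" for i using fmeasurableD2[OF Am] by simp
  qed (use Am in \<open>auto intro: fmeasurableD\<close>)
  have "(\<Inter>n. A n) \<subseteq> {x. polyn p l x = 0}"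
  proof
    fix x assume "x \<in> (\<Inter>n. A n)"
    then have "\<bar>polyn p l x\<bar> \<le> 1 / real (Suc n)" for n unfolding A_def by blast
    then have "\<bar>polyn p l x\<bar> \<le> 0"
      using LIMSEQ_le_const[OF LIMSEQ_inverse_real_of_nat, of "\<bar>polyn p l x\<bar>"] by (auto simp: inverse_eq_divide)
    then show "x \<in> {x. polyn p l x = 0}" by simp
  qed
  then have "negligible (\<Inter>n. A n)" by (rule negligible_subset[OF negligible_polyn_zeros[of \<alpha> p l, OF l]])
  then have "measure lebesgue (\<Inter>n. A n) = 0" by (rule negligible_imp_measure0)
  then have "eventually (\<lambda>n. measure lebesgue (A n) < \<epsilon>) sequentially"
    using lim \<epsilon> order_tendstoD(2) by metis
  then obtain n where "measure lebesgue (A n) < \<epsilon>" unfolding eventually_sequentially by blast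
  moreover have "1 / real (Suc n) > 0" by simp
  ultimately show ?thesis unfolding A_def by blast
qed

text \<open>Compactness of the set of normalized coefficient vectors makes the previous lemma uniform.\<close>

lemma small_sublevel:
  fixes \<epsilon> :: real
  assumes \<epsilon>: "\<epsilon> > 0"
  shows "\<exists>\<kappa>>0. \<forall>a :: ('n::finite \<Rightarrow> nat) \<Rightarrow> real. (\<forall>\<alpha>\<in>multi_idx p. \<bar>a \<alpha>\<bar> \<le> 1) \<longrightarrow> (\<exists>\<alpha>\<in>multi_idx p. \<bar>a \<alpha>\<bar> = 1) \<longrightarrow>
     measure lebesgue {x \<in> cball 0 1. \<bar>polyn p a x\<bar> < \<kappa>} < \<epsilon>"
proof (rule ccontr)
  let ?I = "multi_idx p :: ('n \<Rightarrow> nat) set"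
  assume neg: "\<not> ?thesis"
  have "\<exists>a. (\<forall>\<alpha>\<in>?I. \<bar>a \<alpha>\<bar> \<le> 1) \<and> (\<exists>\<alpha>\<in>?I. \<bar>a \<alpha>\<bar> = 1) \<and>
     \<not> measure lebesgue {x \<in> cball 0 1. \<bar>polyn p a x\<bar> < 1 / real (Suc n)} < \<epsilon>" for n
  proof -
    have "1 / real (Suc n) > 0" by simp
    then show ?thesis using neg by blast
  qed
  then have "\<forall>n. \<exists>a. (\<forall>\<alpha>\<in>?I. \<bar>a \<alpha>\<bar> \<le> 1) \<and> (\<exists>\<alpha>\<in>?I. \<bar>a \<alpha>\<bar> = 1) \<and>
     \<not> measure lebesgue {x \<in> cball 0 1. \<bar>polyn p a x\<bar> < 1 / real (Suc n)} < \<epsilon>" by blast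
  from choice[OF this] obtain f where "\<forall>n. (\<forall>\<alpha>\<in>?I. \<bar>f n \<alpha>\<bar> \<le> 1) \<and> (\<exists>\<alpha>\<in>?I. \<bar>f n \<alpha>\<bar> = 1) \<and>
     \<not> measure lebesgue {x \<in> cball 0 1. \<bar>polyn p (f n) x\<bar> < 1 / real (Suc n)} < \<epsilon>" by blast
  then have f: "\<And>n \<alpha>. \<alpha> \<in> ?I \<Longrightarrow> \<bar>f n \<alpha>\<bar> \<le> 1" "\<And>n. \<exists>\<alpha>\<in>?I. \<bar>f n \<alpha>\<bar> = 1"
    "\<And>n. \<epsilon> \<le> measure lebesgue {x \<in> cball 0 1. \<bar>polyn p (f n) x\<bar> < 1 / real (Suc n)}"
    unfolding not_less by blast+
  have bd: "bounded ((\<lambda>x. x \<alpha>) ` range f)" if "\<alpha> \<in> ?I" for \<alpha>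
    unfolding bounded_iff using f(1)[OF that] by auto
  \<comment> \<open>Bolzano-Weierstrass in the finitely many coordinates \<open>multi_idx p\<close>,
    the only ones that enter \<open>polyn\<close>.\<close>
  obtain l r where r: "strict_mono (r :: nat \<Rightarrow> nat)"
    and conv: "\<And>e. e > 0 \<Longrightarrow> eventually (\<lambda>n. \<forall>\<alpha>\<in>?I. dist (f (r n) \<alpha>) (l \<alpha>) < e) sequentially"
    using compact_lemma_general[where proj = "\<lambda>f \<alpha>. f \<alpha>" and unproj = "\<lambda>f. f" and f = f, OF finite_multi_idx bd]
    by blast
  \<comment> \<open>The limit is nontrivial: some coefficient of absolute value 1 is within distance
    less than 1 of its limit.\<close>
  obtain \<alpha> where \<alpha>: "\<alpha> \<in> ?I" "l \<alpha> \<noteq> 0"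
  proof -
    obtain n where n: "\<forall>\<alpha>\<in>?I. dist (f (r n) \<alpha>) (l \<alpha>) < 1"
      using conv[of 1] unfolding eventually_sequentially by auto
    obtain \<alpha> where a: "\<alpha> \<in> ?I" "\<bar>f (r n) \<alpha>\<bar> = 1" using f(2) by blast
    have "l \<alpha> \<noteq> 0" using n a by (auto simp: dist_real_def)
    then show ?thesis using that a by blast
  qed
  obtain \<delta> where \<delta>: "\<delta> > 0" "measure lebesgue {x \<in> cball 0 1. \<bar>polyn p l x\<bar> \<le> \<delta>} < \<epsilon>"
    using small_sublevel_single[OF \<epsilon> \<alpha>(1), of l, OF \<alpha>(2)] by blast
  \<comment> \<open>Monomials are at most 1 on the unit ball, so coefficient errors below
    \<open>\<delta> / (2 * N)\<close> change the polynomial by at most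
    \<open>\<delta> / 2\<close>.\<close>
  define N where "N = real (card ?I) + 1"
  have N: "N > 0" by (simp add: N_def)
  have "eventually (\<lambda>n. \<forall>\<alpha>\<in>?I. dist (f (r n) \<alpha>) (l \<alpha>) < \<delta> / (2 * N)) sequentially"
    using conv \<delta> N by simp
  then obtain n0 where n0: "\<And>n. n \<ge> n0 \<Longrightarrow> \<forall>\<alpha>\<in>?I. dist (f (r n) \<alpha>) (l \<alpha>) < \<delta> / (2 * N)"
    unfolding eventually_sequentially by blast
  obtain n1 :: nat where n1: "2 / \<delta> < real n1" using reals_Archimedean2 by blast
  define n where "n = max n0 n1"
  have rn: "n \<le> r n" using r by (rule seq_suble)
  have small: "1 / real (Suc (r n)) \<le> \<delta> / 2"
  proof -
    have "2 / \<delta> < real (Suc (r n))" using n1 rn by (simp add: n_def)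
    then show ?thesis using \<delta>(1) by (simp add: field_simps)
  qed
  have "{x \<in> cball 0 1. \<bar>polyn p (f (r n)) x\<bar> < 1 / real (Suc (r n))} \<subseteq> {x \<in> cball 0 1. \<bar>polyn p l x\<bar> \<le> \<delta>}"
  proof
    fix x assume "x \<in> {x \<in> cball 0 1. \<bar>polyn p (f (r n)) x\<bar> < 1 / real (Suc (r n))}"
    then have x: "x \<in> cball 0 1" "\<bar>polyn p (f (r n)) x\<bar> \<le> \<delta> / 2" using small by auto
    have "\<bar>polyn p (f (r n)) x - polyn p l x\<bar> = \<bar>\<Sum>\<alpha>\<in>?I. (f (r n) \<alpha> - l \<alpha>) * monomial \<alpha> x\<bar>"
      unfolding polyn_def by (simp add: sum_subtractf[symmetric] left_diff_distrib)
    also have "\<dots> \<le> (\<Sum>\<alpha>\<in>?I. \<bar>(f (r n) \<alpha> - l \<alpha>) * monomial \<alpha> x\<bar>)" by (rule sum_abs)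
    also have "\<dots> \<le> (\<Sum>\<alpha>\<in>?I. \<delta> / (2 * N))"
    proof (rule sum_mono)
      fix \<alpha> assume a: "\<alpha> \<in> ?I"
      have "\<bar>f (r n) \<alpha> - l \<alpha>\<bar> \<le> \<delta> / (2 * N)" using n0[of n] a by (auto simp: n_def dist_real_def less_imp_le)
      then have "\<bar>f (r n) \<alpha> - l \<alpha>\<bar> * \<bar>monomial \<alpha> x\<bar> \<le> \<delta> / (2 * N) * 1"
        using monomial_le_1[OF x(1)] \<delta>(1) N by (intro mult_mono) auto
      then show "\<bar>(f (r n) \<alpha> - l \<alpha>) * monomial \<alpha> x\<bar> \<le> \<delta> / (2 * N)" by (simp add: abs_mult)
    qed
    also have "\<dots> = (N - 1) * (\<delta> / (2 * N))" by (simp add: N_def)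
    also have "\<dots> \<le> N * (\<delta> / (2 * N))" using \<delta>(1) N by (intro mult_right_mono) auto
    also have "\<dots> = \<delta> / 2" using N by simp
    finally have "\<bar>polyn p (f (r n)) x - polyn p l x\<bar> \<le> \<delta> / 2" .
    then have "\<bar>polyn p l x\<bar> \<le> \<delta>" using x(2) by linarith
    then show "x \<in> {x \<in> cball 0 1. \<bar>polyn p l x\<bar> \<le> \<delta>}" using x(1) by blast
  qed
  moreover have "{x \<in> cball 0 1. \<bar>polyn p l x\<bar> \<le> \<delta>} \<in> lmeasurable"
  proof (rule lmeasurable_compact)
    have "closed {x. \<bar>polyn p l x\<bar> \<le> \<delta>}"
      by (intro closed_Collect_le continuous_intros smooth_continuous_on[OF smooth_polyn])
    moreover have "{x \<in> cball 0 1. \<bar>polyn p l x\<bar> \<le> \<delta>} = cball 0 1 \<inter> {x. \<bar>polyn p l x\<bar> \<le> \<delta>}" by blast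
    ultimately show "compact {x \<in> cball 0 1. \<bar>polyn p l x\<bar> \<le> \<delta>}"
      by (simp only:) (rule compact_Int_closed[OF compact_cball])
  qed
  moreover have "{x \<in> cball 0 1. \<bar>polyn p (f (r n)) x\<bar> < 1 / real (Suc (r n))} \<in> sets lebesgue"
  proof -
    have "open {x. \<bar>polyn p (f (r n)) x\<bar> < 1 / real (Suc (r n))}"
      by (intro open_Collect_less continuous_intros smooth_continuous_on[OF smooth_polyn])
    then have "cball 0 1 \<inter> {x. \<bar>polyn p (f (r n)) x\<bar> < 1 / real (Suc (r n))} \<in> sets lebesgue"
      by (intro sets.Int closed_in_lebesgue open_in_lebesgue) auto
    moreover have "{x \<in> cball 0 1. \<bar>polyn p (f (r n)) x\<bar> < 1 / real (Suc (r n))} =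
      cball 0 1 \<inter> {x. \<bar>polyn p (f (r n)) x\<bar> < 1 / real (Suc (r n))}" by blast
    ultimately show ?thesis by simp
  qed
  ultimately have "measure lebesgue {x \<in> cball 0 1. \<bar>polyn p (f (r n)) x\<bar> < 1 / real (Suc (r n))} < \<epsilon>"
    using measure_mono_fmeasurable \<delta>(2) by (metis (no_types, lifting) le_less_trans)
  then show False using f(3)[of "r n"] by linarith
qed

lemma partial_affine:
  fixes q :: "real ^ 'n \<Rightarrow> real"
  assumes "smooth q"
  shows "partial i (\<lambda>y. q (x0 + R *\<^sub>R y)) y = R * partial i q (x0 + R *\<^sub>R y)"
proof -
  obtain q' where q': "(q has_derivative q') (at (x0 + R *\<^sub>R y))"
    using smooth_differentiable[OF assms] unfolding differentiable_def by blast
  have "((\<lambda>y. x0 + R *\<^sub>R y) has_derivative (\<lambda>h. R *\<^sub>R h)) (at y)"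
    by (auto intro!: derivative_eq_intros)
  from partial_has_derivative[OF has_derivative_compose[OF this q'], of i]
  show ?thesis
    using partial_has_derivative[OF q', of i] has_derivative_bounded_linear[OF q'] by (simp add: linear_simps(5))
qed

text \<open>The exceptional set \<open>E\<close> takes away at most half of \<open>T\<close>, and
  \<open>f\<close> is at least \<open>c\<close> on the rest.\<close>

lemma integral_lower_bound:
  fixes f :: "'a::euclidean_space \<Rightarrow> real"
  assumes f: "integrable (lebesgue_on T) f" "\<And>x. x \<in> T \<Longrightarrow> 0 \<le> f x" and T: "T \<in> lmeasurable"
    and E: "E \<in> lmeasurable" "measure lebesgue E \<le> measure lebesgue T / 2" and c: "c \<ge> 0"
    and lower: "\<And>x. x \<in> T \<Longrightarrow> x \<notin> E \<Longrightarrow> c \<le> f x"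
  shows "c * measure lebesgue T / 2 \<le> (LINT x|lebesgue_on T. f x)"
proof -
  have D: "T - E \<in> lmeasurable" using T E by (simp add: fmeasurable_Diff fmeasurableD)
  have "measure lebesgue T \<le> measure lebesgue ((T - E) \<union> E)"
    by (rule measure_mono_fmeasurable) (use T E D in \<open>auto intro: fmeasurableD fmeasurable.Un\<close>)
  also have "\<dots> \<le> measure lebesgue (T - E) + measure lebesgue E"
    by (rule measure_Un_le) (use D E in \<open>auto intro: fmeasurableD\<close>)
  finally have "measure lebesgue T / 2 \<le> measure lebesgue (T - E)" using E(2) by linarith
  then have "c * (measure lebesgue T / 2) \<le> c * measure lebesgue (T - E)" by (rule mult_left_mono[OF _ c])
  also have "\<dots> = (LINT x|lebesgue_on (T - E). c)"
    using D by (simp add: measure_restrict_space fmeasurableD)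
  also have "\<dots> \<le> (LINT x|lebesgue_on T. f x)"
    by (rule integral_mono_lebesgue_on_AE) (use f T D lower in \<open>auto intro!: AE_I2 fmeasurableD\<close>)
  finally show ?thesis by simp
qed

text \<open>After rescaling to the unit ball and normalizing the largest coefficient to 1, the
  polynomial exceeds \<kappa> in absolute value off a set of measure below
  \<open>\<epsilon> / 2\<close>, hence on at least half of the rescaled \<open>T\<close>. So the
  integral over \<open>T\<close> controls all coefficients, and these control values and derivatives
  on the whole ball. The set \<open>T\<close> enters through its measure only.\<close>

lemma inverse_estimate:
  fixes \<epsilon> :: real
  assumes \<epsilon>: "\<epsilon> > 0"
  shows "\<exists>C>0. \<forall>q \<in> (poly_space p :: (real ^ 'n::finite \<Rightarrow> real) set). \<forall>x0 R T.
    R > 0 \<longrightarrow> T \<subseteq> cball x0 R \<longrightarrow> T \<in> sets lebesgue \<longrightarrow> \<epsilon> * R ^ CARD('n) \<le> measure lebesgue T \<longrightarrow>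
    (\<forall>x\<in>cball x0 R. (q x)\<^sup>2 * measure lebesgue T \<le> C * (LINT x|lebesgue_on T. (q x)\<^sup>2) \<and>
       (\<forall>i. R\<^sup>2 * (partial i q x)\<^sup>2 * measure lebesgue T \<le> C * (LINT x|lebesgue_on T. (q x)\<^sup>2)))"
proof -
  let ?I = "multi_idx p :: ('n \<Rightarrow> nat) set"
  have "\<epsilon> / 2 > 0" using \<epsilon> by simp
  from small_sublevel[OF this, of p, where 'n = 'n]
  obtain \<kappa> where \<kappa>: "\<kappa> > 0" "\<And>a :: ('n \<Rightarrow> nat) \<Rightarrow> real. (\<forall>\<alpha>\<in>?I. \<bar>a \<alpha>\<bar> \<le> 1) \<Longrightarrow> (\<exists>\<alpha>\<in>?I. \<bar>a \<alpha>\<bar> = 1) \<Longrightarrow>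
     measure lebesgue {x \<in> cball 0 1. \<bar>polyn p a x\<bar> < \<kappa>} < \<epsilon> / 2"
    by blast
  have ne: "(\<lambda>_. 0) \<in> ?I" by (simp add: multi_idx_def)
  \<comment> \<open>The number of monomials, times a bound for the exponents that differentiation
    brings down.\<close>
  define N where "N = real (card ?I) * real (Suc p)"
  have "card ?I > 0" using ne finite_multi_idx by (auto simp: card_gt_0_iff)
  then have N: "N > 0" by (simp add: N_def)
  \<comment> \<open>The ratio of the upper bound \<open>(N * m)\<^sup>2\<close> to the lower bound
    \<open>(\<kappa> * m)\<^sup>2 / 2\<close>, where \<open>m\<close> is the largest
    coefficient.\<close>
  define C where "C = 2 * N\<^sup>2 / \<kappa>\<^sup>2"
  have C: "C > 0" using N \<kappa>(1) by (simp add: C_def)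
  show ?thesis
  proof (intro exI[of _ C] conjI ballI allI impI C)
    fix q :: "real ^ 'n \<Rightarrow> real" and x0 :: "real ^ 'n" and R :: real and T :: "(real ^ 'n) set" and x i
    assume q: "q \<in> poly_space p" and R: "R > 0" and T: "T \<subseteq> cball x0 R" "T \<in> sets lebesgue"
      "\<epsilon> * R ^ CARD('n) \<le> measure lebesgue T" and x: "x \<in> cball x0 R"
    obtain a where a: "(\<lambda>y. q (x0 + R *\<^sub>R y)) = polyn p a"
      using poly_space_affine[OF q, of x0 R] unfolding poly_space_iff by blast
    have qa: "q z = polyn p a ((1 / R) *\<^sub>R (z - x0))" for z
      using fun_cong[OF a, of "(1 / R) *\<^sub>R (z - x0)"] R by simp
    have unit: "(1 / R) *\<^sub>R (z - x0) \<in> cball 0 1" if "z \<in> cball x0 R" for z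
      using that R by (simp add: dist_norm norm_minus_commute)
    define m where "m = Max ((\<lambda>\<alpha>. \<bar>a \<alpha>\<bar>) ` ?I)"
    have m: "\<bar>a \<alpha>\<bar> \<le> m" if "\<alpha> \<in> ?I" for \<alpha>
      unfolding m_def by (rule Max_ge) (use that finite_multi_idx in auto)
    have "m \<in> (\<lambda>\<alpha>. \<bar>a \<alpha>\<bar>) ` ?I" unfolding m_def by (rule Max_in) (use ne finite_multi_idx in auto)
    then obtain \<alpha>0 where \<alpha>0: "\<alpha>0 \<in> ?I" "\<bar>a \<alpha>0\<bar> = m" by auto
    have m0: "m \<ge> 0" using \<alpha>0 by auto
    have Tm: "T \<in> lmeasurable" using T bounded_set_imp_lmeasurable bounded_subset[OF bounded_cball] by blast
    have qint: "integrable (lebesgue_on T) (\<lambda>x. (q x)\<^sup>2)"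
    proof (rule integrable_lebesgue_on_subset[OF _ T(1,2)])
      show "integrable (lebesgue_on (cball x0 R)) (\<lambda>x. (q x)\<^sup>2)"
        by (intro integrable_continuous_compact continuous_intros smooth_continuous_on[OF smooth_poly_space[OF q]]) simp
    qed (simp add: closed_in_lebesgue)
    have low: "(\<kappa> * m)\<^sup>2 * measure lebesgue T / 2 \<le> (LINT x|lebesgue_on T. (q x)\<^sup>2)"
    proof (cases "m = 0")
      case True
      then show ?thesis by (simp add: integral_nonneg)
    next
      case False
      then have mp: "m > 0" using m0 by simp
      define F where "F = {y \<in> cball 0 1. \<bar>polyn p a y\<bar> < \<kappa> * m}"
      have Fmem: "y \<in> F \<longleftrightarrow> y \<in> cball 0 1 \<and> \<bar>polyn p a y\<bar> < \<kappa> * m" for y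
        unfolding F_def by blast
      let ?E = "(\<lambda>y. R *\<^sub>R y + x0) ` F"
      have p1: "polyn p (\<lambda>\<alpha>. a \<alpha> / m) y = polyn p a y / m" for y
        by (simp add: polyn_def sum_divide_distrib)
      have p2: "\<bar>t / m\<bar> < \<kappa> \<longleftrightarrow> \<bar>t\<bar> < \<kappa> * m" for t using mp by (simp add: abs_divide pos_divide_less_eq)
      have "measure lebesgue {y \<in> cball 0 1. \<bar>polyn p (\<lambda>\<alpha>. a \<alpha> / m) y\<bar> < \<kappa>} < \<epsilon> / 2"
        by (rule \<kappa>(2)) (use m mp \<alpha>0 in \<open>auto simp: abs_divide\<close>)
      then have F: "measure lebesgue F < \<epsilon> / 2" unfolding p1 p2 F_def .
      have E_eq: "?E = cball x0 R \<inter> {z. \<bar>q z\<bar> < \<kappa> * m}"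
      proof (intro equalityI subsetI)
        fix z assume "z \<in> ?E"
        then obtain y where y: "y \<in> F" "z = R *\<^sub>R y + x0" by blast
        have "dist x0 z \<le> R" using y R by (simp add: dist_norm Fmem)
        moreover have "q z = polyn p a y" using fun_cong[OF a, of y] y(2) by (simp add: add.commute)
        ultimately show "z \<in> cball x0 R \<inter> {z. \<bar>q z\<bar> < \<kappa> * m}" using y by (simp add: Fmem)
      next
        fix z assume z: "z \<in> cball x0 R \<inter> {z. \<bar>q z\<bar> < \<kappa> * m}"
        have "z = R *\<^sub>R ((1 / R) *\<^sub>R (z - x0)) + x0" using R by simp
        moreover have "(1 / R) *\<^sub>R (z - x0) \<in> F" using z unit[of z] qa[of z] by (simp add: Fmem)
        ultimately show "z \<in> ?E" by blast
      qed
      have "open {z. \<bar>q z\<bar> < \<kappa> * m}"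
        by (intro open_Collect_less continuous_intros smooth_continuous_on[OF smooth_poly_space[OF q]])
      then have "?E \<in> sets lebesgue" unfolding E_eq
        by (intro sets.Int closed_in_lebesgue open_in_lebesgue) auto
      moreover have "bounded ?E" unfolding E_eq by (rule bounded_subset[OF bounded_cball]) auto
      ultimately have Em: "?E \<in> lmeasurable" using bounded_set_imp_lmeasurable by blast
      have "measure lebesgue ?E = R ^ CARD('n) * measure lebesgue F"
        using measure_lebesgue_affine[of R x0 F] R by simp
      also have "\<dots> \<le> R ^ CARD('n) * (\<epsilon> / 2)" using F R by (intro mult_left_mono) auto
      also have "\<dots> \<le> measure lebesgue T / 2" using T(3) by (simp add: mult.commute)
      finally have E2: "measure lebesgue ?E \<le> measure lebesgue T / 2" .
      show ?thesis
      proof (rule integral_lower_bound[OF qint _ Tm Em E2])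
        fix z assume z: "z \<in> T" "z \<notin> ?E"
        then have "\<kappa> * m \<le> \<bar>q z\<bar>" using T(1) unfolding E_eq by auto
        then show "(\<kappa> * m)\<^sup>2 \<le> (q z)\<^sup>2" using \<kappa>(1) m0 by (metis abs_le_square_iff abs_of_nonneg mult_nonneg_nonneg less_imp_le)
      qed auto
    qed
    have main: "g\<^sup>2 * measure lebesgue T \<le> C * (LINT x|lebesgue_on T. (q x)\<^sup>2)" if g: "\<bar>g\<bar> \<le> N * m" for g
    proof -
      have "g\<^sup>2 \<le> (N * m)\<^sup>2" using power_mono[OF g, of 2] by simp
      then have "g\<^sup>2 * measure lebesgue T \<le> (N * m)\<^sup>2 * measure lebesgue T" by (intro mult_right_mono) auto
      also have "\<dots> = C * ((\<kappa> * m)\<^sup>2 * measure lebesgue T / 2)" using \<kappa>(1) by (simp add: C_def power_mult_distrib)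
      also have "\<dots> \<le> C * (LINT x|lebesgue_on T. (q x)\<^sup>2)" using low C by (intro mult_left_mono) auto
      finally show ?thesis .
    qed
    let ?y = "(1 / R) *\<^sub>R (x - x0)"
    note y = unit[OF x]
    have sumbd: "\<bar>\<Sum>\<alpha>\<in>?I. a \<alpha> * t \<alpha>\<bar> \<le> N * m" if t: "\<And>\<alpha>. \<alpha> \<in> ?I \<Longrightarrow> \<bar>t \<alpha>\<bar> \<le> real (Suc p)" for t
    proof -
      have "\<bar>\<Sum>\<alpha>\<in>?I. a \<alpha> * t \<alpha>\<bar> \<le> (\<Sum>\<alpha>\<in>?I. \<bar>a \<alpha> * t \<alpha>\<bar>)" by (rule sum_abs)
      also have "\<dots> \<le> (\<Sum>\<alpha>\<in>?I. m * real (Suc p))"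
        unfolding abs_mult by (intro sum_mono mult_mono m t) (use m0 in auto)
      also have "\<dots> = N * m" by (simp add: N_def)
      finally show ?thesis .
    qed
    have "\<bar>q x\<bar> \<le> N * m"
      unfolding qa[of x] polyn_def
    proof (rule sumbd)
      fix \<alpha> :: "'n \<Rightarrow> nat"
      show "\<bar>monomial \<alpha> ?y\<bar> \<le> real (Suc p)" using monomial_le_1[OF y, of \<alpha>] by simp
    qed
    then show "(q x)\<^sup>2 * measure lebesgue T \<le> C * (LINT x|lebesgue_on T. (q x)\<^sup>2)" by (rule main)
    have "R * partial i q x = partial i (polyn p a) ?y"
      using partial_affine[OF smooth_poly_space[OF q], of i x0 R ?y] R unfolding a by simp
    also have "\<bar>\<dots>\<bar> \<le> N * m"
      unfolding partial_polyn
    proof (rule sumbd)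
      fix \<alpha> assume \<alpha>: "\<alpha> \<in> ?I"
      have "\<alpha> i \<le> p" using \<alpha> member_le_sum[of i UNIV \<alpha>] by (auto simp: multi_idx_def intro: order_trans)
      then have "real (\<alpha> i) * \<bar>monomial (\<alpha>(i := \<alpha> i - 1)) ?y\<bar> \<le> real (Suc p) * 1"
        using monomial_le_1[OF y, of "\<alpha>(i := \<alpha> i - 1)"] by (intro mult_mono) auto
      then show "\<bar>real (\<alpha> i) * monomial (\<alpha>(i := \<alpha> i - 1)) ?y\<bar> \<le> real (Suc p)" by (simp add: abs_mult)
    qed
    finally have "\<bar>R * partial i q x\<bar> \<le> N * m" .
    from main[OF this] show "R\<^sup>2 * (partial i q x)\<^sup>2 * measure lebesgue T \<le> C * (LINT x|lebesgue_on T. (q x)\<^sup>2)"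
      by (simp add: power_mult_distrib)
  qed
qed

section \<open>Simplicial meshes\<close>

lemma compact_elem: "compact (elem T)"
  by (simp add: elem_def finite_imp_compact_convex_hull)

lemma convex_elem: "convex (elem T)"
  by (simp add: elem_def convex_convex_hull)

lemma lmeasurable_elem: "elem T \<in> lmeasurable"
  by (simp add: compact_elem lmeasurable_compact)

lemma sets_elem: "elem T \<in> sets lebesgue" "interior (elem T) \<in> sets lebesgue"
  by (simp_all add: compact_in_lebesgue compact_elem open_in_lebesgue)

lemma tagged_simplexD:
  fixes T :: "'n::finite tagged_simplex"
  assumes "is_tagged_simplex T"
  shows "card (set (fst T)) = CARD('n) + 1" "\<not> affine_dependent (set (fst T))" "fst T \<noteq> []"
    "interior (elem T) \<noteq> {}" "vol T > 0" "\<not> negligible (elem T)" "\<not> negligible (interior (elem T))"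
proof -
  show c: "card (set (fst T)) = CARD('n) + 1" and a: "\<not> affine_dependent (set (fst T))" and "fst T \<noteq> []"
    using assms unfolding is_tagged_simplex_def by (auto simp: distinct_card)
  show i: "interior (elem T) \<noteq> {}"
    unfolding elem_def using interior_convex_hull_eq_empty[of "set (fst T)"] c a by simp
  show ni: "\<not> negligible (interior (elem T))" using i open_not_negligible open_interior by blast
  then show n: "\<not> negligible (elem T)" using negligible_subset interior_subset by blast
  then have "measure lebesgue (elem T) \<noteq> 0" using negligible_iff_measure0[OF lmeasurable_elem] by blast
  then show "vol T > 0" unfolding vol_def by (simp add: less_le)
qed

lemma negligible_frontier_elem: "negligible (frontier (elem T))"
  by (rule negligible_convex_frontier[OF convex_elem])

text \<open>The frontier of a convex set is null. Statements on the open element, where weak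
  derivatives are taken, thus transfer to the compact element.\<close>

lemma AE_interior_elem: "AE x in lebesgue. x \<in> elem T \<longrightarrow> x \<in> interior (elem T)"
proof -
  have "AE x in lebesgue. x \<notin> frontier (elem T)"
    using negligible_frontier_elem by (intro AE_not_in) (simp add: negligible_iff_null_sets)
  then show ?thesis
    by eventually_elim (use compact_elem[of T] in \<open>auto simp: frontier_def dest: closure_subset[THEN subsetD]\<close>)
qed

lemma AE_elem_iff: "(AE x in lebesgue_on (interior (elem T)). P x) \<longleftrightarrow> (AE x in lebesgue_on (elem T). P x)"
proof
  assume "AE x in lebesgue_on (interior (elem T)). P x"
  then have "AE x in lebesgue. x \<in> interior (elem T) \<longrightarrow> P x" by (simp add: AE_lebesgue_on_iff sets_elem)
  with AE_interior_elem[of T] have "AE x in lebesgue. x \<in> elem T \<longrightarrow> P x" by eventually_elim blast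
  then show "AE x in lebesgue_on (elem T). P x" by (simp add: AE_lebesgue_on_iff sets_elem)
next
  assume "AE x in lebesgue_on (elem T). P x"
  then show "AE x in lebesgue_on (interior (elem T)). P x"
    by (rule AE_lebesgue_on_subset) (auto simp: sets_elem interior_subset)
qed

lemma integral_interior_elem:
  fixes f :: "real ^ 'n::finite \<Rightarrow> real"
  shows "(LINT x|lebesgue_on (interior (elem T)). f x) = (LINT x|lebesgue_on (elem T). f x)"
proof -
  have "(LINT x|lebesgue_on UNIV. (if x \<in> interior (elem T) then f x else 0)) =
      (LINT x|lebesgue_on UNIV. (if x \<in> elem T then f x else 0))"
  proof (rule integral_cong_AE_on)
    show "AE x in lebesgue_on UNIV. (if x \<in> interior (elem T) then f x else 0) = (if x \<in> elem T then f x else 0)"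
      unfolding lebesgue_on_UNIV_eq using AE_interior_elem[of T]
      by eventually_elim (use interior_subset[of "elem T"] in auto)
  qed simp
  then show ?thesis
    by (simp add: lebesgue_on_UNIV_eq Lebesgue_Measure.integral_restrict_UNIV sets_elem)
qed

text \<open>Two distinct elements meet in a common face. It is a proper face of each: otherwise one
  element would be a proper face of the other, lie in its boundary, and have no interior. All
  overlap statements follow.\<close>

lemma conforming_meshD:
  assumes "conforming_mesh \<Omega> \<T>"
  shows "finite \<T>" "\<And>T. T \<in> \<T> \<Longrightarrow> is_tagged_simplex T" "\<And>T. T \<in> \<T> \<Longrightarrow> elem T \<subseteq> closure \<Omega>"
    "\<And>T T'. T \<in> \<T> \<Longrightarrow> T' \<in> \<T> \<Longrightarrow> T \<noteq> T' \<Longrightarrow> elem T \<inter> elem T' \<subseteq> frontier (elem T)"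
    "\<And>T T'. T \<in> \<T> \<Longrightarrow> T' \<in> \<T> \<Longrightarrow> T \<noteq> T' \<Longrightarrow> negligible (elem T \<inter> elem T')"
    "\<And>T T'. T \<in> \<T> \<Longrightarrow> T' \<in> \<T> \<Longrightarrow> T \<noteq> T' \<Longrightarrow> interior (elem T) \<inter> elem T' = {}"
    "closure \<Omega> = \<Union>(elem ` \<T>)"
proof -
  have tr: "triangulation (elem ` \<T>)" and inj: "inj_on elem \<T>"
    and tag: "\<And>T. T \<in> \<T> \<Longrightarrow> is_tagged_simplex T" and U: "\<Union>(elem ` \<T>) = closure \<Omega>"
    using assms unfolding conforming_mesh_def by auto
  show "finite \<T>" using tr inj unfolding triangulation_def by (auto dest: finite_imageD)
  show "is_tagged_simplex T" if "T \<in> \<T>" for T using tag that .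
  show "elem T \<subseteq> closure \<Omega>" if "T \<in> \<T>" for T using U that by blast
  show "closure \<Omega> = \<Union>(elem ` \<T>)" using U by simp
  fix T T' assume T: "T \<in> \<T>" "T' \<in> \<T>" "T \<noteq> T'"
  have f: "(elem T \<inter> elem T') face_of elem T" "(elem T' \<inter> elem T) face_of elem T'"
    using tr T unfolding triangulation_def by blast+
  have ne: "elem T \<noteq> elem T'" using inj T by (auto dest: inj_onD)
  have "elem T \<inter> elem T' \<noteq> elem T"
  proof
    assume eq: "elem T \<inter> elem T' = elem T"
    then have "elem T face_of elem T'" using f(2) by (simp add: Int_commute)
    then have "elem T \<inter> interior (elem T') = {}" using ne face_of_disjoint_interior by blast
    moreover have "interior (elem T) \<subseteq> interior (elem T')" using eq by (intro interior_mono) blast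
    ultimately show False using tagged_simplexD(4)[OF tag[OF T(1)]] interior_subset by blast
  qed
  then have "(elem T \<inter> elem T') \<inter> interior (elem T) = {}" using f(1) face_of_disjoint_interior by blast
  then show *: "elem T \<inter> elem T' \<subseteq> frontier (elem T)" "interior (elem T) \<inter> elem T' = {}"
    using closure_subset[of "elem T"] interior_subset[of "elem T"] by (auto simp: frontier_def)
  show "negligible (elem T \<inter> elem T')" using *(1) negligible_frontier_elem negligible_subset by blast
qed

text \<open>Excludes slits: near a boundary point the part strictly below the Lipschitz graph is
  open and disjoint from \<Omega>, so no ball around the point is contained in the closure.
  Consequently open elements lie in \<Omega>.\<close>

lemma interior_closure_lipschitz_domain:
  fixes \<Omega> :: "(real ^ 'n) set"
  assumes "lipschitz_domain \<Omega>"
  shows "interior (closure \<Omega>) \<subseteq> \<Omega>"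
proof
  fix x assume x: "x \<in> interior (closure \<Omega>)"
  have op: "open \<Omega>" using assms unfolding lipschitz_domain_def by blast
  show "x \<in> \<Omega>"
  proof (rule ccontr)
    assume nx: "x \<notin> \<Omega>"
    then have "x \<in> frontier \<Omega>" using x op interior_subset[of "closure \<Omega>"] by (auto simp: frontier_def interior_open)
    then obtain r e L and \<psi> :: "real ^ 'n \<Rightarrow> real" where r: "r > 0" and e: "norm e = 1" and L: "L-lipschitz_on {z. e \<bullet> z = 0} \<psi>"
      and gr: "\<And>y. y \<in> ball x r \<Longrightarrow> (y \<in> \<Omega> \<longleftrightarrow> \<psi> (y - (e \<bullet> y) *\<^sub>R e) < e \<bullet> y)"
      using assms unfolding lipschitz_domain_def by meson
    obtain r' where r': "r' > 0" "ball x r' \<subseteq> closure \<Omega>"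
      using x unfolding mem_interior by blast
    define s where "s = min r r' / 2"
    have s: "s > 0" "s < r" "s < r'" using r r' by (auto simp: s_def min_def)
    \<comment> \<open>Moving against \<open>e\<close> keeps the foot point on the hyperplane, so
      \<open>y\<close> falls strictly below the graph.\<close>
    define y where "y = x - s *\<^sub>R e"
    have ee: "e \<bullet> e = 1" using e by (simp add: norm_eq_1)
    have proj: "e \<bullet> (z - (e \<bullet> z) *\<^sub>R e) = 0" for z by (simp add: inner_diff_right ee)
    have py: "y - (e \<bullet> y) *\<^sub>R e = x - (e \<bullet> x) *\<^sub>R e"
      by (simp add: y_def inner_diff_right ee algebra_simps)
    have "e \<bullet> x \<le> \<psi> (x - (e \<bullet> x) *\<^sub>R e)" using gr[of x] r nx by simp
    then have y1: "e \<bullet> y < \<psi> (y - (e \<bullet> y) *\<^sub>R e)"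
      unfolding py using s by (simp add: y_def inner_diff_right ee)
    have yb: "y \<in> ball x r" "y \<in> ball x r'" using s e by (simp_all add: y_def dist_norm)
    define W where "W = {z. e \<bullet> z < \<psi> (z - (e \<bullet> z) *\<^sub>R e)} \<inter> ball x r"
    have "continuous_on {z. e \<bullet> z = 0} \<psi>" using L by (rule lipschitz_on_continuous_on)
    then have "continuous_on UNIV (\<lambda>z. \<psi> (z - (e \<bullet> z) *\<^sub>R e))"
      by (rule continuous_on_compose2) (use proj in \<open>auto intro!: continuous_intros\<close>)
    then have "open W" unfolding W_def by (intro open_Int open_Collect_less continuous_intros) auto
    moreover have "y \<in> W" using y1 yb by (simp add: W_def)
    moreover have "W \<inter> \<Omega> = {}" using gr unfolding W_def by fastforce
    ultimately have "y \<notin> closure \<Omega>" by (meson closure_iff_nhds_not_empty disjoint_iff order_refl)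
    then show False using r'(2) yb(2) by blast
  qed
qed

lemma interior_elem_subset:
  assumes "conforming_mesh \<Omega> \<T>" "lipschitz_domain \<Omega>" "T \<in> \<T>"
  shows "interior (elem T) \<subseteq> \<Omega>"
  using interior_mono[OF conforming_meshD(3)[OF assms(1,3)]] interior_closure_lipschitz_domain[OF assms(2)] by blast

text \<open>The open elements are pairwise disjoint subsets of \<Omega> and carry the full integrals
  over the closed ones.\<close>

lemma sum_integral_elem_le:
  fixes g :: "real ^ 'n::finite \<Rightarrow> real"
  assumes conf: "conforming_mesh \<Omega> \<T>" and lip: "lipschitz_domain \<Omega>" and M: "M \<subseteq> \<T>"
    and g: "integrable (lebesgue_on \<Omega>) g" "\<And>x. x \<in> \<Omega> \<Longrightarrow> 0 \<le> g x"
  shows "(\<Sum>T\<in>M. LINT x|lebesgue_on (elem T). g x) \<le> (LINT x|lebesgue_on \<Omega>. g x)"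
proof -
  have fin: "finite M" using conforming_meshD(1)[OF conf] M finite_subset by blast
  have op: "open \<Omega>" using lip unfolding lipschitz_domain_def by blast
  have sub: "interior (elem T) \<subseteq> \<Omega>" if "T \<in> M" for T
    using interior_elem_subset[OF conf lip] M that by blast
  have int: "integrable lebesgue (\<lambda>x. if x \<in> interior (elem T) then g x else 0)" if "T \<in> M" for T
    using integrable_lebesgue_on_subset[OF g(1) sub[OF that]] op
    by (simp add: Lebesgue_Measure.integrable_restrict_UNIV sets_elem open_in_lebesgue)
  have "(\<Sum>T\<in>M. LINT x|lebesgue_on (elem T). g x) = (\<Sum>T\<in>M. LINT x|lebesgue. (if x \<in> interior (elem T) then g x else 0))"
    by (simp add: integral_interior_elem[symmetric] Lebesgue_Measure.integral_restrict_UNIV sets_elem)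
  also have "\<dots> = (LINT x|lebesgue. (\<Sum>T\<in>M. (if x \<in> interior (elem T) then g x else 0)))"
    using int by (simp add: Bochner_Integration.integral_sum)
  also have "\<dots> \<le> (LINT x|lebesgue. (if x \<in> \<Omega> then g x else 0))"
  proof (rule integral_mono')
    show "integrable lebesgue (\<lambda>x. if x \<in> \<Omega> then g x else 0)"
      using g(1) op by (simp add: Lebesgue_Measure.integrable_restrict_UNIV open_in_lebesgue)
    fix x
    show "(\<Sum>T\<in>M. (if x \<in> interior (elem T) then g x else 0)) \<le> (if x \<in> \<Omega> then g x else 0)"
    proof (cases "\<exists>T\<in>M. x \<in> interior (elem T)")
      case True
      then obtain T where T: "T \<in> M" "x \<in> interior (elem T)" by blast
      have "x \<notin> interior (elem T')" if "T' \<in> M - {T}" for T'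
        using conforming_meshD(6)[OF conf, of T T'] T M that interior_subset by blast
      then have "(\<Sum>T\<in>M. (if x \<in> interior (elem T) then g x else 0)) = g x"
        using T by (subst sum.remove[OF fin T(1)]) (simp add: sum.neutral)
      moreover have "x \<in> \<Omega>" using sub[OF T(1)] T(2) by blast
      ultimately show ?thesis by simp
    next
      case False
      then have "(\<Sum>T\<in>M. (if x \<in> interior (elem T) then g x else 0)) = 0" by (intro sum.neutral) auto
      then show ?thesis using g(2) by auto
    qed
    show "0 \<le> (if x \<in> \<Omega> then g x else 0)" using g(2) by auto
  qed
  also have "\<dots> = (LINT x|lebesgue_on \<Omega>. g x)"
    using op by (simp add: Lebesgue_Measure.integral_restrict_UNIV open_in_lebesgue)
  finally show ?thesis .
qed

lemma sum_vol_le: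
  assumes conf: "conforming_mesh \<Omega> \<T>" and M: "M \<subseteq> \<T>" and B: "B \<in> lmeasurable" "\<And>T. T \<in> M \<Longrightarrow> elem T \<subseteq> B"
  shows "(\<Sum>T\<in>M. vol T) \<le> measure lebesgue B"
proof -
  have fin: "finite M" using conforming_meshD(1)[OF conf] M finite_subset by blast
  have "(\<Sum>T\<in>M. vol T) = measure lebesgue (\<Union>(elem ` M))"
    unfolding vol_def
    by (rule measure_negligible_finite_Union_image[symmetric, OF fin lmeasurable_elem])
      (unfold pairwise_def, use conforming_meshD(5)[OF conf] M in blast)
  also have "\<dots> \<le> measure lebesgue B"
    by (rule measure_mono_fmeasurable[OF _ _ B(1)])
      (use B(2) fin in \<open>auto intro!: fmeasurableD fmeasurable.finite_UN lmeasurable_elem\<close>)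
  finally show ?thesis .
qed

section \<open>Bisection reduces volumes\<close>

text \<open>For volumes, type and vertex order are immaterial: either son arises by replacing one
  end \<open>y\<close> of the refinement edge by its midpoint.\<close>

lemma sons_vertices:
  assumes "is_tagged_simplex T" "K \<in> sons T" "CARD('n) \<ge> 2"
  obtains x y where "x \<in> set (fst T)" "y \<in> set (fst T)" "x \<noteq> y"
    "set (fst (K :: 'n::finite tagged_simplex)) = insert x (insert (midpoint x y) (set (fst T) - {x, y}))"
proof -
  define z where "z = fst T"
  have len: "length z = CARD('n) + 1" and dist: "distinct z"
    using assms(1) unfolding is_tagged_simplex_def z_def by auto
  obtain x z' where z': "z = x # z'" using len by (cases z) auto
  have "z' \<noteq> []" using len z' assms(3) by auto
  then obtain mid y where mid: "z' = mid @ [y]" by (meson rev_exhaust)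
  have zz: "z = x # mid @ [y]" using z' mid by simp
  have xy: "x \<noteq> y" "set mid = set z - {x, y}" using dist unfolding zz by auto
  define t where "t = snd T"
  have td: "set (take t mid) \<union> set (drop t mid) = set mid" by (metis append_take_drop_id set_append)
  have hl: "hd z = x" "last z = y" "butlast (tl z) = mid" unfolding zz by simp_all
  have two: "set (fst K) = insert x (insert (midpoint x y) (set mid)) \<or> set (fst K) = insert y (insert (midpoint x y) (set mid))"
  proof -
    have "K = (x # midpoint x y # take t mid @ drop t mid, (t + 1) mod CARD('n)) \<or>
      K = (y # midpoint x y # take t mid @ rev (drop t mid), (t + 1) mod CARD('n))"
      using assms(2) unfolding sons_def Let_def z_def[symmetric] t_def[symmetric] hl by blast
    then show ?thesis using td by (elim disjE) simp_all
  qed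
  have mem: "x \<in> set z" "y \<in> set z" unfolding zz by simp_all
  from two show ?thesis
  proof
    assume K: "set (fst K) = insert x (insert (midpoint x y) (set mid))"
    show ?thesis by (rule that[of x y, folded z_def, OF mem xy(1) K[unfolded xy(2)]])
  next
    assume K: "set (fst K) = insert y (insert (midpoint x y) (set mid))"
    have "set (fst K) = insert y (insert (midpoint y x) (set z - {y, x}))"
      unfolding K xy(2) by (simp only: midpoint_sym[of y x] insert_commute[of y x])
    then show ?thesis by (intro that[of y x, folded z_def] mem xy(1)[symmetric])
  qed
qed

text \<open>The functional is, up to the additive constant \<beta>, the barycentric coordinate of
  the vertex \<open>y\<close>.\<close>

lemma vertex_functional:
  fixes T :: "'n::finite tagged_simplex"
  assumes T: "is_tagged_simplex T" and y: "y \<in> set (fst T)"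
  obtains e \<beta> where "\<And>u. u \<in> set (fst T) \<Longrightarrow> u \<noteq> y \<Longrightarrow> e \<bullet> u = \<beta>" "e \<bullet> y = \<beta> + 1" "e \<noteq> 0"
    "elem T \<subseteq> {u. e \<bullet> u \<ge> \<beta>}" "elem T \<subseteq> {u. e \<bullet> u \<le> \<beta> + 1}"
proof -
  define S where "S = set (fst T)"
  have S: "finite S" "card S = CARD('n) + 1" using tagged_simplexD[OF T] by (auto simp: S_def)
  have "aff_dim (S - {y}) < int DIM(real ^ 'n)"
    using aff_dim_le_card[of "S - {y}"] S y by (simp add: S_def[symmetric])
  then obtain e \<beta> where e: "e \<noteq> 0" "S - {y} \<subseteq> {u. e \<bullet> u = \<beta>}"
    by (rule aff_lowdim_subset_hyperplane)
  have ey: "e \<bullet> y \<noteq> \<beta>"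
  \<comment> \<open>If \<open>y\<close> lay in the hyperplane spanned by the other vertices, the
    whole simplex would, and its interior would be empty.\<close>
  proof
    assume "e \<bullet> y = \<beta>"
    then have "S \<subseteq> {u. e \<bullet> u = \<beta>}" using e(2) by auto
    then have "elem T \<subseteq> {u. e \<bullet> u = \<beta>}" unfolding elem_def S_def[symmetric]
      by (rule hull_minimal) (rule convex_hyperplane)
    then have "interior (elem T) \<subseteq> {}" using interior_mono[of "elem T" "{u. e \<bullet> u = \<beta>}"] interior_hyperplane[OF e(1)] by auto
    then show False using tagged_simplexD(4)[OF T] by auto
  qed
  define e' \<beta>' where "e' = (1 / (e \<bullet> y - \<beta>)) *\<^sub>R e" and "\<beta>' = \<beta> / (e \<bullet> y - \<beta>)"
  have f0: "e' \<bullet> u = \<beta>'" if "u \<in> S" "u \<noteq> y" for u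
    using e(2) that by (auto simp: e'_def \<beta>'_def)
  have f1: "e' \<bullet> y = \<beta>' + 1" using ey by (simp add: e'_def \<beta>'_def field_simps)
  have "e' \<noteq> 0" using e(1) ey by (simp add: e'_def)
  have T_ge: "elem T \<subseteq> {u. e' \<bullet> u \<ge> \<beta>'}"
    unfolding elem_def
  proof (rule hull_minimal)
    show "convex {u. e' \<bullet> u \<ge> \<beta>'}" by (rule convex_halfspace_ge)
    show "set (fst T) \<subseteq> {u. e' \<bullet> u \<ge> \<beta>'}"
    proof
      fix u assume "u \<in> set (fst T)"
      then show "u \<in> {u. e' \<bullet> u \<ge> \<beta>'}" using f0[of u] f1 by (cases "u = y") (simp_all add: S_def)
    qed
  qed
  have T_le: "elem T \<subseteq> {u. e' \<bullet> u \<le> \<beta>' + 1}"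
    unfolding elem_def
  proof (rule hull_minimal)
    show "convex {u. e' \<bullet> u \<le> \<beta>' + 1}" by (rule convex_halfspace_le)
    show "set (fst T) \<subseteq> {u. e' \<bullet> u \<le> \<beta>' + 1}"
    proof
      fix u assume "u \<in> set (fst T)"
      then show "u \<in> {u. e' \<bullet> u \<le> \<beta>' + 1}" using f0[of u] f1 by (cases "u = y") (simp_all add: S_def)
    qed
  qed
  show ?thesis
    by (rule that[of e' \<beta>']) (use f0 in \<open>simp add: S_def\<close>, fact+)
qed

text \<open>
  The copy of the simplex shrunk by the factor \<open>1/3\<close> towards the vertex that the son lacks is
  disjoint from the son, as the barycentric coordinate of that vertex shows.
\<close>

lemma vol_son_le:
  assumes T: "is_tagged_simplex T" and K: "K \<in> sons T" and d: "CARD('n) \<ge> 2"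
  shows "elem K \<subseteq> elem T" "vol (K :: 'n::finite tagged_simplex) \<le> (1 - (1/3) ^ CARD('n)) * vol T"
proof -
  obtain x y where xy: "x \<in> set (fst T)" "y \<in> set (fst T)" "x \<noteq> y"
    and setK: "set (fst K) = insert x (insert (midpoint x y) (set (fst T) - {x, y}))"
    using sons_vertices[OF T K d] by metis
  define S where "S = set (fst T)"
  have S: "finite S" "card S = CARD('n) + 1" using tagged_simplexD[OF T] by (auto simp: S_def)
  have SC: "S \<subseteq> elem T" unfolding S_def elem_def by (rule hull_subset)
  have mC: "midpoint x y \<in> elem T"
    using convexD[OF convex_elem, of x T y "1/2" "1/2"] xy SC by (auto simp: midpoint_def S_def scaleR_add_right)
  show KT: "elem K \<subseteq> elem T"
    unfolding elem_def[of K] setK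
  proof (rule hull_minimal)
    show "insert x (insert (midpoint x y) (set (fst T) - {x, y})) \<subseteq> elem T"
      using xy SC mC unfolding S_def by blast
  qed (rule convex_elem)
  obtain e' \<beta>' where f: "\<And>u. u \<in> set (fst T) \<Longrightarrow> u \<noteq> y \<Longrightarrow> e' \<bullet> u = \<beta>'" and f1: "e' \<bullet> y = \<beta>' + 1"
    and T_ge: "elem T \<subseteq> {u. e' \<bullet> u \<ge> \<beta>'}"
    using vertex_functional[OF T xy(2)] by metis
  have f0: "e' \<bullet> u = \<beta>'" if "u \<in> S" "u \<noteq> y" for u using f that by (simp add: S_def)
  have K_le: "elem K \<subseteq> {u. e' \<bullet> u \<le> \<beta>' + 1/2}"
    unfolding elem_def setK
  proof (rule hull_minimal)
    show "convex {u. e' \<bullet> u \<le> \<beta>' + 1 / 2}" by (rule convex_halfspace_le)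
    show "insert x (insert (midpoint x y) (set (fst T) - {x, y})) \<subseteq> {u. e' \<bullet> u \<le> \<beta>' + 1 / 2}"
      using f0 f1 xy by (auto simp: S_def midpoint_def inner_add_right)
  qed
  \<comment> \<open>Shrinking by a factor below 1/2 keeps the coordinate of \<open>y\<close> above
    1/2, which is its maximum on the son. The factor 1/3 leaves a gap and yields the volume loss
    \<open>(1/3) ^ CARD('n)\<close>.\<close>
  define G where "G = (\<lambda>u. (1/3::real) *\<^sub>R u + (2/3::real) *\<^sub>R y) ` elem T"
  have GT: "G \<subseteq> elem T"
    unfolding G_def using convexD[OF convex_elem, of _ T y "1/3" "2/3"] SC xy(2) by (auto simp: S_def)
  have G_ge: "G \<subseteq> {u. e' \<bullet> u \<ge> \<beta>' + 2/3}"
  proof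
    fix w assume "w \<in> G"
    then obtain u where u: "u \<in> elem T" "w = (1/3::real) *\<^sub>R u + (2/3::real) *\<^sub>R y" unfolding G_def by blast
    have "\<beta>' \<le> e' \<bullet> u" using T_ge u(1) by blast
    then show "w \<in> {u. e' \<bullet> u \<ge> \<beta>' + 2/3}" using f1 by (simp add: u(2) inner_add_right field_simps)
  qed
  have dj: "elem K \<inter> G = {}"
  proof -
    have "\<not> (e' \<bullet> u \<le> \<beta>' + 1/2 \<and> e' \<bullet> u \<ge> \<beta>' + 2/3)" for u by linarith
    then show ?thesis using K_le G_ge by blast
  qed
  have "compact G" unfolding G_def by (intro compact_continuous_image compact_elem continuous_intros)
  then have Gm: "G \<in> lmeasurable" by (rule lmeasurable_compact)
  have "measure lebesgue G = (1/3) ^ CARD('n) * vol T"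
    unfolding G_def vol_def using measure_lebesgue_affine[of "1/3" "(2/3) *\<^sub>R y" "elem T"] by simp
  moreover have "measure lebesgue (elem K \<union> G) = measure lebesgue (elem K) + measure lebesgue G"
    by (rule measure_Un_AE[OF _ lmeasurable_elem Gm]) (use dj in \<open>intro AE_I2, blast\<close>)
  moreover have "measure lebesgue (elem K \<union> G) \<le> measure lebesgue (elem T)"
    by (rule measure_mono_fmeasurable[OF _ fmeasurableD[OF fmeasurable.Un[OF lmeasurable_elem Gm]] lmeasurable_elem])
      (use KT GT in blast)
  ultimately show "vol K \<le> (1 - (1/3) ^ CARD('n)) * vol T" by (simp add: vol_def algebra_simps)
qed

text \<open>The inclusion from \<open>vol_son_le\<close> under a condition that is inherited by sons
  immediately, so that it passes through the intermediate meshes of a sequence of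
  bisections.\<close>

lemma elem_son_subset:
  assumes "fst T \<noteq> []" "K \<in> sons T"
  shows "fst K \<noteq> []" "elem K \<subseteq> elem T"
proof -
  define z where "z = fst T"
  have z: "hd z \<in> set z" "last z \<in> set z" using assms(1) by (auto simp: z_def)
  have mid: "set (butlast (tl z)) \<subseteq> set z"
    by (metis in_set_butlastD list.set_sel(2) subsetI assms(1) z_def)
  have td: "set (take t m) \<union> set (drop t m) = set m" for t and m :: "(real ^ 'a) list"
    by (metis append_take_drop_id set_append)
  have K: "set (fst K) \<subseteq> insert (midpoint (hd z) (last z)) (set z)" "fst K \<noteq> []"
    using assms(2) z mid td[of "snd T" "butlast (tl z)"] unfolding sons_def Let_def z_def[symmetric] by auto
  show "fst K \<noteq> []" by (rule K(2))
  have "set z \<subseteq> elem T" unfolding z_def elem_def by (rule hull_subset)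
  moreover have "midpoint (hd z) (last z) \<in> elem T"
    using convexD[OF convex_elem, of "hd z" T "last z" "1/2" "1/2"] calculation z by (auto simp: midpoint_def scaleR_add_right)
  ultimately show "elem K \<subseteq> elem T"
    unfolding elem_def[of K] using K(1) by (intro hull_minimal convex_elem) blast
qed

text \<open>Records the part of bisection that the volume argument uses: a new element lies in a son
  of an old element, hence it has lost a fixed fraction of volume.\<close>

definition refines :: "('n::finite) tagged_simplex set \<Rightarrow> 'n tagged_simplex set \<Rightarrow> bool" where
  "refines \<T> \<T>' \<longleftrightarrow> (\<forall>T'\<in>\<T>'. T' \<in> \<T> \<or> (\<exists>T\<in>\<T>. \<exists>K\<in>sons T. elem T' \<subseteq> elem K))"

text \<open>If the bisected simplex is itself new, it already lies in a son of an original element,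
  and so do its own sons.\<close>

lemma nvb_refines:
  assumes "nvb_refinement \<T> \<T>'" "\<And>T. T \<in> \<T> \<Longrightarrow> fst T \<noteq> []"
  shows "refines \<T> \<T>'"
proof -
  have "bisection\<^sup>*\<^sup>* \<T> \<T>'" using assms(1) by (simp add: nvb_refinement_def)
  then have "(\<forall>T'\<in>\<T>'. fst T' \<noteq> []) \<and> refines \<T> \<T>'"
  proof (induction rule: rtranclp_induct)
    case base
    then show ?case using assms(2) by (auto simp: refines_def)
  next
    case (step \<S> \<S>')
    from step(2) obtain T where T: "T \<in> \<S>" "\<S>' = \<S> - {T} \<union> sons T" by (auto elim: bisection.cases)
    have ne: "fst T \<noteq> []" using step(3) T(1) by blast
    have "T' \<in> \<T> \<or> (\<exists>T\<in>\<T>. \<exists>K\<in>sons T. elem T' \<subseteq> elem K)" if K: "T' \<in> sons T" for T'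
    proof (cases "T \<in> \<T>")
      case True
      then show ?thesis using K by blast
    next
      case False
      then obtain T0 K0 where "T0 \<in> \<T>" "K0 \<in> sons T0" "elem T \<subseteq> elem K0"
        using step(3) T(1) unfolding refines_def by blast
      then show ?thesis using elem_son_subset(2)[OF ne K] by blast
    qed
    then show ?case using step(3) T elem_son_subset(1)[OF ne] unfolding refines_def by blast
  qed
  then show ?thesis by blast
qed

text \<open>Subdivision preserves the sum of volumes but lowers the sum of their squares, since the
  parts are strictly smaller than the whole.\<close>

definition potential :: "('n::finite) tagged_simplex set \<Rightarrow> real" where
  "potential \<T> = (\<Sum>T\<in>\<T>. (vol T)\<^sup>2)"

lemma vol_nonneg: "0 \<le> vol T" by (simp add: vol_def)

lemma vol_mono: "elem K \<subseteq> elem T \<Longrightarrow> vol K \<le> vol T"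
  unfolding vol_def by (rule measure_mono_fmeasurable) (auto intro: lmeasurable_elem fmeasurableD)

text \<open>New elements are grouped by an old element containing them. Within a group the sum of
  squares is at most the largest volume times the total volume; the total is at most that of the old
  element, and after refinement the largest is at most \<rho> times it.\<close>

lemma potential_decrease:
  fixes \<T> \<T>' :: "'n::finite tagged_simplex set"
  assumes conf: "conforming_mesh \<Omega> \<T>" and conf': "conforming_mesh \<Omega> \<T>'" and ref: "refines \<T> \<T>'"
    and d: "CARD('n) \<ge> 2" and T0: "T0 \<in> \<T>" "T0 \<notin> \<T>'"
  shows "(1/3) ^ CARD('n) * (vol T0)\<^sup>2 + potential \<T>' \<le> potential \<T>"
proof -
  note D = conforming_meshD[OF conf] and D' = conforming_meshD[OF conf']
  define \<rho> :: real where "\<rho> = 1 - (1/3) ^ CARD('n)"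
  have \<rho>: "0 \<le> \<rho>" "\<rho> \<le> 1" by (auto simp: \<rho>_def power_le_one)
  \<comment> \<open>A surviving element is its own ancestor, so the group of a refined element
    consists of new elements only.\<close>
  define anc where "anc T' = (if T' \<in> \<T> then T' else SOME T. T \<in> \<T> \<and> (\<exists>K\<in>sons T. elem T' \<subseteq> elem K))" for T'
  have anc: "anc T' \<in> \<T>" "T' \<notin> \<T> \<Longrightarrow> \<exists>K\<in>sons (anc T'). elem T' \<subseteq> elem K" if T': "T' \<in> \<T>'" for T'
  proof -
    have "T' \<notin> \<T> \<Longrightarrow> anc T' \<in> \<T> \<and> (\<exists>K\<in>sons (anc T'). elem T' \<subseteq> elem K)"
    proof -
      assume n: "T' \<notin> \<T>"
      then have "\<exists>T. T \<in> \<T> \<and> (\<exists>K\<in>sons T. elem T' \<subseteq> elem K)" using ref T' unfolding refines_def by blast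
      from someI_ex[OF this] show ?thesis using n by (simp add: anc_def)
    qed
    then show "anc T' \<in> \<T>" "T' \<notin> \<T> \<Longrightarrow> \<exists>K\<in>sons (anc T'). elem T' \<subseteq> elem K"
      by (cases "T' \<in> \<T>"; simp add: anc_def)+
  qed
  have sub: "elem T' \<subseteq> elem (anc T')" if T': "T' \<in> \<T>'" for T'
  proof (cases "T' \<in> \<T>")
    case False
    then obtain K where "K \<in> sons (anc T')" "elem T' \<subseteq> elem K" using anc(2)[OF T'] by blast
    then show ?thesis using vol_son_le(1)[OF D(2)[OF anc(1)[OF T']] _ d] by blast
  qed (simp add: anc_def)
  define m where "m T = (if T \<in> \<T>' then 1 else \<rho>)" for T
  have m: "m T \<ge> 0" for T using \<rho> by (simp add: m_def)
  have part: "(\<Sum>T'\<in>{T' \<in> \<T>'. anc T' = T}. (vol T')\<^sup>2) \<le> m T * (vol T)\<^sup>2" if T: "T \<in> \<T>" for T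
  proof -
    have le: "vol T' \<le> m T * vol T" if T': "T' \<in> \<T>'" "anc T' = T" for T'
    proof (cases "T \<in> \<T>'")
      case True
      then show ?thesis using vol_mono[OF sub[OF T'(1)]] T'(2) by (simp add: m_def)
    next
      case False
      then have "T' \<notin> \<T>" using T' by (auto simp: anc_def)
      then obtain K where K: "K \<in> sons T" "elem T' \<subseteq> elem K" using anc(2)[OF T'(1)] T'(2) by blast
      then have "vol T' \<le> \<rho> * vol T"
        using vol_mono[OF K(2)] vol_son_le(2)[OF D(2)[OF T] K(1) d] by (simp add: \<rho>_def)
      then show ?thesis using False by (simp add: m_def)
    qed
    have "(\<Sum>T'\<in>{T' \<in> \<T>'. anc T' = T}. (vol T')\<^sup>2) \<le> (\<Sum>T'\<in>{T' \<in> \<T>'. anc T' = T}. (m T * vol T) * vol T')"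
      using le by (intro sum_mono) (simp add: power2_eq_square mult_right_mono vol_nonneg)
    also have "\<dots> = (m T * vol T) * (\<Sum>T'\<in>{T' \<in> \<T>'. anc T' = T}. vol T')" by (simp add: sum_distrib_left)
    also have "\<dots> \<le> (m T * vol T) * vol T"
    proof (rule mult_left_mono)
      show "(\<Sum>T'\<in>{T' \<in> \<T>'. anc T' = T}. vol T') \<le> vol T"
        unfolding vol_def[of T] by (rule sum_vol_le[OF conf' _ lmeasurable_elem]) (use sub in blast)+
    qed (simp add: m vol_nonneg)
    finally show ?thesis by (simp add: power2_eq_square mult.assoc)
  qed
  have "potential \<T>' = (\<Sum>T\<in>\<T>. \<Sum>T'\<in>{T' \<in> \<T>'. anc T' = T}. (vol T')\<^sup>2)"
    unfolding potential_def by (rule sum.group[symmetric]) (use D(1) D'(1) anc(1) in auto)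
  also have "\<dots> \<le> (\<Sum>T\<in>\<T>. m T * (vol T)\<^sup>2)" by (intro sum_mono part)
  also have "\<dots> = m T0 * (vol T0)\<^sup>2 + (\<Sum>T\<in>\<T> - {T0}. m T * (vol T)\<^sup>2)" by (rule sum.remove[OF D(1) T0(1)])
  also have "\<dots> \<le> \<rho> * (vol T0)\<^sup>2 + (\<Sum>T\<in>\<T> - {T0}. (vol T)\<^sup>2)"
    using T0(2) \<rho> by (intro add_mono sum_mono) (auto simp: m_def mult_left_le_one_le)
  also have "(\<Sum>T\<in>\<T> - {T0}. (vol T)\<^sup>2) = potential \<T> - (vol T0)\<^sup>2"
    unfolding potential_def using sum.remove[OF D(1) T0(1), of "\<lambda>T. (vol T)\<^sup>2"] by simp
  finally show ?thesis by (simp add: \<rho>_def algebra_simps)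
qed

text \<open>The potential decreases and is nonnegative, so its increments tend to zero, and each
  increment dominates a fixed multiple of the squared volume of every element refined in that
  step.\<close>

lemma refined_volumes_vanish:
  fixes \<T> :: "nat \<Rightarrow> 'n::finite tagged_simplex set"
  assumes conf: "\<And>l. conforming_mesh \<Omega> (\<T> l)" and ref: "\<And>l. refines (\<T> l) (\<T> (Suc l))"
    and d: "CARD('n) \<ge> 2" and \<epsilon>: "\<epsilon> > 0"
  shows "\<exists>l0. \<forall>l\<ge>l0. \<forall>T\<in>\<T> l - \<T> (Suc l). vol T < \<epsilon>"
proof -
  define c :: real where "c = (1/3) ^ CARD('n)"
  have c: "c > 0" by (simp add: c_def)
  have mono: "potential (\<T> (Suc l)) \<le> potential (\<T> l)" for l
  proof (cases "\<exists>T0. T0 \<in> \<T> l \<and> T0 \<notin> \<T> (Suc l)")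
    case True
    then obtain T0 where "T0 \<in> \<T> l" "T0 \<notin> \<T> (Suc l)" by blast
    from potential_decrease[OF conf conf ref d this]
    have "(1/3) ^ CARD('n) * (vol T0)\<^sup>2 + potential (\<T> (Suc l)) \<le> potential (\<T> l)" .
    moreover have "0 \<le> (1/3::real) ^ CARD('n) * (vol T0)\<^sup>2" by simp
    ultimately show ?thesis by linarith
  \<comment> \<open>If every old element survives, the meshes coincide: an additional element would
    lie inside an old one that is still present, against conformity.\<close>
  next
    case False
    then have sub: "\<T> l \<subseteq> \<T> (Suc l)" by blast
    have "T \<in> \<T> l" if T: "T \<in> \<T> (Suc l)" for T
    proof (rule ccontr)
      assume n: "T \<notin> \<T> l"
      then obtain T' K where T': "T' \<in> \<T> l" "K \<in> sons T'" "elem T \<subseteq> elem K" using ref T unfolding refines_def by blast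
      have "elem T \<subseteq> elem T'" using T'(3) vol_son_le(1)[OF conforming_meshD(2)[OF conf T'(1)] T'(2) d] by blast
      then have "interior (elem T) \<inter> elem T' \<noteq> {}"
        using tagged_simplexD(4)[OF conforming_meshD(2)[OF conf T]] interior_subset by blast
      then show False using conforming_meshD(6)[OF conf T, of T'] sub T'(1) n by blast
    qed
    then have "\<T> (Suc l) = \<T> l" using sub by blast
    then show ?thesis by simp
  qed
  have "potential (\<T> l) \<ge> 0" for l by (simp add: potential_def sum_nonneg)
  then have "convergent (\<lambda>l. potential (\<T> l))"
    using mono by (intro Bseq_monoseq_convergent decseq_bounded decseq_imp_monoseq) (auto simp: decseq_Suc_iff)
  then obtain L where "(\<lambda>l. potential (\<T> l)) \<longlonglongrightarrow> L" unfolding convergent_def by blast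
  then have "(\<lambda>l. potential (\<T> l) - potential (\<T> (Suc l))) \<longlonglongrightarrow> L - L"
    by (intro tendsto_diff LIMSEQ_Suc)
  then have "eventually (\<lambda>l. potential (\<T> l) - potential (\<T> (Suc l)) < c * \<epsilon>\<^sup>2) sequentially"
    using c \<epsilon> by (intro order_tendstoD(2)[of _ "L - L"]) auto
  then obtain l0 where l0: "\<And>l. l \<ge> l0 \<Longrightarrow> potential (\<T> l) - potential (\<T> (Suc l)) < c * \<epsilon>\<^sup>2"
    unfolding eventually_sequentially by blast
  have "vol T < \<epsilon>" if l: "l \<ge> l0" and T: "T \<in> \<T> l - \<T> (Suc l)" for l T
  proof -
    have "c * (vol T)\<^sup>2 < c * \<epsilon>\<^sup>2"
      using potential_decrease[OF conf[of l] conf[of "Suc l"] ref d, of T, folded c_def] T l0[OF l] by simp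
    then show ?thesis using c \<epsilon> by (simp add: power2_less_imp_less)
  qed
  then show ?thesis by blast
qed

lemma ancestor_exists:
  fixes \<T> :: "nat \<Rightarrow> 'n::finite tagged_simplex set"
  assumes conf: "\<And>l. conforming_mesh \<Omega> (\<T> l)" and ref: "\<And>l. refines (\<T> l) (\<T> (Suc l))"
    and d: "CARD('n) \<ge> 2" and kl: "k \<le> l" and T: "T \<in> \<T> l"
  shows "\<exists>K\<in>\<T> k. elem T \<subseteq> elem K"
  using kl T
proof (induction l arbitrary: T rule: dec_induct)
  case base
  then show ?case by blast
next
  case (step l)
  have "\<exists>T'\<in>\<T> l. elem T \<subseteq> elem T'"
  proof (cases "T \<in> \<T> l")
    case False
    then obtain T' K where T': "T' \<in> \<T> l" "K \<in> sons T'" "elem T \<subseteq> elem K"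
      using ref step.prems unfolding refines_def by blast
    then show ?thesis using vol_son_le(1)[OF conforming_meshD(2)[OF conf T'(1)] T'(2) d] by blast
  qed blast
  then show ?case using step.IH by blast
qed

section \<open>Geometry of shape regular meshes\<close>

abbreviation diam :: "('n::finite) tagged_simplex \<Rightarrow> real" where
  "diam T \<equiv> diameter (elem T)"

lemma dist_le_diam: "a \<in> elem T \<Longrightarrow> b \<in> elem T \<Longrightarrow> norm (a - b) \<le> diam T"
  using diameter_bounded_bound[OF compact_imp_bounded[OF compact_elem], of a T b] by (simp add: dist_norm)

lemma elem_subset_cball: "a \<in> elem T \<Longrightarrow> elem T \<subseteq> cball a (diam T)"
  using dist_le_diam[of a T] by (auto simp: dist_norm)

lemma vertex_in_elem: "a \<in> set (fst T) \<Longrightarrow> a \<in> elem T"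
  unfolding elem_def by (rule hull_inc)

lemma diam_pos:
  fixes T :: "'n::finite tagged_simplex"
  assumes "is_tagged_simplex T"
  shows "diam T > 0"
proof (rule ccontr)
  assume "\<not> diam T > 0"
  then have "diam T \<le> 0" by simp
  obtain a where a: "a \<in> elem T" using tagged_simplexD(4)[OF assms] interior_subset by blast
  have "elem T \<subseteq> {a}"
  proof
    fix b assume "b \<in> elem T"
    from dist_le_diam[OF this a] \<open>diam T \<le> 0\<close> have "norm (b - a) \<le> 0" by linarith
    then show "b \<in> {a}" by simp
  qed
  then have "negligible (elem T)" using negligible_subset[OF negligible_sing] by blast
  then show False using tagged_simplexD(6)[OF assms] by blast
qed

text \<open>The type argument expresses that the constant depends on the dimension only.\<close>

definition ball_vol :: "'n::finite itself \<Rightarrow> real" where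
  "ball_vol _ = measure lebesgue (cball (0 :: real ^ 'n) 1)"

lemma measure_cball:
  fixes a :: "real ^ 'n::finite"
  assumes "r \<ge> 0"
  shows "measure lebesgue (cball a r) = ball_vol TYPE('n) * r ^ CARD('n)"
proof (cases "r = 0")
  case False
  have "(\<lambda>y. r *\<^sub>R y + a) ` cball 0 1 = cball a r"
  proof (intro equalityI subsetI)
    fix z assume "z \<in> cball a r"
    then have "(1 / r) *\<^sub>R (z - a) \<in> cball 0 1" "z = r *\<^sub>R ((1 / r) *\<^sub>R (z - a)) + a"
      using False assms by (simp_all add: dist_norm norm_minus_commute)
    then show "z \<in> (\<lambda>y. r *\<^sub>R y + a) ` cball 0 1" by blast
  next
    fix z assume "z \<in> (\<lambda>y. r *\<^sub>R y + a) ` cball 0 1"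
    then show "z \<in> cball a r" using assms by (auto simp: dist_norm mult_left_le)
  qed
  then show ?thesis
    using measure_lebesgue_affine[of r a "cball 0 1"] assms by (simp add: ball_vol_def mult.commute)
qed (simp add: power_0_left)

lemma ball_vol_pos: "ball_vol TYPE('n::finite) > 0"
proof -
  have "\<not> negligible (cball (0 :: real ^ 'n) 1)"
    using negligible_subset[OF _ ball_subset_cball] open_not_negligible[OF open_ball, of "0 :: real ^ 'n" 1] by auto
  then have "measure lebesgue (cball (0 :: real ^ 'n) 1) \<noteq> 0"
    using negligible_iff_measure0[OF lmeasurable_cball] by blast
  then show ?thesis unfolding ball_vol_def by (simp add: less_le)
qed

text \<open>
  Translates of the simplex by distinct integer multiples of an edge overlap only in a hyperplane;
  all of those that start in a ball of radius \<open>diam T\<close> fit into a ball of twice the radius.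
\<close>

lemma edge_bound:
  fixes T :: "'n::finite tagged_simplex"
  assumes T: "is_tagged_simplex T" and ab: "a \<in> set (fst T)" "b \<in> set (fst T)" "a \<noteq> b"
  shows "vol T * diam T \<le> ball_vol TYPE('n) * (2 * diam T) ^ CARD('n) * norm (b - a)"
proof -
  define h v where "h = diam T" and "v = b - a"
  have h: "h > 0" using diam_pos[OF T] by (simp add: h_def)
  have v: "norm v > 0" using ab by (simp add: v_def)
  \<comment> \<open>The translates by \<open>k * v\<close> with \<open>k \<le> N\<close> move by at
    most \<open>h\<close>; there are \<open>N + 1 \<ge> h / norm v\<close> of them, counting
    \<open>k = 0\<close>.\<close>
  define N where "N = nat \<lfloor>h / norm v\<rfloor>"
  have N: "real N \<le> h / norm v" "h / norm v \<le> real (Suc N)"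
    using h v unfolding N_def by (simp_all add: of_nat_nat) linarith
  obtain e \<beta> where e: "\<And>u. u \<in> set (fst T) \<Longrightarrow> u \<noteq> b \<Longrightarrow> e \<bullet> u = \<beta>" "e \<bullet> b = \<beta> + 1" "e \<noteq> 0"
    "elem T \<subseteq> {u. e \<bullet> u \<ge> \<beta>}" "elem T \<subseteq> {u. e \<bullet> u \<le> \<beta> + 1}"
    using vertex_functional[OF T ab(2)] by metis
  have ev: "e \<bullet> v = 1" using e(1)[OF ab(1,3)] e(2) by (simp add: v_def inner_diff_right)
  define I where "I = (\<lambda>k. real k *\<^sub>R v) ` {..N}"
  have inj: "inj_on (\<lambda>k. real k *\<^sub>R v) {..N}" using v by (auto simp: inj_on_def)
  have "real (card I) * measure lebesgue (elem T) \<le> measure lebesgue (cball a (2 * h))"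
  proof (rule measure_disjoint_translates[OF lmeasurable_elem lmeasurable_cball])
    show "finite I" by (simp add: I_def)
    fix d assume "d \<in> I"
    then obtain k where k: "k \<le> N" "d = real k *\<^sub>R v" by (auto simp: I_def)
    have "norm d \<le> real N * norm v" using k by (simp add: mult_right_mono)
    also have "\<dots> \<le> h" using N(1) v by (simp add: pos_le_divide_eq)
    finally have d: "norm d \<le> h" .
    show "(+) d ` elem T \<subseteq> cball a (2 * h)"
    proof
      fix z assume "z \<in> (+) d ` elem T"
      then obtain y where y: "y \<in> elem T" "z = d + y" by blast
      have "norm (y - a) \<le> h" using dist_le_diam[OF y(1) vertex_in_elem[OF ab(1)]] by (simp add: h_def)
      then have "norm ((y - a) + d) \<le> h + h" using d by (intro norm_triangle_le) simp
      moreover have "z - a = (y - a) + d" using y(2) by simp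
      ultimately have "norm (z - a) \<le> h + h" by (simp only:)
      then show "z \<in> cball a (2 * h)" by (simp add: dist_norm norm_minus_commute)
    qed
  next
    \<comment> \<open>The functional \<open>e\<close> confines the simplex to a slab of width 1 and
      gains exactly 1 along \<open>v\<close>, so translated slabs share at most a
      hyperplane.\<close>
    have half: "negligible ((+) (real k *\<^sub>R v) ` elem T \<inter> (+) (real k' *\<^sub>R v) ` elem T)" if kk: "k < k'" for k k'
    proof (rule negligible_subset[OF negligible_hyperplane])
      show "e \<noteq> 0 \<or> \<beta> + real k' \<noteq> 0" using e(3) by blast
      show "(+) (real k *\<^sub>R v) ` elem T \<inter> (+) (real k' *\<^sub>R v) ` elem T \<subseteq> {x. e \<bullet> x = \<beta> + real k'}"
      proof
        fix z assume "z \<in> (+) (real k *\<^sub>R v) ` elem T \<inter> (+) (real k' *\<^sub>R v) ` elem T"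
        then obtain y y' where y: "y \<in> elem T" "z = real k *\<^sub>R v + y" "y' \<in> elem T" "z = real k' *\<^sub>R v + y'" by blast
        have "e \<bullet> z = real k + e \<bullet> y" "e \<bullet> z = real k' + e \<bullet> y'"
          using y(2,4) ev by (metis inner_add_right inner_scaleR_right mult.right_neutral)+
        moreover have "e \<bullet> y \<le> \<beta> + 1" "\<beta> \<le> e \<bullet> y'" using e(4,5) y by blast+
        moreover have "real k + 1 \<le> real k'" using kk by linarith
        ultimately have "e \<bullet> z = \<beta> + real k'" by linarith
        then show "z \<in> {x. e \<bullet> x = \<beta> + real k'}" by simp
      qed
    qed
    fix d d' assume dd: "d \<in> I" "d' \<in> I" "d \<noteq> d'"
    then obtain k k' where k: "d = real k *\<^sub>R v" "d' = real k' *\<^sub>R v" "k \<noteq> k'" by (auto simp: I_def)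
    then have "k < k' \<or> k' < k" by linarith
    then show "negligible ((+) d ` elem T \<inter> (+) d' ` elem T)"
      using half[of k k'] half[of k' k] k by (auto simp: Int_commute)
  qed
  also have "real (card I) = real (Suc N)" using inj by (simp add: I_def card_image)
  finally have *: "real (Suc N) * vol T \<le> ball_vol TYPE('n) * (2 * h) ^ CARD('n)"
    using measure_cball[of "2 * h" a] h by (simp add: vol_def)
  have "(h / norm v) * vol T \<le> real (Suc N) * vol T" by (rule mult_right_mono[OF N(2) vol_nonneg])
  then have "(h / norm v) * vol T \<le> ball_vol TYPE('n) * (2 * h) ^ CARD('n)" using * by linarith
  then have "(h / norm v) * vol T * norm v \<le> ball_vol TYPE('n) * (2 * h) ^ CARD('n) * norm v"
    using v by (intro mult_right_mono) auto
  then show ?thesis using v by (simp add: h_def v_def mult.commute)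
qed

lemma shape_regularD:
  fixes \<T> :: "'n::finite tagged_simplex set"
  assumes "shape_regular \<gamma> \<T>" "\<gamma> > 0" "T \<in> \<T>" "is_tagged_simplex T"
  shows "diam T ^ CARD('n) \<le> \<gamma> ^ CARD('n) * vol T"
    "vol T \<le> \<gamma> ^ CARD('n) * diam T ^ CARD('n)"
    "vol T powr (1 / CARD('n)) \<le> \<gamma> * diam T"
    "vol T powr (2 / CARD('n)) \<le> \<gamma>\<^sup>2 * (diam T)\<^sup>2"
    "diam T \<le> \<gamma> * vol T powr (1 / CARD('n))"
proof -
  have v: "vol T > 0" using tagged_simplexD(5)[OF assms(4)] .
  define s where "s = vol T powr (1 / CARD('n))"
  have s: "inverse \<gamma> * s \<le> diam T" and ub: "diam T \<le> \<gamma> * s"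
    using assms(1,3) unfolding shape_regular_def s_def by blast+
  have sd: "s ^ CARD('n) = vol T" unfolding s_def using v by (simp add: powr_power)
  have s0: "s \<ge> 0" by (simp add: s_def)
  have s1: "s \<le> \<gamma> * diam T" using s assms(2) by (simp add: field_simps)
  show "diam T \<le> \<gamma> * vol T powr (1 / CARD('n))" using ub by (simp add: s_def)
  have "diam T ^ CARD('n) \<le> (\<gamma> * s) ^ CARD('n)"
    using ub diam_pos[OF assms(4)] by (intro power_mono) auto
  then show "diam T ^ CARD('n) \<le> \<gamma> ^ CARD('n) * vol T" by (simp add: power_mult_distrib sd)
  show "vol T powr (1 / CARD('n)) \<le> \<gamma> * diam T" using s1 by (simp add: s_def)
  have "s ^ CARD('n) \<le> (\<gamma> * diam T) ^ CARD('n)" using s1 s0 by (rule power_mono)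
  then show "vol T \<le> \<gamma> ^ CARD('n) * diam T ^ CARD('n)" by (simp add: power_mult_distrib sd)
  have "s ^ 2 \<le> (\<gamma> * diam T) ^ 2" using s1 s0 by (rule power_mono)
  moreover have "s ^ 2 = vol T powr (2 / CARD('n))" unfolding s_def using v by (simp add: powr_power)
  ultimately show "vol T powr (2 / CARD('n)) \<le> \<gamma>\<^sup>2 * (diam T)\<^sup>2" by (simp add: power_mult_distrib)
qed

text \<open>A facet omits a single vertex and therefore has \<open>CARD('n) \<ge> 2\<close>
  vertices; it thus contains an edge. Through this edge the sizes of facet neighbours are
  compared.\<close>

lemma facetD:
  fixes T :: "'n::finite tagged_simplex"
  assumes T: "is_tagged_simplex T" and F: "F facet_of elem T" and d: "CARD('n) \<ge> 2"
  shows "compact F" "F \<subseteq> elem T" "F \<noteq> {}" "\<exists>a b. a \<in> set (fst T) \<and> b \<in> set (fst T) \<and> a \<noteq> b \<and> a \<in> F \<and> b \<in> F"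
    "\<exists>n c. n \<noteq> 0 \<and> F \<subseteq> {x. n \<bullet> x = c}"
proof -
  let ?S = "set (fst T)"
  note D = tagged_simplexD[OF T]
  obtain u where u: "F \<noteq> {}" "u \<in> ?S" "F = convex hull (?S - {u})"
    using F facet_of_convex_hull_affine_independent[OF D(2), of F] unfolding elem_def by blast
  show "F \<noteq> {}" by (rule u(1))
  show "compact F" unfolding u(3) by (simp add: finite_imp_compact_convex_hull)
  show "F \<subseteq> elem T" unfolding u(3) elem_def by (rule hull_mono) blast
  have c: "card (?S - {u}) = CARD('n)" using D(1) u(2) by simp
  then have "\<not> card (?S - {u}) \<le> Suc 0" using d by simp
  then obtain a b where "a \<in> ?S - {u}" "b \<in> ?S - {u}" "a \<noteq> b"
    using card_le_Suc0_iff_eq[of "?S - {u}"] by blast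
  then show "\<exists>a b. a \<in> ?S \<and> b \<in> ?S \<and> a \<noteq> b \<and> a \<in> F \<and> b \<in> F"
    unfolding u(3) using hull_subset[of "?S - {u}" convex] by blast
  have "aff_dim (?S - {u}) < int DIM(real ^ 'n)"
    using aff_dim_le_card[of "?S - {u}"] c by simp
  then have "aff_dim F < int DIM(real ^ 'n)" unfolding u(3) by (simp add: aff_dim_convex_hull)
  then show "\<exists>n c. n \<noteq> 0 \<and> F \<subseteq> {x. n \<bullet> x = c}" by (metis aff_lowdim_subset_hyperplane)
qed

lemma card_facets:
  fixes T :: "'n::finite tagged_simplex"
  assumes T: "is_tagged_simplex T"
  shows "finite {F. F facet_of elem T}" "card {F. F facet_of elem T} \<le> CARD('n) + 1"
proof -
  let ?S = "set (fst T)"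
  note D = tagged_simplexD[OF T]
  have sub: "{F. F facet_of elem T} \<subseteq> (\<lambda>u. convex hull (?S - {u})) ` ?S"
    using facet_of_convex_hull_affine_independent[OF D(2)] unfolding elem_def by blast
  then show "finite {F. F facet_of elem T}" by (rule finite_subset) simp
  have "card {F. F facet_of elem T} \<le> card ((\<lambda>u. convex hull (?S - {u})) ` ?S)"
    by (rule card_mono[OF _ sub]) simp
  also have "\<dots> \<le> card ?S" by (rule card_image_le) simp
  finally show "card {F. F facet_of elem T} \<le> CARD('n) + 1" using D(1) by simp
qed

text \<open>The constant that results from \<open>edge_bound\<close> when
  \<open>diam T ^ CARD('n)\<close> is replaced by a multiple of \<open>vol T\<close> through shape
  regularity: the diameter is at most this multiple of any edge.\<close>

definition comparability :: "'n::finite itself \<Rightarrow> real \<Rightarrow> real" where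
  "comparability _ \<gamma> = ball_vol TYPE('n) * 2 ^ CARD('n) * \<gamma> ^ CARD('n)"

lemma comparability_pos: "\<gamma> > 0 \<Longrightarrow> comparability TYPE('n::finite) \<gamma> > 0"
  by (simp add: comparability_def ball_vol_pos)

text \<open>An edge of \<open>T\<close> in the common facet is at least a fixed fraction of
  \<open>diam T\<close>, and it lies in \<open>T'\<close>, whose diameter bounds it.\<close>

lemma diam_comparable:
  fixes \<T> :: "'n::finite tagged_simplex set"
  assumes reg: "shape_regular \<gamma> \<T>" "\<gamma> > 0" and T: "T \<in> \<T>" "is_tagged_simplex T" and d: "CARD('n) \<ge> 2"
    and F: "F facet_of elem T" "F \<subseteq> elem T'"
  shows "diam T \<le> comparability TYPE('n) \<gamma> * diam T'"
proof -
  obtain a b where ab: "a \<in> set (fst T)" "b \<in> set (fst T)" "a \<noteq> b" "a \<in> F" "b \<in> F"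
    using facetD(4)[OF T(2) F(1) d] by blast
  have v: "vol T > 0" using tagged_simplexD(5)[OF T(2)] .
  have "vol T * diam T \<le> ball_vol TYPE('n) * (2 * diam T) ^ CARD('n) * norm (b - a)"
    by (rule edge_bound[OF T(2) ab(1-3)])
  also have "\<dots> = (ball_vol TYPE('n) * 2 ^ CARD('n)) * norm (b - a) * diam T ^ CARD('n)"
    by (simp add: power_mult_distrib)
  also have "\<dots> \<le> (ball_vol TYPE('n) * 2 ^ CARD('n)) * norm (b - a) * (\<gamma> ^ CARD('n) * vol T)"
    using shape_regularD(1)[OF reg T] ball_vol_pos[where 'n = 'n] by (intro mult_left_mono) auto
  also have "\<dots> = vol T * (comparability TYPE('n) \<gamma> * norm (b - a))" by (simp add: comparability_def)
  finally have "diam T \<le> comparability TYPE('n) \<gamma> * norm (b - a)" using v by (rule mult_left_le_imp_le)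
  also have "\<dots> \<le> comparability TYPE('n) \<gamma> * diam T'"
    using dist_le_diam[of b T' a] ab F(2) comparability_pos[OF reg(2), where 'n = 'n] by (intro mult_left_mono) auto
  finally show ?thesis .
qed

definition nbs :: "('n::finite) tagged_simplex set \<Rightarrow> 'n tagged_simplex \<Rightarrow> 'n tagged_simplex set" where
  "nbs \<T> T = {T' \<in> \<T> - {T}. \<exists>F. F facet_of elem T \<and> F facet_of elem T'}"

lemma facet_of_subset: "F facet_of S \<Longrightarrow> F \<subseteq> S"
  by (meson facet_of_imp_face_of face_of_imp_subset)

text \<open>Facet neighbours have comparable size, hence volumes bounded below by a multiple of
  \<open>?h ^ CARD('n)\<close>. They overlap in null sets and lie in one ball of radius proportional
  to \<open>?h\<close>.\<close>

lemma card_nbs: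
  fixes \<T> :: "'n::finite tagged_simplex set"
  assumes conf: "conforming_mesh \<Omega> \<T>" and reg: "shape_regular \<gamma> \<T>" "\<gamma> > 0" and d: "CARD('n) \<ge> 2" and T: "T \<in> \<T>"
  shows "real (card (nbs \<T> T)) \<le> ball_vol TYPE('n) *
    ((1 + comparability TYPE('n) \<gamma>) * comparability TYPE('n) \<gamma> * \<gamma>) ^ CARD('n)"
proof -
  note D = conforming_meshD[OF conf]
  let ?L = "comparability TYPE('n) \<gamma>" and ?h = "diam T"
  have L: "?L > 0" by (rule comparability_pos[OF reg(2)])
  have h: "?h > 0" by (rule diam_pos[OF D(2)[OF T]])
  obtain x where x: "x \<in> elem T" using tagged_simplexD(4)[OF D(2)[OF T]] interior_subset by blast
  have nb: "T' \<in> \<T>" "?h \<le> ?L * diam T'" "elem T' \<subseteq> cball x ((1 + ?L) * ?h)" if nb: "T' \<in> nbs \<T> T" for T'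
  proof -
    obtain F where F: "T' \<in> \<T>" "F facet_of elem T" "F facet_of elem T'" using nb unfolding nbs_def by blast
    show "T' \<in> \<T>" by (rule F(1))
    have FS: "F \<subseteq> elem T" "F \<subseteq> elem T'" using F facet_of_subset by blast+
    show "?h \<le> ?L * diam T'" by (rule diam_comparable[OF reg T D(2)[OF T] d F(2) FS(2)])
    have h': "diam T' \<le> ?L * ?h" by (rule diam_comparable[OF reg F(1) D(2)[OF F(1)] d F(3) FS(1)])
    obtain w where w: "w \<in> F" using facetD(3)[OF D(2)[OF T] F(2) d] by blast
    show "elem T' \<subseteq> cball x ((1 + ?L) * ?h)"
    proof
      fix y assume y: "y \<in> elem T'"
      have "norm (x - w) \<le> ?h" "norm (w - y) \<le> diam T'"
        using dist_le_diam[OF x, of w] dist_le_diam[OF _ y, of w] w FS by blast+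
      then have "norm ((x - w) + (w - y)) \<le> ?h + ?L * ?h" using h' by (intro norm_triangle_le) simp
      then show "y \<in> cball x ((1 + ?L) * ?h)" by (simp add: dist_norm algebra_simps)
    qed
  qed
  have "real (card (nbs \<T> T)) * (?h ^ CARD('n) / (?L ^ CARD('n) * \<gamma> ^ CARD('n))) =
     (\<Sum>T'\<in>nbs \<T> T. ?h ^ CARD('n) / (?L ^ CARD('n) * \<gamma> ^ CARD('n)))" by simp
  also have "\<dots> \<le> (\<Sum>T'\<in>nbs \<T> T. vol T')"
  proof (rule sum_mono)
    fix T' assume T': "T' \<in> nbs \<T> T"
    have "?h ^ CARD('n) \<le> (?L * diam T') ^ CARD('n)" using nb(2)[OF T'] h by (intro power_mono) auto
    also have "\<dots> = ?L ^ CARD('n) * diam T' ^ CARD('n)" by (rule power_mult_distrib)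
    also have "\<dots> \<le> ?L ^ CARD('n) * (\<gamma> ^ CARD('n) * vol T')"
      using shape_regularD(1)[OF reg nb(1)[OF T'] D(2)[OF nb(1)[OF T']]] L by (intro mult_left_mono) auto
    finally show "?h ^ CARD('n) / (?L ^ CARD('n) * \<gamma> ^ CARD('n)) \<le> vol T'"
      using L reg(2) by (simp add: pos_divide_le_eq mult_ac)
  qed
  also have "\<dots> \<le> measure lebesgue (cball x ((1 + ?L) * ?h))"
    by (rule sum_vol_le[OF conf _ lmeasurable_cball]) (use nb in blast)+
  also have "\<dots> = ball_vol TYPE('n) * ((1 + ?L) * ?h) ^ CARD('n)" by (rule measure_cball) (use L h in simp)
  finally have "real (card (nbs \<T> T)) * ?h ^ CARD('n) \<le>
     ball_vol TYPE('n) * ((1 + ?L) * ?h) ^ CARD('n) * (?L ^ CARD('n) * \<gamma> ^ CARD('n))"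
    using L reg(2) by (simp add: pos_divide_le_eq)
  also have "\<dots> = ball_vol TYPE('n) * ((1 + ?L) * ?L * \<gamma>) ^ CARD('n) * ?h ^ CARD('n)"
    by (simp only: power_mult_distrib mult_ac)
  finally show ?thesis by (rule mult_right_le_imp_le) (simp add: h)
qed

lemma nbs_sym: "T \<in> \<T> \<Longrightarrow> T' \<in> nbs \<T> T \<Longrightarrow> T \<in> nbs \<T> T'"
  unfolding nbs_def by blast

section \<open>Facet integrals\<close>

lemma unit_normal_facet:
  assumes "n \<noteq> 0" "F \<subseteq> {x. n \<bullet> x = c}"
  shows "norm (unit_normal F) = 1" "\<And>x y. x \<in> F \<Longrightarrow> y \<in> F \<Longrightarrow> unit_normal F \<bullet> (x - y) = 0"
proof -
  have "norm ((1 / norm n) *\<^sub>R n) = 1 \<and> (\<forall>x\<in>F. \<forall>y\<in>F. ((1 / norm n) *\<^sub>R n) \<bullet> (x - y) = 0)"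
    using assms by (auto simp: inner_diff_right)
  then have "norm (unit_normal F) = 1 \<and> (\<forall>x\<in>F. \<forall>y\<in>F. unit_normal F \<bullet> (x - y) = 0)"
    unfolding unit_normal_def by (rule someI)
  then show "norm (unit_normal F) = 1" "\<And>x y. x \<in> F \<Longrightarrow> y \<in> F \<Longrightarrow> unit_normal F \<bullet> (x - y) = 0" by blast+
qed

text \<open>The prism over \<open>F\<close> has height 1 and base diameter at most \<open>h\<close>,
  so about \<open>1 / h\<close> balls of radius \<open>2 * h\<close> cover it. Multiplication by
  \<open>h\<close> cancels this count; the bound \<open>h \<le> R\<close> absorbs the lower order
  part.\<close>

lemma facet_integral_le:
  fixes F :: "(real ^ 'n::finite) set"
  assumes F: "compact F" "F \<noteq> {}" "n0 \<noteq> 0" "F \<subseteq> {x. n0 \<bullet> x = c}"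
    and h: "0 < h" "h \<le> R" "\<And>x y. x \<in> F \<Longrightarrow> y \<in> F \<Longrightarrow> norm (x - y) \<le> h"
    and g: "\<And>x. x \<in> F \<Longrightarrow> g x \<le> G" and G: "G \<ge> 0"
  shows "h * facet_integral F g \<le> (ball_vol TYPE('n) * 2 ^ CARD('n) * (1 + 2 * R)) * G * h ^ CARD('n)"
proof -
  define n where "n = unit_normal F"
  have n: "norm n = 1" "\<And>x y. x \<in> F \<Longrightarrow> y \<in> F \<Longrightarrow> n \<bullet> (x - y) = 0"
    using unit_normal_facet[OF F(3,4)] by (simp_all add: n_def)
  define P where "P = {y + s *\<^sub>R n | y s. y \<in> F \<and> s \<in> {0..1::real}}"
  have "P = (\<lambda>(y, s). y + s *\<^sub>R n) ` (F \<times> {0..1::real})"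
  proof (intro equalityI subsetI)
    fix x assume "x \<in> P"
    then obtain y s where "y \<in> F" "s \<in> {0..1}" "x = y + s *\<^sub>R n" unfolding P_def by blast
    then show "x \<in> (\<lambda>(y, s). y + s *\<^sub>R n) ` (F \<times> {0..1::real})"
      by (intro image_eqI[of _ _ "(y, s)"]) simp_all
  next
    fix x assume "x \<in> (\<lambda>(y, s). y + s *\<^sub>R n) ` (F \<times> {0..1::real})"
    then obtain q where q: "q \<in> F \<times> {0..1::real}" "x = (\<lambda>(y, s). y + s *\<^sub>R n) q" by blast
    obtain y s where "q = (y, s)" by (cases q)
    then have "y \<in> F" "s \<in> {0..1}" "x = y + s *\<^sub>R n" using q by simp_all
    then show "x \<in> P" unfolding P_def by blast
  qed
  moreover have "compact ((\<lambda>(y, s). y + s *\<^sub>R n) ` (F \<times> {0..1::real}))"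
    by (intro compact_continuous_image compact_Times F(1) compact_Icc)
      (auto simp: case_prod_unfold intro!: continuous_intros)
  ultimately have Pm: "P \<in> lmeasurable" by (simp add: lmeasurable_compact)
  obtain y0 where y0: "y0 \<in> F" using F(2) by blast
  have orth: "n \<bullet> (z - y0) = 0" if "z \<in> affine hull F" for z
  proof -
    have "F \<subseteq> {z. n \<bullet> z = n \<bullet> y0}" using n(2)[OF _ y0] by (auto simp: inner_diff_right)
    then have "affine hull F \<subseteq> {z. n \<bullet> z = n \<bullet> y0}" by (rule hull_minimal) (rule affine_hyperplane)
    then show ?thesis using that by (auto simp: inner_diff_right)
  qed
  \<comment> \<open>The direction \<open>n\<close> is orthogonal to the affine hull, so by
    Pythagoras the foot point is the closest one.\<close>
  have cp: "closest_point (affine hull F) (y + s *\<^sub>R n) = y" if y: "y \<in> F" for y s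
  proof (rule closest_point_unique[symmetric])
    show "convex (affine hull F)" "closed (affine hull F)" by (auto simp: affine_imp_convex)
    show yh: "y \<in> affine hull F" using y by (rule hull_inc)
    show "\<forall>z\<in>affine hull F. dist (y + s *\<^sub>R n) y \<le> dist (y + s *\<^sub>R n) z"
    proof
      fix z assume z: "z \<in> affine hull F"
      have o: "n \<bullet> (y - z) = 0" using orth[OF yh] orth[OF z] by (simp add: inner_diff_right)
      have "(norm ((y - z) + s *\<^sub>R n))\<^sup>2 = (norm (y - z))\<^sup>2 + (norm (s *\<^sub>R n))\<^sup>2"
        unfolding power2_norm_eq_inner using o by (simp add: inner_add_left inner_add_right inner_commute)
      then have "(norm (s *\<^sub>R n))\<^sup>2 \<le> (norm ((y - z) + s *\<^sub>R n))\<^sup>2" by simp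
      then have "norm (s *\<^sub>R n) \<le> norm ((y - z) + s *\<^sub>R n)" by (rule power2_le_imp_le) simp
      then show "dist (y + s *\<^sub>R n) y \<le> dist (y + s *\<^sub>R n) z" by (simp add: dist_norm algebra_simps)
    qed
  qed
  have "facet_integral F g = (LINT x|lebesgue_on P. g (closest_point (affine hull F) x))"
    unfolding facet_integral_def P_def n_def ..
  also have "\<dots> \<le> (LINT x|lebesgue_on P. G)"
  \<comment> \<open>Only the majorant has to be integrable: a non-integrable integrand has integral
    0, which \<open>G \<ge> 0\<close> takes care of.\<close>
  proof (rule integral_mono')
    show "integrable (lebesgue_on P) (\<lambda>x. G)"
      using Pm by (simp add: finite_measure.integrable_const finite_measure_lebesgue_on)
    fix x assume "x \<in> space (lebesgue_on P)"
    then obtain y s where "y \<in> F" "x = y + s *\<^sub>R n" unfolding P_def by auto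
    then show "g (closest_point (affine hull F) x) \<le> G" using cp g by simp
  qed (rule G)
  also have "\<dots> = measure lebesgue P * G" using Pm by (simp add: measure_restrict_space fmeasurableD)
  also have "\<dots> \<le> ((1 / h + 2) * (ball_vol TYPE('n) * (2 * h) ^ CARD('n))) * G"
  proof (rule mult_right_mono[OF _ G])
    define N where "N = nat \<lfloor>1 / h\<rfloor>"
    let ?B = "\<lambda>j. cball (y0 + (real j * h) *\<^sub>R n) (2 * h)"
    \<comment> \<open>The height \<open>s\<close> is rounded down to a multiple of \<open>h\<close>;
      the error \<open>h\<close> together with the base diameter \<open>h\<close> gives the
      radius.\<close>
    have "P \<subseteq> (\<Union>j\<in>{..N}. ?B j)"
    proof
      fix x assume "x \<in> P"
      then obtain y s where y: "y \<in> F" "0 \<le> s" "s \<le> 1" "x = y + s *\<^sub>R n" unfolding P_def by auto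
      define j where "j = nat \<lfloor>s / h\<rfloor>"
      have "\<lfloor>s / h\<rfloor> \<le> \<lfloor>1 / h\<rfloor>" using y h by (intro floor_mono divide_right_mono) auto
      then have jN: "j \<le> N" unfolding j_def N_def by (rule nat_mono)
      have "0 \<le> \<lfloor>s / h\<rfloor>" using y h by simp
      then have "real j = of_int \<lfloor>s / h\<rfloor>" unfolding j_def by (simp add: of_nat_nat)
      then have "real j \<le> s / h" "s / h \<le> real j + 1" by linarith+
      then have "real j * h \<le> s" "s \<le> real j * h + h" using h by (simp_all add: field_simps)
      then have "\<bar>real j * h - s\<bar> \<le> h" by linarith
      then have "norm ((real j * h - s) *\<^sub>R n) \<le> h" using n(1) by simp
      moreover have "norm (y0 - y) \<le> h" using h(3)[OF y0 y(1)] .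
      ultimately have "norm ((y0 - y) + (real j * h - s) *\<^sub>R n) \<le> h + h" by (intro norm_triangle_le) simp
      then have "x \<in> ?B j" by (simp add: y(4) dist_norm algebra_simps)
      then show "x \<in> (\<Union>j\<in>{..N}. ?B j)" using jN by blast
    qed
    then have "measure lebesgue P \<le> measure lebesgue (\<Union>j\<in>{..N}. ?B j)"
      by (rule measure_mono_fmeasurable[OF _ fmeasurableD[OF Pm]]) (intro fmeasurable.finite_UN, auto)
    also have "\<dots> \<le> (\<Sum>j\<in>{..N}. measure lebesgue (?B j))" by (rule measure_UNION_le) auto
    also have "\<dots> = real (Suc N) * (ball_vol TYPE('n) * (2 * h) ^ CARD('n))"
    proof -
      have "measure lebesgue (?B j) = ball_vol TYPE('n) * (2 * h) ^ CARD('n)" for j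
        by (rule measure_cball) (use h in simp)
      then show ?thesis by (simp only: sum_constant card_atMost)
    qed
    also have "\<dots> \<le> (1 / h + 2) * (ball_vol TYPE('n) * (2 * h) ^ CARD('n))"
    proof (rule mult_right_mono)
      have "real N \<le> 1 / h" using h unfolding N_def by (simp add: of_nat_nat)
      then show "real (Suc N) \<le> 1 / h + 2" by simp
      show "0 \<le> ball_vol TYPE('n) * (2 * h) ^ CARD('n)" using h ball_vol_pos[where 'n = 'n] by simp
    qed
    finally show "measure lebesgue P \<le> (1 / h + 2) * (ball_vol TYPE('n) * (2 * h) ^ CARD('n))" .
  qed
  finally have "h * facet_integral F g \<le> h * (((1 / h + 2) * (ball_vol TYPE('n) * (2 * h) ^ CARD('n))) * G)"
    using h by (intro mult_left_mono) auto
  also have "\<dots> = (h * (1 / h + 2)) * (ball_vol TYPE('n) * 2 ^ CARD('n) * G * h ^ CARD('n))"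
    by (simp only: power_mult_distrib mult_ac)
  also have "h * (1 / h + 2) = 1 + 2 * h" using h by (simp add: algebra_simps)
  also have "(1 + 2 * h) * (ball_vol TYPE('n) * 2 ^ CARD('n) * G * h ^ CARD('n)) \<le>
      (1 + 2 * R) * (ball_vol TYPE('n) * 2 ^ CARD('n) * G * h ^ CARD('n))"
    using h G ball_vol_pos[where 'n = 'n] by (intro mult_right_mono) auto
  finally show ?thesis by (simp only: mult_ac)
qed

lemma facet_integral_nonneg:
  assumes "\<And>x. 0 \<le> g x"
  shows "0 \<le> facet_integral F g"
  unfolding facet_integral_def by (rule Bochner_Integration.integral_nonneg) (rule assms)

text \<open>The closed neighbourhoods are compact and decrease to the closed set \<open>S\<close>.
  Nonemptiness matters because the distance to the empty set is 0 by convention.\<close>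

lemma small_neighbourhood:
  fixes S :: "'a::euclidean_space set"
  assumes S: "compact S" "S \<noteq> {}" "negligible S" and \<epsilon>: "\<epsilon> > 0"
  shows "\<exists>\<delta>>0. {x. infdist x S \<le> \<delta>} \<in> lmeasurable \<and> measure lebesgue {x. infdist x S \<le> \<delta>} < \<epsilon>"
proof -
  define A where "A n = {x. infdist x S \<le> 1 / real (Suc n)}" for n
  have "closed (A n)" for n unfolding A_def by (intro closed_Collect_le continuous_intros)
  moreover have "bounded (A n)" for n
  proof -
    obtain R where R: "\<And>x. x \<in> S \<Longrightarrow> norm x \<le> R" using compact_imp_bounded[OF S(1)] unfolding bounded_iff by blast
    have "norm x \<le> R + 1" if "x \<in> A n" for x
    proof -
      have "infdist x S \<le> 1" using that by (rule_tac order_trans[of _ "1 / real (Suc n)"]) (auto simp: A_def)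
      moreover obtain y where y: "y \<in> S" "infdist x S = dist x y"
        using infdist_attains_inf[of S x] S(1,2) compact_imp_closed by auto
      ultimately have "norm (x - y) \<le> 1" by (simp add: dist_norm)
      then show ?thesis using R[OF y(1)] norm_triangle_sub[of x y] by linarith
    qed
    then show ?thesis unfolding bounded_iff by blast
  qed
  ultimately have "compact (A n)" for n using compact_eq_bounded_closed by blast
  then have Am: "A n \<in> lmeasurable" for n by (rule lmeasurable_compact)
  have lim: "(\<lambda>n. measure lebesgue (A n)) \<longlonglongrightarrow> measure lebesgue (\<Inter>n. A n)"
  proof (rule Lim_measure_decseq)
    show "decseq A"
    proof (rule decseq_SucI)
      fix n
      have "1 / real (Suc (Suc n)) \<le> 1 / real (Suc n)" by (simp add: field_simps)
      then show "A (Suc n) \<subseteq> A n" unfolding A_def by fastforce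
    qed
    show "emeasure lebesgue (A i) \<noteq> \<infinity>" for i using fmeasurableD2[OF Am] by simp
  qed (use Am in \<open>auto intro: fmeasurableD\<close>)
  have "(\<Inter>n. A n) \<subseteq> S"
  proof
    fix x assume "x \<in> (\<Inter>n. A n)"
    then have "infdist x S \<le> 1 / real (Suc n)" for n unfolding A_def by blast
    then have "infdist x S \<le> 0"
      using LIMSEQ_le_const[OF LIMSEQ_inverse_real_of_nat, of "infdist x S"] by (auto simp: inverse_eq_divide)
    then have "infdist x S = 0" using infdist_nonneg[of x S] by simp
    then show "x \<in> S" using in_closed_iff_infdist_zero[of S x] S compact_imp_closed by blast
  qed
  then have "measure lebesgue (\<Inter>n. A n) = 0" using S(3) negligible_subset negligible_imp_measure0 by blast
  then have "eventually (\<lambda>n. measure lebesgue (A n) < \<epsilon>) sequentially"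
    using lim \<epsilon> order_tendstoD(2)[of "\<lambda>n. measure lebesgue (A n)" 0] by simp
  then obtain n where "measure lebesgue (A n) < \<epsilon>" unfolding eventually_sequentially by blast
  moreover have "1 / real (Suc n) > 0" by simp
  ultimately show ?thesis using Am[of n] unfolding A_def by blast
qed

section \<open>Discrete functions on elements\<close>

lemma elem_poly_eq:
  assumes "is_tagged_simplex T" "q \<in> poly_space p" "AE x in lebesgue_on (elem T). v x = q x"
  shows "elem_poly p T v = q"
proof -
  have "elem_poly p T v \<in> poly_space p \<and> (AE x in lebesgue_on (elem T). v x = elem_poly p T v x)"
    unfolding elem_poly_def by (rule someI[of _ q]) (use assms in blast)
  then have 1: "elem_poly p T v \<in> poly_space p" and 2: "AE x in lebesgue_on (elem T). v x = elem_poly p T v x" by blast+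
  have "AE x in lebesgue_on (elem T). elem_poly p T v x = q x" using 2 assms(3) by eventually_elim simp
  then show ?thesis by (rule poly_space_unique[OF 1 assms(2) sets_elem(1) tagged_simplexD(6)[OF assms(1)]])
qed

lemma Sp0_elem_poly:
  assumes "v \<in> Sp0_space \<Omega> p \<T>" "T \<in> \<T>" "is_tagged_simplex T"
  shows "elem_poly p T v \<in> poly_space p" "AE x in lebesgue_on (elem T). v x = elem_poly p T v x"
proof -
  obtain q where q: "q \<in> poly_space p" "AE x in lebesgue_on (elem T). v x = q x"
    using assms(1,2) unfolding Sp0_space_def by blast
  then have "elem_poly p T v = q" using elem_poly_eq[OF assms(3)] by blast
  then show "elem_poly p T v \<in> poly_space p" "AE x in lebesgue_on (elem T). v x = elem_poly p T v x"
    using q by simp_all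
qed

text \<open>A coarse discrete function keeps its polynomial on every descendant of an element, which
  is what allows \<open>U k\<close> to be compared with \<open>U l\<close> on the finer
  mesh.\<close>

lemma elem_poly_ancestor:
  assumes "v \<in> Sp0_space \<Omega> p \<T>" "K \<in> \<T>" "is_tagged_simplex K" "is_tagged_simplex T" "elem T \<subseteq> elem K"
  shows "elem_poly p T v = elem_poly p K v"
  by (rule elem_poly_eq[OF assms(4) Sp0_elem_poly(1)[OF assms(1-3)]
        AE_lebesgue_on_subset[OF Sp0_elem_poly(2)[OF assms(1-3)] assms(5) sets_elem(1) sets_elem(1)]])

lemma grad_norm_power2: "(norm (grad q x))\<^sup>2 = (\<Sum>i\<in>UNIV. (partial i q x)\<^sup>2)"
  unfolding norm_vec_power2 grad_def by simp

lemma continuous_on_grad_sq: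
  "smooth q \<Longrightarrow> continuous_on S (\<lambda>x. (norm (grad q x))\<^sup>2)"
  unfolding grad_norm_power2 by (intro continuous_intros smooth_continuous_on smooth_partial)

text \<open>Weak derivatives are local, so on the open element they are the classical ones of the
  polynomial.\<close>

lemma weak_grad_elem:
  fixes v :: "real ^ 'n::finite \<Rightarrow> real"
  assumes v: "v \<in> H1_space \<Omega>" "open \<Omega>" and T: "interior (elem T) \<subseteq> \<Omega>"
    and ae: "AE x in lebesgue_on (elem T). v x = q x" and q: "smooth q"
  shows "AE x in lebesgue_on (elem T). weak_grad \<Omega> v x = grad q x"
proof -
  have "AE x in lebesgue_on (interior (elem T)). weak_partial \<Omega> i v x = partial i q x" for i
    by (rule has_weak_partial_unique[OF has_weak_partial_subset[OF H1_spaceD(2)[OF v] T v(2) open_interior]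
          has_weak_partial_smooth[OF q open_interior] _ open_interior])
      (use ae in \<open>simp add: AE_elem_iff\<close>)
  then have "AE x in lebesgue_on (interior (elem T)). \<forall>i\<in>UNIV. weak_partial \<Omega> i v x = partial i q x"
    by (intro AE_finite_allI) auto
  then have "AE x in lebesgue_on (interior (elem T)). weak_grad \<Omega> v x = grad q x"
    by eventually_elim (simp add: weak_grad_def grad_def)
  then show ?thesis by (simp add: AE_elem_iff)
qed

definition elem_energy :: "('n::finite) tagged_simplex \<Rightarrow> (real ^ 'n \<Rightarrow> real) \<Rightarrow> real" where
  "elem_energy T q = (LINT x|lebesgue_on (elem T). (norm (grad q x))\<^sup>2)"

lemma elem_energy_nonneg: "0 \<le> elem_energy T q"
  unfolding elem_energy_def by (rule Bochner_Integration.integral_nonneg) simp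

lemma sum_elem_energy_le:
  fixes w :: "real ^ 'n::finite \<Rightarrow> real"
  assumes conf: "conforming_mesh \<Omega> \<T>" and lip: "lipschitz_domain \<Omega>" and M: "M \<subseteq> \<T>"
    and w: "w \<in> H1_space \<Omega>" and r: "\<And>T. T \<in> M \<Longrightarrow> smooth (r T)"
    "\<And>T. T \<in> M \<Longrightarrow> AE x in lebesgue_on (elem T). w x = r T x"
  shows "(\<Sum>T\<in>M. elem_energy T (r T)) \<le> energy \<Omega> w"
proof -
  have op: "open \<Omega>" using lip unfolding lipschitz_domain_def by blast
  have eq: "elem_energy T (r T) = (LINT x|lebesgue_on (elem T). (norm (weak_grad \<Omega> w x))\<^sup>2)" if T: "T \<in> M" for T
    unfolding elem_energy_def
  proof (rule integral_cong_AE_on[OF sets_elem(1)])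
    have "AE x in lebesgue_on (elem T). weak_grad \<Omega> w x = grad (r T) x"
      using weak_grad_elem[OF w op interior_elem_subset[OF conf lip] r(2)[OF T] r(1)[OF T]] T M by blast
    then show "AE x in lebesgue_on (elem T). (norm (grad (r T) x))\<^sup>2 = (norm (weak_grad \<Omega> w x))\<^sup>2"
      by eventually_elim simp
  qed
  have "(\<Sum>T\<in>M. elem_energy T (r T)) = (\<Sum>T\<in>M. LINT x|lebesgue_on (elem T). (norm (weak_grad \<Omega> w x))\<^sup>2)"
    by (rule sum.cong[OF refl eq])
  also have "\<dots> \<le> energy \<Omega> w"
    unfolding energy_def by (rule sum_integral_elem_le[OF conf lip M weak_grad_sq_integrable[OF w op]]) simp
  finally show ?thesis .
qed

text \<open>The inverse estimate is applied to \<open>partial j q\<close>, again of degree at most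
  \<open>p\<close>, in the ball of radius \<open>diam T\<close> around a point of \<open>T\<close>.
  Shape regularity provides the filling fraction \<open>1 / \<gamma> ^ CARD('n)\<close>.\<close>

lemma elem_inverse:
  fixes \<gamma> :: real
  assumes \<gamma>: "\<gamma> > 0"
  shows "\<exists>C>0. \<forall>T :: 'n::finite tagged_simplex. is_tagged_simplex T \<longrightarrow> diam T ^ CARD('n) \<le> \<gamma> ^ CARD('n) * vol T \<longrightarrow>
    (\<forall>q\<in>poly_space p.
      (\<forall>x\<in>elem T. (norm (grad q x))\<^sup>2 * vol T \<le> C * elem_energy T q) \<and>
      (\<forall>i j. (diam T)\<^sup>2 * (LINT x|lebesgue_on (elem T). (partial i (partial j q) x)\<^sup>2) \<le> C * elem_energy T q))"
proof -
  have "1 / \<gamma> ^ CARD('n) > 0" using \<gamma> by simp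
  from inverse_estimate[OF this, of p, where 'n = 'n]
  obtain C where C: "C > 0" and inv: "\<forall>q \<in> (poly_space p :: (real ^ 'n \<Rightarrow> real) set). \<forall>x0 R T.
    R > 0 \<longrightarrow> T \<subseteq> cball x0 R \<longrightarrow> T \<in> sets lebesgue \<longrightarrow> 1 / \<gamma> ^ CARD('n) * R ^ CARD('n) \<le> measure lebesgue T \<longrightarrow>
    (\<forall>x\<in>cball x0 R. (q x)\<^sup>2 * measure lebesgue T \<le> C * (LINT x|lebesgue_on T. (q x)\<^sup>2) \<and>
       (\<forall>i. R\<^sup>2 * (partial i q x)\<^sup>2 * measure lebesgue T \<le> C * (LINT x|lebesgue_on T. (q x)\<^sup>2)))"
    by blast
  show ?thesis
  proof (intro exI[of _ C] conjI allI impI ballI C)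
    fix T :: "'n tagged_simplex" and q :: "real ^ 'n \<Rightarrow> real"
    assume T: "is_tagged_simplex T" "diam T ^ CARD('n) \<le> \<gamma> ^ CARD('n) * vol T" and q: "q \<in> poly_space p"
    have h: "diam T > 0" using diam_pos[OF T(1)] .
    have v: "vol T > 0" using tagged_simplexD(5)[OF T(1)] .
    obtain x0 where x0: "x0 \<in> elem T" using tagged_simplexD(4)[OF T(1)] interior_subset by blast
    have sc: "elem T \<subseteq> cball x0 (diam T)" by (rule elem_subset_cball[OF x0])
    have lb: "1 / \<gamma> ^ CARD('n) * diam T ^ CARD('n) \<le> measure lebesgue (elem T)"
      using T(2) \<gamma> by (simp add: vol_def pos_divide_le_eq mult.commute)
    have est: "(g x)\<^sup>2 * vol T \<le> C * (LINT x|lebesgue_on (elem T). (g x)\<^sup>2)"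
      "(diam T)\<^sup>2 * (partial i g x)\<^sup>2 * vol T \<le> C * (LINT x|lebesgue_on (elem T). (g x)\<^sup>2)"
      if g: "g \<in> poly_space p" and x: "x \<in> elem T" for g x i
      using inv[rule_format, OF g h sc sets_elem(1) lb subsetD[OF sc x]] unfolding vol_def by blast+
    note sp = smooth_partial[OF smooth_poly_space[OF q]]
    have ii: "integrable (lebesgue_on (elem T)) (\<lambda>x. (partial i q x)\<^sup>2)" for i
      by (intro integrable_continuous_compact compact_elem continuous_intros smooth_continuous_on sp)
    have en: "elem_energy T q = (\<Sum>i\<in>UNIV. LINT x|lebesgue_on (elem T). (partial i q x)\<^sup>2)"
      unfolding elem_energy_def grad_norm_power2 using ii by (rule Bochner_Integration.integral_sum)
    show "(norm (grad q x))\<^sup>2 * vol T \<le> C * elem_energy T q" if x: "x \<in> elem T" for x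
      unfolding grad_norm_power2 en sum_distrib_right sum_distrib_left
      by (intro sum_mono est(1) poly_space_partial q x)
    fix i j
    have le: "C * (LINT x|lebesgue_on (elem T). (partial j q x)\<^sup>2) \<le> C * elem_energy T q"
    proof (rule mult_left_mono)
      show "(LINT x|lebesgue_on (elem T). (partial j q x)\<^sup>2) \<le> elem_energy T q"
        unfolding en by (rule member_le_sum) (auto intro: Bochner_Integration.integral_nonneg)
    qed (use C in simp)
    have pw: "(partial i (partial j q) x)\<^sup>2 \<le> C * elem_energy T q / ((diam T)\<^sup>2 * vol T)" if x: "x \<in> elem T" for x
      using order_trans[OF est(2)[OF poly_space_partial[OF q] x, of i j] le] h v
      by (simp add: pos_le_divide_eq mult_ac)
    have "(LINT x|lebesgue_on (elem T). (partial i (partial j q) x)\<^sup>2) \<le>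
       (LINT x|lebesgue_on (elem T). C * elem_energy T q / ((diam T)\<^sup>2 * vol T))"
    proof (rule integral_mono')
      show "integrable (lebesgue_on (elem T)) (\<lambda>x. C * elem_energy T q / ((diam T)\<^sup>2 * vol T))"
        by (simp add: finite_measure.integrable_const finite_measure_lebesgue_on lmeasurable_elem)
      show "0 \<le> C * elem_energy T q / ((diam T)\<^sup>2 * vol T)"
        using C v elem_energy_nonneg[of T q] by simp
    qed (use pw in simp)
    also have "\<dots> = vol T * (C * elem_energy T q / ((diam T)\<^sup>2 * vol T))"
      by (simp add: measure_restrict_space sets_elem vol_def)
    also have "\<dots> = C * elem_energy T q / (diam T)\<^sup>2" using v by simp
    finally show "(diam T)\<^sup>2 * (LINT x|lebesgue_on (elem T). (partial i (partial j q) x)\<^sup>2) \<le> C * elem_energy T q"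
      using h by (simp add: pos_le_divide_eq mult.commute)
  qed
qed

section \<open>The volume residual\<close>

definition hess_sq :: "(real ^ 'n::finite \<Rightarrow> real) \<Rightarrow> real ^ 'n \<Rightarrow> real" where
  "hess_sq q x = (\<Sum>i\<in>UNIV. \<Sum>j\<in>UNIV. (partial i (partial j q) x)\<^sup>2)"

lemma hess_sq_nonneg: "0 \<le> hess_sq q x"
  unfolding hess_sq_def by (intro sum_nonneg) simp

lemma Linf_bound_subset:
  assumes "a \<in> Linf_space \<Omega>"
  shows "\<exists>M\<ge>0. AE x in lebesgue_on \<Omega>. \<bar>a x\<bar> \<le> M"
proof -
  obtain M where "AE x in lebesgue_on \<Omega>. \<bar>a x\<bar> \<le> M" using assms unfolding Linf_space_def by blast
  then have "AE x in lebesgue_on \<Omega>. \<bar>a x\<bar> \<le> max M 0" by eventually_elim simp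
  then show ?thesis by (intro exI[of _ "max M 0"]) simp
qed

lemma Linf_common_bound:
  fixes a :: "'j \<Rightarrow> real ^ 'n \<Rightarrow> real"
  assumes "finite J" "\<And>j. j \<in> J \<Longrightarrow> a j \<in> Linf_space \<Omega>"
  shows "\<exists>M\<ge>0. AE x in lebesgue_on \<Omega>. \<forall>j\<in>J. \<bar>a j x\<bar> \<le> M"
proof -
  obtain m where m: "\<And>j. j \<in> J \<Longrightarrow> m j \<ge> 0 \<and> (AE x in lebesgue_on \<Omega>. \<bar>a j x\<bar> \<le> m j)"
    using Linf_bound_subset[OF assms(2)] by metis
  have "AE x in lebesgue_on \<Omega>. \<forall>j\<in>J. \<bar>a j x\<bar> \<le> m j"
    by (intro AE_finite_allI assms(1)) (use m in blast)
  then have "AE x in lebesgue_on \<Omega>. \<forall>j\<in>J. \<bar>a j x\<bar> \<le> (\<Sum>j\<in>J. m j)"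
  proof eventually_elim
    case (elim x)
    show ?case
    proof
      fix j assume j: "j \<in> J"
      have "m j \<le> (\<Sum>j\<in>J. m j)" by (rule member_le_sum[OF j _ assms(1)]) (use m in blast)
      then show "\<bar>a j x\<bar> \<le> (\<Sum>j\<in>J. m j)" using elim j by force
    qed
  qed
  then show ?thesis using m by (intro exI[of _ "\<Sum>j\<in>J. m j"]) (simp add: sum_nonneg)
qed

text \<open>On \<open>G\<close> all weak derivatives inside \<open>diff_op\<close> are almost
  everywhere those given by \<open>q\<close> and by the product rule with the bounded weak
  derivatives of \<open>A\<close>. One \<open>M\<close> serves every open \<open>G\<close> in
  \<Omega>, hence all elements of all meshes.\<close>

lemma diff_op_bound:
  fixes \<Omega> :: "(real ^ 'n::finite) set"
  assumes \<Omega>: "open \<Omega>" and A: "\<And>i j. (\<lambda>x. A x $ i $ j) \<in> W1inf_space \<Omega>"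
    and b: "\<And>i. (\<lambda>x. b x $ i) \<in> Linf_space \<Omega>" and c: "c \<in> Linf_space \<Omega>"
  shows "\<exists>M\<ge>0. \<forall>G v q. open G \<longrightarrow> G \<subseteq> \<Omega> \<longrightarrow> smooth q \<longrightarrow> (AE x in lebesgue_on G. v x = q x) \<longrightarrow>
     (AE x in lebesgue_on G. \<bar>diff_op G A b c v x\<bar> \<le>
        M * ((\<Sum>i\<in>UNIV. \<Sum>j\<in>UNIV. \<bar>partial i (partial j q) x\<bar>) + (\<Sum>i\<in>UNIV. \<bar>partial i q x\<bar>) + \<bar>q x\<bar>))"
proof -
  have "\<exists>g. g \<in> Linf_space \<Omega> \<and> has_weak_partial \<Omega> i (\<lambda>x. A x $ i $ j) g" for i j
    using A[of i j] unfolding W1inf_space_def by blast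
  then obtain g where g: "\<And>i j. g i j \<in> Linf_space \<Omega>" "\<And>i j. has_weak_partial \<Omega> i (\<lambda>x. A x $ i $ j) (g i j)" by metis
  have AL: "(\<lambda>x. A x $ i $ j) \<in> Linf_space \<Omega>" for i j using A unfolding W1inf_space_def by blast
  obtain M1 where M1: "M1 \<ge> 0" "AE x in lebesgue_on \<Omega>. \<forall>ij\<in>UNIV. \<bar>A x $ fst ij $ snd ij\<bar> \<le> M1"
    using Linf_common_bound[of UNIV "\<lambda>ij x. A x $ fst ij $ snd ij" \<Omega>] AL by auto
  obtain M2 where M2: "M2 \<ge> 0" "AE x in lebesgue_on \<Omega>. \<forall>ij\<in>UNIV. \<bar>g (fst ij) (snd ij) x\<bar> \<le> M2"
    using Linf_common_bound[of UNIV "\<lambda>ij. g (fst ij) (snd ij)" \<Omega>] g(1) by auto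
  obtain M3 where M3: "M3 \<ge> 0" "AE x in lebesgue_on \<Omega>. \<forall>i\<in>UNIV. \<bar>b x $ i\<bar> \<le> M3"
    using Linf_common_bound[of UNIV "\<lambda>i x. b x $ i" \<Omega>] b by auto
  obtain M4 where M4: "M4 \<ge> 0" "AE x in lebesgue_on \<Omega>. \<bar>c x\<bar> \<le> M4"
    using Linf_bound_subset[OF c] by blast
  define m where "m = M1 + M2 + M3 + M4"
  \<comment> \<open>In the divergence each first derivative of \<open>q\<close> occurs once for
    every row of \<open>A\<close>, and once more in the convection term.\<close>
  define M where "M = m * (real CARD('n) + 1)"
  have m: "M1 \<le> m" "M2 \<le> m" "M3 \<le> m" "M4 \<le> m" "0 \<le> m" using M1 M2 M3 M4 by (auto simp: m_def)
  have M: "M \<ge> 0" "m \<le> M" using m by (auto simp: M_def mult_nonneg_nonneg algebra_simps)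
  show ?thesis
  proof (intro exI[of _ M] conjI allI impI M(1))
    fix G :: "(real ^ 'n) set" and v q :: "real ^ 'n \<Rightarrow> real"
    assume G: "open G" "G \<subseteq> \<Omega>" and q: "smooth q" and vq: "AE x in lebesgue_on G. v x = q x"
    have SG: "G \<in> sets lebesgue" "\<Omega> \<in> sets lebesgue" using G \<Omega> by (simp_all add: open_in_lebesgue)
    have "AE x in lebesgue_on G. weak_partial G i v x = partial i q x" for i
      by (rule weak_partial_AE[OF has_weak_partial_smooth[OF q G(1)] vq G(1)])
    then have "AE x in lebesgue_on G. \<forall>i\<in>UNIV. weak_partial G i v x = partial i q x"
      by (intro AE_finite_allI) auto
    then have wg: "AE x in lebesgue_on G. weak_grad G v x = grad q x"
      by eventually_elim (simp add: weak_grad_def grad_def)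
    have hw: "has_weak_partial G i (\<lambda>x. \<Sum>j\<in>UNIV. A x $ i $ j * partial j q x)
       (\<lambda>x. \<Sum>j\<in>UNIV. g i j x * partial j q x + A x $ i $ j * partial i (partial j q) x)" for i
      by (intro has_weak_partial_sum has_weak_partial_mult_smooth has_weak_partial_subset[OF g(2) G(2) \<Omega> G(1)]
          smooth_partial q G(1)) simp
    have "AE x in lebesgue_on G. weak_partial G i (\<lambda>y. (A y *v weak_grad G v y) $ i) x =
        (\<Sum>j\<in>UNIV. g i j x * partial j q x + A x $ i $ j * partial i (partial j q) x)" for i
    proof (rule weak_partial_AE[OF hw _ G(1)])
      show "AE x in lebesgue_on G. (A x *v weak_grad G v x) $ i = (\<Sum>j\<in>UNIV. A x $ i $ j * partial j q x)"
        using wg by eventually_elim (simp add: matrix_vector_mult_def grad_def)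
    qed
    then have dv: "AE x in lebesgue_on G. \<forall>i\<in>UNIV. weak_partial G i (\<lambda>y. (A y *v weak_grad G v y) $ i) x =
        (\<Sum>j\<in>UNIV. g i j x * partial j q x + A x $ i $ j * partial i (partial j q) x)"
      by (intro AE_finite_allI) auto
    show "AE x in lebesgue_on G. \<bar>diff_op G A b c v x\<bar> \<le>
        M * ((\<Sum>i\<in>UNIV. \<Sum>j\<in>UNIV. \<bar>partial i (partial j q) x\<bar>) + (\<Sum>i\<in>UNIV. \<bar>partial i q x\<bar>) + \<bar>q x\<bar>)"
      using dv wg vq AE_lebesgue_on_subset[OF M1(2) G(2) SG] AE_lebesgue_on_subset[OF M2(2) G(2) SG]
        AE_lebesgue_on_subset[OF M3(2) G(2) SG] AE_lebesgue_on_subset[OF M4(2) G(2) SG]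
    proof eventually_elim
      case (elim x)
      define S2 S1 where "S2 = (\<Sum>i\<in>UNIV. \<Sum>j\<in>UNIV. \<bar>partial i (partial j q) x\<bar>)" and "S1 = (\<Sum>i\<in>UNIV. \<bar>partial i q x\<bar>)"
      have bA: "\<bar>A x $ i $ j\<bar> \<le> m" "\<bar>g i j x\<bar> \<le> m" "\<bar>b x $ i\<bar> \<le> m" "\<bar>c x\<bar> \<le> m" for i j
        using elim(4)[rule_format, of "(i, j)"] elim(5)[rule_format, of "(i, j)"] elim(6)[rule_format, of i] elim(7) m
        by simp_all
      have "\<bar>weak_div G (\<lambda>y. A y *v weak_grad G v y) x\<bar> =
         \<bar>\<Sum>i\<in>UNIV. \<Sum>j\<in>UNIV. g i j x * partial j q x + A x $ i $ j * partial i (partial j q) x\<bar>"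
        unfolding weak_div_def using elim(1) by simp
      also have "\<dots> \<le> (\<Sum>i\<in>UNIV. \<Sum>j\<in>UNIV. m * \<bar>partial j q x\<bar> + m * \<bar>partial i (partial j q) x\<bar>)"
      proof (rule order_trans[OF sum_abs sum_mono], rule order_trans[OF sum_abs sum_mono])
        fix i j
        have "\<bar>g i j x * partial j q x\<bar> \<le> m * \<bar>partial j q x\<bar>"
          "\<bar>A x $ i $ j * partial i (partial j q) x\<bar> \<le> m * \<bar>partial i (partial j q) x\<bar>"
          unfolding abs_mult by (intro mult_right_mono bA abs_ge_zero)+
        then show "\<bar>g i j x * partial j q x + A x $ i $ j * partial i (partial j q) x\<bar> \<le>
           m * \<bar>partial j q x\<bar> + m * \<bar>partial i (partial j q) x\<bar>" by linarith
      qed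
      also have "\<dots> = real CARD('n) * (m * S1) + m * S2"
        by (simp add: sum.distrib S1_def S2_def sum_distrib_left)
      finally have d1: "\<bar>weak_div G (\<lambda>y. A y *v weak_grad G v y) x\<bar> \<le> real CARD('n) * (m * S1) + m * S2" .
      have "\<bar>b x \<bullet> weak_grad G v x\<bar> = \<bar>\<Sum>i\<in>UNIV. b x $ i * partial i q x\<bar>"
        unfolding elim(2) by (simp add: inner_vec_def grad_def)
      also have "\<dots> \<le> (\<Sum>i\<in>UNIV. m * \<bar>partial i q x\<bar>)"
        by (rule order_trans[OF sum_abs sum_mono]) (simp add: abs_mult mult_right_mono bA)
      also have "\<dots> = m * S1" by (simp add: S1_def sum_distrib_left)
      finally have d2: "\<bar>b x \<bullet> weak_grad G v x\<bar> \<le> m * S1" .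
      have d3: "\<bar>c x * v x\<bar> \<le> m * \<bar>q x\<bar>" using bA(4) unfolding elim(3) abs_mult by (rule mult_right_mono) simp
      have "\<bar>diff_op G A b c v x\<bar> \<le> (real CARD('n) * (m * S1) + m * S2) + m * S1 + m * \<bar>q x\<bar>"
        unfolding diff_op_def using d1 d2 d3 by linarith
      also have "\<dots> = m * S2 + M * S1 + m * \<bar>q x\<bar>" by (simp add: M_def algebra_simps)
      also have "\<dots> \<le> M * S2 + M * S1 + M * \<bar>q x\<bar>"
        using M(2) by (intro add_mono mult_right_mono order_refl) (auto simp: S2_def sum_nonneg)
      finally show ?case by (simp add: S1_def S2_def distrib_left)
    qed
  qed
qed

lemma sum_sq_le: "(a + b)\<^sup>2 \<le> 2 * a\<^sup>2 + 2 * (b::real)\<^sup>2"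
  using zero_le_power2[of "a - b"] by (simp add: power2_sum power2_diff)

text \<open>Cauchy-Schwarz passes from sums of absolute values to sums of squares. The second
  derivatives are kept apart because they alone require an inverse estimate.\<close>

lemma residual_sq_le:
  fixes q :: "real ^ 'n::finite \<Rightarrow> real"
  assumes "\<bar>D\<bar> \<le> M * ((\<Sum>i\<in>UNIV. \<Sum>j\<in>UNIV. \<bar>partial i (partial j q) x\<bar>) + (\<Sum>i\<in>UNIV. \<bar>partial i q x\<bar>) + \<bar>q x\<bar>)" "M \<ge> 0"
  shows "(D - y)\<^sup>2 \<le> (8 * M\<^sup>2 * (real CARD('n))\<^sup>2 + 2) * (hess_sq q x + ((norm (grad q x))\<^sup>2 + (q x)\<^sup>2 + y\<^sup>2))"
proof -
  define N where "N = real CARD('n)"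
  have N: "N \<ge> 1" by (simp add: N_def Suc_leI)
  define S2 S1 where "S2 = (\<Sum>i\<in>UNIV. \<Sum>j\<in>UNIV. \<bar>partial i (partial j q) x\<bar>)" and "S1 = (\<Sum>i\<in>UNIV. \<bar>partial i q x\<bar>)"
  have "S2\<^sup>2 \<le> (\<Sum>i\<in>UNIV. (\<Sum>j\<in>UNIV. \<bar>partial i (partial j q) x\<bar>)\<^sup>2) * N"
    unfolding S2_def N_def by (rule sum_squared_le_sum_of_squares)
  also have "\<dots> \<le> (\<Sum>i\<in>UNIV. (\<Sum>j\<in>UNIV. (partial i (partial j q) x)\<^sup>2) * N) * N"
  proof (intro mult_right_mono sum_mono)
    fix i
    show "(\<Sum>j\<in>UNIV. \<bar>partial i (partial j q) x\<bar>)\<^sup>2 \<le> (\<Sum>j\<in>UNIV. (partial i (partial j q) x)\<^sup>2) * N"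
      using sum_squared_le_sum_of_squares[of "\<lambda>j. \<bar>partial i (partial j q) x\<bar>" UNIV] by (simp add: N_def)
  qed (use N in simp)
  also have "\<dots> = N\<^sup>2 * hess_sq q x"
    by (simp add: hess_sq_def sum_distrib_right[symmetric] power2_eq_square)
  finally have s2: "S2\<^sup>2 \<le> N\<^sup>2 * hess_sq q x" .
  have N1: "N \<le> N\<^sup>2" "1 \<le> N\<^sup>2" using N one_le_power[of N 2] self_le_power[of N 2] by simp_all
  have "S1\<^sup>2 \<le> (norm (grad q x))\<^sup>2 * N"
    using sum_squared_le_sum_of_squares[of "\<lambda>i. \<bar>partial i q x\<bar>" UNIV] by (simp add: S1_def N_def grad_norm_power2)
  also have "\<dots> \<le> (norm (grad q x))\<^sup>2 * N\<^sup>2" using N1 by (intro mult_left_mono) auto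
  finally have s1: "S1\<^sup>2 \<le> N\<^sup>2 * (norm (grad q x))\<^sup>2" by (simp add: mult.commute)
  have s0: "(q x)\<^sup>2 \<le> N\<^sup>2 * (q x)\<^sup>2" using N1(2) mult_right_mono[of 1 "N\<^sup>2" "(q x)\<^sup>2"] by simp
  have "(S2 + S1 + \<bar>q x\<bar>)\<^sup>2 \<le> 4 * S2\<^sup>2 + 4 * S1\<^sup>2 + 2 * (q x)\<^sup>2"
    using sum_sq_le[of "S2 + S1" "\<bar>q x\<bar>"] sum_sq_le[of S2 S1] by simp
  also have "\<dots> \<le> 4 * S2\<^sup>2 + 4 * S1\<^sup>2 + 4 * (q x)\<^sup>2" by simp
  also have "\<dots> \<le> 4 * (N\<^sup>2 * hess_sq q x) + 4 * (N\<^sup>2 * (norm (grad q x))\<^sup>2) + 4 * (N\<^sup>2 * (q x)\<^sup>2)"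
    using s2 s1 s0 by simp
  finally have S: "(S2 + S1 + \<bar>q x\<bar>)\<^sup>2 \<le> 4 * N\<^sup>2 * (hess_sq q x + (norm (grad q x))\<^sup>2 + (q x)\<^sup>2)"
    by (simp add: algebra_simps)
  have "D\<^sup>2 \<le> (M * (S2 + S1 + \<bar>q x\<bar>))\<^sup>2"
    using power_mono[OF assms(1) abs_ge_zero, of 2] by (simp add: S1_def S2_def)
  also have "\<dots> = M\<^sup>2 * (S2 + S1 + \<bar>q x\<bar>)\<^sup>2" by (rule power_mult_distrib)
  also have "\<dots> \<le> M\<^sup>2 * (4 * N\<^sup>2 * (hess_sq q x + (norm (grad q x))\<^sup>2 + (q x)\<^sup>2))"
    by (rule mult_left_mono[OF S]) simp
  finally have D: "D\<^sup>2 \<le> M\<^sup>2 * (4 * N\<^sup>2 * (hess_sq q x + (norm (grad q x))\<^sup>2 + (q x)\<^sup>2))" .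
  define Z where "Z = hess_sq q x + (norm (grad q x))\<^sup>2 + (q x)\<^sup>2"
  have Z: "Z \<ge> 0" unfolding Z_def by (simp add: hess_sq_nonneg)
  have "(D - y)\<^sup>2 \<le> 2 * D\<^sup>2 + 2 * y\<^sup>2" using sum_sq_le[of D "- y"] by simp
  also have "\<dots> \<le> 8 * M\<^sup>2 * N\<^sup>2 * Z + 2 * y\<^sup>2" using D[folded Z_def] by (simp add: mult_ac)
  also have "\<dots> \<le> (8 * M\<^sup>2 * N\<^sup>2 + 2) * Z + (8 * M\<^sup>2 * N\<^sup>2 + 2) * y\<^sup>2"
    using Z by (intro add_mono mult_right_mono) auto
  finally show ?thesis by (simp add: Z_def N_def algebra_simps)
qed

lemma partial_diff:
  "smooth f \<Longrightarrow> smooth g \<Longrightarrow> partial i (\<lambda>x. f x - g x) = (\<lambda>x. partial i f x - partial i g x)"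
proof
  fix x
  assume "smooth f" "smooth g"
  then obtain f' g' where d: "(f has_derivative f') (at x)" "(g has_derivative g') (at x)"
    using smooth_differentiable unfolding differentiable_def by blast
  show "partial i (\<lambda>x. f x - g x) x = partial i f x - partial i g x"
    using partial_has_derivative[OF has_derivative_diff[OF d], of i]
      partial_has_derivative[OF d(1), of i] partial_has_derivative[OF d(2), of i] by simp
qed

lemma grad_diff: "smooth f \<Longrightarrow> smooth g \<Longrightarrow> grad (\<lambda>x. f x - g x) x = grad f x - grad g x"
  by (simp add: grad_def partial_diff vec_eq_iff)

lemma hess_sq_le:
  assumes "smooth q" "smooth q'"
  shows "hess_sq q x \<le> 2 * hess_sq (\<lambda>x. q x - q' x) x + 2 * hess_sq q' x"
proof -
  have "(partial i (partial j q) x)\<^sup>2 \<le> 2 * (partial i (partial j (\<lambda>x. q x - q' x)) x)\<^sup>2 + 2 * (partial i (partial j q') x)\<^sup>2" for i j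
    using sum_sq_le[of "partial i (partial j q) x - partial i (partial j q') x" "partial i (partial j q') x"]
    by (simp add: partial_diff smooth_partial assms)
  then have "hess_sq q x \<le> (\<Sum>i\<in>UNIV. \<Sum>j\<in>UNIV. 2 * (partial i (partial j (\<lambda>x. q x - q' x)) x)\<^sup>2 + 2 * (partial i (partial j q') x)\<^sup>2)"
    unfolding hess_sq_def by (intro sum_mono)
  then show ?thesis by (simp add: hess_sq_def sum.distrib sum_distrib_left)
qed

lemma continuous_on_hess_sq: "smooth q \<Longrightarrow> continuous_on S (hess_sq q)"
  unfolding hess_sq_def[abs_def] by (intro continuous_intros smooth_continuous_on smooth_partial)

text \<open>The second derivatives of \<open>q\<close> are split at a comparison polynomial
  \<open>q'\<close>. Those of \<open>q - q'\<close> times the squared diameter are bounded by its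
  energy, an inverse estimate; those of \<open>q'\<close> are bounded by \<open>B\<close> and keep
  the small factor \<open>(diam T)\<^sup>2\<close>, as do all lower order terms.\<close>

lemma volume_part:
  fixes \<Omega> :: "(real ^ 'n::finite) set" and \<gamma> :: real
  assumes \<Omega>: "open \<Omega>" and A: "\<And>i j. (\<lambda>x. A x $ i $ j) \<in> W1inf_space \<Omega>"
    and b: "\<And>i. (\<lambda>x. b x $ i) \<in> Linf_space \<Omega>" and c: "c \<in> Linf_space \<Omega>" and f: "f \<in> L2_space \<Omega>"
    and \<gamma>: "\<gamma> > 0"
  shows "\<exists>C\<ge>0. \<forall>(T :: 'n tagged_simplex) v q q' B. is_tagged_simplex T \<longrightarrow> diam T ^ CARD('n) \<le> \<gamma> ^ CARD('n) * vol T \<longrightarrow>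
    vol T powr (2 / CARD('n)) \<le> \<gamma>\<^sup>2 * (diam T)\<^sup>2 \<longrightarrow>
    interior (elem T) \<subseteq> \<Omega> \<longrightarrow> q \<in> poly_space p \<longrightarrow> q' \<in> poly_space p \<longrightarrow>
    (AE x in lebesgue_on (elem T). v x = q x) \<longrightarrow> (\<forall>x\<in>elem T. hess_sq q' x \<le> B) \<longrightarrow> 0 \<le> B \<longrightarrow>
    vol T powr (2 / CARD('n)) * (L2_norm (interior (elem T)) (\<lambda>x. diff_op (interior (elem T)) A b c v x - f x))\<^sup>2 \<le>
      C * (elem_energy T (\<lambda>x. q x - q' x) + (diam T)\<^sup>2 * (B * vol T +
        (LINT x|lebesgue_on (elem T). (norm (grad q x))\<^sup>2 + (q x)\<^sup>2 + (f x)\<^sup>2)))"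
proof -
  obtain M where M: "M \<ge> 0" and bd: "\<forall>G v q. open G \<longrightarrow> G \<subseteq> \<Omega> \<longrightarrow> smooth q \<longrightarrow> (AE x in lebesgue_on G. v x = q x) \<longrightarrow>
     (AE x in lebesgue_on G. \<bar>diff_op G A b c v x\<bar> \<le>
        M * ((\<Sum>i\<in>UNIV. \<Sum>j\<in>UNIV. \<bar>partial i (partial j q) x\<bar>) + (\<Sum>i\<in>UNIV. \<bar>partial i q x\<bar>) + \<bar>q x\<bar>))"
    using diff_op_bound[OF \<Omega> A b c] by blast
  obtain C1 where C1: "C1 > 0" and inv: "\<forall>T :: 'n tagged_simplex. is_tagged_simplex T \<longrightarrow> diam T ^ CARD('n) \<le> \<gamma> ^ CARD('n) * vol T \<longrightarrow>
    (\<forall>q\<in>poly_space p.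
      (\<forall>x\<in>elem T. (norm (grad q x))\<^sup>2 * vol T \<le> C1 * elem_energy T q) \<and>
      (\<forall>i j. (diam T)\<^sup>2 * (LINT x|lebesgue_on (elem T). (partial i (partial j q) x)\<^sup>2) \<le> C1 * elem_energy T q))"
    using elem_inverse[OF \<gamma>, of p, where 'n = 'n] by blast
  define N where "N = real CARD('n)"
  define C0 where "C0 = 8 * M\<^sup>2 * N\<^sup>2 + 2"
  have C0: "C0 \<ge> 0" by (simp add: C0_def)
  \<comment> \<open>The factor \<open>\<gamma>\<^sup>2\<close> trades the volume weight for the
    squared diameter, \<open>C0\<close> comes from \<open>residual_sq_le\<close>, and
    \<open>N\<^sup>2\<close> counts the second derivatives.\<close>
  define C where "C = \<gamma>\<^sup>2 * C0 * (2 * N\<^sup>2 * C1 + 2)"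
  have C: "C \<ge> 0" using C0 C1 by (simp add: C_def)
  show ?thesis
  proof (intro exI[of _ C] conjI allI impI C)
    fix T :: "'n tagged_simplex" and v q q' :: "real ^ 'n \<Rightarrow> real" and B :: real
    assume T: "is_tagged_simplex T" "diam T ^ CARD('n) \<le> \<gamma> ^ CARD('n) * vol T"
      and vT: "vol T powr (2 / CARD('n)) \<le> \<gamma>\<^sup>2 * (diam T)\<^sup>2"
      and iT: "interior (elem T) \<subseteq> \<Omega>" and q: "q \<in> poly_space p" and q': "q' \<in> poly_space p"
      and vq: "AE x in lebesgue_on (elem T). v x = q x" and B: "\<forall>x\<in>elem T. hess_sq q' x \<le> B" "0 \<le> B"
    let ?G = "interior (elem T)"
    let ?R = "\<lambda>x. diff_op ?G A b c v x - f x"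
    let ?r = "\<lambda>x. q x - q' x"
    let ?W = "\<lambda>x. (norm (grad q x))\<^sup>2 + (q x)\<^sup>2 + (f x)\<^sup>2"
    have sq: "smooth q" "smooth q'" using q q' smooth_poly_space by blast+
    have r: "?r \<in> poly_space p" using poly_space_lincomb[OF q q', of 1 "-1"] by simp
    have sr: "smooth ?r" using smooth_poly_space[OF r] .
    have ih: "integrable (lebesgue_on (elem T)) (hess_sq g)" if "smooth g" for g
      using that by (intro integrable_continuous_compact compact_elem continuous_on_hess_sq)
    have fG: "integrable (lebesgue_on ?G) (\<lambda>x. (f x)\<^sup>2)"
      using L2_space_subset[OF f iT sets_elem(2) open_in_lebesgue[OF \<Omega>]] unfolding L2_space_def by blast
    have gq: "integrable (lebesgue_on (elem T)) (\<lambda>x. (norm (grad q x))\<^sup>2 + (q x)\<^sup>2)"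
      by (intro integrable_continuous_compact compact_elem continuous_intros continuous_on_grad_sq[unfolded power2_eq_square, folded power2_eq_square] smooth_continuous_on sq)
    have iG: "integrable (lebesgue_on ?G) ?W" "integrable (lebesgue_on ?G) (hess_sq q)"
      using Bochner_Integration.integrable_add[OF integrable_lebesgue_on_subset[OF gq interior_subset sets_elem(2,1)] fG]
        integrable_lebesgue_on_subset[OF ih[OF sq(1)] interior_subset sets_elem(2,1)] by simp_all
    have "(L2_norm ?G ?R)\<^sup>2 = (LINT x|lebesgue_on ?G. (?R x)\<^sup>2)" by (simp add: L2_norm_power2)
    also have "\<dots> \<le> (LINT x|lebesgue_on ?G. C0 * (hess_sq q x + ?W x))"
    \<comment> \<open>The residual contains chosen weak derivatives; an integrable nonnegative
      majorant suffices for this comparison.\<close>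
    proof (rule Bochner_Integration.integral_mono_AE')
      show "integrable (lebesgue_on ?G) (\<lambda>x. C0 * (hess_sq q x + ?W x))" using iG by simp
      have "AE x in lebesgue_on ?G. \<bar>diff_op ?G A b c v x\<bar> \<le>
        M * ((\<Sum>i\<in>UNIV. \<Sum>j\<in>UNIV. \<bar>partial i (partial j q) x\<bar>) + (\<Sum>i\<in>UNIV. \<bar>partial i q x\<bar>) + \<bar>q x\<bar>)"
        using bd[rule_format, OF open_interior iT sq(1), of v] vq by (simp add: AE_elem_iff)
      then show "AE x in lebesgue_on ?G. (?R x)\<^sup>2 \<le> C0 * (hess_sq q x + ?W x)"
        by eventually_elim (unfold C0_def N_def, rule residual_sq_le, use M in auto)
      show "AE x in lebesgue_on ?G. 0 \<le> C0 * (hess_sq q x + ?W x)" using C0 by (simp add: hess_sq_nonneg)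
    qed
    also have "\<dots> = C0 * ((LINT x|lebesgue_on ?G. hess_sq q x) + (LINT x|lebesgue_on ?G. ?W x))" using iG by simp
    also have "\<dots> = C0 * ((LINT x|lebesgue_on (elem T). hess_sq q x) + (LINT x|lebesgue_on (elem T). ?W x))"
      by (simp only: integral_interior_elem)
    finally have 1: "(L2_norm ?G ?R)\<^sup>2 \<le> C0 * ((LINT x|lebesgue_on (elem T). hess_sq q x) + (LINT x|lebesgue_on (elem T). ?W x))" .
    have icB: "integrable (lebesgue_on (elem T)) (\<lambda>x. 2 * B)"
      by (simp add: finite_measure.integrable_const finite_measure_lebesgue_on lmeasurable_elem)
    have "(LINT x|lebesgue_on (elem T). hess_sq q x) \<le> (LINT x|lebesgue_on (elem T). 2 * hess_sq ?r x + 2 * B)"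
    proof (rule Bochner_Integration.integral_mono)
      fix x assume "x \<in> space (lebesgue_on (elem T))"
      then show "hess_sq q x \<le> 2 * hess_sq ?r x + 2 * B" using hess_sq_le[OF sq, of x] B(1) by fastforce
    qed (use ih[OF sq(1)] ih[OF sr] icB in auto)
    also have "\<dots> = 2 * (LINT x|lebesgue_on (elem T). hess_sq ?r x) + 2 * B * vol T"
      using ih[OF sr] icB by (simp add: measure_restrict_space sets_elem vol_def)
    finally have 2: "(LINT x|lebesgue_on (elem T). hess_sq q x) \<le> 2 * (LINT x|lebesgue_on (elem T). hess_sq ?r x) + 2 * B * vol T" .
    have ip: "integrable (lebesgue_on (elem T)) (\<lambda>x. (partial i (partial j ?r) x)\<^sup>2)" for i j
      by (intro integrable_continuous_compact compact_elem continuous_intros smooth_continuous_on smooth_partial sr)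
    have "(diam T)\<^sup>2 * (LINT x|lebesgue_on (elem T). hess_sq ?r x) =
       (\<Sum>i\<in>UNIV. \<Sum>j\<in>UNIV. (diam T)\<^sup>2 * (LINT x|lebesgue_on (elem T). (partial i (partial j ?r) x)\<^sup>2))"
      unfolding hess_sq_def using ip by (simp add: Bochner_Integration.integral_sum sum_distrib_left)
    also have "\<dots> \<le> (\<Sum>i\<in>(UNIV::'n set). \<Sum>j\<in>(UNIV::'n set). C1 * elem_energy T ?r)"
      using inv[rule_format, OF T r] by (intro sum_mono) blast
    also have "\<dots> = N\<^sup>2 * C1 * elem_energy T ?r" by (simp add: N_def power2_eq_square)
    finally have 3: "(diam T)\<^sup>2 * (LINT x|lebesgue_on (elem T). hess_sq ?r x) \<le> N\<^sup>2 * C1 * elem_energy T ?r" .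
    define I where "I = (LINT x|lebesgue_on (elem T). ?W x)"
    have I: "I \<ge> 0" unfolding I_def by (rule Bochner_Integration.integral_nonneg) simp
    define e where "e = elem_energy T ?r"
    have e: "e \<ge> 0" by (simp add: e_def elem_energy_nonneg)
    have "vol T powr (2 / CARD('n)) * (L2_norm ?G ?R)\<^sup>2 \<le> \<gamma>\<^sup>2 * (diam T)\<^sup>2 * (L2_norm ?G ?R)\<^sup>2"
      by (rule mult_right_mono[OF vT]) simp
    also have "\<dots> \<le> \<gamma>\<^sup>2 * (diam T)\<^sup>2 * (C0 * ((2 * (LINT x|lebesgue_on (elem T). hess_sq ?r x) + 2 * B * vol T) + I))"
    proof (rule mult_left_mono[OF order_trans[OF 1]])
      show "C0 * ((LINT x|lebesgue_on (elem T). hess_sq q x) + (LINT x|lebesgue_on (elem T). ?W x)) \<le>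
          C0 * ((2 * (LINT x|lebesgue_on (elem T). hess_sq ?r x) + 2 * B * vol T) + I)"
        unfolding I_def by (rule mult_left_mono[OF add_right_mono[OF 2] C0])
    qed simp
    also have "\<dots> = \<gamma>\<^sup>2 * C0 * (2 * ((diam T)\<^sup>2 * (LINT x|lebesgue_on (elem T). hess_sq ?r x)) + (diam T)\<^sup>2 * (2 * (B * vol T) + I))"
      by (simp add: algebra_simps)
    also have "\<dots> \<le> \<gamma>\<^sup>2 * C0 * (2 * (N\<^sup>2 * C1 * e) + (diam T)\<^sup>2 * (2 * (B * vol T) + I))"
      using 3 C0 unfolding e_def by (intro mult_left_mono add_right_mono) auto
    also have "\<dots> \<le> \<gamma>\<^sup>2 * C0 * ((2 * N\<^sup>2 * C1 + 2) * (e + (diam T)\<^sup>2 * (B * vol T + I)))"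
    proof (rule mult_left_mono)
      have Bv: "0 \<le> B * vol T" using B(2) vol_nonneg[of T] by simp
      have nn: "0 \<le> 2 * N\<^sup>2 * C1" using C1 by simp
      have h2: "0 \<le> (diam T)\<^sup>2 * (B * vol T + I)" using Bv I by simp
      have "(diam T)\<^sup>2 * (2 * (B * vol T) + I) \<le> (diam T)\<^sup>2 * (2 * (B * vol T + I))"
        using I by (intro mult_left_mono) auto
      also have "\<dots> = 2 * ((diam T)\<^sup>2 * (B * vol T + I))" by simp
      also have "\<dots> \<le> (2 * N\<^sup>2 * C1 + 2) * ((diam T)\<^sup>2 * (B * vol T + I))"
        using nn h2 by (intro mult_right_mono) auto
      finally have a: "(diam T)\<^sup>2 * (2 * (B * vol T) + I) \<le> (2 * N\<^sup>2 * C1 + 2) * ((diam T)\<^sup>2 * (B * vol T + I))" .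
      have "2 * (N\<^sup>2 * C1 * e) = (2 * N\<^sup>2 * C1) * e" by simp
      also have "\<dots> \<le> (2 * N\<^sup>2 * C1 + 2) * e" using e by (intro mult_right_mono) auto
      finally have b: "2 * (N\<^sup>2 * C1 * e) \<le> (2 * N\<^sup>2 * C1 + 2) * e" .
      show "2 * (N\<^sup>2 * C1 * e) + (diam T)\<^sup>2 * (2 * (B * vol T) + I) \<le> (2 * N\<^sup>2 * C1 + 2) * (e + (diam T)\<^sup>2 * (B * vol T + I))"
        unfolding distrib_left[of "2 * N\<^sup>2 * C1 + 2" e] using a b by linarith
    qed (use C0 in simp)
    finally show "vol T powr (2 / CARD('n)) * (L2_norm ?G ?R)\<^sup>2 \<le>
      C * (elem_energy T ?r + (diam T)\<^sup>2 * (B * vol T + (LINT x|lebesgue_on (elem T). ?W x)))"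
      by (simp only: C_def e_def I_def mult.assoc)
  qed
qed

section \<open>The jump residual\<close>

lemma conormal_jump_le:
  fixes A :: "real ^ 'n ^ 'n"
  assumes "\<And>i j. \<bar>A $ i $ j\<bar> \<le> m" "norm n = 1"
  shows "((A *v g - A *v g') \<bullet> n)\<^sup>2 \<le> (m * (real CARD('n))\<^sup>2)\<^sup>2 * (norm (g - g'))\<^sup>2"
proof -
  let ?w = "g - g'"
  have "\<bar>(A *v ?w) \<bullet> n\<bar> = \<bar>\<Sum>i\<in>UNIV. \<Sum>j\<in>UNIV. A $ i $ j * ?w $ j * n $ i\<bar>"
    by (simp add: inner_vec_def matrix_vector_mult_def sum_distrib_right)
  also have "\<dots> \<le> (\<Sum>i\<in>(UNIV::'n set). \<Sum>j\<in>(UNIV::'n set). m * norm ?w)"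
  proof (rule order_trans[OF sum_abs sum_mono], rule order_trans[OF sum_abs sum_mono])
    fix i j
    have "\<bar>A $ i $ j\<bar> * \<bar>?w $ j\<bar> * \<bar>n $ i\<bar> \<le> m * norm ?w * 1"
      using assms(1)[of i j] component_le_norm_cart[of ?w j] component_le_norm_cart[of n i] assms(2)
      by (intro mult_mono) (auto intro: order_trans[OF abs_ge_zero])
    then show "\<bar>A $ i $ j * ?w $ j * n $ i\<bar> \<le> m * norm ?w" by (simp add: abs_mult)
  qed
  also have "\<dots> = m * (real CARD('n))\<^sup>2 * norm ?w" by (simp add: power2_eq_square)
  finally have "\<bar>(A *v g - A *v g') \<bullet> n\<bar> \<le> m * (real CARD('n))\<^sup>2 * norm ?w"
    by (simp add: matrix_vector_mult_diff_distrib)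
  from power_mono[OF this abs_ge_zero, of 2] show ?thesis by (simp add: power_mult_distrib)
qed

lemma norm_add_sq_le: "(norm (a + b))\<^sup>2 \<le> 2 * (norm a)\<^sup>2 + 2 * (norm (b :: 'a::real_normed_vector))\<^sup>2"
  using power_mono[OF norm_triangle_ineq[of a b] norm_ge_zero, of 2] sum_sq_le[of "norm a" "norm b"] by linarith

text \<open>The gradient jump splits into that of \<open>v - Q'\<close> and that of the comparison
  family \<open>Q'\<close>. Inverse estimates bound the former pointwise by energy over volume, and
  the facet factor of order \<open>vol T\<close> cancels the denominator. The latter vanishes unless
  \<open>touch T\<close> holds, and then it is bounded through \<open>B\<close>.\<close>

lemma jump_part:
  fixes \<Omega> :: "(real ^ 'n::finite) set" and \<gamma> :: real
  assumes d: "CARD('n) \<ge> 2" and \<Omega>: "bounded \<Omega>" and A: "continuous_on (closure \<Omega>) A" and \<gamma>: "\<gamma> > 0"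
  shows "\<exists>C\<ge>0. \<forall>(\<T> :: 'n tagged_simplex set) v Q' B touch T. conforming_mesh \<Omega> \<T> \<longrightarrow> shape_regular \<gamma> \<T> \<longrightarrow>
    v \<in> Sp0_space \<Omega> p \<T> \<longrightarrow> (\<forall>T\<in>\<T>. Q' T \<in> poly_space p) \<longrightarrow>
    (\<forall>T\<in>\<T>. \<forall>x\<in>elem T. (norm (grad (Q' T) x))\<^sup>2 \<le> B) \<longrightarrow> 0 \<le> B \<longrightarrow>
    (\<forall>T\<in>\<T>. \<forall>T'\<in>nbs \<T> T. Q' T = Q' T' \<or> touch T) \<longrightarrow> T \<in> \<T> \<longrightarrow>
    vol T powr (1 / CARD('n)) * jump_sq A p \<T> v T \<le>
      C * (elem_energy T (\<lambda>x. elem_poly p T v x - Q' T x) +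
        (\<Sum>T'\<in>nbs \<T> T. elem_energy T' (\<lambda>x. elem_poly p T' v x - Q' T' x)) + (if touch T then B * vol T else 0))"
proof -
  obtain R where R: "R > 0" "\<And>x. x \<in> closure \<Omega> \<Longrightarrow> norm x \<le> R"
    using bounded_closure[OF \<Omega>] unfolding bounded_pos by blast
  have cc: "compact (closure \<Omega>)" using \<Omega> by simp
  obtain m where m: "\<And>x i j. x \<in> closure \<Omega> \<Longrightarrow> \<bar>A x $ i $ j\<bar> \<le> m"
  proof -
    have "compact (A ` closure \<Omega>)" using compact_continuous_image[OF A cc] .
    then obtain m where m: "\<forall>y\<in>A ` closure \<Omega>. norm y \<le> m"
      using compact_imp_bounded[of "A ` closure \<Omega>"] unfolding bounded_iff by blast
    have "\<bar>A x $ i $ j\<bar> \<le> m" if "x \<in> closure \<Omega>" for x i j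
    proof -
      have "\<bar>A x $ i $ j\<bar> \<le> norm (A x $ i)" by (rule component_le_norm_cart)
      also have "\<dots> \<le> norm (A x)" by (rule Finite_Cartesian_Product.norm_nth_le)
      finally show ?thesis using m that by force
    qed
    then show ?thesis using that by blast
  qed
  obtain Ci where Ci: "Ci > 0" and inv: "\<forall>T :: 'n tagged_simplex. is_tagged_simplex T \<longrightarrow> diam T ^ CARD('n) \<le> \<gamma> ^ CARD('n) * vol T \<longrightarrow>
    (\<forall>q\<in>poly_space p.
      (\<forall>x\<in>elem T. (norm (grad q x))\<^sup>2 * vol T \<le> Ci * elem_energy T q) \<and>
      (\<forall>i j. (diam T)\<^sup>2 * (LINT x|lebesgue_on (elem T). (partial i (partial j q) x)\<^sup>2) \<le> Ci * elem_energy T q))"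
    using elem_inverse[OF \<gamma>, of p, where 'n = 'n] by blast
  define L where "L = comparability TYPE('n) \<gamma>"
  have L: "L > 0" unfolding L_def by (rule comparability_pos[OF \<gamma>])
  \<comment> \<open>Bounds the volume ratio of facet neighbours.\<close>
  define W where "W = \<gamma> ^ CARD('n) * L ^ CARD('n) * \<gamma> ^ CARD('n)"
  have W: "W > 0" using L \<gamma> by (simp add: W_def)
  \<comment> \<open>The constant of \<open>facet_integral_le\<close>, where \<open>2 * R\<close>
    bounds the diameter of every element inside the ball of radius \<open>R\<close>.\<close>
  define Kf where "Kf = ball_vol TYPE('n) * 2 ^ CARD('n) * (1 + 2 * (2 * R))"
  have Kf: "Kf > 0" using ball_vol_pos[where 'n = 'n] R by (simp add: Kf_def)
  define m2 where "m2 = (m * (real CARD('n))\<^sup>2)\<^sup>2"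
  have m2: "m2 \<ge> 0" by (simp add: m2_def)
  \<comment> \<open>Splitting a square twice gives the coefficient 4 for either element energy and 8
    for the jump of the comparison family.\<close>
  define C2 where "C2 = \<gamma> * (Kf * \<gamma> ^ CARD('n)) * m2 * (4 * Ci + 4 * Ci * W + 8)"
  have C2: "C2 \<ge> 0" using \<gamma> Kf m2 Ci W by (simp add: C2_def)
  define Nn where "Nn = ball_vol TYPE('n) * ((1 + L) * L * \<gamma>) ^ CARD('n)"
  have Nn: "Nn \<ge> 0" using ball_vol_pos[where 'n = 'n] L \<gamma> by (simp add: Nn_def)
  define C where "C = (real CARD('n) + 1) * C2 * (Nn + 1)"
  have C: "C \<ge> 0" using C2 Nn by (simp add: C_def)
  show ?thesis
  proof (intro exI[of _ C] conjI allI impI C)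
    fix \<T> :: "'n tagged_simplex set" and v Q' B touch T
    assume conf: "conforming_mesh \<Omega> \<T>" and reg: "shape_regular \<gamma> \<T>" and v: "v \<in> Sp0_space \<Omega> p \<T>"
      and Q': "\<forall>T\<in>\<T>. Q' T \<in> poly_space p" and B: "\<forall>T\<in>\<T>. \<forall>x\<in>elem T. (norm (grad (Q' T) x))\<^sup>2 \<le> B" "0 \<le> B"
      and touch: "\<forall>T\<in>\<T>. \<forall>T'\<in>nbs \<T> T. Q' T = Q' T' \<or> touch T" and T: "T \<in> \<T>"
    note D = conforming_meshD[OF conf]
    define q where "q T = elem_poly p T v" for T
    define r where "r T = (\<lambda>x. q T x - Q' T x)" for T
    define e where "e T = elem_energy T (r T)" for T
    have q: "q T \<in> poly_space p" if "T \<in> \<T>" for T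
      unfolding q_def by (rule Sp0_elem_poly(1)[OF v that D(2)[OF that]])
    have r: "r T \<in> poly_space p" if "T \<in> \<T>" for T
      using poly_space_lincomb[OF q[OF that] Q'[rule_format, OF that], of 1 "-1"] by (simp add: r_def)
    have e0: "e T \<ge> 0" for T by (simp add: e_def elem_energy_nonneg)
    have gr: "(norm (grad (r T) x))\<^sup>2 \<le> Ci * e T / vol T" if "T \<in> \<T>" "x \<in> elem T" for T x
    proof -
      have "(norm (grad (r T) x))\<^sup>2 * vol T \<le> Ci * e T"
        using inv[rule_format, OF D(2)[OF that(1)] shape_regularD(1)[OF reg \<gamma> that(1) D(2)[OF that(1)]] r[OF that(1)]] that(2)
        unfolding e_def by blast
      then show ?thesis using tagged_simplexD(5)[OF D(2)[OF that(1)]] by (simp add: pos_le_divide_eq)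
    qed
    define \<beta> where "\<beta> = (if touch T then B * vol T else 0)"
    have \<beta>: "\<beta> \<ge> 0" using B(2) vol_nonneg[of T] by (simp add: \<beta>_def)
    note tT = D(2)[OF T]
    have vT: "vol T > 0" using tagged_simplexD(5)[OF tT] .
    let ?f = "\<lambda>T' F. facet_integral F (\<lambda>x. ((A x *v grad (elem_poly p T v) x - A x *v grad (elem_poly p T' v) x) \<bullet> unit_normal F)\<^sup>2)"
    have f0: "0 \<le> ?f T' F" for T' F by (rule facet_integral_nonneg) simp
    have one: "vol T powr (1 / CARD('n)) * ?f T' F \<le> C2 * (e T + e T' + \<beta>)"
      if T': "T' \<in> \<T>" "T' \<noteq> T" and F: "F facet_of elem T" "F facet_of elem T'" for T' F
    proof -
      have nb: "T' \<in> nbs \<T> T" using T' F unfolding nbs_def by blast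
      note tT' = D(2)[OF T'(1)]
      have vT': "vol T' > 0" using tagged_simplexD(5)[OF tT'] .
      have FS: "F \<subseteq> elem T" "F \<subseteq> elem T'" using F facet_of_subset by blast+
      obtain n0 c0 where n0: "n0 \<noteq> 0" "F \<subseteq> {x. n0 \<bullet> x = c0}" using facetD(5)[OF tT F(1) d] by blast
      have un: "norm (unit_normal F) = 1" by (rule unit_normal_facet(1)[OF n0])
      define G where "G = m2 * (4 * (Ci * e T / vol T) + 4 * (Ci * e T' / vol T') + 8 * \<beta> / vol T)"
      have G: "G \<ge> 0" using m2 Ci e0[of T] e0[of T'] vT vT' \<beta> by (simp add: G_def)
      have gG: "((A x *v grad (q T) x - A x *v grad (q T') x) \<bullet> unit_normal F)\<^sup>2 \<le> G" if x: "x \<in> F" for x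
      proof -
        have xT: "x \<in> elem T" "x \<in> elem T'" using x FS by blast+
        have xc: "x \<in> closure \<Omega>" using D(3)[OF T] xT by blast
        have s: "smooth (q T)" "smooth (q T')" "smooth (Q' T)" "smooth (Q' T')"
          using q[OF T] q[OF T'(1)] Q' T T'(1) smooth_poly_space by blast+
        define \<delta> where "\<delta> = grad (Q' T) x - grad (Q' T') x"
        have dl: "(norm \<delta>)\<^sup>2 \<le> 4 * \<beta> / vol T"
        proof (cases "touch T")
          case True
          have "(norm \<delta>)\<^sup>2 \<le> 2 * (norm (grad (Q' T) x))\<^sup>2 + 2 * (norm (grad (Q' T') x))\<^sup>2"
            using norm_add_sq_le[of "grad (Q' T) x" "- grad (Q' T') x"] by (simp add: \<delta>_def)
          also have "\<dots> \<le> 2 * B + 2 * B" using B(1) T T'(1) xT by (intro add_mono mult_left_mono) auto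
          also have "\<dots> = 4 * \<beta> / vol T" using True vT by (simp add: \<beta>_def)
          finally show ?thesis .
        next
          case False
          then have "Q' T = Q' T'" using touch T nb by blast
          then show ?thesis using \<beta> vT by (simp add: \<delta>_def)
        qed
        have "grad (q T) x - grad (q T') x = (grad (r T) x - grad (r T') x) + \<delta>"
          unfolding r_def \<delta>_def by (simp add: grad_diff s)
        then have "(norm (grad (q T) x - grad (q T') x))\<^sup>2 \<le> 2 * (norm (grad (r T) x - grad (r T') x))\<^sup>2 + 2 * (norm \<delta>)\<^sup>2"
          using norm_add_sq_le by metis
        also have "\<dots> \<le> 2 * (2 * (norm (grad (r T) x))\<^sup>2 + 2 * (norm (grad (r T') x))\<^sup>2) + 2 * (norm \<delta>)\<^sup>2"
          using norm_add_sq_le[of "grad (r T) x" "- grad (r T') x"] by simp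
        also have "\<dots> \<le> 4 * (Ci * e T / vol T) + 4 * (Ci * e T' / vol T') + 8 * \<beta> / vol T"
          using gr[OF T xT(1)] gr[OF T'(1) xT(2)] dl by simp
        finally have "m2 * (norm (grad (q T) x - grad (q T') x))\<^sup>2 \<le> G"
          unfolding G_def by (rule mult_left_mono[OF _ m2])
        then show ?thesis using conormal_jump_le[OF m[OF xc] un, of "grad (q T) x" "grad (q T') x"]
          unfolding m2_def by linarith
      qed
      have hR: "diam T \<le> 2 * R"
      proof (rule diameter_le)
        fix x y assume "x \<in> elem T" "y \<in> elem T"
        then have "norm x \<le> R" "norm y \<le> R" using R(2) D(3)[OF T] by blast+
        then show "norm (x - y) \<le> 2 * R" using norm_triangle_ineq4[of x y] by linarith
      qed (use R in simp)
      have "diam T * ?f T' F \<le> Kf * G * diam T ^ CARD('n)"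
        unfolding Kf_def q_def[symmetric]
        by (rule facet_integral_le[OF facetD(1,3)[OF tT F(1) d] n0 diam_pos[OF tT] hR])
          (use FS(1) dist_le_diam gG G in blast)+
      also have "\<dots> \<le> Kf * G * (\<gamma> ^ CARD('n) * vol T)"
        using shape_regularD(1)[OF reg \<gamma> T tT] Kf G by (intro mult_left_mono) auto
      also have "\<dots> = Kf * \<gamma> ^ CARD('n) * (G * vol T)" by simp
      finally have hf: "diam T * ?f T' F \<le> Kf * \<gamma> ^ CARD('n) * (G * vol T)" .
      have "G * vol T = m2 * (4 * Ci * e T + 4 * Ci * (e T' * (vol T / vol T')) + 8 * \<beta>)"
        using vT vT' by (simp add: G_def field_simps)
      also have "\<dots> \<le> m2 * (4 * Ci * e T + 4 * Ci * (e T' * W) + 8 * \<beta>)"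
      proof -
        have "vol T \<le> \<gamma> ^ CARD('n) * diam T ^ CARD('n)" by (rule shape_regularD(2)[OF reg \<gamma> T tT])
        also have "\<dots> \<le> \<gamma> ^ CARD('n) * (L * diam T') ^ CARD('n)"
          using diam_comparable[OF reg \<gamma> T tT d F(1) FS(2)] diam_pos[OF tT] \<gamma>
          by (intro mult_left_mono power_mono) (auto simp: L_def)
        also have "\<dots> = \<gamma> ^ CARD('n) * L ^ CARD('n) * diam T' ^ CARD('n)" by (simp add: power_mult_distrib)
        also have "\<dots> \<le> \<gamma> ^ CARD('n) * L ^ CARD('n) * (\<gamma> ^ CARD('n) * vol T')"
          using shape_regularD(1)[OF reg \<gamma> T'(1) tT'] \<gamma> L by (intro mult_left_mono) auto
        also have "\<dots> = W * vol T'" by (simp add: W_def)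
        finally have "vol T / vol T' \<le> W" using vT' by (simp add: pos_divide_le_eq)
        then show ?thesis using m2 Ci e0[of T'] by (intro mult_left_mono add_mono order_refl) auto
      qed
      also have "\<dots> \<le> m2 * ((4 * Ci + 4 * Ci * W + 8) * (e T + e T' + \<beta>))"
      proof (rule mult_left_mono[OF _ m2])
        define a1 a2 where "a1 = 4 * Ci" and "a2 = 4 * Ci * W"
        have a: "a1 \<ge> 0" "a2 \<ge> 0" using Ci W by (simp_all add: a1_def a2_def)
        have "a1 * e T \<le> (a1 + a2 + 8) * e T" "a2 * e T' \<le> (a1 + a2 + 8) * e T'" "8 * \<beta> \<le> (a1 + a2 + 8) * \<beta>"
          using a e0[of T] e0[of T'] \<beta> by (intro mult_right_mono; simp)+
        then have "a1 * e T + a2 * e T' + 8 * \<beta> \<le> (a1 + a2 + 8) * (e T + e T' + \<beta>)"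
          unfolding distrib_left by linarith
        then show "4 * Ci * e T + 4 * Ci * (e T' * W) + 8 * \<beta> \<le> (4 * Ci + 4 * Ci * W + 8) * (e T + e T' + \<beta>)"
          by (simp add: a1_def a2_def mult.commute mult.left_commute)
      qed
      finally have GV: "G * vol T \<le> m2 * ((4 * Ci + 4 * Ci * W + 8) * (e T + e T' + \<beta>))" .
      have "vol T powr (1 / CARD('n)) * ?f T' F \<le> (\<gamma> * diam T) * ?f T' F"
        by (rule mult_right_mono[OF shape_regularD(3)[OF reg \<gamma> T tT] f0])
      also have "\<dots> \<le> \<gamma> * (Kf * \<gamma> ^ CARD('n) * (G * vol T))"
        unfolding mult.assoc[of \<gamma> "diam T"] using hf \<gamma> by (intro mult_left_mono) auto
      also have "\<dots> \<le> \<gamma> * (Kf * \<gamma> ^ CARD('n) * (m2 * ((4 * Ci + 4 * Ci * W + 8) * (e T + e T' + \<beta>))))"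
        using GV \<gamma> Kf by (intro mult_left_mono) auto
      also have "\<dots> = C2 * (e T + e T' + \<beta>)" by (simp only: C2_def mult.assoc)
      finally show ?thesis .
    qed
    have Fset: "finite {F. F facet_of elem T \<and> F facet_of elem T'}"
      "real (card {F. F facet_of elem T \<and> F facet_of elem T'}) \<le> real CARD('n) + 1" for T'
    proof -
      have sub: "{F. F facet_of elem T \<and> F facet_of elem T'} \<subseteq> {F. F facet_of elem T}" by blast
      show "finite {F. F facet_of elem T \<and> F facet_of elem T'}" by (rule finite_subset[OF sub card_facets(1)[OF tT]])
      have "card {F. F facet_of elem T \<and> F facet_of elem T'} \<le> CARD('n) + 1"
        using card_mono[OF card_facets(1)[OF tT] sub] card_facets(2)[OF tT] by linarith
      then show "real (card {F. F facet_of elem T \<and> F facet_of elem T'}) \<le> real CARD('n) + 1" by linarith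
    qed
    have nbT: "nbs \<T> T \<subseteq> \<T> - {T}" unfolding nbs_def by blast
    \<comment> \<open>Elements without a common facet contribute empty sums, so the sum over the
      whole mesh reduces to boundedly many neighbours.\<close>
    have "jump_sq A p \<T> v T = (\<Sum>T'\<in>nbs \<T> T. \<Sum>F | F facet_of elem T \<and> F facet_of elem T'. ?f T' F)"
      unfolding jump_sq_def
    proof (rule sum.mono_neutral_right[OF finite_Diff[OF D(1)] nbT])
      show "\<forall>T'\<in>\<T> - {T} - nbs \<T> T. (\<Sum>F | F facet_of elem T \<and> F facet_of elem T'. ?f T' F) = 0"
      proof
        fix T' assume "T' \<in> \<T> - {T} - nbs \<T> T"
        then have "{F. F facet_of elem T \<and> F facet_of elem T'} = {}" unfolding nbs_def by blast
        then show "(\<Sum>F | F facet_of elem T \<and> F facet_of elem T'. ?f T' F) = 0" by (simp only: sum.empty)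
      qed
    qed
    then have "vol T powr (1 / CARD('n)) * jump_sq A p \<T> v T =
       (\<Sum>T'\<in>nbs \<T> T. \<Sum>F | F facet_of elem T \<and> F facet_of elem T'. vol T powr (1 / CARD('n)) * ?f T' F)"
      by (simp only: sum_distrib_left)
    also have "\<dots> \<le> (\<Sum>T'\<in>nbs \<T> T. \<Sum>F | F facet_of elem T \<and> F facet_of elem T'. C2 * (e T + e T' + \<beta>))"
    proof (intro sum_mono)
      fix T' F assume "T' \<in> nbs \<T> T" "F \<in> {F. F facet_of elem T \<and> F facet_of elem T'}"
      then have "T' \<in> \<T>" "T' \<noteq> T" "F facet_of elem T" "F facet_of elem T'" using nbT by blast+
      then show "vol T powr (1 / CARD('n)) * ?f T' F \<le> C2 * (e T + e T' + \<beta>)" by (rule one)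
    qed
    also have "\<dots> \<le> (\<Sum>T'\<in>nbs \<T> T. (real CARD('n) + 1) * (C2 * (e T + e T' + \<beta>)))"
    proof (rule sum_mono)
      fix T'
      show "(\<Sum>F | F facet_of elem T \<and> F facet_of elem T'. C2 * (e T + e T' + \<beta>)) \<le> (real CARD('n) + 1) * (C2 * (e T + e T' + \<beta>))"
        unfolding sum_constant using Fset(2)[of T'] C2 e0[of T] e0[of T'] \<beta> by (intro mult_right_mono) auto
    qed
    also have "\<dots> = (real CARD('n) + 1) * C2 * (real (card (nbs \<T> T)) * (e T + \<beta>) + (\<Sum>T'\<in>nbs \<T> T. e T'))"
    proof -
      have "(\<Sum>T'\<in>nbs \<T> T. (real CARD('n) + 1) * (C2 * (e T + e T' + \<beta>))) =
         (real CARD('n) + 1) * C2 * (\<Sum>T'\<in>nbs \<T> T. (e T + \<beta>) + e T')"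
        by (simp add: sum_distrib_left mult.assoc add_ac)
      then show ?thesis by (simp add: sum.distrib)
    qed
    also have "\<dots> \<le> (real CARD('n) + 1) * C2 * ((Nn + 1) * (e T + (\<Sum>T'\<in>nbs \<T> T. e T') + \<beta>))"
    proof (rule mult_left_mono)
      have "real (card (nbs \<T> T)) * (e T + \<beta>) \<le> Nn * (e T + \<beta>)"
        using card_nbs[OF conf reg \<gamma> d T] e0[of T] \<beta> unfolding Nn_def L_def by (intro mult_right_mono) auto
      moreover have S: "0 \<le> (\<Sum>T'\<in>nbs \<T> T. e T')" by (rule sum_nonneg) (rule e0)
      moreover have "0 \<le> Nn * (\<Sum>T'\<in>nbs \<T> T. e T')" using Nn S by simp
      ultimately show "real (card (nbs \<T> T)) * (e T + \<beta>) + (\<Sum>T'\<in>nbs \<T> T. e T') \<le> (Nn + 1) * (e T + (\<Sum>T'\<in>nbs \<T> T. e T') + \<beta>)"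
        using e0[of T] \<beta> by (simp add: distrib_left distrib_right)
    qed (use C2 in simp)
    also have "\<dots> = C * (e T + (\<Sum>T'\<in>nbs \<T> T. e T') + \<beta>)" by (simp only: C_def mult.assoc)
    finally show "vol T powr (1 / CARD('n)) * jump_sq A p \<T> v T \<le>
      C * (elem_energy T (\<lambda>x. elem_poly p T v x - Q' T x) +
        (\<Sum>T'\<in>nbs \<T> T. elem_energy T' (\<lambda>x. elem_poly p T' v x - Q' T' x)) + (if touch T then B * vol T else 0))"
      by (simp only: e_def r_def q_def \<beta>_def)
  qed
qed

section \<open>Discrete spaces\<close>

lemma Sp0_subset_H10: "Sp0_space \<Omega> p \<T> \<subseteq> H10_space \<Omega>"
  unfolding Sp0_space_def by blast

lemma Sp0_lincomb:
  fixes v w :: "real ^ 'n::finite \<Rightarrow> real"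
  assumes "v \<in> Sp0_space \<Omega> p \<T>" "w \<in> Sp0_space \<Omega> p \<T>" "open \<Omega>"
  shows "(\<lambda>x. \<alpha> * v x + \<beta> * w x) \<in> Sp0_space \<Omega> p \<T>"
  unfolding Sp0_space_def
proof (intro CollectI conjI ballI)
  show "(\<lambda>x. \<alpha> * v x + \<beta> * w x) \<in> H10_space \<Omega>"
    using assms Sp0_subset_H10 by (intro H10_lincomb) blast+
  fix T assume T: "T \<in> \<T>"
  obtain q r where qr: "q \<in> poly_space p" "AE x in lebesgue_on (elem T). v x = q x"
    "r \<in> poly_space p" "AE x in lebesgue_on (elem T). w x = r x"
    using assms(1,2) T unfolding Sp0_space_def by blast
  have "AE x in lebesgue_on (elem T). \<alpha> * v x + \<beta> * w x = \<alpha> * q x + \<beta> * r x"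
    using qr(2,4) by eventually_elim simp
  then show "\<exists>q\<in>poly_space p. AE x in lebesgue_on (elem T). \<alpha> * v x + \<beta> * w x = q x"
    by (intro bexI[OF _ poly_space_lincomb[OF qr(1,3)]])
qed

lemma Sp0_nested:
  assumes "\<And>T'. T' \<in> \<T>' \<Longrightarrow> \<exists>T\<in>\<T>. elem T' \<subseteq> elem T"
  shows "Sp0_space \<Omega> p \<T> \<subseteq> Sp0_space \<Omega> p \<T>'"
proof
  fix v assume v: "v \<in> Sp0_space \<Omega> p \<T>"
  have "\<exists>q\<in>poly_space p. AE x in lebesgue_on (elem T'). v x = q x" if T': "T' \<in> \<T>'" for T'
  proof -
    obtain T where T: "T \<in> \<T>" "elem T' \<subseteq> elem T" using assms[OF T'] by blast
    then obtain q where q: "q \<in> poly_space p" "AE x in lebesgue_on (elem T). v x = q x"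
      using v unfolding Sp0_space_def by blast
    show ?thesis using AE_lebesgue_on_subset[OF q(2) T(2) sets_elem(1) sets_elem(1)] q(1) by blast
  qed
  then show "v \<in> Sp0_space \<Omega> p \<T>'" using v unfolding Sp0_space_def by blast
qed

lemma indicator_sq_nonneg: "0 \<le> indicator_sq A b c f p \<T> v T"
  unfolding indicator_sq_def jump_sq_def
  by (intro add_nonneg_nonneg mult_nonneg_nonneg sum_nonneg facet_integral_nonneg) auto

section \<open>The indicators of the refined elements vanish\<close>

lemma refined_indicators_vanish:
  fixes \<Omega> :: "(real ^ 'n::finite) set" and \<T> :: "nat \<Rightarrow> 'n tagged_simplex set"
    and U :: "nat \<Rightarrow> real ^ 'n \<Rightarrow> real" and \<gamma> :: real
  assumes d: "CARD('n) \<ge> 2" and bdd: "bounded \<Omega>" and lip: "lipschitz_domain \<Omega>" and f: "f \<in> L2_space \<Omega>"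
    and A: "\<And>i j. (\<lambda>x. A x $ i $ j) \<in> W1inf_space \<Omega>" and cA: "continuous_on (closure \<Omega>) A"
    and b: "\<And>i. (\<lambda>x. b x $ i) \<in> Linf_space \<Omega>" and c: "c \<in> Linf_space \<Omega>"
    and conf: "\<And>l. conforming_mesh \<Omega> (\<T> l)" and ref: "\<And>l. refines (\<T> l) (\<T> (Suc l))"
    and U: "\<And>l. U l \<in> Sp0_space \<Omega> p (\<T> l)" and \<gamma>: "\<gamma> > 0" and reg: "\<And>l. shape_regular \<gamma> (\<T> l)"
    and Ubd: "\<exists>M. \<forall>l. energy \<Omega> (U l) \<le> M"
    and cauchy: "\<And>e. e > 0 \<Longrightarrow> \<exists>k. \<forall>l\<ge>k. energy \<Omega> (\<lambda>x. U l x - U k x) < e"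
    and M: "\<And>l. M l \<subseteq> \<T> l - \<T> (Suc l)" and \<epsilon>: "\<epsilon> > 0"
  shows "\<exists>l0. \<forall>l\<ge>l0. (\<Sum>T\<in>M l. indicator_sq A b c f p (\<T> l) (U l) T) < \<epsilon>"
proof -
  have op: "open \<Omega>" using lip unfolding lipschitz_domain_def by blast
  note D = conforming_meshD[OF conf]
  have cc: "compact (closure \<Omega>)" using bdd by simp
  have UH: "U l \<in> H10_space \<Omega>" "U l \<in> H1_space \<Omega>" for l using U Sp0_subset_H10 H10_subset_H1 by blast+
  obtain C1 where C1: "C1 \<ge> 0" and volp: "\<forall>(T :: 'n tagged_simplex) v q q' B. is_tagged_simplex T \<longrightarrow> diam T ^ CARD('n) \<le> \<gamma> ^ CARD('n) * vol T \<longrightarrow>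
    vol T powr (2 / CARD('n)) \<le> \<gamma>\<^sup>2 * (diam T)\<^sup>2 \<longrightarrow>
    interior (elem T) \<subseteq> \<Omega> \<longrightarrow> q \<in> poly_space p \<longrightarrow> q' \<in> poly_space p \<longrightarrow>
    (AE x in lebesgue_on (elem T). v x = q x) \<longrightarrow> (\<forall>x\<in>elem T. hess_sq q' x \<le> B) \<longrightarrow> 0 \<le> B \<longrightarrow>
    vol T powr (2 / CARD('n)) * (L2_norm (interior (elem T)) (\<lambda>x. diff_op (interior (elem T)) A b c v x - f x))\<^sup>2 \<le>
      C1 * (elem_energy T (\<lambda>x. q x - q' x) + (diam T)\<^sup>2 * (B * vol T +
        (LINT x|lebesgue_on (elem T). (norm (grad q x))\<^sup>2 + (q x)\<^sup>2 + (f x)\<^sup>2)))"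
    using volume_part[OF op A b c f \<gamma>, of p] by blast
  obtain C2 where C2: "C2 \<ge> 0" and jumpp: "\<forall>(\<T> :: 'n tagged_simplex set) v Q' B touch T. conforming_mesh \<Omega> \<T> \<longrightarrow> shape_regular \<gamma> \<T> \<longrightarrow>
    v \<in> Sp0_space \<Omega> p \<T> \<longrightarrow> (\<forall>T\<in>\<T>. Q' T \<in> poly_space p) \<longrightarrow>
    (\<forall>T\<in>\<T>. \<forall>x\<in>elem T. (norm (grad (Q' T) x))\<^sup>2 \<le> B) \<longrightarrow> 0 \<le> B \<longrightarrow>
    (\<forall>T\<in>\<T>. \<forall>T'\<in>nbs \<T> T. Q' T = Q' T' \<or> touch T) \<longrightarrow> T \<in> \<T> \<longrightarrow>
    vol T powr (1 / CARD('n)) * jump_sq A p \<T> v T \<le>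
      C2 * (elem_energy T (\<lambda>x. elem_poly p T v x - Q' T x) +
        (\<Sum>T'\<in>nbs \<T> T. elem_energy T' (\<lambda>x. elem_poly p T' v x - Q' T' x)) + (if touch T then B * vol T else 0))"
    using jump_part[OF d bdd cA \<gamma>, of p] by blast
  define Nn where "Nn = ball_vol TYPE('n) * ((1 + comparability TYPE('n) \<gamma>) * comparability TYPE('n) \<gamma> * \<gamma>) ^ CARD('n)"
  have Nn: "Nn \<ge> 0" using ball_vol_pos[where 'n = 'n] comparability_pos[OF \<gamma>, where 'n = 'n] \<gamma> by (simp add: Nn_def)
  obtain Me where Me: "\<And>l. energy \<Omega> (U l) \<le> Me" using Ubd by blast
  obtain Cp where Cp: "Cp > 0" "\<And>v. v \<in> H10_space \<Omega> \<Longrightarrow> l2sq \<Omega> v \<le> Cp * energy \<Omega> v"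
    using poincare[OF op bdd] by blast
  define M1 where "M1 = Me + Cp * Me + l2sq \<Omega> f"
  have M1: "energy \<Omega> (U l) + l2sq \<Omega> (U l) + l2sq \<Omega> f \<le> M1" for l
    using Me[of l] Cp(2)[OF UH(1)[of l]] mult_left_mono[OF Me[of l], of Cp] Cp(1) unfolding M1_def by linarith
  \<comment> \<open>Dominates the coefficients of the three error sources: the energy difference,
    the terms with squared diameter, and the skeleton. Each is made at most
    \<open>\<epsilon> / (3 * C3)\<close>.\<close>
  define C3 where "C3 = C1 + C2 * (1 + Nn) + 1"
  have C3: "C3 > 0" using C1 C2 Nn by (simp add: C3_def add_nonneg_pos)
  have "\<epsilon> / (3 * C3) > 0" using \<epsilon> C3 by simp
  \<comment> \<open>From here on \<open>k\<close> is fixed. The bound \<open>B\<close>, the skeleton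
    and the thresholds below depend on it, but not on \<open>l\<close>.\<close>
  then obtain k where k: "\<And>l. l \<ge> k \<Longrightarrow> energy \<Omega> (\<lambda>x. U l x - U k x) < \<epsilon> / (3 * C3)" using cauchy by blast
  \<comment> \<open>Finitely many polynomials represent \<open>U k\<close>, and each has bounded
    derivatives on the compact closure of \<Omega>.\<close>
  obtain B where B: "B \<ge> 0" "\<And>K x. K \<in> \<T> k \<Longrightarrow> x \<in> closure \<Omega> \<Longrightarrow>
      (norm (grad (elem_poly p K (U k)) x))\<^sup>2 \<le> B \<and> hess_sq (elem_poly p K (U k)) x \<le> B"
  proof -
    have "\<exists>B\<ge>0. \<forall>x\<in>closure \<Omega>. (norm (grad (elem_poly p K (U k)) x))\<^sup>2 \<le> B \<and> hess_sq (elem_poly p K (U k)) x \<le> B"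
      if K: "K \<in> \<T> k" for K
    proof -
      have s: "smooth (elem_poly p K (U k))"
        by (rule smooth_poly_space[OF Sp0_elem_poly(1)[OF U K D(2)[OF K]]])
      obtain B1 where B1: "B1 \<ge> 0" "\<And>x. x \<in> closure \<Omega> \<Longrightarrow> \<bar>(norm (grad (elem_poly p K (U k)) x))\<^sup>2\<bar> \<le> B1"
        using continuous_on_compact_bound[OF continuous_on_grad_sq[OF s] cc] by blast
      obtain B2 where B2: "B2 \<ge> 0" "\<And>x. x \<in> closure \<Omega> \<Longrightarrow> \<bar>hess_sq (elem_poly p K (U k)) x\<bar> \<le> B2"
        using continuous_on_compact_bound[OF continuous_on_hess_sq[OF s] cc] by blast
      show ?thesis
      proof (intro exI[of _ "B1 + B2"] conjI ballI)
        fix x assume x: "x \<in> closure \<Omega>"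
        show "(norm (grad (elem_poly p K (U k)) x))\<^sup>2 \<le> B1 + B2" "hess_sq (elem_poly p K (U k)) x \<le> B1 + B2"
          using B1(1) B2(1) B1(2)[OF x] B2(2)[OF x] by linarith+
      qed (use B1 B2 in simp)
    qed
    then obtain BK where BK: "\<And>K. K \<in> \<T> k \<Longrightarrow> BK K \<ge> 0 \<and> (\<forall>x\<in>closure \<Omega>.
        (norm (grad (elem_poly p K (U k)) x))\<^sup>2 \<le> BK K \<and> hess_sq (elem_poly p K (U k)) x \<le> BK K)" by metis
    have "BK K \<le> (\<Sum>K\<in>\<T> k. BK K)" if "K \<in> \<T> k" for K
      by (rule member_le_sum[OF that _ D(1)]) (use BK in blast)
    note le = this
    show ?thesis
    proof (rule that[of "\<Sum>K\<in>\<T> k. BK K"])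
      show "0 \<le> (\<Sum>K\<in>\<T> k. BK K)" by (rule sum_nonneg) (use BK in blast)
      fix K x assume "K \<in> \<T> k" "x \<in> closure \<Omega>"
      then have "(norm (grad (elem_poly p K (U k)) x))\<^sup>2 \<le> BK K" "hess_sq (elem_poly p K (U k)) x \<le> BK K" "BK K \<le> (\<Sum>K\<in>\<T> k. BK K)"
        using BK le by blast+
      then show "(norm (grad (elem_poly p K (U k)) x))\<^sup>2 \<le> (\<Sum>K\<in>\<T> k. BK K) \<and> hess_sq (elem_poly p K (U k)) x \<le> (\<Sum>K\<in>\<T> k. BK K)"
        by linarith
    qed
  qed

  \<comment> \<open>The skeleton of the fixed mesh and the thresholds for the element size\<close>
  define S where "S = (\<Union>K\<in>\<T> k. frontier (elem K))"
  have S_compact: "compact S" unfolding S_def by (intro compact_UN D(1) compact_frontier compact_elem)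
  have S_neg: "negligible S" unfolding S_def
    by (intro negligible_Union finite_imageI D(1)) (use negligible_frontier_elem in blast)
  have S_ne: "S \<noteq> {}"
  proof -
    have "\<Omega> \<noteq> {}" using lip unfolding lipschitz_domain_def by blast
    then obtain K where K: "K \<in> \<T> k" using D(7)[of k] closure_subset[of \<Omega>] by blast
    have "elem K \<noteq> {}" using tagged_simplexD(4)[OF D(2)[OF K]] interior_subset by blast
    moreover have "elem K \<noteq> UNIV" using compact_elem[of K] compact_imp_bounded not_bounded_UNIV by metis
    ultimately have "frontier (elem K) \<noteq> {}" using frontier_eq_empty by blast
    then show ?thesis using K unfolding S_def by blast
  qed
  have "\<epsilon> / (3 * C3 * (B + 1)) > 0" using \<epsilon> C3 B(1) by simp
  then obtain \<delta>0 where \<delta>0: "\<delta>0 > 0" "{x. infdist x S \<le> \<delta>0} \<in> lmeasurable"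
    "measure lebesgue {x. infdist x S \<le> \<delta>0} < \<epsilon> / (3 * C3 * (B + 1))"
    using small_neighbourhood[OF S_compact S_ne S_neg] by blast
  define P where "P = {x. infdist x S \<le> \<delta>0}"
  define X where "X = B * measure lebesgue (closure \<Omega>) + M1"
  have M10: "M1 \<ge> 0" using M1[of 0] energy_nonneg[of \<Omega> "U 0"] l2sq_nonneg[of \<Omega> "U 0"] l2sq_nonneg[of \<Omega> f] by linarith
  have X: "X \<ge> 0" using B(1) M10 by (simp add: X_def)
  \<comment> \<open>The first entry keeps small elements that meet the skeleton inside the
    neighbourhood \<open>P\<close>; the second makes the terms with squared diameter small.\<close>
  define \<delta> where "\<delta> = min \<delta>0 (sqrt (\<epsilon> / (3 * C3 * (X + 1))))"
  have \<delta>: "\<delta> > 0" "\<delta> \<le> \<delta>0" using \<delta>0(1) \<epsilon> C3 X by (simp_all add: \<delta>_def)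
  have \<delta>2: "\<delta>\<^sup>2 \<le> \<epsilon> / (3 * C3 * (X + 1))"
  proof -
    have "\<delta>\<^sup>2 \<le> (sqrt (\<epsilon> / (3 * C3 * (X + 1))))\<^sup>2" using \<delta>(1) by (intro power_mono) (auto simp: \<delta>_def)
    then show ?thesis using \<epsilon> C3 X by simp
  qed
  \<comment> \<open>By shape regularity this volume threshold forces the diameter to be at most
    \<delta>.\<close>
  have "(\<delta> / \<gamma>) ^ CARD('n) > 0" using \<delta> \<gamma> by simp
  then obtain l1 where l1: "\<And>l T. l \<ge> l1 \<Longrightarrow> T \<in> \<T> l - \<T> (Suc l) \<Longrightarrow> vol T < (\<delta> / \<gamma>) ^ CARD('n)"
    using refined_volumes_vanish[where \<Omega> = \<Omega> and \<T> = \<T>, OF conf ref d, of "(\<delta> / \<gamma>) ^ CARD('n)"] by blast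
  have "(\<Sum>T\<in>M l. indicator_sq A b c f p (\<T> l) (U l) T) < \<epsilon>" if l: "l \<ge> max k l1" for l
  proof -

    \<comment> \<open>Elementwise comparison of \<open>U l\<close> with \<open>U k\<close>\<close>
    have kl: "k \<le> l" using l by simp
    define Q where "Q T = elem_poly p T (U l)" for T
    define Q' where "Q' T = elem_poly p T (U k)" for T
    define e where "e T = elem_energy T (\<lambda>x. Q T x - Q' T x)" for T
    have e0: "e T \<ge> 0" for T by (simp add: e_def elem_energy_nonneg)
    have anc: "\<exists>K\<in>\<T> k. elem T \<subseteq> elem K" if "T \<in> \<T> l" for T by (rule ancestor_exists[where \<Omega> = \<Omega> and \<T> = \<T>, OF conf ref d kl that])
    have Q'K: "Q' T = elem_poly p K (U k)" if "T \<in> \<T> l" "K \<in> \<T> k" "elem T \<subseteq> elem K" for T K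
      unfolding Q'_def by (rule elem_poly_ancestor[OF U that(2) D(2)[OF that(2)] D(2)[OF that(1)] that(3)])
    have Q: "Q T \<in> poly_space p" "AE x in lebesgue_on (elem T). U l x = Q T x" if "T \<in> \<T> l" for T
      unfolding Q_def by (rule Sp0_elem_poly[OF U that D(2)[OF that]])+
    have Q'p: "Q' T \<in> poly_space p" "AE x in lebesgue_on (elem T). U k x = Q' T x"
      "\<And>x. x \<in> elem T \<Longrightarrow> (norm (grad (Q' T) x))\<^sup>2 \<le> B \<and> hess_sq (Q' T) x \<le> B" if T: "T \<in> \<T> l" for T
    proof -
      obtain K where K: "K \<in> \<T> k" "elem T \<subseteq> elem K" using anc[OF T] by blast
      note w = Sp0_elem_poly[OF U K(1) D(2)[OF K(1)]] and eq = Q'K[OF T K]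
      show "Q' T \<in> poly_space p" unfolding eq by (rule w(1))
      show "AE x in lebesgue_on (elem T). U k x = Q' T x"
        unfolding eq by (rule AE_lebesgue_on_subset[OF w(2) K(2) sets_elem(1) sets_elem(1)])
      show "(norm (grad (Q' T) x))\<^sup>2 \<le> B \<and> hess_sq (Q' T) x \<le> B" if "x \<in> elem T" for x
        unfolding eq by (rule B(2)[OF K(1)]) (use that D(3)[OF T] in blast)
    qed
    have sr: "smooth (\<lambda>x. Q T x - Q' T x)" if "T \<in> \<T> l" for T
      using smooth_poly_space[OF poly_space_lincomb[OF Q(1)[OF that] Q'p(1)[OF that], of 1 "-1"]] by simp
    have rAE: "AE x in lebesgue_on (elem T). U l x - U k x = Q T x - Q' T x" if "T \<in> \<T> l" for T
      using Q(2)[OF that] Q'p(2)[OF that] by eventually_elim simp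
    define E where "E = energy \<Omega> (\<lambda>x. U l x - U k x)"
    have E: "E < \<epsilon> / (3 * C3)" using k[OF kl] by (simp add: E_def)
    have sumE: "(\<Sum>T\<in>N. e T) \<le> E" if "N \<subseteq> \<T> l" for N
      unfolding e_def E_def
      by (rule sum_elem_energy_le[OF conf lip that H1_diff[OF UH(2) UH(2) op]])
        (use sr rAE that in blast)+
    have Ml: "M l \<subseteq> \<T> l" using M by blast
    have small: "diam T \<le> \<delta>" if T: "T \<in> M l" for T
    proof (rule ccontr)
      have Tl: "T \<in> \<T> l" using Ml T by blast
      assume "\<not> diam T \<le> \<delta>"
      then have "\<delta> ^ CARD('n) \<le> diam T ^ CARD('n)" using \<delta>(1) by (intro power_mono) auto
      also have "\<dots> \<le> \<gamma> ^ CARD('n) * vol T" by (rule shape_regularD(1)[OF reg \<gamma> Tl D(2)[OF Tl]])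
      also have "\<dots> < \<gamma> ^ CARD('n) * (\<delta> / \<gamma>) ^ CARD('n)"
        using l1[of l T] M[of l] T l \<gamma> by (intro mult_strict_left_mono) auto
      also have "\<dots> = \<delta> ^ CARD('n)" using \<gamma> by (simp add: power_divide)
      finally show False by simp
    qed
    \<comment> \<open>\<open>jump_part\<close> asks for the alternative on the whole mesh, while
      smallness is known on the marked elements only. The second disjunct covers large elements and
      is false on \<open>M l\<close>.\<close>
    define touch where "touch T \<longleftrightarrow> elem T \<subseteq> P \<or> diam T > \<delta>" for T :: "'n tagged_simplex"
    have touch: "Q' T = Q' T' \<or> touch T" if T: "T \<in> \<T> l" and T': "T' \<in> nbs (\<T> l) T" for T T'
    proof (rule ccontr)
      assume n: "\<not> (Q' T = Q' T' \<or> touch T)"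
      obtain F where F: "T' \<in> \<T> l" "F facet_of elem T" "F facet_of elem T'" using T' unfolding nbs_def by blast
      obtain K K' where K: "K \<in> \<T> k" "elem T \<subseteq> elem K" "K' \<in> \<T> k" "elem T' \<subseteq> elem K'" using anc[OF T] anc[OF F(1)] by blast
      \<comment> \<open>Different polynomials on neighbours can only come from different elements of
        the fixed mesh, so the common facet lies in the skeleton.\<close>
      have "K \<noteq> K'" using Q'K[OF T K(1,2)] Q'K[OF F(1) K(3,4)] n by auto
      then have "elem K \<inter> elem K' \<subseteq> S" using D(4)[OF K(1,3)] K(1) unfolding S_def by blast
      moreover obtain w where w: "w \<in> F" using facetD(3)[OF D(2)[OF T] F(2) d] by blast
      ultimately have wS: "w \<in> S" and wT: "w \<in> elem T" using F facet_of_subset K(2,4) by blast+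
      have "elem T \<subseteq> P"
      proof
        fix x assume x: "x \<in> elem T"
        have "infdist x S \<le> dist x w" by (rule infdist_le[OF wS])
        also have "\<dots> \<le> diam T" using dist_le_diam[OF x wT] by (simp add: dist_norm)
        also have "\<dots> \<le> \<delta>0" using n \<delta>(2) unfolding touch_def by simp
        finally show "x \<in> P" by (simp add: P_def)
      qed
      then show False using n unfolding touch_def by blast
    qed
    define I where "I T = (LINT x|lebesgue_on (elem T). (norm (grad (Q T) x))\<^sup>2 + (Q T x)\<^sup>2 + (f x)\<^sup>2)" for T
    have I0: "I T \<ge> 0" for T unfolding I_def by (rule Bochner_Integration.integral_nonneg) simp
    have ind: "indicator_sq A b c f p (\<T> l) (U l) T \<le>
      C1 * (e T + \<delta>\<^sup>2 * (B * vol T + I T)) + C2 * (e T + (\<Sum>T'\<in>nbs (\<T> l) T. e T') + (if elem T \<subseteq> P then B * vol T else 0))"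
      if T: "T \<in> M l" for T
    proof -
      have Tl: "T \<in> \<T> l" using Ml T by blast
      note tT = D(2)[OF Tl]
      have tc: "touch T \<longleftrightarrow> elem T \<subseteq> P" using small[OF T] by (simp add: touch_def not_less)
      have "vol T powr (2 / CARD('n)) * (L2_norm (interior (elem T)) (\<lambda>x. diff_op (interior (elem T)) A b c (U l) x - f x))\<^sup>2 \<le>
        C1 * (e T + (diam T)\<^sup>2 * (B * vol T + I T))"
        unfolding e_def I_def
        by (rule volp[rule_format, OF tT shape_regularD(1,4)[OF reg \<gamma> Tl tT] interior_elem_subset[OF conf lip Tl] Q(1)[OF Tl] Q'p(1)[OF Tl] Q(2)[OF Tl] _ B(1)])
          (use Q'p(3)[OF Tl] in blast)
      also have "\<dots> \<le> C1 * (e T + \<delta>\<^sup>2 * (B * vol T + I T))"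
      proof (intro mult_left_mono[OF _ C1] add_left_mono mult_right_mono)
        show "(diam T)\<^sup>2 \<le> \<delta>\<^sup>2" using small[OF T] diam_pos[OF tT] by (intro power_mono) auto
        show "0 \<le> B * vol T + I T" using B(1) vol_nonneg[of T] I0[of T] by simp
      qed
      finally have 1: "vol T powr (2 / CARD('n)) * (L2_norm (interior (elem T)) (\<lambda>x. diff_op (interior (elem T)) A b c (U l) x - f x))\<^sup>2 \<le>
         C1 * (e T + \<delta>\<^sup>2 * (B * vol T + I T))" .
      have "\<forall>T\<in>\<T> l. Q' T \<in> poly_space p" "\<forall>T\<in>\<T> l. \<forall>x\<in>elem T. (norm (grad (Q' T) x))\<^sup>2 \<le> B"
        "\<forall>T\<in>\<T> l. \<forall>T'\<in>nbs (\<T> l) T. Q' T = Q' T' \<or> touch T" using Q'p touch by blast+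
      then have 2: "vol T powr (1 / CARD('n)) * jump_sq A p (\<T> l) (U l) T \<le>
         C2 * (e T + (\<Sum>T'\<in>nbs (\<T> l) T. e T') + (if touch T then B * vol T else 0))"
        unfolding e_def Q_def using jumpp conf reg U B(1) Tl by blast
      show ?thesis using 1 2 unfolding indicator_sq_def tc by linarith
    qed

    \<comment> \<open>Summation over the marked elements\<close>
    have fM: "finite (M l)" using D(1) Ml finite_subset by blast
    have s1: "(\<Sum>T\<in>M l. B * vol T + I T) \<le> X"
    proof -
      have "(\<Sum>T\<in>M l. vol T) \<le> measure lebesgue (closure \<Omega>)"
        by (rule sum_vol_le[OF conf Ml lmeasurable_compact[OF cc]]) (use D(3) Ml in blast)
      then have a: "B * (\<Sum>T\<in>M l. vol T) \<le> B * measure lebesgue (closure \<Omega>)" by (rule mult_left_mono[OF _ B(1)])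
      have int: "integrable (lebesgue_on \<Omega>) (\<lambda>x. (norm (weak_grad \<Omega> (U l) x))\<^sup>2)"
        "integrable (lebesgue_on \<Omega>) (\<lambda>x. (U l x)\<^sup>2)" "integrable (lebesgue_on \<Omega>) (\<lambda>x. (f x)\<^sup>2)"
        using weak_grad_sq_integrable[OF UH(2) op] H1_spaceD(1)[OF UH(2) op] f unfolding L2_space_def by blast+
      have "I T = (LINT x|lebesgue_on (elem T). (norm (weak_grad \<Omega> (U l) x))\<^sup>2 + (U l x)\<^sup>2 + (f x)\<^sup>2)" if T: "T \<in> M l" for T
        unfolding I_def
      proof (rule integral_cong_AE_on[OF sets_elem(1)])
        have Tl: "T \<in> \<T> l" using Ml T by blast
        show "AE x in lebesgue_on (elem T). (norm (grad (Q T) x))\<^sup>2 + (Q T x)\<^sup>2 + (f x)\<^sup>2 =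
            (norm (weak_grad \<Omega> (U l) x))\<^sup>2 + (U l x)\<^sup>2 + (f x)\<^sup>2"
          using weak_grad_elem[OF UH(2) op interior_elem_subset[OF conf lip Tl] Q(2)[OF Tl] smooth_poly_space[OF Q(1)[OF Tl]]] Q(2)[OF Tl]
          by eventually_elim simp
      qed
      then have "(\<Sum>T\<in>M l. I T) = (\<Sum>T\<in>M l. LINT x|lebesgue_on (elem T). (norm (weak_grad \<Omega> (U l) x))\<^sup>2 + (U l x)\<^sup>2 + (f x)\<^sup>2)"
        by (intro sum.cong refl)
      also have "\<dots> \<le> (LINT x|lebesgue_on \<Omega>. (norm (weak_grad \<Omega> (U l) x))\<^sup>2 + (U l x)\<^sup>2 + (f x)\<^sup>2)"
        by (rule sum_integral_elem_le[OF conf lip Ml]) (use int in auto)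
      also have "\<dots> = energy \<Omega> (U l) + l2sq \<Omega> (U l) + l2sq \<Omega> f" using int by (simp add: energy_def l2sq_def)
      finally have "(\<Sum>T\<in>M l. I T) \<le> M1" using M1[of l] by linarith
      then show ?thesis using a by (simp add: X_def sum.distrib sum_distrib_left)
    qed
    \<comment> \<open>Exchanging the sums, each energy is counted once for every neighbour of its
      element, hence at most \<open>Nn\<close> times.\<close>
    have s2: "(\<Sum>T\<in>M l. \<Sum>T'\<in>nbs (\<T> l) T. e T') \<le> Nn * E"
    proof -
      have nbs_sub: "nbs (\<T> l) T \<subseteq> \<T> l" for T unfolding nbs_def by blast
      have "(\<Sum>T\<in>M l. \<Sum>T'\<in>nbs (\<T> l) T. e T') \<le> (\<Sum>T\<in>\<T> l. \<Sum>T'\<in>nbs (\<T> l) T. e T')"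
        by (rule sum_mono2[OF D(1) Ml]) (intro sum_nonneg e0)
      also have "\<dots> = (\<Sum>T\<in>\<T> l. \<Sum>T'\<in>\<T> l. if T' \<in> nbs (\<T> l) T then e T' else 0)"
      proof (rule sum.cong[OF refl])
        fix T
        have "(\<Sum>T'\<in>\<T> l. if T' \<in> nbs (\<T> l) T then e T' else 0) = (\<Sum>T'\<in>\<T> l \<inter> nbs (\<T> l) T. e T')"
          by (rule sum.inter_restrict[OF D(1), symmetric])
        moreover have "\<T> l \<inter> nbs (\<T> l) T = nbs (\<T> l) T" using nbs_sub[of T] by blast
        ultimately show "(\<Sum>T'\<in>nbs (\<T> l) T. e T') = (\<Sum>T'\<in>\<T> l. if T' \<in> nbs (\<T> l) T then e T' else 0)" by simp
      qed
      also have "\<dots> = (\<Sum>T'\<in>\<T> l. \<Sum>T\<in>\<T> l. if T' \<in> nbs (\<T> l) T then e T' else 0)" by (rule sum.swap)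
      also have "\<dots> \<le> (\<Sum>T'\<in>\<T> l. Nn * e T')"
      proof (rule sum_mono)
        fix T' assume T': "T' \<in> \<T> l"
        have "(\<Sum>T\<in>\<T> l. if T' \<in> nbs (\<T> l) T then e T' else 0) = (\<Sum>T\<in>\<T> l. if T \<in> nbs (\<T> l) T' then e T' else 0)"
          by (rule sum.cong[OF refl]) (use nbs_sym T' in metis)
        also have "\<dots> = (\<Sum>T\<in>\<T> l \<inter> nbs (\<T> l) T'. e T')" by (rule sum.inter_restrict[OF D(1), symmetric])
        also have "\<T> l \<inter> nbs (\<T> l) T' = nbs (\<T> l) T'" using nbs_sub[of T'] by blast
        also have "(\<Sum>T\<in>nbs (\<T> l) T'. e T') = real (card (nbs (\<T> l) T')) * e T'" by simp
        also have "\<dots> \<le> Nn * e T'" unfolding Nn_def by (rule mult_right_mono[OF card_nbs[OF conf reg \<gamma> d T'] e0])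
        finally show "(\<Sum>T\<in>\<T> l. if T' \<in> nbs (\<T> l) T then e T' else 0) \<le> Nn * e T'" .
      qed
      also have "\<dots> = Nn * (\<Sum>T'\<in>\<T> l. e T')" by (simp add: sum_distrib_left)
      also have "\<dots> \<le> Nn * E" by (rule mult_left_mono[OF sumE[OF order_refl] Nn])
      finally show ?thesis .
    qed
    have s3: "(\<Sum>T\<in>M l. if elem T \<subseteq> P then B * vol T else 0) \<le> B * measure lebesgue P"
    proof -
      have "(\<Sum>T\<in>M l. if elem T \<subseteq> P then B * vol T else 0) = (\<Sum>T\<in>{T\<in>M l. elem T \<subseteq> P}. B * vol T)"
        by (rule sum.inter_filter[OF fM, symmetric])
      also have "\<dots> = B * (\<Sum>T\<in>{T\<in>M l. elem T \<subseteq> P}. vol T)" by (simp add: sum_distrib_left)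
      also have "\<dots> \<le> B * measure lebesgue P"
        by (intro mult_left_mono[OF _ B(1)] sum_vol_le[OF conf]) (use Ml \<delta>0(2) P_def in blast)+
      finally show ?thesis .
    qed
    define Y where "Y = B * measure lebesgue P"
    have "(\<Sum>T\<in>M l. indicator_sq A b c f p (\<T> l) (U l) T) \<le>
      (\<Sum>T\<in>M l. C1 * (e T + \<delta>\<^sup>2 * (B * vol T + I T)) + C2 * (e T + (\<Sum>T'\<in>nbs (\<T> l) T. e T') + (if elem T \<subseteq> P then B * vol T else 0)))"
      by (rule sum_mono[OF ind])
    also have "\<dots> = C1 * ((\<Sum>T\<in>M l. e T) + \<delta>\<^sup>2 * (\<Sum>T\<in>M l. B * vol T + I T)) +
       C2 * ((\<Sum>T\<in>M l. e T) + (\<Sum>T\<in>M l. \<Sum>T'\<in>nbs (\<T> l) T. e T') + (\<Sum>T\<in>M l. if elem T \<subseteq> P then B * vol T else 0))"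
      by (simp only: sum.distrib sum_distrib_left[symmetric])
    also have "\<dots> \<le> C1 * (E + \<delta>\<^sup>2 * X) + C2 * (E + Nn * E + Y)"
      unfolding Y_def
      by (intro add_mono mult_left_mono[OF _ C1] mult_left_mono[OF _ C2] mult_left_mono[OF s1 zero_le_power2] sumE[OF Ml] s2 s3)
    also have "\<dots> \<le> C3 * (E + \<delta>\<^sup>2 * X + Y)"
    proof -
      define Z where "Z = \<delta>\<^sup>2 * X"
      have nn: "E \<ge> 0" "Z \<ge> 0" "Y \<ge> 0" using X B(1) by (simp_all add: E_def energy_nonneg Z_def Y_def)
      have "C1 * Z \<le> C3 * Z" "C2 * Y \<le> C3 * Y" "(C1 + C2 * (1 + Nn)) * E \<le> C3 * E"
        using nn C1 C2 Nn by (intro mult_right_mono; simp add: C3_def algebra_simps)+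
      then show ?thesis unfolding Z_def[symmetric] by (simp add: algebra_simps)
    qed
    also have "\<dots> < C3 * (\<epsilon> / (3 * C3) + \<epsilon> / (3 * C3) + \<epsilon> / (3 * C3))"
    proof (rule mult_strict_left_mono[OF _ C3])
      have "\<delta>\<^sup>2 * X \<le> \<epsilon> / (3 * C3 * (X + 1)) * (X + 1)" using X \<epsilon> C3 by (intro mult_mono \<delta>2) auto
      also have "\<dots> = \<epsilon> / (3 * C3)" using X by simp
      finally have a: "\<delta>\<^sup>2 * X \<le> \<epsilon> / (3 * C3)" .
      have "Y \<le> (B + 1) * (\<epsilon> / (3 * C3 * (B + 1)))"
        unfolding Y_def P_def using B(1) \<delta>0(3) by (intro mult_mono) auto
      also have "\<dots> = \<epsilon> / (3 * C3)" using B(1) by simp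
      finally have b: "Y \<le> \<epsilon> / (3 * C3)" .
      show "E + \<delta>\<^sup>2 * X + Y < \<epsilon> / (3 * C3) + \<epsilon> / (3 * C3) + \<epsilon> / (3 * C3)" using a b E by linarith
    qed
    also have "\<dots> = \<epsilon>" using C3 by (simp add: field_simps)
    finally show ?thesis .
  qed
  then show ?thesis by blast
qed

text \<open>Approximation in two stages. With halves of \<epsilon> the quasi-triangle inequality for
  squares returns exactly the square of \<epsilon>.\<close>

lemma H1_closure_H10:
  fixes W :: "(real ^ 'n \<Rightarrow> real) set"
  assumes W: "W \<subseteq> H10_space \<Omega>" and \<Omega>: "open \<Omega>"
  shows "H1_closure \<Omega> W \<subseteq> H10_space \<Omega>"
proof
  fix v assume v: "v \<in> H1_closure \<Omega> W"
  have vH: "v \<in> H1_space \<Omega>" using v unfolding H1_closure_def by blast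
  have nn: "0 \<le> H1_norm \<Omega> g" for g :: "real ^ 'n \<Rightarrow> real" by (simp add: H1_norm_def)
  have "\<exists>\<phi>\<in>test_functions \<Omega>. H1_norm \<Omega> (\<lambda>x. v x - \<phi> x) < \<epsilon>" if \<epsilon>: "\<epsilon> > 0" for \<epsilon>
  proof -
    have e2: "\<epsilon> / 2 > 0" using \<epsilon> by simp
    obtain w where w: "w \<in> W" "H1_norm \<Omega> (\<lambda>x. v x - w x) < \<epsilon> / 2" using v e2 unfolding H1_closure_def by blast
    then have wH: "w \<in> H10_space \<Omega>" "w \<in> H1_space \<Omega>" using W H10_subset_H1 by blast+
    obtain \<phi> where \<phi>: "\<phi> \<in> test_functions \<Omega>" "H1_norm \<Omega> (\<lambda>x. w x - \<phi> x) < \<epsilon> / 2"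
      using wH(1) e2 unfolding H10_space_def H1_closure_def by blast
    have \<phi>H: "\<phi> \<in> H1_space \<Omega>" using test_function_H1(1)[OF \<phi>(1) \<Omega>] .
    have "(H1_norm \<Omega> (\<lambda>x. v x - \<phi> x))\<^sup>2 \<le> 2 * (H1_norm \<Omega> (\<lambda>x. v x - w x))\<^sup>2 + 2 * (H1_norm \<Omega> (\<lambda>x. w x - \<phi> x))\<^sup>2"
      using H1_norm_lincomb_le[OF H1_diff[OF vH wH(2) \<Omega>] H1_diff[OF wH(2) \<phi>H \<Omega>] \<Omega>, of 1 1] by simp
    also have "\<dots> < 2 * (\<epsilon> / 2)\<^sup>2 + 2 * (\<epsilon> / 2)\<^sup>2"
      by (intro add_strict_mono mult_strict_left_mono power_strict_mono w(2) \<phi>(2) nn) auto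
    also have "\<dots> = \<epsilon>\<^sup>2" by (simp add: power_divide)
    finally have "H1_norm \<Omega> (\<lambda>x. v x - \<phi> x) < \<epsilon>" using \<epsilon> by (simp add: power2_less_imp_less)
    then show ?thesis using \<phi>(1) by blast
  qed
  then show "v \<in> H10_space \<Omega>" using vH unfolding H10_space_def H1_closure_def by blast
qed

text \<open>Once the error is known to vanish, \<open>u\<close> lies in the limit space and solves
  the Galerkin equations there, so \<open>u\<close> is the witness for \<open>u_inf\<close>.
  Uniqueness almost everywhere follows from ellipticity together with the Poincare
  inequality.\<close>

theorem proposition4:
  fixes \<Omega> :: "(real ^ 'n) set"
    and A :: "real ^ 'n \<Rightarrow> real ^ 'n ^ 'n" and b :: "real ^ 'n \<Rightarrow> real ^ 'n"
    and c f u :: "real ^ 'n \<Rightarrow> real"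
    and \<T> :: "nat \<Rightarrow> ('n::finite) tagged_simplex set" and U :: "nat \<Rightarrow> real ^ 'n \<Rightarrow> real"
    and p :: nat and \<theta> \<gamma> C_cont C_ell C_rel :: real
  assumes dim: "CARD('n) \<ge> 2"
    and domain: "bounded \<Omega>" "polyhedral \<Omega>" "lipschitz_domain \<Omega>"
    and rhs: "f \<in> L2_space \<Omega>"
    and coeff_A: "\<And>i j. (\<lambda>x. A x $ i $ j) \<in> W1inf_space \<Omega>"
    \<comment> \<open>\<open>A\<close> is the continuous representative of its class, whose point values on facets are the traces\<close>
    and cont_A: "continuous_on (closure \<Omega>) A"
    and sym_A: "\<And>x. x \<in> \<Omega> \<Longrightarrow> transpose (A x) = A x"
    and coeff_b: "\<And>i. (\<lambda>x. b x $ i) \<in> Linf_space \<Omega>"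
    and coeff_c: "c \<in> Linf_space \<Omega>"
    and bounded_form: "\<And>v w. v \<in> H10_space \<Omega> \<Longrightarrow> w \<in> H10_space \<Omega> \<Longrightarrow>
      \<bar>bilinear_form \<Omega> A b c v w\<bar> \<le> C_cont * L2_norm \<Omega> (weak_grad \<Omega> v) * L2_norm \<Omega> (weak_grad \<Omega> w)"
    and C_ell: "C_ell > 0"
    and elliptic: "\<And>v. v \<in> H10_space \<Omega> \<Longrightarrow>
      C_ell * (L2_norm \<Omega> (weak_grad \<Omega> v))\<^sup>2 \<le> bilinear_form \<Omega> A b c v v"
    and u: "galerkin_solution \<Omega> A b c f (H10_space \<Omega>) u"
    and p: "p \<ge> 1"
    and \<theta>: "0 < \<theta>" "\<theta> \<le> 1"
    and run: "adaptive_run \<Omega> A b c f p \<theta> \<T> U"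
    and \<gamma>: "\<gamma> > 0" "\<And>l. shape_regular \<gamma> (\<T> l)"
    and C_rel: "C_rel > 0"
    and reliable: "\<And>l. L2_norm \<Omega> (weak_grad \<Omega> (\<lambda>x. u x - U l x))
                        \<le> C_rel * estimator A b c f p (\<T> l) (U l)"
  shows "(\<lambda>l. H1_norm \<Omega> (\<lambda>x. U l x - u x)) \<longlonglongrightarrow> 0 \<and>
    u \<in> Sp0_limit_space \<Omega> p \<T> \<and>
    (\<exists>u_inf. galerkin_solution \<Omega> A b c f (Sp0_limit_space \<Omega> p \<T>) u_inf \<and>
       (\<forall>w. galerkin_solution \<Omega> A b c f (Sp0_limit_space \<Omega> p \<T>) w \<longrightarrow>
            (AE x in lebesgue_on \<Omega>. w x = u_inf x)) \<and>
       (\<lambda>l. H1_norm \<Omega> (\<lambda>x. U l x - u_inf x)) \<longlonglongrightarrow> 0 \<and>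
       (AE x in lebesgue_on \<Omega>. u x = u_inf x))"
  proof -
  let ?B = "bilinear_form \<Omega> A b c"
  let ?V = "\<lambda>l. Sp0_space \<Omega> p (\<T> l)"
  note lip = domain(3)
  have op: "open \<Omega>" using lip unfolding lipschitz_domain_def by blast
  have AL: "(\<lambda>x. A x $ i $ j) \<in> Linf_space \<Omega>" for i j using coeff_A unfolding W1inf_space_def by blast
  have conf: "conforming_mesh \<Omega> (\<T> l)" for l
  proof (cases l)
    case 0
    then show ?thesis using run unfolding adaptive_run_def by blast
  next
    case (Suc k)
    then show ?thesis using run unfolding adaptive_run_def by blast
  qed
  note D = conforming_meshD[OF conf]
  have "\<forall>l. \<exists>M. doerfler_marking \<theta> (indicator_sq A b c f p (\<T> l) (U l)) (\<T> l) M \<and>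
      nvb_refinement (\<T> l) (\<T> (Suc l)) \<and> M \<inter> \<T> (Suc l) = {}"
    using run unfolding adaptive_run_def by blast
  from choice[OF this] obtain M where M: "\<And>l. doerfler_marking \<theta> (indicator_sq A b c f p (\<T> l) (U l)) (\<T> l) (M l)"
    "\<And>l. nvb_refinement (\<T> l) (\<T> (Suc l))" "\<And>l. M l \<inter> \<T> (Suc l) = {}" by blast
  have ref: "refines (\<T> l) (\<T> (Suc l))" for l
    by (rule nvb_refines[OF M(2)]) (rule tagged_simplexD(3)[OF D(2)])
  have Ms: "M l \<subseteq> \<T> l - \<T> (Suc l)" for l using M(1,3)[of l] unfolding doerfler_marking_def by blast
  have nest: "?V k \<subseteq> ?V l" if "k \<le> l" for k l
    by (rule Sp0_nested) (rule ancestor_exists[where \<Omega> = \<Omega> and \<T> = \<T>, OF conf ref dim that])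
  have gal: "galerkin_solution \<Omega> A b c f (?V l) (U l)" for l using run unfolding adaptive_run_def by blast
  have UV: "U l \<in> ?V l" and Ueq: "v \<in> ?V l \<Longrightarrow> ?B (U l) v = (LINT x|lebesgue_on \<Omega>. f x * v x)" for l v
    using gal[of l] unfolding galerkin_solution_def by blast+
  have uH: "u \<in> H10_space \<Omega>" and ueq: "v \<in> H10_space \<Omega> \<Longrightarrow> ?B u v = (LINT x|lebesgue_on \<Omega>. f x * v x)" for v
    using u unfolding galerkin_solution_def by blast+
  have H1: "v \<in> H10_space \<Omega> \<Longrightarrow> v \<in> H1_space \<Omega>" for v using H10_subset_H1 by blast
  have UH: "U l \<in> H10_space \<Omega>" for l using UV Sp0_subset_H10 by blast
  have diffH: "(\<lambda>x. v x - w x) \<in> H10_space \<Omega>" if "v \<in> H10_space \<Omega>" "w \<in> H10_space \<Omega>" for v w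
    using H10_lincomb[OF that op, of 1 "-1"] by simp
  have Blin: "?B (\<lambda>x. \<alpha> * v x + \<beta> * w x) z = \<alpha> * ?B v z + \<beta> * ?B w z"
    if "v \<in> H10_space \<Omega>" "w \<in> H10_space \<Omega>" "z \<in> H10_space \<Omega>" for v w z \<alpha> \<beta>
    by (rule bilinear_form_lincomb(1)[OF op AL coeff_b coeff_c H1[OF that(1)] H1[OF that(2)] H1[OF that(3)]])
  have ell: "C_ell * energy \<Omega> v \<le> ?B v v" if "v \<in> H10_space \<Omega>" for v
    using elliptic[OF that] by (simp only: energy_eq)
  have bnd: "\<bar>?B v w\<bar> \<le> C_cont * sqrt (energy \<Omega> v) * sqrt (energy \<Omega> w)"
    if "v \<in> H10_space \<Omega>" "w \<in> H10_space \<Omega>" for v w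
    using bounded_form[OF that] by (simp only: L2_norm_energy)
  have BU: "?B (U l) v = ?B u v" if "v \<in> ?V l" for l v
    using Ueq[OF that] ueq[of v] that Sp0_subset_H10 by fastforce
  note gc = galerkin_cauchy[where V = ?V and B = ?B and U = U and u = u and C = C_cont and c = C_ell,
      OF op Sp0_subset_H10 Sp0_lincomb[OF _ _ op] nest[OF le_SucI[OF order_refl]] Blin bnd C_ell ell UV BU uH]
  have est: "\<exists>l0. \<forall>l\<ge>l0. (\<Sum>T\<in>M l. indicator_sq A b c f p (\<T> l) (U l) T) < e" if "e > 0" for e
    by (rule refined_indicators_vanish[where \<T> = \<T> and U = U and M = M,
        OF dim domain(1) lip rhs coeff_A cont_A coeff_b coeff_c conf ref UV \<gamma> gc(1) gc(2) Ms that])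
  \<comment> \<open>Reliability bounds the error by the full estimator, and Doerfler marking bounds
    \<theta> times its square by the sum over the marked elements.\<close>
  have en: "\<theta> * energy \<Omega> (\<lambda>x. u x - U l x) \<le> C_rel\<^sup>2 * (\<Sum>T\<in>M l. indicator_sq A b c f p (\<T> l) (U l) T)" for l
  proof -
    let ?s = "\<Sum>T\<in>\<T> l. indicator_sq A b c f p (\<T> l) (U l) T"
    have s0: "0 \<le> ?s" by (rule sum_nonneg) (rule indicator_sq_nonneg)
    have "(L2_norm \<Omega> (weak_grad \<Omega> (\<lambda>x. u x - U l x)))\<^sup>2 \<le> (C_rel * estimator A b c f p (\<T> l) (U l))\<^sup>2"
      by (rule power_mono[OF reliable]) (simp add: L2_norm_energy energy_nonneg)
    also have "\<dots> = C_rel\<^sup>2 * ?s" using s0 by (simp add: estimator_def power_mult_distrib)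
    finally have "energy \<Omega> (\<lambda>x. u x - U l x) \<le> C_rel\<^sup>2 * ?s" by (simp only: energy_eq)
    then have "\<theta> * energy \<Omega> (\<lambda>x. u x - U l x) \<le> \<theta> * (C_rel\<^sup>2 * ?s)" using \<theta>(1) by (intro mult_left_mono) auto
    also have "\<dots> = C_rel\<^sup>2 * (\<theta> * ?s)" by simp
    also have "\<dots> \<le> C_rel\<^sup>2 * (\<Sum>T\<in>M l. indicator_sq A b c f p (\<T> l) (U l) T)"
      using M(1)[of l] unfolding doerfler_marking_def by (intro mult_left_mono) auto
    finally show ?thesis .
  qed

  \<comment> \<open>From energy to the full norm\<close>
  obtain Cp where Cp: "Cp > 0" "\<And>v. v \<in> H10_space \<Omega> \<Longrightarrow> l2sq \<Omega> v \<le> Cp * energy \<Omega> v"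
    using poincare[OF op domain(1)] by blast
  \<comment> \<open>Both orders of the difference are treated: convergence is stated for
    \<open>U l - u\<close>, the closure for \<open>u - U l\<close>, and \<open>weak_grad\<close>
    selects their gradients independently.\<close>
  have conv: "\<exists>l0. \<forall>l\<ge>l0. H1_norm \<Omega> (\<lambda>x. U l x - u x) < e \<and> H1_norm \<Omega> (\<lambda>x. u x - U l x) < e" if e: "e > 0" for e
  proof -
    \<comment> \<open>Chosen so that the factor \<open>Cp + 1\<close>, which passes from the energy
      to the squared norm, and the reliability constant cancel against \<theta>.\<close>
    define \<delta> where "\<delta> = \<theta> * e\<^sup>2 / (C_rel\<^sup>2 * (Cp + 1))"
    have den: "C_rel\<^sup>2 * (Cp + 1) > 0" using C_rel Cp(1) by simp
    have "\<delta> > 0" unfolding \<delta>_def using \<theta>(1) e C_rel Cp(1) by (intro divide_pos_pos mult_pos_pos) auto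
    from est[OF this] obtain l0 where
      l0: "\<And>l. l \<ge> l0 \<Longrightarrow> (\<Sum>T\<in>M l. indicator_sq A b c f p (\<T> l) (U l) T) < \<delta>" by blast
    have "H1_norm \<Omega> w < e" if l: "l \<ge> l0" and w: "w = (\<lambda>x. U l x - u x) \<or> w = (\<lambda>x. u x - U l x)" for l w
    proof -
      have wH: "w \<in> H10_space \<Omega>" using w diffH[OF UH uH] diffH[OF uH UH] by blast
      have enw: "energy \<Omega> w = energy \<Omega> (\<lambda>x. u x - U l x)"
        using w energy_diff_commute[OF H1[OF UH] H1[OF uH] op] by blast
      have less: "C_rel\<^sup>2 * (\<Sum>T\<in>M l. indicator_sq A b c f p (\<T> l) (U l) T) < C_rel\<^sup>2 * \<delta>"
        using l0[OF l] C_rel by (intro mult_strict_left_mono) auto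
      have "\<theta> * energy \<Omega> w < C_rel\<^sup>2 * \<delta>" unfolding enw by (rule le_less_trans[OF en less])
      then have "(Cp + 1) * (\<theta> * energy \<Omega> w) < (Cp + 1) * (C_rel\<^sup>2 * \<delta>)"
        using Cp(1) by (intro mult_strict_left_mono) auto
      also have "\<dots> = \<theta> * e\<^sup>2" using den C_rel Cp(1) by (simp add: \<delta>_def)
      finally have "\<theta> * ((Cp + 1) * energy \<Omega> w) < \<theta> * e\<^sup>2" by (simp only: mult.left_commute)
      then have "(Cp + 1) * energy \<Omega> w < e\<^sup>2" using \<theta>(1) by simp
      then have "(H1_norm \<Omega> w)\<^sup>2 < e\<^sup>2"
        using Cp(2)[OF wH] unfolding H1_norm_power2 by (simp add: distrib_right)
      then show ?thesis using e by (simp add: power2_less_imp_less)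
    qed
    then show ?thesis by blast
  qed
  have lim: "(\<lambda>l. H1_norm \<Omega> (\<lambda>x. U l x - u x)) \<longlonglongrightarrow> 0"
  proof (rule LIMSEQ_I)
    fix e :: real assume "e > 0"
    from conv[OF this] show "\<exists>l0. \<forall>l\<ge>l0. norm (H1_norm \<Omega> (\<lambda>x. U l x - u x) - 0) < e"
      by (simp add: H1_norm_def) blast
  qed

  \<comment> \<open>Identification of the limit in the limit space\<close>
  have ulim: "u \<in> Sp0_limit_space \<Omega> p \<T>"
    unfolding Sp0_limit_space_def H1_closure_def
  proof (intro CollectI conjI allI impI)
    show "u \<in> H1_space \<Omega>" by (rule H1[OF uH])
    fix e :: real assume "e > 0"
    from conv[OF this] show "\<exists>w\<in>\<Union>l. ?V l. H1_norm \<Omega> (\<lambda>x. u x - w x) < e" using UV by blast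
  qed
  have WH: "(\<Union>l. ?V l) \<subseteq> H10_space \<Omega>" using Sp0_subset_H10 by blast
  \<comment> \<open>The equation of \<open>u\<close> is known for test functions in
    \<open>H10_space \<Omega>\<close>, so the limit space has to be contained in it.\<close>
  have limH: "v \<in> H10_space \<Omega>" if "v \<in> Sp0_limit_space \<Omega> p \<T>" for v
    using H1_closure_H10[OF WH op] that unfolding Sp0_limit_space_def by blast
  have ugal: "galerkin_solution \<Omega> A b c f (Sp0_limit_space \<Omega> p \<T>) u"
    unfolding galerkin_solution_def using ulim ueq limH by blast
  have uniq: "AE x in lebesgue_on \<Omega>. w x = u x" if w: "galerkin_solution \<Omega> A b c f (Sp0_limit_space \<Omega> p \<T>) w" for w
  proof -
    have wl: "w \<in> Sp0_limit_space \<Omega> p \<T>" using w unfolding galerkin_solution_def by blast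
    have Wlin: "(\<lambda>x. \<alpha> * v x + \<beta> * z x) \<in> (\<Union>l. ?V l)" if vz: "v \<in> (\<Union>l. ?V l)" "z \<in> (\<Union>l. ?V l)" for v z \<alpha> \<beta>
    proof -
      obtain i j where ij: "v \<in> ?V i" "z \<in> ?V j" using vz by blast
      then have "v \<in> ?V (max i j)" "z \<in> ?V (max i j)" using nest[of i "max i j"] nest[of j "max i j"] by auto
      from Sp0_lincomb[OF this op] show ?thesis by blast
    qed
    have "(\<lambda>x. 1 * w x + (-1) * u x) \<in> Sp0_limit_space \<Omega> p \<T>"
      using H1_closure_lincomb[OF wl[unfolded Sp0_limit_space_def] ulim[unfolded Sp0_limit_space_def] op
          order_trans[OF WH H10_subset_H1] Wlin] unfolding Sp0_limit_space_def .
    then have zl: "(\<lambda>x. w x - u x) \<in> Sp0_limit_space \<Omega> p \<T>" by simp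
    let ?z = "\<lambda>x. w x - u x"
    have zH: "?z \<in> H10_space \<Omega>" by (rule limH[OF zl])
    have "?B ?z ?z = ?B w ?z - ?B u ?z" using Blin[OF limH[OF wl] uH zH, of 1 "-1"] by simp
    also have "\<dots> = 0" using w zl ueq[OF zH] unfolding galerkin_solution_def by simp
    finally have "C_ell * energy \<Omega> ?z \<le> 0" using ell[OF zH] by simp
    then have "energy \<Omega> ?z \<le> 0" using C_ell by (simp add: mult_le_0_iff)
    then have "l2sq \<Omega> ?z \<le> 0"
      using Cp(2)[OF zH] mult_left_mono[of "energy \<Omega> ?z" 0 Cp] Cp(1) by simp
    \<comment> \<open>Zero energy makes the function itself vanish almost everywhere by the Poincare
      inequality, which yields uniqueness of the function rather than of its gradient.\<close>
    then have "(LINT x|lebesgue_on \<Omega>. (?z x)\<^sup>2) = 0" using l2sq_nonneg[of \<Omega> ?z] unfolding l2sq_def by (rule order.antisym)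
    moreover have "integrable (lebesgue_on \<Omega>) (\<lambda>x. (?z x)\<^sup>2)"
      using H1_spaceD(1)[OF H1[OF zH] op] unfolding L2_space_def by blast
    ultimately have "AE x in lebesgue_on \<Omega>. (?z x)\<^sup>2 = 0"
      by (simp add: integral_nonneg_eq_0_iff_AE)
    then show ?thesis by eventually_elim simp
  qed
  show ?thesis using lim ulim ugal uniq by blast
qed

end
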